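(* Let $\mathfrak h=\langle H;\ddot o,b_j;d_j\rangle$ be an elementary indefinite Hamiltonian of kind (A), let $z\in\mathbb C$, let $F=(f,\xi,\alpha)\in\mathring{\mathfrak P}(\mathfrak h)$ be such that $(F;zF)\in\mathring T(\mathfrak h)$, and let $\hat f=(\hat f_-,\hat f_+)$ be a locally absolutely continuous representative of $f$ on $(s_-,\sigma)\cup(\sigma,s_+)$ satisfying $\hat f'=zJH\hat f$ a.e. Then the limits $$\Gamma_{\mathsf r}^\pm\hat f_\pm:=\lim_{x\to\sigma\pm}\hat f_\pm(x)_2,$$ $$\Gamma_{\mathsf s}^\pm(z)\hat f_\pm:=\lim_{x\to\sigma\pm}\sum_{n=0}^\Delta z^n\bigl(\mathfrak w_n(x)\bigr)^*J\Bigl(\hat f_\pm(x)-\bigl(\Gamma_{\mathsf r}^\pm\hat f_\pm\bigr)\sum_{j=\Delta+1}^{2\Delta-n}z^j\mathfrak w_j(x)\Bigr)$$ exist, and $$\Gamma_{\mathsf r}^+\hat f_+=\Gamma_{\mathsf r}^-\hat f_-,$$ $$\Gamma_{\mathsf s}^+(z)\hat f_+=\Gamma_{\mathsf s}^-(z)\hat f_-+\mathscr p(z)\,\Gamma_{\mathsf r}^-\hat f_-+\mathring\Gamma(\mathfrak h)(F;zF)(s_-)_1-\hat f_-(s_-)_1-\mathring\Gamma(\mathfrak h)(F;zF)(s_+)_1+\hat f_+(s_+)_1 .$$ Moreover: (i) If $(s_-,\sigma)$ is not indivisible, then $\hat f_-$ is uniquely determined and $\hat f_-(s_-)=\mathring\Gamma(\mathfrak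 h)(F;zF)(s_-)$. Otherwise, $\hat f_-$ is unique up to an additive multiple of $\binom10$, and there exists exactly one $\hat f_-$ such that $\hat f_-(s_-)=\mathring\Gamma(\mathfrak h)(F;zF)(s_-)$. (ii) If $(\sigma,s_+)$ is not indivisible, then $\hat f_+$ is uniquely determined and $\hat f_+(s_+)=\mathring\Gamma(\mathfrak h)(F;zF)(s_+)$. Otherwise, $\hat f_+$ is unique up to an additive multiple of $\binom10$, and there exists exactly one $\hat f_+$ such that $\hat f_+(s_+)=\mathring\Gamma(\mathfrak h)(F;zF)(s_+)$.
   Context: **Hamiltonians.** $J=\begin{pmatrix}0&-1\\1&0\end{pmatrix}$. A Hamiltonian on an interval $(a,b)$ is a measurable, locally integrable function $H:(a,b)\to\mathbb R^{2\times2}$ with $H(t)\ge0$ a.e. and $\{t:H(t)=0\}$ of measure $0$; entries: $H=\begin{pmatrix}h_1&h_3\\ h_3&h_2\end{pmatrix}$. $H$ is in limit circle case at an endpoint if it is integrable near that endpoint, and in limit point case otherwise. An interval $(c,d)$ is $H$-indivisible of type $\phi$ if $\operatorname{ran}H(t)=\operatorname{span}\{\xi_\phi\}$ for a.a. $t\in(c,d)$, where $\xi_\phi=(\cos\phi,\sin\phi)^T$. Functions $f_1,f_2$ are identified ($f_1=_Hf_2$) if $Hf_1=Hf_2$ a.e. $L^2(H)$ is the space of classes modulo $=_H$ of measurable $f:(a,b)\to\mathbb C^2$ with $\int f^*Hf<\infty$ and such that $\xi_\phi^*f$ is a.e. constant on each $H$-indivisible interval of type $\phi$. $T_{\max}(H)$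 is the set of $(f;g)\in L^2(H)\times L^2(H)$ for which $f$ has a locally absolutely continuous representative $\hat f$ with $\hat f'=JHg$ a.e. **The functions $\mathfrak w_n$.** Let $H_-$ be a Hamiltonian on $(s_-,\sigma)$, limit circle at $s_-$, limit point at $\sigma$, satisfying conditions (I) and (HS), i.e. $\int_{s_-}^{\sigma}h_1<\infty$ and $\int_{s_-}^{\sigma}\bigl(\int_{s_-}^th_2\bigr)h_1(t)\,dt<\infty$. Put $(\mathcal If)(t)=\int_{s_-}^tJH_-(s)f(s)\,ds$. $\Delta(H_-)$ is the infimum of all $n\in\mathbb N_0$ such that $\mathcal I^n\binom01+\sum_{k=0}^{n-1}\mathcal I^kv_{n-k}\in L^2(H_-)$ for some $v_1,\dots,v_n\in\mathbb C^2$ ($\inf\emptyset=\infty$). If $\Delta(H_-)<\infty$, there is a unique sequence $(\omega_n^-)_{n\ge0}$ with $\omega_0^-=1$ and $\sum_{k=0}^n\mathcal I^k\binom0{\omega^-_{n-k}}\in L^2(H_-)$ for all $n\ge\Delta(H_-)$; set $\mathfrak w_n:=\sum_{k=0}^n\mathcal I^k\binom0{\omega^-_{n-k}}$ on $[s_-,\sigma)$ for all $n\ge0$. For a Hamiltonian $H_+$ on $(\sigma,s_+)$, limit point at $\sigma$, limit circle at $s_+$, everything is analogous with $\int_t^{s_+}h_2$ instead of $\int_{s_-}^th_2$ in (HS) and with $(\tilde{\mathcal I}f)(t)=-\int_t^{s_+}JH_+(s)f(s)\,ds$, giving $\Delta(H_+)$, $(\omega_n^+)$ and $\mathfrak w_n$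 on $(\sigma,s_+]$. **Elementary indefinite Hamiltonian of kind (A)**, $\mathfrak h=\langle H;\ddot o,b_j;d_j\rangle$: (1) finite non-empty intervals $(s_-,\sigma)$, $(\sigma,s_+)$ and Hamiltonians $H_-$ on $(s_-,\sigma)$ (limit circle at $s_-$, limit point at $\sigma$) and $H_+$ on $(\sigma,s_+)$ (limit point at $\sigma$, limit circle at $s_+$), both satisfying (I) and (HS), with $\Delta(H_\pm)<\infty$, and such that either no interval $(s,\sigma)$, $s\in[s_-,\sigma)$, is $H_-$-indivisible, or no interval $(\sigma,s)$, $s\in(\sigma,s_+)$, is $H_+$-indivisible; $H:=(H_-,H_+)$ and $\Delta:=\Delta(H):=\max\{\Delta(H_-),\Delta(H_+)\}$; (2) numbers $d_0,\dots,d_{2\Delta-1}\in\mathbb R$; (3) $\ddot o\in\mathbb N_0$ and, if $\ddot o>0$, $b_1,\dots,b_{\ddot o}\in\mathbb R$ with $b_1\ne0$. "$(s_-,\sigma)$ (resp. $(\sigma,s_+)$) is indivisible" means $H_-$- (resp. $H_+$-) indivisible. $L^2(H):=L^2(H_+)\oplus L^2(H_-)$, $T_{\max}(H):=T_{\max}(H_+)\oplus T_{\max}(H_-)$; $\mathfrak w_n$ is regarded as a function on $[s_-,\sigma)\cup(\sigma,s_+]$. The functions $\mathfrak w_0,\dots,\mathfrak w_{\Delta-1}$ are linearly independent modulo $L^2(H)$ and $\mathfrak w_0,\dots,\mathfrak w_\Delta$ are linearly independent modulo $\operatorname{dom}T_{\max}(H)$. **Model space, relation and boundary mapping.** $L^2_\Delta(H):=L^2(H)\dot+\operatorname{span}\{\mathfrak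 w_0,\dots,\mathfrak w_{\Delta-1}\}$, $\mathring{\mathfrak P}(\mathfrak h):=L^2_\Delta(H)\times\mathbb C^\Delta\times\mathbb C^{\ddot o}$, with elements $(f,(\xi_i)_{i=0}^{\Delta-1},(\alpha_k)_{k=1}^{\ddot o})$. The linear relation $\mathring T(\mathfrak h)$ consists of all pairs $(F;G)$, $F=(f,\xi,\alpha)$, $G=(g,\eta,\beta)$ in $\mathring{\mathfrak P}(\mathfrak h)$, such that (1)–(5) hold, where, for $1\le k\le\Delta$, $B_k:=\omega_k^-f(s_-)_1$ if $(\sigma,s_+)$ is indivisible, $B_k:=-\omega_k^+f(s_+)_1$ if $(s_-,\sigma)$ is indivisible, and $B_k:=\omega_k^-f(s_-)_1-\omega_k^+f(s_+)_1$ otherwise: (1) $f=f_0+\sum_{i=0}^\Delta\lambda_i\mathfrak w_i$ with $\lambda_i\in\mathbb C$ and $(f_0;g-\sum_{i=0}^{\Delta-1}\lambda_{i+1}\mathfrak w_i)\in T_{\max}(H)$. Put $E:=\int_{s_-}^{s_+}\mathfrak w_\Delta^*H(g-\sum_{i=0}^{\Delta-1}\lambda_{i+1}\mathfrak w_i)+\frac12\sum_{i=0}^{\Delta-1}d_{\Delta-1+i}\lambda_i+d_{2\Delta-1}\lambda_\Delta-B_\Delta$. (2) If $\ddot o=0$: $\xi_{\Delta-1}=E$. If $\ddot o>0$: $\alpha_{\ddot o}=b_1\lambda_\Delta$. (3) If neither interval is indivisible: $\eta_0=f(s_-)_1-f(s_+)_1-\frac12\sum_{i=0}^{\Delta-1}d_i\lambda_{i+1}$.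 (4) $\eta_k=\xi_{k-1}-\frac12d_{k-1}\lambda_0-\frac12d_{k+\Delta-1}\lambda_\Delta+B_k$ for $1\le k\le\Delta-1$. (5) If $\ddot o>0$: $\beta_1=E-\xi_{\Delta-1}$ and $\beta_j=\alpha_{j-1}-b_{\ddot o+2-j}\lambda_\Delta$ for $2\le j\le\ddot o$. Here $f(s_-)$ (resp. $f(s_+)$) is used only when $(s_-,\sigma)$ (resp. $(\sigma,s_+)$) is not indivisible, and denotes the value of the unique locally absolutely continuous representative of $f$ satisfying $\hat f'=JHg$ a.e. Subscripts $1,2$ denote components. The boundary mapping $\mathring\Gamma(\mathfrak h)$ assigns to $(F;G)\in\mathring T(\mathfrak h)$ two vectors in $\mathbb C^2$: $\mathring\Gamma(\mathfrak h)(F;G)(s_-)=f(s_-)$ if $(s_-,\sigma)$ is not indivisible, and $=\bigl(f(s_+)_1+\eta_0+\frac12\sum_{i=0}^{\Delta-1}d_i\lambda_{i+1},\ \lambda_0\bigr)^T$ if it is; $\mathring\Gamma(\mathfrak h)(F;G)(s_+)=f(s_+)$ if $(\sigma,s_+)$ is not indivisible, and $=\bigl(f(s_-)_1-\eta_0-\frac12\sum_{i=0}^{\Delta-1}d_i\lambda_{i+1},\ \lambda_0\bigr)^T$ if it is. **The polynomial $\mathscr p$.** $\mathscr p(z):=-\sum_{n=1}^{2\Delta}d_{n-1}z^n+\sum_{n=2\Delta+1}^{2\Delta+\ddot o}b_{\ddot o+2\Delta+1-n}z^n$. **Conventions.** $\hat f_-$, $\hat f_+$ are the restrictions of $\hat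 f$ to $(s_-,\sigma)$, $(\sigma,s_+)$; they extend continuously to $s_-$, $s_+$ respectively. $*$ is the conjugate transpose; empty sums are $0$. *)

theory Defs
  imports "HOL-Analysis.Analysis" "HOL-Library.Extended_Nat"
begin

text \<open>
  Functions on an interval are total functions on the reals of which only the values on that
  interval matter.  Elements of $L^2(H)$ are represented by functions, and equality of classes is
  the relation \<open>eq_H\<close>; every notion below is invariant under it.
  In a vector or matrix the indices 1, 2 denote the first and second row or column.
\<close>

definition abs_continuous_on :: "real \<Rightarrow> real \<Rightarrow> (real \<Rightarrow> 'a::real_normed_vector) \<Rightarrow> bool" where
  "abs_continuous_on c d f \<longleftrightarrow>
     (\<forall>\<epsilon>>0. \<exists>\<delta>>0. \<forall>D T. D division_of T \<longrightarrow> T \<subseteq> {c..d} \<longrightarrow>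
        (\<Sum>K\<in>D. Sup K - Inf K) < \<delta> \<longrightarrow> (\<Sum>K\<in>D. norm (f (Sup K) - f (Inf K))) < \<epsilon>)"

definition loc_abs_continuous :: "real \<Rightarrow> real \<Rightarrow> (real \<Rightarrow> 'a::real_normed_vector) \<Rightarrow> bool" where
  "loc_abs_continuous a b f \<longleftrightarrow> (\<forall>c d. a < c \<and> c < d \<and> d < b \<longrightarrow> abs_continuous_on c d f)"

type_synonym fn = "real \<Rightarrow> complex^2"

definition Jmat :: "complex^2^2" where
  "Jmat = vector [vector [0, -1], vector [1, 0]]"

definition cmat :: "real^2^2 \<Rightarrow> complex^2^2" where
  "cmat A = map_matrix complex_of_real A"

text \<open>$u^* v$\<close>
definition cdot :: "complex^2 \<Rightarrow> complex^2 \<Rightarrow> complex" where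
  "cdot u v = (\<Sum>i\<in>UNIV. cnj (u $ i) * v $ i)"

definition pos_semidef :: "real^2^2 \<Rightarrow> bool" where
  "pos_semidef A \<longleftrightarrow> transpose A = A \<and> (\<forall>x. 0 \<le> x \<bullet> (A *v x))"

definition hamiltonian :: "real \<Rightarrow> real \<Rightarrow> (real \<Rightarrow> real^2^2) \<Rightarrow> bool" where
  "hamiltonian a b H \<longleftrightarrow>
     H \<in> borel_measurable (lebesgue_on {a<..<b}) \<and>
     (\<forall>c d. a < c \<and> c < d \<and> d < b \<longrightarrow> set_integrable lebesgue {c..d} H) \<and>
     (AE t\<in>{a<..<b} in lebesgue. pos_semidef (H t)) \<and>
     {t \<in> {a<..<b}. H t = 0} \<in> null_sets lebesgue"

definition limit_circle_left :: "real \<Rightarrow> real \<Rightarrow> (real \<Rightarrow> real^2^2) \<Rightarrow> bool" where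
  "limit_circle_left a b H \<longleftrightarrow> (\<exists>c. a < c \<and> c < b \<and> set_integrable lebesgue {a<..<c} H)"

definition limit_circle_right :: "real \<Rightarrow> real \<Rightarrow> (real \<Rightarrow> real^2^2) \<Rightarrow> bool" where
  "limit_circle_right a b H \<longleftrightarrow> (\<exists>c. a < c \<and> c < b \<and> set_integrable lebesgue {c<..<b} H)"

abbreviation limit_point_left :: "real \<Rightarrow> real \<Rightarrow> (real \<Rightarrow> real^2^2) \<Rightarrow> bool" where
  "limit_point_left a b H \<equiv> \<not> limit_circle_left a b H"

abbreviation limit_point_right :: "real \<Rightarrow> real \<Rightarrow> (real \<Rightarrow> real^2^2) \<Rightarrow> bool" where
  "limit_point_right a b H \<equiv> \<not> limit_circle_right a b H"

definition xi_vec :: "real \<Rightarrow> real^2" where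
  "xi_vec \<phi> = vector [cos \<phi>, sin \<phi>]"

definition indivisible_type :: "(real \<Rightarrow> real^2^2) \<Rightarrow> real \<Rightarrow> real \<Rightarrow> real \<Rightarrow> bool" where
  "indivisible_type H \<phi> c d \<longleftrightarrow>
     c < d \<and> (AE t\<in>{c<..<d} in lebesgue. range ((*v) (H t)) = span {xi_vec \<phi>})"

definition indivisible :: "(real \<Rightarrow> real^2^2) \<Rightarrow> real \<Rightarrow> real \<Rightarrow> bool" where
  "indivisible H c d \<longleftrightarrow> (\<exists>\<phi>. indivisible_type H \<phi> c d)"

definition eq_H :: "(real \<Rightarrow> real^2^2) \<Rightarrow> real \<Rightarrow> real \<Rightarrow> fn \<Rightarrow> fn \<Rightarrow> bool" where
  "eq_H H a b f g \<longleftrightarrow> (AE t\<in>{a<..<b} in lebesgue. cmat (H t) *v f t = cmat (H t) *v g t)"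

definition L2H :: "(real \<Rightarrow> real^2^2) \<Rightarrow> real \<Rightarrow> real \<Rightarrow> fn set" where
  "L2H H a b = {f. f \<in> borel_measurable (lebesgue_on {a<..<b}) \<and>
     set_integrable lebesgue {a<..<b} (\<lambda>t. cdot (f t) (cmat (H t) *v f t)) \<and>
     (\<forall>\<phi> c d. a \<le> c \<and> d \<le> b \<and> indivisible_type H \<phi> c d \<longrightarrow>
        (\<exists>k. AE t\<in>{c<..<d} in lebesgue.
           complex_of_real (cos \<phi>) * f t $ 1 + complex_of_real (sin \<phi>) * f t $ 2 = k))}"

definition ac_rep :: "(real \<Rightarrow> real^2^2) \<Rightarrow> real \<Rightarrow> real \<Rightarrow> fn \<Rightarrow> fn \<Rightarrow> fn \<Rightarrow> bool" where
  "ac_rep H a b f g fh \<longleftrightarrow>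
     loc_abs_continuous a b fh \<and> eq_H H a b fh f \<and>
     (AE t\<in>{a<..<b} in lebesgue.
        (fh has_vector_derivative (Jmat *v (cmat (H t) *v g t))) (at t))"

definition Tmax :: "(real \<Rightarrow> real^2^2) \<Rightarrow> real \<Rightarrow> real \<Rightarrow> (fn \<times> fn) set" where
  "Tmax H a b = {(f, g). f \<in> L2H H a b \<and> g \<in> L2H H a b \<and> (\<exists>fh. ac_rep H a b f g fh)}"

text \<open>$\mathcal I$ (integration from the limit circle endpoint \<open>a\<close> on the left) and
  $\tilde{\mathcal I}$ (limit circle endpoint \<open>b\<close> on the right).\<close>

definition I_left :: "(real \<Rightarrow> real^2^2) \<Rightarrow> real \<Rightarrow> fn \<Rightarrow> fn" where
  "I_left H a f = (\<lambda>t. LINT s:{a..t}|lebesgue. Jmat *v (cmat (H s) *v f s))"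

definition I_right :: "(real \<Rightarrow> real^2^2) \<Rightarrow> real \<Rightarrow> fn \<Rightarrow> fn" where
  "I_right H b f = (\<lambda>t. - (LINT s:{t..b}|lebesgue. Jmat *v (cmat (H s) *v f s)))"

text \<open>In the following three definitions \<open>I\<close> is one of the two operators above.
  \<open>Delta_num\<close> takes the value infinity if the set of admissible \<open>n\<close> is empty.\<close>

definition Delta_num :: "(real \<Rightarrow> real^2^2) \<Rightarrow> real \<Rightarrow> real \<Rightarrow> (fn \<Rightarrow> fn) \<Rightarrow> enat" where
  "Delta_num H a b I = Inf {enat n | n. \<exists>v :: nat \<Rightarrow> complex^2.
     (\<lambda>t. (I ^^ n) (\<lambda>_. vector [0, 1]) t + (\<Sum>k<n. (I ^^ k) (\<lambda>_. v (n - k)) t)) \<in> L2H H a b}"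

definition w_comb :: "(fn \<Rightarrow> fn) \<Rightarrow> (nat \<Rightarrow> complex) \<Rightarrow> nat \<Rightarrow> fn" where
  "w_comb I \<omega> n = (\<lambda>t. \<Sum>k\<le>n. (I ^^ k) (\<lambda>_. vector [0, \<omega> (n - k)]) t)"

definition omega_seq :: "(real \<Rightarrow> real^2^2) \<Rightarrow> real \<Rightarrow> real \<Rightarrow> (fn \<Rightarrow> fn) \<Rightarrow> nat \<Rightarrow> complex" where
  "omega_seq H a b I = (THE \<omega>. \<omega> 0 = 1 \<and>
     (\<forall>n. Delta_num H a b I \<le> enat n \<longrightarrow> w_comb I \<omega> n \<in> L2H H a b))"

text \<open>\<open>o_par\<close> is $\ddot o$, and \<open>ham\<close> carries $H_-$ on $(s_-,\sigma)$ and $H_+$ on $(\sigma,s_+)$.  Only the values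
  \<open>b_par j\<close> with $1\le j\le\ddot o$ and \<open>d_par j\<close> with $j<2\Delta$ are used.\<close>
record indef_ham =
  s_minus :: real
  sing :: real
  s_plus :: real
  ham :: "real \<Rightarrow> real^2^2"
  o_par :: nat
  b_par :: "nat \<Rightarrow> real"
  d_par :: "nat \<Rightarrow> real"

definition I_minus :: "indef_ham \<Rightarrow> fn \<Rightarrow> fn" where
  "I_minus h = I_left (ham h) (s_minus h)"

definition I_plus :: "indef_ham \<Rightarrow> fn \<Rightarrow> fn" where
  "I_plus h = I_right (ham h) (s_plus h)"

definition Delta_minus :: "indef_ham \<Rightarrow> enat" where
  "Delta_minus h = Delta_num (ham h) (s_minus h) (sing h) (I_minus h)"

definition Delta_plus :: "indef_ham \<Rightarrow> enat" where
  "Delta_plus h = Delta_num (ham h) (sing h) (s_plus h) (I_plus h)"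

definition Delta :: "indef_ham \<Rightarrow> nat" where
  "Delta h = the_enat (max (Delta_minus h) (Delta_plus h))"

definition indiv_minus :: "indef_ham \<Rightarrow> bool" where
  "indiv_minus h \<longleftrightarrow> indivisible (ham h) (s_minus h) (sing h)"

definition indiv_plus :: "indef_ham \<Rightarrow> bool" where
  "indiv_plus h \<longleftrightarrow> indivisible (ham h) (sing h) (s_plus h)"

definition ham_side_minus :: "indef_ham \<Rightarrow> bool" where
  "ham_side_minus h \<longleftrightarrow>
     hamiltonian (s_minus h) (sing h) (ham h) \<and>
     limit_circle_left (s_minus h) (sing h) (ham h) \<and>
     limit_point_right (s_minus h) (sing h) (ham h) \<and>
     set_integrable lebesgue {s_minus h<..<sing h} (\<lambda>t. ham h t $ 1 $ 1) \<and>
     set_integrable lebesgue {s_minus h<..<sing h}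
       (\<lambda>t. (LINT s:{s_minus h<..<t}|lebesgue. ham h s $ 2 $ 2) * ham h t $ 1 $ 1)"

definition ham_side_plus :: "indef_ham \<Rightarrow> bool" where
  "ham_side_plus h \<longleftrightarrow>
     hamiltonian (sing h) (s_plus h) (ham h) \<and>
     limit_point_left (sing h) (s_plus h) (ham h) \<and>
     limit_circle_right (sing h) (s_plus h) (ham h) \<and>
     set_integrable lebesgue {sing h<..<s_plus h} (\<lambda>t. ham h t $ 1 $ 1) \<and>
     set_integrable lebesgue {sing h<..<s_plus h}
       (\<lambda>t. (LINT s:{t<..<s_plus h}|lebesgue. ham h s $ 2 $ 2) * ham h t $ 1 $ 1)"

definition elem_indef_ham_A :: "indef_ham \<Rightarrow> bool" where
  "elem_indef_ham_A h \<longleftrightarrow>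
     s_minus h < sing h \<and> sing h < s_plus h \<and>
     ham_side_minus h \<and> ham_side_plus h \<and>
     Delta_minus h < \<infinity> \<and> Delta_plus h < \<infinity> \<and>
     ((\<forall>s\<in>{s_minus h..<sing h}. \<not> indivisible (ham h) s (sing h)) \<or>
      (\<forall>s\<in>{sing h<..<s_plus h}. \<not> indivisible (ham h) (sing h) s)) \<and>
     (o_par h > 0 \<longrightarrow> b_par h 1 \<noteq> 0)"

definition omega_minus :: "indef_ham \<Rightarrow> nat \<Rightarrow> complex" where
  "omega_minus h = omega_seq (ham h) (s_minus h) (sing h) (I_minus h)"

definition omega_plus :: "indef_ham \<Rightarrow> nat \<Rightarrow> complex" where
  "omega_plus h = omega_seq (ham h) (sing h) (s_plus h) (I_plus h)"

definition wfun :: "indef_ham \<Rightarrow> nat \<Rightarrow> fn" where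
  "wfun h n = (\<lambda>t. if t < sing h then w_comb (I_minus h) (omega_minus h) n t
                   else w_comb (I_plus h) (omega_plus h) n t)"

definition eq_ham :: "indef_ham \<Rightarrow> fn \<Rightarrow> fn \<Rightarrow> bool" where
  "eq_ham h f g \<longleftrightarrow>
     eq_H (ham h) (s_minus h) (sing h) f g \<and> eq_H (ham h) (sing h) (s_plus h) f g"

definition L2_ham :: "indef_ham \<Rightarrow> fn set" where
  "L2_ham h = L2H (ham h) (s_minus h) (sing h) \<inter> L2H (ham h) (sing h) (s_plus h)"

definition Tmax_ham :: "indef_ham \<Rightarrow> (fn \<times> fn) set" where
  "Tmax_ham h = Tmax (ham h) (s_minus h) (sing h) \<inter> Tmax (ham h) (sing h) (s_plus h)"

definition L2_Delta :: "indef_ham \<Rightarrow> fn set" where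
  "L2_Delta h = {f. \<exists>\<mu> :: nat \<Rightarrow> complex. (\<lambda>t. f t - (\<Sum>i<Delta h. \<mu> i *s wfun h i t)) \<in> L2_ham h}"

text \<open>An element is a triple $(f,(\xi_i),(\alpha_k))$; only $\xi_i$ with $i<\Delta$ and $\alpha_k$ with
  $1\le k\le\ddot o$ are used.\<close>
type_synonym elt = "fn \<times> (nat \<Rightarrow> complex) \<times> (nat \<Rightarrow> complex)"

definition P_ring :: "indef_ham \<Rightarrow> elt set" where
  "P_ring h = {F. fst F \<in> L2_Delta h}"

definition scale_elt :: "complex \<Rightarrow> elt \<Rightarrow> elt" where
  "scale_elt z = (\<lambda>(f, \<xi>, \<alpha>). (\<lambda>t. z *s f t, \<lambda>i. z * \<xi> i, \<lambda>k. z * \<alpha> k))"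

definition shift_part :: "indef_ham \<Rightarrow> fn \<Rightarrow> (nat \<Rightarrow> complex) \<Rightarrow> fn" where
  "shift_part h g \<mu> = (\<lambda>t. g t - (\<Sum>i<Delta h. \<mu> (Suc i) *s wfun h i t))"

definition decomposes :: "indef_ham \<Rightarrow> fn \<Rightarrow> fn \<Rightarrow> (nat \<Rightarrow> complex) \<Rightarrow> bool" where
  "decomposes h f g \<mu> \<longleftrightarrow>
     (\<exists>f0. eq_ham h f (\<lambda>t. f0 t + (\<Sum>i\<le>Delta h. \<mu> i *s wfun h i t)) \<and>
           (f0, shift_part h g \<mu>) \<in> Tmax_ham h)"

text \<open>The coefficients $\lambda_0,\dots,\lambda_\Delta$.  They are unique because
  $\mathfrak w_0,\dots,\mathfrak w_\Delta$ are linearly independent modulo the domain of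
  $T_{\max}(H)$; the values beyond $\Delta$ are normalised to 0.\<close>
definition lam :: "indef_ham \<Rightarrow> fn \<Rightarrow> fn \<Rightarrow> nat \<Rightarrow> complex" where
  "lam h f g = (THE \<mu>. decomposes h f g \<mu> \<and> (\<forall>i>Delta h. \<mu> i = 0))"

text \<open>$f(s_-)$ and $f(s_+)$, as boundary values of the representative with $\hat f'=JHg$; meaningful
  (and used) only if the respective interval is not indivisible.\<close>

definition val_minus :: "indef_ham \<Rightarrow> fn \<Rightarrow> fn \<Rightarrow> complex^2" where
  "val_minus h f g = (THE v. \<exists>fh. ac_rep (ham h) (s_minus h) (sing h) f g fh \<and>
     (fh \<longlongrightarrow> v) (at_right (s_minus h)))"

definition val_plus :: "indef_ham \<Rightarrow> fn \<Rightarrow> fn \<Rightarrow> complex^2" where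
  "val_plus h f g = (THE v. \<exists>fh. ac_rep (ham h) (sing h) (s_plus h) f g fh \<and>
     (fh \<longlongrightarrow> v) (at_left (s_plus h)))"

definition B_num :: "indef_ham \<Rightarrow> fn \<Rightarrow> fn \<Rightarrow> nat \<Rightarrow> complex" where
  "B_num h f g k =
     (if indiv_plus h then omega_minus h k * val_minus h f g $ 1
      else if indiv_minus h then - omega_plus h k * val_plus h f g $ 1
      else omega_minus h k * val_minus h f g $ 1 - omega_plus h k * val_plus h f g $ 1)"

definition E_num :: "indef_ham \<Rightarrow> fn \<Rightarrow> fn \<Rightarrow> complex" where
  "E_num h f g =
     (LINT t:{s_minus h<..<sing h} \<union> {sing h<..<s_plus h}|lebesgue.
        cdot (wfun h (Delta h) t) (cmat (ham h t) *v shift_part h g (lam h f g) t))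
     + 1/2 * (\<Sum>i<Delta h. complex_of_real (d_par h (Delta h - 1 + i)) * lam h f g i)
     + complex_of_real (d_par h (2 * Delta h - 1)) * lam h f g (Delta h)
     - B_num h f g (Delta h)"

definition T_ring :: "indef_ham \<Rightarrow> (elt \<times> elt) set" where
  "T_ring h = {((f, \<xi>, \<alpha>), (g, \<eta>, \<beta>)).
     (f, \<xi>, \<alpha>) \<in> P_ring h \<and> (g, \<eta>, \<beta>) \<in> P_ring h \<and>
     decomposes h f g (lam h f g) \<and>
     (if o_par h = 0 then \<xi> (Delta h - 1) = E_num h f g
      else \<alpha> (o_par h) = complex_of_real (b_par h 1) * lam h f g (Delta h)) \<and>
     (\<not> indiv_minus h \<and> \<not> indiv_plus h \<longrightarrow>
        \<eta> 0 = val_minus h f g $ 1 - val_plus h f g $ 1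
          - 1/2 * (\<Sum>i<Delta h. complex_of_real (d_par h i) * lam h f g (i + 1))) \<and>
     (\<forall>k. 1 \<le> k \<and> k \<le> Delta h - 1 \<longrightarrow>
        \<eta> k = \<xi> (k - 1) - 1/2 * complex_of_real (d_par h (k - 1)) * lam h f g 0
          - 1/2 * complex_of_real (d_par h (k + Delta h - 1)) * lam h f g (Delta h)
          + B_num h f g k) \<and>
     (o_par h > 0 \<longrightarrow>
        \<beta> 1 = E_num h f g - \<xi> (Delta h - 1) \<and>
        (\<forall>j. 2 \<le> j \<and> j \<le> o_par h \<longrightarrow>
           \<beta> j = \<alpha> (j - 1) - complex_of_real (b_par h (o_par h + 2 - j)) * lam h f g (Delta h)))}"

definition Gamma_minus :: "indef_ham \<Rightarrow> elt \<Rightarrow> elt \<Rightarrow> complex^2" where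
  "Gamma_minus h = (\<lambda>(f, \<xi>, \<alpha>) (g, \<eta>, \<beta>).
     if \<not> indiv_minus h then val_minus h f g
     else vector [val_plus h f g $ 1 + \<eta> 0
                    + 1/2 * (\<Sum>i<Delta h. complex_of_real (d_par h i) * lam h f g (i + 1)),
                  lam h f g 0])"

definition Gamma_plus :: "indef_ham \<Rightarrow> elt \<Rightarrow> elt \<Rightarrow> complex^2" where
  "Gamma_plus h = (\<lambda>(f, \<xi>, \<alpha>) (g, \<eta>, \<beta>).
     if \<not> indiv_plus h then val_plus h f g
     else vector [val_minus h f g $ 1 - \<eta> 0
                    - 1/2 * (\<Sum>i<Delta h. complex_of_real (d_par h i) * lam h f g (i + 1)),
                  lam h f g 0])"

definition p_poly :: "indef_ham \<Rightarrow> complex \<Rightarrow> complex" where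
  "p_poly h z =
     - (\<Sum>n=1..2 * Delta h. complex_of_real (d_par h (n - 1)) * z ^ n)
     + (\<Sum>n=2 * Delta h + 1..2 * Delta h + o_par h.
          complex_of_real (b_par h (o_par h + 2 * Delta h + 1 - n)) * z ^ n)"

definition sol_minus :: "indef_ham \<Rightarrow> complex \<Rightarrow> fn \<Rightarrow> fn \<Rightarrow> bool" where
  "sol_minus h z f fh \<longleftrightarrow> ac_rep (ham h) (s_minus h) (sing h) f (\<lambda>t. z *s fh t) fh"

definition sol_plus :: "indef_ham \<Rightarrow> complex \<Rightarrow> fn \<Rightarrow> fn \<Rightarrow> bool" where
  "sol_plus h z f fh \<longleftrightarrow> ac_rep (ham h) (sing h) (s_plus h) f (\<lambda>t. z *s fh t) fh"

text \<open>The expression whose limit at $\sigma$ is $\Gamma_{\mathsf s}^{\pm}(z)\hat f_{\pm}$, with \<open>r\<close> in the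
  place of $\Gamma_{\mathsf r}^{\pm}\hat f_{\pm}$:\<close>
definition sing_expr :: "indef_ham \<Rightarrow> complex \<Rightarrow> fn \<Rightarrow> complex \<Rightarrow> real \<Rightarrow> complex" where
  "sing_expr h z fh r x = (\<Sum>n\<le>Delta h. z ^ n * cdot (wfun h n x)
     (Jmat *v (fh x - r *s (\<Sum>j=Delta h + 1..2 * Delta h - n. z ^ j *s wfun h j x))))"

end

theory Submission
  imports Defs "HOL-Computational_Algebra.Fundamental_Theorem_Algebra"
begin

text \<open>
  A solution $\hat f$ of $y' = zJHy$ is, on either side of $\sigma$, the sum of an element of
  $\operatorname{dom} T_{\max}$ and $\sum_i \lambda_i \mathfrak w_i$, up to a constant in the kernel
  of $H$.  Independence of the $\mathfrak w_i$ modulo $L^2(H)$ forces $\lambda_i = z^i\lambda_0$.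
  The second components of elements of $\operatorname{dom} T_{\max}$ and of $\mathfrak w_n$, $n \ge 1$,
  tend to $0$ at $\sigma$, so the regular boundary value is $\lambda_0$ on both sides.
  By the Lagrange identity the derivative of the sum defining the singular boundary value
  telescopes to $-z^\Delta \mathfrak w_\Delta^* H (zf - \sum_i \lambda_{i+1} \mathfrak w_i)$, which is
  integrable up to $\sigma$.  The two limits therefore exist, and their difference is expressed by
  boundary values at $s_\pm$ and by the integral in $E$; eliminating $\xi$ and $\alpha$ from the
  recursions that define $\mathring T(\mathfrak h)$ yields $\mathscr p(z)\lambda_0$.

  The analytic input is that $\mathfrak w_n$ has a second component tending to $0$ and lies in
  $L^2(H)$ for large $n$.  Conjugation by $e^{\pm z\int h_3}$ shows that
  for $\kappa \ne 0$, if the combination of the $\mathfrak w_i$ with the coefficients of $(X - \kappa)P$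
  lies in $L^2(H)$, then so does the one with the coefficients of $P$; a non-zero polynomial of minimal
  degree whose combination lies in $L^2(H)$ is hence a multiple of a power of $X$.
\<close>

section \<open>Indefinite integrals\<close>

text \<open>The numbers \<omega>_n are defined through a unique sequence, whose existence must be
  derived from \<Delta> < \<infinity>. The obstacle is the off-diagonal entry h_3: its integral
  \<open>av\<close> is not known to converge at \<sigma>. A growth estimate first shows that one
  non-trivial L^2 combination of iterated integrals forces \<open>av\<close> to be bounded. Then
  \<open>av\<close> converges along suitable sequences, each of them yields a candidate for
  \<omega>, and uniqueness makes all candidates agree, which gives limits at \<sigma> itself.
  Dividing by X - \<kappa> amounts to a resolvent estimate: an a priori bound of order 1 + M for the
  first component, M being the integral of h_2, has to be improved to its square root, which is the
  size that (I) and (HS) admit in L^2. All of this is done on the left interval; the right one is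
  its image under t -> -t combined with diag(-1, 1). Differential equations enter in integrated form
  only. \<open>indef_int\<close> records that the increments of f are integrals of g, a notion
  stable under sums, products, compositions and changes of g on null sets.\<close>

definition indef_int :: "real set \<Rightarrow> (real \<Rightarrow> complex) \<Rightarrow> (real \<Rightarrow> complex) \<Rightarrow> bool" where
  "indef_int S f g \<longleftrightarrow> (\<forall>x\<in>S. \<forall>y\<in>S. x \<le> y \<longrightarrow>
     g absolutely_integrable_on {x..y} \<and> (g has_integral (f y - f x)) {x..y})"

lemma indef_int_subset: "indef_int S f g \<Longrightarrow> T \<subseteq> S \<Longrightarrow> indef_int T f g"
  unfolding indef_int_def by blast

lemma indef_int_const: "indef_int S (\<lambda>t. c) (\<lambda>t. 0)"
  unfolding indef_int_def by auto

lemma indef_intD: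
  assumes "indef_int S f g" "x \<in> S" "y \<in> S" "x \<le> y"
  shows "g absolutely_integrable_on {x..y}" "(g has_integral (f y - f x)) {x..y}"
  using assms unfolding indef_int_def by auto

lemma indef_intI:
  assumes "\<And>x y. x \<in> S \<Longrightarrow> y \<in> S \<Longrightarrow> x \<le> y \<Longrightarrow> g absolutely_integrable_on {x..y}"
    and "\<And>x y. x \<in> S \<Longrightarrow> y \<in> S \<Longrightarrow> x \<le> y \<Longrightarrow> (g has_integral (f y - f x)) {x..y}"
  shows "indef_int S f g"
  using assms unfolding indef_int_def by blast

lemma indef_int_add:
  assumes "indef_int S f g" "indef_int S f' g'"
  shows "indef_int S (\<lambda>t. f t + f' t) (\<lambda>t. g t + g' t)"
proof (rule indef_intI)
  fix x y assume xy: "x \<in> S" "y \<in> S" "x \<le> y"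
  note a = indef_intD[OF assms(1) xy] and b = indef_intD[OF assms(2) xy]
  show "(\<lambda>t. g t + g' t) absolutely_integrable_on {x..y}" using a(1) b(1) by (rule set_integral_add(1))
  show "((\<lambda>t. g t + g' t) has_integral (f y + f' y - (f x + f' x))) {x..y}"
    using has_integral_add[OF a(2) b(2)] by (simp only: add_diff_add)
qed

lemma indef_int_cmult:
  assumes "indef_int S f g"
  shows "indef_int S (\<lambda>t. c * f t) (\<lambda>t. c * g t)"
proof (rule indef_intI)
  fix x y assume xy: "x \<in> S" "y \<in> S" "x \<le> y"
  note a = indef_intD[OF assms(1) xy]
  show "(\<lambda>t. c * g t) absolutely_integrable_on {x..y}" using a(1) by (intro set_integrable_mult_right) auto
  show "((\<lambda>t. c * g t) has_integral (c * f y - c * f x)) {x..y}"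
    using has_integral_mult_right[OF a(2), of c] by (simp only: right_diff_distrib)
qed

lemma indef_int_minus:
  assumes "indef_int S f g" shows "indef_int S (\<lambda>t. - f t) (\<lambda>t. - g t)"
  using indef_int_cmult[OF assms, of "-1"] by simp

lemma indef_int_diff:
  assumes "indef_int S f g" "indef_int S f' g'"
  shows "indef_int S (\<lambda>t. f t - f' t) (\<lambda>t. g t - g' t)"
  using indef_int_add[OF assms(1) indef_int_minus[OF assms(2)]] by simp

lemma indef_int_sum:
  assumes "\<And>i. i \<in> A \<Longrightarrow> indef_int S (f i) (g i)"
  shows "indef_int S (\<lambda>t. \<Sum>i\<in>A. f i t) (\<lambda>t. \<Sum>i\<in>A. g i t)"
proof (cases "finite A")
  case True
  then show ?thesis using assms
  proof (induction A)
    case empty then show ?case using indef_int_const by simp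
  next
    case (insert i A)
    then show ?case using indef_int_add[of S "f i" "g i"] by simp
  qed
next
  case False then show ?thesis using indef_int_const by simp
qed

lemma indef_int_cong:
  assumes "indef_int S f g" "\<And>t. t \<in> S \<Longrightarrow> f t = f' t"
    and N: "negligible N" and "\<And>t. t \<notin> N \<Longrightarrow> (\<exists>x\<in>S. \<exists>y\<in>S. x \<le> t \<and> t \<le> y) \<Longrightarrow> g t = g' t"
  shows "indef_int S f' g'"
  unfolding indef_int_def
proof (intro ballI impI conjI)
  fix x y assume xy: "x \<in> S" "y \<in> S" "x \<le> y"
  have g: "g absolutely_integrable_on {x..y}" "(g has_integral (f y - f x)) {x..y}"
    using assms(1) xy unfolding indef_int_def by auto
  have e: "\<And>t. t \<in> {x..y} - N \<Longrightarrow> g' t = g t" using assms(4) xy by force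
  show "g' absolutely_integrable_on {x..y}"
    using absolutely_integrable_spike[OF g(1) N e] by blast
  show "(g' has_integral f' y - f' x) {x..y}"
    using has_integral_spike[OF N e g(2)] assms(2) xy by auto
qed

lemma indef_int_continuous:
  assumes f: "indef_int S f g" and xy: "x \<le> y" "{x..y} \<subseteq> S"
  shows "continuous_on {x..y} f"
proof -
  have S: "x \<in> S" "y \<in> S" using xy by auto
  have "g integrable_on {x..y}" using indef_intD(2)[OF f S xy(1)] by blast
  then have "continuous_on {x..y} (\<lambda>t. f x + integral {x..t} g)"
    by (intro continuous_intros indefinite_integral_continuous_1)
  moreover have "f x + integral {x..t} g = f t" if "t \<in> {x..y}" for t
    using integral_unique[OF indef_intD(2)[OF f S(1), of t]] that xy by auto
  ultimately show ?thesis using continuous_on_cong[of "{x..y}" "{x..y}" f "\<lambda>t. f x + integral {x..t} g"] by simp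
qed

text \<open>The mean value inequality on the segment from \<open>f u\<close> to \<open>f v\<close>,
  applied to \<open>G w - G' (f t) * w\<close>, bounds the error of linearising G by
  \<open>e1\<close> times the increment of f. The other error is that of replacing the integral of g
  by its Riemann term at the tag t.\<close>

lemma norm_tagged_chain_step:
  fixes f g G G' :: "_ \<Rightarrow> complex"
  assumes "cbox u v = {u..v::real}" "u \<le> v"
    and fuv: "f v - f u = integral {u..v} g"
    and GL: "\<And>w. w \<in> closed_segment (f u) (f v) \<Longrightarrow> norm (G' w - G' (f t)) \<le> e1"
    and G: "\<And>w. (G has_field_derivative G' w) (at w)"
    and B: "norm (G' (f t)) \<le> B"
  shows "norm ((v - u) *\<^sub>R (G' (f t) * g t) - (G (f v) - G (f u)))
     \<le> B * norm ((v - u) *\<^sub>R g t - integral {u..v} g) + e1 * norm (integral {u..v} g)"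
proof -
  have "norm ((G (f v) - G' (f t) * f v) - (G (f u) - G' (f t) * f u)) \<le> e1 * norm (f v - f u)"
  proof (rule field_differentiable_bound[where S="closed_segment (f u) (f v)" and f="\<lambda>w. G w - G' (f t) * w" and f'="\<lambda>w. G' w - G' (f t)"])
    fix w assume "w \<in> closed_segment (f u) (f v)"
    then show "norm (G' w - G' (f t)) \<le> e1" by (rule GL)
    have "((\<lambda>w. G w - G' (f t) * w) has_field_derivative (G' w - G' (f t) * 1)) (at w)"
      by (intro derivative_intros G DERIV_cmult DERIV_ident)
    then show "((\<lambda>w. G w - G' (f t) * w) has_field_derivative (G' w - G' (f t))) (at w within closed_segment (f u) (f v))"
      by (auto intro: has_field_derivative_at_within)
  qed auto
  then have 1: "norm (G' (f t) * (f v - f u) - (G (f v) - G (f u))) \<le> e1 * norm (f v - f u)"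
    by (simp add: algebra_simps norm_minus_commute)
  have "norm ((v - u) *\<^sub>R (G' (f t) * g t) - G' (f t) * (f v - f u)) = norm (G' (f t)) * norm ((v - u) *\<^sub>R g t - integral {u..v} g)"
    unfolding fuv norm_mult[symmetric] by (simp add: algebra_simps)
  also have "\<dots> \<le> B * norm ((v - u) *\<^sub>R g t - integral {u..v} g)"
    using B by (intro mult_right_mono) auto
  finally have 2: "norm ((v - u) *\<^sub>R (G' (f t) * g t) - G' (f t) * (f v - f u)) \<le> B * norm ((v - u) *\<^sub>R g t - integral {u..v} g)" .
  show ?thesis using norm_triangle_le[OF add_mono[OF 2 1]] unfolding fuv by (simp add: algebra_simps)
qed

text \<open>The integral is computed from Riemann sums, as pointwise derivatives of f are not at
  hand. Over a tagged division the increments of G along f telescope, and each differs from its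
  Riemann term by the two errors of \<open>norm_tagged_chain_step\<close>. Henstock's lemma controls
  the sum of the first errors, the integral of the norm of g that of the second.\<close>

lemma has_integral_chain_rule:
  fixes f g G G' :: "_ \<Rightarrow> complex"
  assumes xy: "x \<le> (y::real)" and g: "g absolutely_integrable_on {x..y}"
    and f: "\<And>u v. x \<le> u \<Longrightarrow> u \<le> v \<Longrightarrow> v \<le> y \<Longrightarrow> (g has_integral f v - f u) {u..v}"
    and G: "\<And>w. (G has_field_derivative G' w) (at w)" and G': "continuous_on UNIV G'"
  shows "((\<lambda>t. G' (f t) * g t) has_integral (G (f y) - G (f x))) {x..y}"
proof -
  have S: "indef_int {x..y} f g"
    by (intro indef_intI f set_integrable_subset[OF g]) auto
  have cf: "continuous_on {x..y} f" using indef_int_continuous[OF S xy] by simp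
  have "bounded (f ` {x..y})" using compact_imp_bounded[OF compact_continuous_image[OF cf]] by simp
  then obtain R where "\<forall>w\<in>f ` {x..y}. norm w \<le> R"
    unfolding bounded_iff by blast
  then have R: "\<And>t. t \<in> {x..y} \<Longrightarrow> f t \<in> cball 0 R" by auto
  have cG': "continuous_on (cball 0 R) G'" using G' continuous_on_subset by blast
  have "bounded (G' ` cball 0 R)" using compact_imp_bounded[OF compact_continuous_image[OF cG']] by simp
  then obtain B0 where "\<forall>w\<in>G' ` cball 0 R. norm w \<le> B0"
    unfolding bounded_iff by blast
  then have B0: "\<And>w. w \<in> cball 0 R \<Longrightarrow> norm (G' w) \<le> B0" by auto
  define B where "B = max B0 0"
  have B: "B \<ge> 0" "\<And>w. w \<in> cball 0 R \<Longrightarrow> norm (G' w) \<le> B" using B0 unfolding B_def by force+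
  have ucG: "uniformly_continuous_on (cball 0 R) G'" using compact_uniformly_continuous[OF cG'] by simp
  have ucf: "uniformly_continuous_on {x..y} f" using compact_uniformly_continuous[OF cf] by simp
  have ng: "(\<lambda>t. norm (g t)) integrable_on {x..y}" "g integrable_on {x..y}"
    using g absolutely_integrable_on_def by blast+
  define V where "V = integral {x..y} (\<lambda>t. norm (g t))"
  have V: "V \<ge> 0" unfolding V_def by (intro integral_nonneg ng) auto
  show ?thesis unfolding has_integral[of _ _ x y, unfolded box_real]
  proof (intro allI impI)
    fix e :: real assume e: "0 < e"
    \<comment> \<open>\<open>e1\<close> gets multiplied by the variation bound V and
      \<open>e2\<close> by the bound B of the derivative, so each contributes at most e/2. The added
      1 avoids division by zero and makes the final inequality strict.\<close>
    define e1 where "e1 = e / (2 * (V + 1))"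
    define e2 where "e2 = e / (2 * (B + 1))"
    have e12: "e1 > 0" "e2 > 0" using e V B unfolding e1_def e2_def by (auto intro!: divide_pos_pos)
    obtain d1 where d1: "d1 > 0" "\<And>w w'. w \<in> cball 0 R \<Longrightarrow> w' \<in> cball 0 R \<Longrightarrow> dist w' w < d1 \<Longrightarrow> dist (G' w') (G' w) < e1"
      using ucG e12(1) unfolding uniformly_continuous_on_def by metis
    obtain d2 where d2: "d2 > 0" "\<And>s t. s \<in> {x..y} \<Longrightarrow> t \<in> {x..y} \<Longrightarrow> dist t s < d2 \<Longrightarrow> dist (f t) (f s) < d1"
      using ucf d1(1) unfolding uniformly_continuous_on_def by metis
    obtain \<gamma> where \<gamma>: "gauge \<gamma>" "\<And>p. p tagged_partial_division_of (cbox x y) \<Longrightarrow> \<gamma> fine p \<Longrightarrow>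
       (\<Sum>(t,K)\<in>p. norm (measure lborel K *\<^sub>R g t - integral K g)) < e2"
      using Henstock_lemma[of g x y e2] ng(2) e12(2) by auto
    show "\<exists>\<gamma>. gauge \<gamma> \<and> (\<forall>\<D>. \<D> tagged_division_of {x..y} \<and> \<gamma> fine \<D> \<longrightarrow>
       norm ((\<Sum>(t,K)\<in>\<D>. measure lborel K *\<^sub>R (G' (f t) * g t)) - (G (f y) - G (f x))) < e)"
    proof (intro exI conjI allI impI)
      show "gauge (\<lambda>t. \<gamma> t \<inter> ball t d2)" using \<gamma>(1) d2(1) by (intro gauge_Int gauge_ball)
      fix p assume p: "p tagged_division_of {x..y} \<and> (\<lambda>t. \<gamma> t \<inter> ball t d2) fine p"
      then have p1: "p tagged_division_of {x..y}" and p2: "\<gamma> fine p" and p3: "(\<lambda>t. ball t d2) fine p"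
        by (auto simp: fine_Int)
      have fin: "finite p" using p1 by auto
      have tel: "G (f y) - G (f x) = (\<Sum>(t,K)\<in>p. G (f (Sup K)) - G (f (Inf K)))"
        using additive_tagged_division_1[OF xy p1, of "\<lambda>t. G (f t)"] by (auto simp: split_def)
      have vsum: "V = (\<Sum>(t,K)\<in>p. integral K (\<lambda>t. norm (g t)))"
        unfolding V_def using integral_combine_tagged_division_topdown[of "\<lambda>t. norm (g t)" x y p] ng(1) p1 by auto
      have step: "norm (measure lborel K *\<^sub>R (G' (f t) * g t) - (G (f (Sup K)) - G (f (Inf K)))) \<le>
         B * norm (measure lborel K *\<^sub>R g t - integral K g) + e1 * integral K (\<lambda>t. norm (g t))"
        if tK: "(t,K) \<in> p" for t K
      proof -
        obtain u v where K: "K = cbox u v" "u \<le> v" and uv: "t \<in> K" "K \<subseteq> {x..y}"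
          using tagged_division_ofD(2,3,4)[OF p1 tK] by (metis atLeastAtMost_iff box_real(2) order_trans)
        have Kb: "K \<subseteq> ball t d2" using p3 tK unfolding fine_def by auto
        have sub: "x \<le> u" "v \<le> y" using uv K by auto
        have I: "f v - f u = integral {u..v} g" using f[OF sub(1) K(2) sub(2)] integral_unique by metis
        have tt: "t \<in> {x..y}" "u \<in> {x..y}" "v \<in> {x..y}" using uv K by auto
        have du: "dist (f u) (f t) < d1" "dist (f v) (f t) < d1"
          using d2(2)[of t u] d2(2)[of t v] tt Kb K by (auto simp: dist_commute subset_iff)
        have seg: "norm (G' w - G' (f t)) \<le> e1" if w: "w \<in> closed_segment (f u) (f v)" for w
        proof -
          have "closed_segment (f u) (f v) \<subseteq> cball 0 R \<inter> ball (f t) d1"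
            using R[OF tt(2)] R[OF tt(3)] du
            by (intro closed_segment_subset convex_Int convex_cball convex_ball) (auto simp: dist_commute)
          then have "w \<in> cball 0 R" "dist w (f t) < d1" using w by (auto simp: dist_commute subset_iff)
          then show ?thesis using d1(2)[OF R[OF tt(1)], of w] by (simp add: dist_norm less_imp_le)
        qed
        have "norm (integral {u..v} g) \<le> integral {u..v} (\<lambda>t. norm (g t))"
          using ng sub by (intro integral_norm_bound_integral) (auto intro: integrable_subinterval_real)
        then have "e1 * norm (integral {u..v} g) \<le> e1 * integral {u..v} (\<lambda>t. norm (g t))"
          using e12(1) by simp
        then show ?thesis
          using norm_tagged_chain_step[of u v f g G' t e1 G B, OF _ K(2) I seg G B(2)[OF R[OF tt(1)]]] K by auto
      qed
      have "norm ((\<Sum>(t,K)\<in>p. measure lborel K *\<^sub>R (G' (f t) * g t)) - (G (f y) - G (f x)))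
         = norm (\<Sum>(t,K)\<in>p. measure lborel K *\<^sub>R (G' (f t) * g t) - (G (f (Sup K)) - G (f (Inf K))))"
        unfolding tel by (simp add: sum_subtractf split_def)
      also have "\<dots> \<le> (\<Sum>(t,K)\<in>p. B * norm (measure lborel K *\<^sub>R g t - integral K g) + e1 * integral K (\<lambda>t. norm (g t)))"
        by (rule sum_norm_le) (use step in auto)
      also have "\<dots> = B * (\<Sum>(t,K)\<in>p. norm (measure lborel K *\<^sub>R g t - integral K g)) + e1 * V"
        unfolding vsum by (simp add: sum.distrib sum_distrib_left split_def)
      also have "\<dots> \<le> B * e2 + e1 * V"
        using \<gamma>(2)[OF _ p2] p1 B(1) e12 by (intro add_mono mult_left_mono) (auto simp: tagged_division_of_def box_real less_imp_le)
      also have "\<dots> < (B + 1) * e2 + e1 * (V + 1)" using e12 by (simp add: algebra_simps)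
      also have "\<dots> = e / 2 + e / 2"
      proof -
        have "B + 1 \<noteq> 0" "V + 1 \<noteq> 0" using B(1) V by auto
        then have "(B + 1) * (e / (2 * (B + 1))) = e / 2" "e / (2 * (V + 1)) * (V + 1) = e / 2"
          by (metis divide_divide_eq_left nonzero_mult_div_cancel_left times_divide_eq_right mult.commute)+
        then have "(B + 1) * e2 = e / 2" "e1 * (V + 1) = e / 2" unfolding e1_def e2_def by simp_all
        then show ?thesis by simp
      qed
      also have "\<dots> = e" by simp
      finally show "norm ((\<Sum>(t,K)\<in>p. measure lborel K *\<^sub>R (G' (f t) * g t)) - (G (f y) - G (f x))) < e" .
    qed
  qed
qed

lemma absolutely_integrable_continuous_mult:
  fixes c g :: "real \<Rightarrow> complex"
  assumes "continuous_on {x..y} c" "g absolutely_integrable_on {x..y}"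
  shows "(\<lambda>t. c t * g t) absolutely_integrable_on {x..y}"
proof (rule absolutely_integrable_bounded_measurable_product[OF bilinear_times _ _ _ assms(2)])
  show "c \<in> borel_measurable (lebesgue_on {x..y})"
    using continuous_imp_measurable_on_sets_lebesgue[OF assms(1)] by auto
  show "bounded (c ` {x..y})" using compact_imp_bounded compact_continuous_image[OF assms(1)] by auto
qed auto

lemma indef_int_chain:
  assumes f: "indef_int S f g" and S: "is_interval S"
    and G: "\<And>w. (G has_field_derivative G' w) (at w)" and G': "continuous_on UNIV G'"
  shows "indef_int S (\<lambda>t. G (f t)) (\<lambda>t. G' (f t) * g t)"
  unfolding indef_int_def
proof (intro ballI impI conjI)
  fix x y assume xy: "x \<in> S" "y \<in> S" "x \<le> y"
  have sub: "{x..y} \<subseteq> S" using mem_is_interval_1_I[OF S xy(1,2)] by auto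
  have gi: "g absolutely_integrable_on {x..y}" using indef_intD(1)[OF f xy] .
  show "((\<lambda>t. G' (f t) * g t) has_integral G (f y) - G (f x)) {x..y}"
  proof (rule has_integral_chain_rule[OF xy(3) gi _ G G'])
    fix u v assume "x \<le> u" "u \<le> v" "v \<le> y"
    then have "u \<in> S" "v \<in> S" using sub by (auto simp: subset_iff)
    then show "(g has_integral f v - f u) {u..v}" using indef_intD(2)[OF f _ _ \<open>u \<le> v\<close>] by blast
  qed
  show "(\<lambda>t. G' (f t) * g t) absolutely_integrable_on {x..y}"
    by (intro absolutely_integrable_continuous_mult gi continuous_on_compose2[OF G' indef_int_continuous[OF f xy(3) sub]]) simp
qed

text \<open>By polarisation, 4 f f' = (f + f')^2 - (f - f')^2, so the chain rule for the square
  alone suffices.\<close>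

lemma indef_int_mult:
  assumes f: "indef_int S f g" "indef_int S f' g'" and S: "is_interval S"
  shows "indef_int S (\<lambda>t. f t * f' t) (\<lambda>t. g t * f' t + f t * g' t)"
proof -
  have sq: "indef_int S (\<lambda>t. (u t)\<^sup>2) (\<lambda>t. 2 * u t * u' t)" if "indef_int S u u'" for u u'
    by (rule indef_int_chain[OF that S, where G="\<lambda>w. w\<^sup>2" and G'="\<lambda>w. 2 * w"])
       (auto intro!: derivative_eq_intros continuous_intros)
  have "indef_int S (\<lambda>t. (1/4) * ((f t + f' t)\<^sup>2 - (f t - f' t)\<^sup>2))
     (\<lambda>t. (1/4) * (2 * (f t + f' t) * (g t + g' t) - 2 * (f t - f' t) * (g t - g' t)))"
    by (intro indef_int_cmult indef_int_diff sq indef_int_add f)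
  then show ?thesis
    by (rule indef_int_cong[where N="{}"]) (auto simp: power2_eq_square algebra_simps)
qed

lemma indef_int_exp:
  assumes f: "indef_int S f g" and S: "is_interval S"
  shows "indef_int S (\<lambda>t. exp (f t)) (\<lambda>t. exp (f t) * g t)"
  using indef_int_chain[OF f S, of exp exp] DERIV_exp continuous_on_exp[OF continuous_on_id] by auto

lemma indef_int_power:
  assumes f: "indef_int S f g" and S: "is_interval S"
  shows "indef_int S (\<lambda>t. f t ^ n) (\<lambda>t. of_nat n * f t ^ (n - 1) * g t)"
  by (rule indef_int_chain[OF f S, where G="\<lambda>w. w ^ n" and G'="\<lambda>w. of_nat n * w ^ (n - 1)"])
     (auto intro!: derivative_eq_intros continuous_intros)

section \<open>The fundamental theorem of calculus for absolutely continuous functions\<close>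

lemma sum_length_division_le:
  fixes D :: "real set set"
  assumes D: "D division_of T" and TU: "T \<subseteq> U" and U: "U \<in> lmeasurable"
  shows "(\<Sum>K\<in>D. Sup K - Inf K) \<le> measure lebesgue U"
proof -
  have fin: "finite D" and K: "\<And>K. K \<in> D \<Longrightarrow> \<exists>u v. u \<le> v \<and> K = {u..v}"
    using division_ofD(1,3,4)[OF D] by (auto; metis atLeastatMost_empty_iff2 box_real(2))+
  have "(\<Sum>K\<in>D. Sup K - Inf K) = (\<Sum>K\<in>D. measure lebesgue K)"
    by (rule sum.cong) (use K in force)+
  also have "\<dots> = measure lebesgue (\<Union>D)"
  proof (rule measure_negligible_finite_Union[symmetric, OF fin])
    show "\<And>S. S \<in> D \<Longrightarrow> S \<in> lmeasurable" using K by force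
    show "pairwise (\<lambda>S T. negligible (S \<inter> T)) D"
      unfolding pairwise_def
    proof (intro ballI impI)
      fix K L assume KL: "K \<in> D" "L \<in> D" "K \<noteq> L"
      have "interior (K \<inter> L) = {}" using division_ofD(5)[OF D KL] by simp
      moreover have "convex (K \<inter> L)" using K[OF KL(1)] K[OF KL(2)] by (auto intro!: convex_Int)
      ultimately show "negligible (K \<inter> L)" using negligible_convex_interior by blast
    qed
  qed
  also have "\<dots> \<le> measure lebesgue U"
    using division_ofD(6)[OF D] TU K fin
    by (intro measure_mono_fmeasurable[OF _ _ U] sets.finite_Union) force+
  finally show ?thesis .
qed

text \<open>The gauge separates the exceptional null set N. Tags outside N satisfy the straddle
  estimate. Tags in N are confined to an open set U of measure below the \<delta> of absolute
  continuity, so that the increments of f over their intervals are small in total, while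
  \<open>g'\<close> makes their Riemann terms vanish.\<close>

lemma abs_continuous_on_has_integral:
  fixes f g :: "real \<Rightarrow> complex"
  assumes cd: "c < d" and ac: "abs_continuous_on c d f"
    and der: "AE t\<in>{c<..<d} in lebesgue. (f has_vector_derivative g t) (at t)"
  shows "(g has_integral f d - f c) {c..d}"
proof -
  obtain N0 where N0: "N0 \<in> null_sets lebesgue" "{t. \<not> (t \<in> {c<..<d} \<longrightarrow> (f has_vector_derivative g t) (at t))} \<subseteq> N0"
    using der by (auto simp: eventually_ae_filter)
  define N where "N = N0 \<union> {c, d}"
  have N: "negligible N" "N \<in> null_sets lebesgue" using N0(1) unfolding N_def negligible_iff_null_sets[symmetric] by auto
  have dN: "(f has_vector_derivative g t) (at t)" if "t \<in> {c..d} - N" for t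
    using that N0(2) unfolding N_def by force
  define g' where "g' t = (if t \<in> N then 0 else g t)" for t
  have "(g' has_integral f d - f c) {c..d}"
    unfolding has_integral[of _ _ c d, unfolded box_real]
  proof (intro allI impI)
    fix e :: real assume e: "0 < e"
    \<comment> \<open>The straddle errors add up to \<open>e1 * (d - c) = e / 4\<close>; the
      intervals tagged in N contribute less than \<open>e / 2\<close>.\<close>
    define e1 where "e1 = e / (4 * (d - c))"
    have e1: "e1 > 0" using e cd unfolding e1_def by simp
    obtain \<delta> where \<delta>: "\<delta> > 0" "\<And>D T. D division_of T \<Longrightarrow> T \<subseteq> {c..d} \<Longrightarrow>
        (\<Sum>K\<in>D. Sup K - Inf K) < \<delta> \<Longrightarrow> (\<Sum>K\<in>D. norm (f (Sup K) - f (Inf K))) < e / 2"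
      using ac e unfolding abs_continuous_on_def by (metis half_gt_zero)
    obtain U where U: "open U" "N \<subseteq> U" "U - N \<in> lmeasurable" "emeasure lebesgue (U - N) < ennreal \<delta>"
      using sets_lebesgue_outer_open[of N \<delta>] N(2) \<delta>(1) by (metis null_setsD2)
    have UN: "U = (U - N) \<union> N" using U(2) by auto
    have eU: "emeasure lebesgue U = emeasure lebesgue (U - N)"
      using emeasure_Un_null_set[of "U - N" lebesgue N] U(3) N(2) UN by (metis fmeasurableD)
    have Um: "U \<in> lmeasurable" using U(1,4) eU by (auto intro!: fmeasurableI simp: top.not_eq_extremum order_less_trans[OF _ ennreal_less_top])
    have mU: "measure lebesgue U < \<delta>" using eU U(4) \<delta>(1) Um
      by (metis emeasure_eq_measure2 ennreal_less_iff measure_nonneg)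
    have "\<exists>r>0. \<forall>y. norm (y - t) < r \<longrightarrow> norm (f y - f t - (y - t) *\<^sub>R g t) \<le> e1 * norm (y - t)" if "t \<in> {c..d} - N" for t
      using dN[OF that] e1 unfolding has_vector_derivative_def has_derivative_within_alt[of _ _ _ UNIV] by (auto simp: )
    then obtain r where r: "\<And>t. t \<in> {c..d} - N \<Longrightarrow> r t > 0"
      "\<And>t y. t \<in> {c..d} - N \<Longrightarrow> norm (y - t) < r t \<Longrightarrow> norm (f y - f t - (y - t) *\<^sub>R g t) \<le> e1 * norm (y - t)"
      by metis
    define \<gamma> where "\<gamma> t = (if t \<in> N then U else if t \<in> {c..d} then ball t (r t) else ball t 1)" for t
    show "\<exists>\<gamma>. gauge \<gamma> \<and> (\<forall>\<D>. \<D> tagged_division_of {c..d} \<and> \<gamma> fine \<D> \<longrightarrow>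
       norm ((\<Sum>(t,K)\<in>\<D>. measure lborel K *\<^sub>R g' t) - (f d - f c)) < e)"
    proof (intro exI conjI allI impI)
      show "gauge \<gamma>" unfolding gauge_def \<gamma>_def using U(1,2) r(1) by auto
      fix p assume p: "p tagged_division_of {c..d} \<and> \<gamma> fine p"
      then have p1: "p tagged_division_of {c..d}" and p2: "\<gamma> fine p" by auto
      have fin: "finite p" using p1 by auto
      define q where "q = {x\<in>p. fst x \<in> N}"
      have qp: "q \<subseteq> p" unfolding q_def by auto
      have tp: "q tagged_partial_division_of {c..d}"
        using p1 qp tagged_partial_division_subset unfolding tagged_division_of_def by blast
      have tel: "f d - f c = (\<Sum>(t,K)\<in>p. f (Sup K) - f (Inf K))"
        using additive_tagged_division_1[OF _ p1, of f] cd by auto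
      have len: "d - c = (\<Sum>(t,K)\<in>p. Sup K - Inf K)"
        using additive_tagged_division_1[OF _ p1, of "\<lambda>x. x"] cd by auto
      have Kuv: "\<exists>u v. K = {u..v} \<and> u \<le> t \<and> t \<le> v \<and> c \<le> u \<and> v \<le> d" if tK: "(t,K) \<in> p" for t K
        using tagged_division_ofD(2,3,4)[OF p1 tK] by (metis atLeastAtMost_iff atLeastatMost_subset_iff box_real(2) order_trans)
      have good: "norm (measure lborel K *\<^sub>R g' t - (f (Sup K) - f (Inf K))) \<le> e1 * (Sup K - Inf K)" if tK: "(t,K) \<in> p - q" for t K
      proof -
        obtain u v where K: "K = {u..v}" "u \<le> t" "t \<le> v" "c \<le> u" "v \<le> d" using Kuv tK by blast
        have t: "t \<in> {c..d} - N" using tK K unfolding q_def by auto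
        have "K \<subseteq> ball t (r t)" using p2 tK t unfolding fine_def \<gamma>_def by force
        moreover have "u \<in> K" "v \<in> K" using K by auto
        ultimately have "u \<in> ball t (r t)" "v \<in> ball t (r t)" by (auto simp only: subset_iff)
        then have "norm (f u - f t - (u - t) *\<^sub>R g t) \<le> e1 * norm (u - t)" "norm (f v - f t - (v - t) *\<^sub>R g t) \<le> e1 * norm (v - t)"
          using r(2)[OF t, of u] r(2)[OF t, of v] by (auto simp: dist_norm norm_minus_commute)
        then have "norm ((f u - f t - (u - t) *\<^sub>R g t) - (f v - f t - (v - t) *\<^sub>R g t)) \<le> e1 * norm (u - t) + e1 * norm (v - t)"
          by (meson add_mono norm_triangle_ineq4 order_trans)
        moreover have "(f u - f t - (u - t) *\<^sub>R g t) - (f v - f t - (v - t) *\<^sub>R g t) = (v - u) *\<^sub>R g t - (f v - f u)"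
          by (simp add: algebra_simps)
        moreover have "e1 * norm (u - t) + e1 * norm (v - t) = e1 * (v - u)" using K by (simp add: algebra_simps)
        ultimately show ?thesis using K t by (simp add: g'_def)
      qed
      \<comment> \<open>Absolute continuity speaks of sets of intervals, not of tagged pairs. An
        interval carrying two different tags would have empty interior and hence be a single
        point.\<close>
      have injS: "(\<Sum>(t,K)\<in>q. norm (f (Sup K) - f (Inf K))) = (\<Sum>K\<in>snd ` q. norm (f (Sup K) - f (Inf K)))"
      proof (rule sum.reindex_cong[symmetric, where l=snd])
        show "inj_on snd q"
        proof (rule inj_onI)
          fix x y assume xy: "x \<in> q" "y \<in> q" "snd x = snd y"
          obtain s t K where e: "x = (s, K)" "y = (t, K)" using xy(3) by (metis prod.collapse)
          obtain u v where K: "K = {u..v}" "u \<le> s" "s \<le> v" "u \<le> t" "t \<le> v"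
            using Kuv[of s K] Kuv[of t K] xy e qp by (metis Icc_eq_Icc order_trans subsetD)
          have "s = t"
          proof (rule ccontr)
            assume "s \<noteq> t"
            then have "interior K \<inter> interior K = {}"
              using tagged_partial_division_ofD(5)[OF tp, of s K t K] xy e by auto
            then have "\<not> u < v" using K(1) by simp
            then show False using K \<open>s \<noteq> t\<close> by auto
          qed
          then show "x = y" using e by simp
        qed
      qed (auto simp: split_def)
      have bad: "(\<Sum>(t,K)\<in>q. norm (f (Sup K) - f (Inf K))) < e / 2"
        unfolding injS
      proof (rule \<delta>(2))
        show div: "(snd ` q) division_of \<Union>(snd ` q)" by (rule partial_division_of_tagged_division[OF tp])
        show "\<Union>(snd ` q) \<subseteq> {c..d}" using Kuv qp by fastforce
        have "\<Union>(snd ` q) \<subseteq> U" using p2 unfolding q_def fine_def \<gamma>_def by force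
        then show "(\<Sum>K\<in>snd ` q. Sup K - Inf K) < \<delta>" using sum_length_division_le[OF div _ Um] mU by linarith
      qed
      have "norm ((\<Sum>(t,K)\<in>p. measure lborel K *\<^sub>R g' t) - (f d - f c))
         = norm (\<Sum>(t,K)\<in>p. measure lborel K *\<^sub>R g' t - (f (Sup K) - f (Inf K)))"
        unfolding tel by (simp add: sum_subtractf split_def)
      also have "\<dots> \<le> (\<Sum>(t,K)\<in>p. norm (measure lborel K *\<^sub>R g' t - (f (Sup K) - f (Inf K))))"
        by (simp add: split_def norm_sum)
      also have "\<dots> = (\<Sum>(t,K)\<in>q. norm (measure lborel K *\<^sub>R g' t - (f (Sup K) - f (Inf K)))) + (\<Sum>(t,K)\<in>p - q. norm (measure lborel K *\<^sub>R g' t - (f (Sup K) - f (Inf K))))"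
        using sum.subset_diff[OF qp fin] by (simp add: add.commute)
      also have "(\<Sum>(t,K)\<in>q. norm (measure lborel K *\<^sub>R g' t - (f (Sup K) - f (Inf K)))) = (\<Sum>(t,K)\<in>q. norm (f (Sup K) - f (Inf K)))"
        by (rule sum.cong) (auto simp: q_def g'_def norm_minus_commute)
      also have "(\<Sum>(t,K)\<in>p - q. norm (measure lborel K *\<^sub>R g' t - (f (Sup K) - f (Inf K)))) \<le> (\<Sum>(t,K)\<in>p - q. e1 * (Sup K - Inf K))"
        by (rule sum_mono) (use good in auto)
      also have "\<dots> \<le> (\<Sum>(t,K)\<in>p. e1 * (Sup K - Inf K))"
      proof (rule sum_mono2[OF fin])
        fix b assume "b \<in> p - (p - q)"
        then show "0 \<le> (case b of (t, K) \<Rightarrow> e1 * (Sup K - Inf K))" using Kuv e1 by (cases b) force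
      qed auto
      also have "\<dots> = e1 * (d - c)" unfolding len by (simp add: sum_distrib_left split_def)
      also have "\<dots> = e / 4" using cd unfolding e1_def by (simp add: field_simps)
      finally show "norm ((\<Sum>(t,K)\<in>p. measure lborel K *\<^sub>R g' t) - (f d - f c)) < e" using bad e by linarith
    qed
  qed
  then show ?thesis by (rule has_integral_spike[OF N(1), rotated]) (auto simp: g'_def)
qed

section \<open>Forms given by real symmetric matrices\<close>

lemma matrix_vector_mult_2: "(A *v x) $ i = A $ i $ 1 * x $ 1 + A $ i $ 2 * x $ (2::2)"
  by (simp add: matrix_vector_mult_def sum_2)

lemma cdot_2: "cdot u v = cnj (u $ 1) * v $ 1 + cnj (u $ 2) * v $ 2"
  by (simp add: cdot_def sum_2)

lemma vec2_eq_iff: "u = v \<longleftrightarrow> u $ 1 = v $ 1 \<and> u $ 2 = v $ (2::2)"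
  by (simp add: vec_eq_iff forall_2)

lemma Jmat_mult: "Jmat *v u = vector [- u $ 2, u $ 1]"
  by (simp add: vec2_eq_iff matrix_vector_mult_2 Jmat_def)

lemma cmat_nth [simp]: "cmat A $ i $ j = complex_of_real (A $ i $ j)"
  by (simp add: cmat_def map_matrix_def)

lemma quadratic_form_disc:
  fixes \<alpha> \<beta> \<gamma> :: real
  assumes nonneg: "\<And>x y. 0 \<le> \<alpha> * x\<^sup>2 + 2 * \<beta> * x * y + \<gamma> * y\<^sup>2"
  shows "0 \<le> \<alpha>" "0 \<le> \<gamma>" "\<beta>\<^sup>2 \<le> \<alpha> * \<gamma>"
proof -
  show a: "0 \<le> \<alpha>" "0 \<le> \<gamma>" using nonneg[of 1 0] nonneg[of 0 1] by auto
  show "\<beta>\<^sup>2 \<le> \<alpha> * \<gamma>"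
  proof (cases "\<gamma> = 0")
    case True
    \<comment> \<open>The test point is chosen such that for \<gamma> = 0 the form takes the value
      -\<beta>^2 there.\<close>
    have "0 \<le> \<alpha> * (-\<beta>)\<^sup>2 + 2 * \<beta> * (-\<beta>) * ((\<alpha> + 1) / 2) + \<gamma> * ((\<alpha> + 1) / 2)\<^sup>2" by (rule nonneg)
    then have "\<beta>\<^sup>2 \<le> 0" using True by (simp add: power2_eq_square algebra_simps)
    then show ?thesis using True by simp
  next
    case False
    have "0 \<le> \<gamma> * (\<alpha> * \<gamma> - \<beta>\<^sup>2)" using nonneg[of \<gamma> "-\<beta>"] by (simp add: power2_eq_square algebra_simps)
    then show ?thesis using a False by (simp add: zero_le_mult_iff)
  qed
qed

lemma pos_semidef_2:
  assumes "pos_semidef A"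
  shows "0 \<le> A $ 1 $ 1" "0 \<le> A $ 2 $ 2" "A $ 2 $ 1 = A $ 1 $ (2::2)" "(A $ 1 $ 2)\<^sup>2 \<le> A $ 1 $ 1 * A $ 2 $ 2"
proof -
  have t: "transpose A = A" and p: "\<And>x. 0 \<le> x \<bullet> (A *v x)" using assms unfolding pos_semidef_def by auto
  show s: "A $ 2 $ 1 = A $ 1 $ 2"
  proof -
    have "A $ 2 $ 1 = transpose A $ 1 $ 2" by (simp add: transpose_def)
    then show ?thesis unfolding t .
  qed
  have "0 \<le> A $ 1 $ 1 * x\<^sup>2 + 2 * A $ 1 $ 2 * x * y + A $ 2 $ 2 * y\<^sup>2" for x y
    using p[of "vector [x, y]"] by (simp add: inner_vec_def sum_2 matrix_vector_mult_2 s power2_eq_square algebra_simps)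
  from quadratic_form_disc[OF this]
  show "0 \<le> A $ 1 $ 1" "0 \<le> A $ 2 $ 2" "(A $ 1 $ 2)\<^sup>2 \<le> A $ 1 $ 1 * A $ 2 $ 2" by auto
qed

text \<open>The form $u^* A v$ for the symmetric matrix $A$ with rows $(\alpha, \beta)$ and $(\beta, \gamma)$.\<close>
definition sesq :: "real \<Rightarrow> real \<Rightarrow> real \<Rightarrow> complex^2 \<Rightarrow> complex^2 \<Rightarrow> complex" where
  "sesq \<alpha> \<beta> \<gamma> u v = cnj (u $ 1) * (\<alpha> * v $ 1 + \<beta> * v $ 2) + cnj (u $ 2) * (\<beta> * v $ 1 + \<gamma> * v $ 2)"

definition qform :: "real \<Rightarrow> real \<Rightarrow> real \<Rightarrow> complex^2 \<Rightarrow> real" where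
  "qform \<alpha> \<beta> \<gamma> u = Re (sesq \<alpha> \<beta> \<gamma> u u)"

lemma qform_eq: "qform \<alpha> \<beta> \<gamma> u =
   (\<alpha> * (Re (u $ 1))\<^sup>2 + 2 * \<beta> * Re (u $ 1) * Re (u $ 2) + \<gamma> * (Re (u $ 2))\<^sup>2) +
   (\<alpha> * (Im (u $ 1))\<^sup>2 + 2 * \<beta> * Im (u $ 1) * Im (u $ 2) + \<gamma> * (Im (u $ 2))\<^sup>2)"
  by (simp add: qform_def sesq_def power2_eq_square algebra_simps)

lemma sesq_self: "sesq \<alpha> \<beta> \<gamma> u u = of_real (qform \<alpha> \<beta> \<gamma> u)"
proof (rule complex_eqI)
  show "Im (sesq \<alpha> \<beta> \<gamma> u u) = Im (of_real (qform \<alpha> \<beta> \<gamma> u))"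
    by (simp add: sesq_def algebra_simps)
qed (simp add: qform_def)

lemma real_form_nonneg:
  fixes \<alpha> \<beta> \<gamma> :: real
  assumes "0 \<le> \<alpha>" "0 \<le> \<gamma>" "\<beta>\<^sup>2 \<le> \<alpha> * \<gamma>"
  shows "0 \<le> \<alpha> * x\<^sup>2 + 2 * \<beta> * x * y + \<gamma> * y\<^sup>2"
proof (cases "\<alpha> = 0")
  case True then show ?thesis using assms by simp
next
  case False
  have "\<alpha> * (\<alpha> * x\<^sup>2 + 2 * \<beta> * x * y + \<gamma> * y\<^sup>2) = (\<alpha> * x + \<beta> * y)\<^sup>2 + (\<alpha> * \<gamma> - \<beta>\<^sup>2) * y\<^sup>2"
    by (simp add: power2_eq_square algebra_simps)
  also have "\<dots> \<ge> 0" using assms by (intro add_nonneg_nonneg mult_nonneg_nonneg) auto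
  finally show ?thesis using False assms(1) by (simp add: zero_le_mult_iff)
qed

context
  fixes \<alpha> \<beta> \<gamma> :: real
  assumes psd: "0 \<le> \<alpha>" "0 \<le> \<gamma>" "\<beta>\<^sup>2 \<le> \<alpha> * \<gamma>"
begin

lemma qform_nonneg: "0 \<le> qform \<alpha> \<beta> \<gamma> u"
  unfolding qform_eq by (intro add_nonneg_nonneg real_form_nonneg psd)

text \<open>Cauchy-Schwarz for the form, with the first unit vector as second argument; the defect
  is the determinant times the squared modulus of \<open>u $ 2\<close>. It bounds the first row of
  Hf by h_1 and the density of f, which is how integrability of h_1 is brought to bear.\<close>

lemma qform_row1: "(norm (\<alpha> * u $ 1 + \<beta> * u $ 2))\<^sup>2 \<le> \<alpha> * qform \<alpha> \<beta> \<gamma> u"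
proof -
  have "\<alpha> * qform \<alpha> \<beta> \<gamma> u - (norm (\<alpha> * u $ 1 + \<beta> * u $ 2))\<^sup>2 = (\<alpha> * \<gamma> - \<beta>\<^sup>2) * ((Re (u $ 2))\<^sup>2 + (Im (u $ 2))\<^sup>2)"
    unfolding qform_eq cmod_power2 by (simp add: power2_eq_square algebra_simps)
  also have "\<dots> \<ge> 0" using psd by (intro mult_nonneg_nonneg) auto
  finally show ?thesis by simp
qed

lemma qform_row2: "(norm (\<beta> * u $ 1 + \<gamma> * u $ 2))\<^sup>2 \<le> \<gamma> * qform \<alpha> \<beta> \<gamma> u"
proof -
  have "\<gamma> * qform \<alpha> \<beta> \<gamma> u - (norm (\<beta> * u $ 1 + \<gamma> * u $ 2))\<^sup>2 = (\<alpha> * \<gamma> - \<beta>\<^sup>2) * ((Re (u $ 1))\<^sup>2 + (Im (u $ 1))\<^sup>2)"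
    unfolding qform_eq cmod_power2 by (simp add: power2_eq_square algebra_simps)
  also have "\<dots> \<ge> 0" using psd by (intro mult_nonneg_nonneg) auto
  finally show ?thesis by simp
qed

lemma qform_add_le: "qform \<alpha> \<beta> \<gamma> (u + v) \<le> 2 * qform \<alpha> \<beta> \<gamma> u + 2 * qform \<alpha> \<beta> \<gamma> v"
proof -
  have "2 * qform \<alpha> \<beta> \<gamma> u + 2 * qform \<alpha> \<beta> \<gamma> v - qform \<alpha> \<beta> \<gamma> (u + v) = qform \<alpha> \<beta> \<gamma> (u - v)"
    unfolding qform_eq by (simp add: power2_eq_square algebra_simps)
  then show ?thesis using qform_nonneg[of "u - v"] by linarith
qed

text \<open>The values at (u_1, u_2) and (u_1, -u_2) add up to the right-hand side, because the
  mixed terms cancel, and both are non-negative.\<close>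

lemma qform_le_diag: "qform \<alpha> \<beta> \<gamma> u \<le> 2 * (\<alpha> * (norm (u $ 1))\<^sup>2) + 2 * (\<gamma> * (norm (u $ 2))\<^sup>2)"
proof -
  have "2 * (\<alpha> * (norm (u $ 1))\<^sup>2) + 2 * (\<gamma> * (norm (u $ 2))\<^sup>2) - qform \<alpha> \<beta> \<gamma> u = qform \<alpha> \<beta> \<gamma> (vector [u $ 1, - u $ 2])"
    unfolding qform_eq cmod_power2 by (simp add: power2_eq_square algebra_simps)
  then show ?thesis using qform_nonneg[of "vector [u $ 1, - u $ 2]"] by linarith
qed

text \<open>A unimodular \<zeta> rotates the mixed term to its modulus; then the form at
  \<open>u - \<zeta> *s v\<close> is non-negative.\<close>

lemma norm_sesq_le: "norm (sesq \<alpha> \<beta> \<gamma> u v) \<le> (qform \<alpha> \<beta> \<gamma> u + qform \<alpha> \<beta> \<gamma> v) / 2"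
proof -
  define s where "s = sesq \<alpha> \<beta> \<gamma> u v"
  define \<zeta> where "\<zeta> = (if s = 0 then 1 else cnj s / norm s)"
  have z: "(Re \<zeta>)\<^sup>2 + (Im \<zeta>)\<^sup>2 = 1"
  proof -
    have "norm \<zeta> = 1" unfolding \<zeta>_def by (simp add: norm_divide)
    then show ?thesis by (metis cmod_power2 one_power2)
  qed
  have zs: "\<zeta> * s = norm s"
  proof (cases "s = 0")
    case False
    have "cnj s * s = of_real (norm s) * of_real (norm s)"
      using complex_norm_square[of s] by (simp add: power2_eq_square mult.commute)
    then show ?thesis using False unfolding \<zeta>_def by simp
  qed (simp add: \<zeta>_def)
  have "qform \<alpha> \<beta> \<gamma> (u - \<zeta> *s v) = qform \<alpha> \<beta> \<gamma> u + ((Re \<zeta>)\<^sup>2 + (Im \<zeta>)\<^sup>2) * qform \<alpha> \<beta> \<gamma> v - 2 * Re (\<zeta> * s)"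
    unfolding qform_eq s_def sesq_def by (simp add: power2_eq_square algebra_simps)
  moreover have "Re (\<zeta> * s) = norm s" unfolding zs by simp
  ultimately have "0 \<le> qform \<alpha> \<beta> \<gamma> u + qform \<alpha> \<beta> \<gamma> v - 2 * norm s"
    using qform_nonneg[of "u - \<zeta> *s v"] by (simp only: z mult_1)
  then show ?thesis unfolding s_def by simp
qed

end

lemma qform_scale: "qform \<alpha> \<beta> \<gamma> (c *s u) = (norm c)\<^sup>2 * qform \<alpha> \<beta> \<gamma> u"
  unfolding qform_eq cmod_power2 by (simp add: power2_eq_square algebra_simps)

section \<open>Absolute integrability: Fubini on a triangle, monotone limits, Cauchy-Schwarz\<close>

lemma absolutely_integrable_of_real:
  "u absolutely_integrable_on S \<Longrightarrow> (\<lambda>t. complex_of_real (u t)) absolutely_integrable_on S"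
  using absolutely_integrable_linear[OF _ bounded_linear_of_real] by (simp add: o_def)

text \<open>Fubini on a triangle, obtained from the product rule: the product of
  \<open>integral {x..t} u\<close> and \<open>integral {t..y} v\<close> vanishes at both ends, and
  its derivative is the integrand of the first claim.\<close>

lemma integral_triangle:
  fixes u v :: "real \<Rightarrow> real"
  assumes xy: "x \<le> y" and u: "u absolutely_integrable_on {x..y}" and v: "v absolutely_integrable_on {x..y}"
  shows "((\<lambda>t. u t * integral {t..y} v - integral {x..t} u * v t) has_integral 0) {x..y}"
    and "(\<lambda>t. u t * integral {t..y} v) absolutely_integrable_on {x..y}"
    and "(\<lambda>t. integral {x..t} u * v t) absolutely_integrable_on {x..y}"
    and "integral {x..y} (\<lambda>t. u t * integral {t..y} v) = integral {x..y} (\<lambda>t. integral {x..t} u * v t)"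
proof -
  have ui: "u integrable_on {s..t}" "v integrable_on {s..t}" if "x \<le> s" "t \<le> y" for s t
    using u v that absolutely_integrable_on_def by (meson atLeastatMost_subset_iff integrable_subinterval_real)+
  have cU: "continuous_on {x..y} (\<lambda>t. integral {x..t} u)" using ui by (intro indefinite_integral_continuous_1) auto
  have cV: "continuous_on {x..y} (\<lambda>t. integral {t..y} v)" using ui by (intro indefinite_integral_continuous_1') auto
  have U: "indef_int {x..y} (\<lambda>t. complex_of_real (integral {x..t} u)) (\<lambda>t. complex_of_real (u t))"
  proof (rule indef_intI)
    fix s t assume st: "s \<in> {x..y}" "t \<in> {x..y}" "s \<le> t"
    show "(\<lambda>t. complex_of_real (u t)) absolutely_integrable_on {s..t}"
      using set_integrable_subset[OF u, of "{s..t}"] st by (intro absolutely_integrable_of_real) auto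
    have "integral {x..t} u - integral {x..s} u = integral {s..t} u"
      using Henstock_Kurzweil_Integration.integral_combine[of x s t u] ui[of x t] st by auto
    then show "((\<lambda>t. complex_of_real (u t)) has_integral complex_of_real (integral {x..t} u) - complex_of_real (integral {x..s} u)) {s..t}"
      using has_integral_of_real[of u "integral {s..t} u" "{s..t}"] ui[of s t] st by (auto simp flip: of_real_diff simp: integrable_integral)
  qed
  have V: "indef_int {x..y} (\<lambda>t. complex_of_real (integral {t..y} v)) (\<lambda>t. - complex_of_real (v t))"
  proof (rule indef_intI)
    fix s t assume st: "s \<in> {x..y}" "t \<in> {x..y}" "s \<le> t"
    show "(\<lambda>t. - complex_of_real (v t)) absolutely_integrable_on {s..t}"
      using set_integrable_mult_right[of "-1" lebesgue "{s..t}" "\<lambda>t. complex_of_real (v t)", OF absolutely_integrable_of_real[OF set_integrable_subset[OF v, of "{s..t}"]]] st by auto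
    have "integral {t..y} v - integral {s..y} v = - integral {s..t} v"
      using Henstock_Kurzweil_Integration.integral_combine[of s t y v] ui[of s y] st by auto
    then show "((\<lambda>t. - complex_of_real (v t)) has_integral complex_of_real (integral {t..y} v) - complex_of_real (integral {s..y} v)) {s..t}"
      using has_integral_neg[OF has_integral_of_real[of v "integral {s..t} v" "{s..t}"]] ui[of s t] st
      by (auto simp flip: of_real_diff of_real_minus simp: integrable_integral)
  qed
  have "((\<lambda>t. complex_of_real (u t) * complex_of_real (integral {t..y} v) + complex_of_real (integral {x..t} u) * - complex_of_real (v t)) has_integral 0) {x..y}"
    using indef_intD(2)[OF indef_int_mult[OF U V], of x y] xy by (auto simp: is_interval_cc)
  then have "((\<lambda>t. complex_of_real (u t * integral {t..y} v - integral {x..t} u * v t)) has_integral 0) {x..y}" by simp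
  from has_integral_linear[OF this bounded_linear_Re]
  show 1: "((\<lambda>t. u t * integral {t..y} v - integral {x..t} u * v t) has_integral 0) {x..y}" by (simp add: o_def)
  have prod: "(\<lambda>t. c t * w t) absolutely_integrable_on {x..y}" if "continuous_on {x..y} c" "w absolutely_integrable_on {x..y}" for c w :: "real \<Rightarrow> real"
  proof (rule absolutely_integrable_bounded_measurable_product_real[OF _ _ _ that(2)])
    show "c \<in> borel_measurable (lebesgue_on {x..y})"
      using continuous_imp_measurable_on_sets_lebesgue[OF that(1)] by auto
    show "bounded (c ` {x..y})" using compact_imp_bounded compact_continuous_image[OF that(1)] by auto
  qed auto
  show 2: "(\<lambda>t. u t * integral {t..y} v) absolutely_integrable_on {x..y}" using prod[OF cV u] by (simp add: mult.commute)
  show 3: "(\<lambda>t. integral {x..t} u * v t) absolutely_integrable_on {x..y}" using prod[OF cU v] .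
  show "integral {x..y} (\<lambda>t. u t * integral {t..y} v) = integral {x..y} (\<lambda>t. integral {x..t} u * v t)"
  proof -
    have "integral {x..y} (\<lambda>t. u t * integral {t..y} v - integral {x..t} u * v t)
        = integral {x..y} (\<lambda>t. u t * integral {t..y} v) - integral {x..y} (\<lambda>t. integral {x..t} u * v t)"
      by (rule integral_diff) (use set_lebesgue_integral_eq_integral(1)[OF 2] set_lebesgue_integral_eq_integral(1)[OF 3] in blast)+
    then show ?thesis using integral_unique[OF 1] by (simp only: right_minus_eq)
  qed
qed

text \<open>Monotone convergence along cut-offs at points \<open>T k\<close> < b. All cut-offs
  vanish at b itself, so \<open>f b = 0\<close> gives pointwise convergence on the closed
  interval.\<close>

lemma nonneg_absolutely_integrable_if_bounded:
  fixes f :: "real \<Rightarrow> real"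
  assumes ab: "a < b" and nonneg: "\<And>t. 0 \<le> f t" and b0: "f b = 0"
    and int: "\<And>T. a < T \<Longrightarrow> T < b \<Longrightarrow> f integrable_on {a..T}"
    and bd: "\<And>T. a < T \<Longrightarrow> T < b \<Longrightarrow> integral {a..T} f \<le> C"
  shows "f absolutely_integrable_on {a..b}"
proof -
  define T where "T k = b - (b - a) / real (k + 2)" for k
  have T: "a < T k" "T k < b" for k
  proof -
    have "(b - a) * 1 < (b - a) * real (k + 2)" using ab by (intro mult_strict_left_mono) auto
    then have "(b - a) / real (k + 2) < b - a" by (simp add: divide_less_eq)
    then show "a < T k" "T k < b" using ab unfolding T_def by auto
  qed
  have Tm: "T k \<le> T (Suc k)" for k using ab unfolding T_def by (auto simp: frac_le)
  have Tl: "T \<longlonglongrightarrow> b"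
  proof -
    have "(\<lambda>k. b - (b - a) / real (k + 2)) \<longlonglongrightarrow> b - 0"
      by (intro tendsto_intros real_tendsto_divide_at_top filterlim_compose[OF filterlim_real_sequentially filterlim_add_const_nat_at_top]) auto
    then show ?thesis unfolding T_def by simp
  qed
  have hi: "((\<lambda>t. if t \<in> {a..T k} then f t else 0) has_integral integral {a..T k} f) {a..b}" for k
  proof -
    have "{a..T k} \<inter> {a..b} = {a..T k}" using T[of k] by auto
    then show ?thesis unfolding has_integral_restrict_Int using integrable_integral[OF int[OF T]] by (simp only:)
  qed
  have "f integrable_on {a..b} \<and> (\<lambda>k. integral {a..b} (\<lambda>t. if t \<in> {a..T k} then f t else 0)) \<longlonglongrightarrow> integral {a..b} f"
  proof (rule monotone_convergence_increasing)
    fix k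
    show "(\<lambda>t. if t \<in> {a..T k} then f t else 0) integrable_on {a..b}"
      using hi by blast
    show "\<And>t. t \<in> {a..b} \<Longrightarrow> (if t \<in> {a..T k} then f t else 0) \<le> (if t \<in> {a..T (Suc k)} then f t else 0)"
      using Tm[of k] nonneg by auto
  next
    fix t assume t: "t \<in> {a..b}"
    show "(\<lambda>k. if t \<in> {a..T k} then f t else 0) \<longlonglongrightarrow> f t"
    proof (cases "t = b")
      case True
      have "\<not> b \<le> T k" for k using T[of k] by simp
      then show ?thesis using b0 True by simp
    next
      case False
      then have "\<forall>\<^sub>F k in sequentially. t < T k" using order_tendstoD(1)[OF Tl, of t] t by auto
      then have "\<forall>\<^sub>F k in sequentially. (if t \<in> {a..T k} then f t else 0) = f t" by eventually_elim (use t in auto)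
      then show ?thesis by (rule tendsto_eventually)
    qed
  next
    have "norm (integral {a..b} (\<lambda>t. if t \<in> {a..T k} then f t else 0)) \<le> C" for k
    proof -
      have "integral {a..b} (\<lambda>t. if t \<in> {a..T k} then f t else 0) = integral {a..T k} f"
        by (rule integral_unique[OF hi])
      moreover have "0 \<le> integral {a..T k} f" by (intro integral_nonneg[OF int[OF T]] nonneg)
      ultimately show ?thesis using bd[OF T[of k]] by simp
    qed
    then show "bounded (range (\<lambda>k. integral {a..b} (\<lambda>t. if t \<in> {a..T k} then f t else 0)))"
      unfolding bounded_iff by auto
  qed
  then show ?thesis using nonnegative_absolutely_integrable_1[of f "{a..b}"] nonneg by blast
qed

lemma borel_measurable_vec_nth [measurable (raw)]:
  fixes f :: "_ \<Rightarrow> complex^2"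
  shows "f \<in> borel_measurable N \<Longrightarrow> (\<lambda>t. f t $ i) \<in> borel_measurable N"
  by (rule borel_measurable_continuous_on[of "\<lambda>x. x $ i"]) (auto intro!: continuous_intros)

lemma borel_measurable_vector2:
  fixes u v :: "_ \<Rightarrow> complex"
  assumes [measurable]: "u \<in> borel_measurable N" "v \<in> borel_measurable N"
  shows "(\<lambda>t. vector [u t, v t] :: complex^2) \<in> borel_measurable N"
proof -
  have e: "(vector [x, y] :: complex^2) = (\<chi> i. if i = 1 then x else y)" for x y
    by (simp add: vec2_eq_iff)
  have "continuous_on UNIV (\<lambda>p :: complex \<times> complex. (\<chi> i. if i = 1 then fst p else snd p) :: complex^2)"
  proof (rule continuous_on_vec_lambda)
    fix i :: 2
    show "continuous_on UNIV (\<lambda>p :: complex \<times> complex. if i = 1 then fst p else snd p)"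
      by (cases "i = 1") (auto intro!: continuous_intros)
  qed
  from borel_measurable_continuous_on[OF this, of "\<lambda>t. (u t, v t)" N]
  show ?thesis unfolding e by (simp only: fst_conv snd_conv borel_measurable_Pair assms)
qed

text \<open>The weighted inequality of arithmetic and geometric means bounds the norm of w by (e u +
  v/e) / 2 for every e > 0. Integrate and optimise in e.\<close>

lemma integral_norm_Cauchy_Schwarz:
  fixes u v :: "real \<Rightarrow> real" and w :: "real \<Rightarrow> complex"
  assumes S: "S \<in> sets lebesgue" and u: "u absolutely_integrable_on S" and v: "v absolutely_integrable_on S"
    and w: "w \<in> borel_measurable (lebesgue_on S)"
    and nn: "\<And>t. t \<in> S \<Longrightarrow> 0 \<le> u t" "\<And>t. t \<in> S \<Longrightarrow> 0 \<le> v t"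
    and le: "\<And>t. t \<in> S \<Longrightarrow> (norm (w t))\<^sup>2 \<le> u t * v t"
  shows "w absolutely_integrable_on S" "integral S (\<lambda>t. norm (w t)) \<le> sqrt (integral S u * integral S v)"
proof -
  have ui: "u integrable_on S" "v integrable_on S" using u v absolutely_integrable_on_def by blast+
  have pt: "norm (w t) \<le> (e * u t + v t / e) / 2" if "t \<in> S" "e > 0" for t e
  proof -
    have uv: "0 \<le> u t" "0 \<le> v t" using nn that by auto
    have "norm (w t) \<le> sqrt (u t * v t)" using le[OF that(1)] by (simp add: real_le_rsqrt)
    also have "u t * v t = (e * u t) * (v t / e)" using that(2) by simp
    also have "sqrt \<dots> \<le> (e * u t + v t / e) / 2" using uv that by (intro arith_geo_mean_sqrt) auto
    finally show ?thesis .
  qed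
  have gi: "(\<lambda>t. (e * u t + v t / e) / 2) integrable_on S" for e
    using ui by (intro integrable_on_divide integrable_add integrable_on_mult_right) auto
  show w1: "w absolutely_integrable_on S"
    by (rule measurable_bounded_by_integrable_imp_absolutely_integrable[OF w S gi[of 1]]) (use pt[of _ 1] in auto)
  have nw: "(\<lambda>t. norm (w t)) integrable_on S" using w1 absolutely_integrable_on_def by blast
  define I where "I = integral S (\<lambda>t. norm (w t))"
  define U where "U = integral S u" define V where "V = integral S v"
  have UV: "0 \<le> U" "0 \<le> V" "0 \<le> I" unfolding U_def V_def I_def using nn ui nw by (auto intro!: integral_nonneg)
  have bd: "I \<le> (e * U + V / e) / 2" if "e > 0" for e
  proof -
    have "I \<le> integral S (\<lambda>t. (e * u t + v t / e) / 2)"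
      unfolding I_def by (intro integral_le nw gi pt that)
    also have "\<dots> = (e * U + V / e) / 2" unfolding U_def V_def using ui
      by (simp add: integral_add integrable_on_divide integrable_on_mult_right)
    finally show ?thesis .
  qed
  have "I \<le> sqrt (U * V)"
  proof (cases "U > 0 \<and> V > 0")
    case True
    define e where "e = sqrt V / sqrt U"
    have "e > 0" "e * U = sqrt (U * V)" "V / e = sqrt (U * V)" using True unfolding e_def
      by (auto simp: real_sqrt_mult field_simps)
    then show ?thesis using bd[of e] by simp
  next
    case False
    \<comment> \<open>If one of the integrals vanishes there is no optimal weight. A weight
      proportional to I, or to 1/I, turns the bound into I \<le> I / 2.\<close>
    have "I = 0"
    proof (rule ccontr)
      assume "I \<noteq> 0"
      then have I: "I > 0" using UV by simp
      show False
      proof (cases "U > 0")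
        case True
        then have V0: "V = 0" using False UV by simp
        define k where "k = I / (U + 1) * U"
        have "I \<le> k / 2" using bd[of "I / (U + 1)"] I UV V0 unfolding k_def by simp
        moreover have "I * (U / (U + 1)) \<le> I * 1" using I UV by (intro mult_left_mono) auto
        then have "k \<le> I" unfolding k_def by simp
        ultimately show False using I by linarith
      next
        case U: False
        then have U0: "U = 0" using UV by simp
        define k where "k = V / ((V + 1) / I)"
        have "I \<le> k / 2" using bd[of "(V + 1) / I"] I UV U0 unfolding k_def by simp
        moreover have "I * (V / (V + 1)) \<le> I * 1" using I UV by (intro mult_left_mono) auto
        then have "k \<le> I" unfolding k_def by (simp add: mult.commute)
        ultimately show False using I by linarith
      qed
    qed
    then show ?thesis using UV by simp
  qed
  then show "integral S (\<lambda>t. norm (w t)) \<le> sqrt (integral S u * integral S v)" unfolding I_def U_def V_def .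
qed

lemma absolutely_integrable_vec2_iff:
  fixes f :: "real \<Rightarrow> complex^2"
  shows "f absolutely_integrable_on S \<longleftrightarrow> (\<lambda>t. f t $ 1) absolutely_integrable_on S \<and> (\<lambda>t. f t $ 2) absolutely_integrable_on S"
proof
  assume f: "f absolutely_integrable_on S"
  show "(\<lambda>t. f t $ 1) absolutely_integrable_on S \<and> (\<lambda>t. f t $ 2) absolutely_integrable_on S"
    using absolutely_integrable_linear[OF f bounded_linear_vec_nth] by (simp add: o_def)
next
  assume f: "(\<lambda>t. f t $ 1) absolutely_integrable_on S \<and> (\<lambda>t. f t $ 2) absolutely_integrable_on S"
  have bl: "bounded_linear (\<lambda>x::complex. axis i x :: complex^2)" for i
    by (rule linear_conv_bounded_linear[THEN iffD1], rule linearI) (auto simp: vec2_eq_iff axis_def)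
  have "(\<lambda>t. axis 1 (f t $ 1) + axis 2 (f t $ 2) :: complex^2) absolutely_integrable_on S"
    using set_integral_add(1)[OF absolutely_integrable_linear[OF conjunct1[OF f] bl] absolutely_integrable_linear[OF conjunct2[OF f] bl]]
    by (simp add: o_def)
  moreover have "(\<lambda>t. axis 1 (f t $ 1) + axis 2 (f t $ 2)) = f" by (simp add: fun_eq_iff vec2_eq_iff axis_def)
  ultimately show "f absolutely_integrable_on S" by simp
qed

lemma absolutely_integrable_matrix2:
  fixes f :: "real \<Rightarrow> real^2^2"
  assumes "\<And>i j. (\<lambda>t. f t $ i $ j) absolutely_integrable_on S"
  shows "f absolutely_integrable_on S"
proof (rule absolutely_integrable_componentwise)
  fix b :: "real^2^2" assume "b \<in> Basis"
  then obtain i j where "b = axis i (axis j 1)" by (auto simp: Basis_vec_def)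
  then show "(\<lambda>t. f t \<bullet> b) absolutely_integrable_on S" using assms[of i j] by (simp add: inner_axis)
qed

section \<open>A Hamiltonian with regular left and singular right endpoint\<close>

locale hs_side =
  fixes a b :: real and H :: "real \<Rightarrow> real^2^2"
  assumes ab: "a < b" and ham: "hamiltonian a b H"
    and lcl: "limit_circle_left a b H" and lpr: "limit_point_right a b H"
    and condI: "set_integrable lebesgue {a<..<b} (\<lambda>t. H t $ 1 $ 1)"
    and condHS: "set_integrable lebesgue {a<..<b} (\<lambda>t. (LINT s:{a<..<t}|lebesgue. H s $ 2 $ 2) * H t $ 1 $ 1)"
begin

definition bad :: "real set" where "bad = {t \<in> {a<..<b}. \<not> pos_semidef (H t)}"

text \<open>Setting the entries to 0 off the open interval and on the null set without positive
  semidefiniteness makes the inequalities \<open>h_psd\<close> hold at every point, and lets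
  integrals run over closed intervals that end at a or b.\<close>

definition hval :: "2 \<Rightarrow> 2 \<Rightarrow> real \<Rightarrow> real" where
  "hval i j t = (if t \<in> {a<..<b} \<and> t \<notin> bad then H t $ i $ j else 0)"

abbreviation "h1 \<equiv> hval 1 1"
abbreviation "h2 \<equiv> hval 2 2"
abbreviation "h3 \<equiv> hval 1 2"

lemma bad_null: "bad \<in> null_sets lebesgue" and negligible_bad: "negligible bad"
proof -
  have "AE t\<in>{a<..<b} in lebesgue. pos_semidef (H t)" using ham unfolding hamiltonian_def by blast
  then obtain N where N: "N \<in> null_sets lebesgue" "{t. \<not> (t \<in> {a<..<b} \<longrightarrow> pos_semidef (H t))} \<subseteq> N"
    by (auto simp: eventually_ae_filter)
  have "bad \<subseteq> N" using N(2) unfolding bad_def by auto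
  then have "negligible bad" using N(1) negligible_subset unfolding negligible_iff_null_sets[symmetric] by blast
  then show "bad \<in> null_sets lebesgue" "negligible bad" by (auto simp: negligible_iff_null_sets)
qed

lemma h_psd: "0 \<le> h1 t" "0 \<le> h2 t" "(h3 t)\<^sup>2 \<le> h1 t * h2 t" "hval 2 1 t = h3 t"
  using pos_semidef_2[of "H t"] unfolding hval_def bad_def by auto

lemma hval_outside: "t \<notin> {a<..<b} \<Longrightarrow> hval i j t = 0" unfolding hval_def by presburger

lemma h_end [simp]: "hval i j a = 0" "hval i j b = 0" by (auto simp: hval_def)

lemma hval_eq: "t \<in> {a<..<b} \<Longrightarrow> t \<notin> bad \<Longrightarrow> H t $ i $ j = hval i j t" by (simp add: hval_def)

lemma hval_measurable [measurable]: "hval i j \<in> borel_measurable lebesgue"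
proof -
  have "H \<in> borel_measurable (lebesgue_on {a<..<b})" using ham unfolding hamiltonian_def by blast
  then have "(\<lambda>t. H t $ i $ j) \<in> borel_measurable (lebesgue_on {a<..<b})"
    by (rule borel_measurable_continuous_on[of "\<lambda>x. x $ i $ j", rotated]) (auto intro!: continuous_intros)
  then have m: "(\<lambda>t. if t \<in> {a<..<b} then H t $ i $ j else 0) \<in> borel_measurable lebesgue"
    by (subst borel_measurable_if) auto
  have [measurable]: "bad \<in> sets lebesgue" using bad_null by auto
  have "(\<lambda>t. if t \<in> bad then 0 else if t \<in> {a<..<b} then H t $ i $ j else 0) \<in> borel_measurable lebesgue"
    by (intro measurable_If_set m) auto
  moreover have "(\<lambda>t. if t \<in> bad then 0 else if t \<in> {a<..<b} then H t $ i $ j else 0) = hval i j"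
    by (auto simp: hval_def fun_eq_iff)
  ultimately show ?thesis by simp
qed

lemma hval_spike:
  assumes "(\<lambda>t. H t $ i $ j) absolutely_integrable_on S" "negligible (S - T)" "T \<subseteq> {a<..<b}" "T \<subseteq> S"
  shows "hval i j absolutely_integrable_on S"
proof (rule absolutely_integrable_spike[OF assms(1)])
  show "negligible (bad \<union> (S - T))" using assms(2) negligible_bad by auto
  show "\<And>t. t \<in> S - (bad \<union> (S - T)) \<Longrightarrow> hval i j t = H t $ i $ j" using assms(3) by (auto simp: hval_eq)
qed

lemma hval_integrable:
  assumes "a \<le> x" "y < b"
  shows "hval i j absolutely_integrable_on {x..y}"
proof -
  obtain c where c: "a < c" "c < b" "H absolutely_integrable_on {a<..<c}" using lcl unfolding limit_circle_left_def by blast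
  have bl: "bounded_linear (\<lambda>A :: real^2^2. A $ i $ j)"
    using bounded_linear_compose[OF bounded_linear_vec_nth[of j] bounded_linear_vec_nth[of i]] .
  define d where "d = max c y"
  have "d < b" "c \<le> d" "y \<le> d" using c assms unfolding d_def by simp_all
  have "(\<lambda>t. H t $ i $ j) absolutely_integrable_on {a<..<c}" using absolutely_integrable_linear[OF c(3) bl] by (simp add: o_def)
  then have 1: "hval i j absolutely_integrable_on {a<..<c}"
    by (rule hval_spike[where T="{a<..<c}"]) (use c in auto)
  have 1: "hval i j absolutely_integrable_on {a..c}"
  proof -
    have "negligible {x \<in> {a<..<c} - {a..c}. hval i j x \<noteq> 0}" "negligible {x \<in> {a..c} - {a<..<c}. hval i j x \<noteq> 0}"
      by (rule negligible_subset[of "{a, c}"]; auto)+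
    from absolutely_integrable_spike_set_eq[OF this] show ?thesis using 1 by simp
  qed
  have 2: "hval i j absolutely_integrable_on {c..d}"
  proof (cases "c < d")
    case True
    then have "H absolutely_integrable_on {c..d}"
      using ham[unfolded hamiltonian_def, THEN conjunct2, THEN conjunct1, rule_format, of c d] c \<open>d < b\<close> by simp
    then have "(\<lambda>t. H t $ i $ j) absolutely_integrable_on {c..d}" using absolutely_integrable_linear[OF _ bl] by (simp add: o_def)
    then show ?thesis by (rule hval_spike[where T="{c..d}"]) (use c \<open>d < b\<close> in auto)
  next
    case False
    then have "measure lborel (cbox c d) = 0" by simp
    then show ?thesis using absolutely_integrable_on_null[of c d "hval i j"] by (simp only: box_real)
  qed
  have "{a..c} \<union> {c..d} = {a..d}" using c \<open>c \<le> d\<close> by auto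
  then have "hval i j absolutely_integrable_on {a..d}" using absolutely_integrable_Un[OF 1 2] by simp
  then show ?thesis by (rule set_integrable_subset) (use assms \<open>y \<le> d\<close> in auto)
qed

lemma h1_integrable: "h1 absolutely_integrable_on {a..b}"
proof -
  have "h1 absolutely_integrable_on {a<..<b}" by (rule hval_spike[OF condI, where T="{a<..<b}"]) auto
  then have 1: "(\<lambda>t. if t \<in> {a<..<b} then h1 t else 0) absolutely_integrable_on UNIV"
    by (rule iffD2[OF absolutely_integrable_restrict_UNIV])
  have "(\<lambda>t. if t \<in> {a<..<b} then h1 t else 0) = (\<lambda>t. if t \<in> {a..b} then h1 t else 0)"
    by (auto simp: fun_eq_iff hval_def)
  then have "(\<lambda>t. if t \<in> {a..b} then h1 t else 0) absolutely_integrable_on UNIV" using 1 by simp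
  then show ?thesis by (rule iffD1[OF absolutely_integrable_restrict_UNIV])
qed

text \<open>By (I) the entry h_1 is integrable, and h_3 is dominated by (h_1 + h_2) / 2. So the
  limit point case at b can only be due to h_2.\<close>

lemma h2_not_integrable:
  assumes "a < c" "c < b"
  shows "\<not> h2 absolutely_integrable_on {c..b}"
proof
  assume 2: "h2 absolutely_integrable_on {c..b}"
  have 1: "h1 absolutely_integrable_on {c..b}" using set_integrable_subset[OF h1_integrable, of "{c..b}"] assms by auto
  have 3: "h3 absolutely_integrable_on {c..b}"
  proof (rule measurable_bounded_by_integrable_imp_absolutely_integrable[where g="\<lambda>t. (h1 t + h2 t) / 2"])
    show "h3 \<in> borel_measurable (lebesgue_on {c..b})" using measurable_restrict_space1[OF hval_measurable] by blast
    show "(\<lambda>t. (h1 t + h2 t) / 2) integrable_on {c..b}"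
      using 1 2 unfolding absolutely_integrable_on_def by (intro integrable_on_divide integrable_add) auto
    fix t
    have "\<bar>h3 t\<bar> \<le> sqrt (h1 t * h2 t)" using h_psd(3)[of t] by (metis real_sqrt_abs real_sqrt_le_iff)
    also have "\<dots> \<le> (h1 t + h2 t) / 2" by (intro arith_geo_mean_sqrt h_psd)
    finally show "norm (h3 t) \<le> (h1 t + h2 t) / 2" by simp
  qed simp
  have all: "hval i j absolutely_integrable_on {c..b}" for i j
  proof -
    have "hval 2 1 = h3" using h_psd(4) by auto
    then show ?thesis using 1 2 3 exhaust_2[of i] exhaust_2[of j] by (elim disjE) simp_all
  qed
  have "H absolutely_integrable_on {c<..<b}"
  proof (rule absolutely_integrable_matrix2)
    fix i j
    have "hval i j absolutely_integrable_on {c<..<b}" by (rule set_integrable_subset[OF all]) auto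
    then show "(\<lambda>t. H t $ i $ j) absolutely_integrable_on {c<..<b}"
      by (rule absolutely_integrable_spike[OF _ negligible_bad]) (use assms in \<open>auto simp: hval_eq\<close>)
  qed
  then show False using lpr assms unfolding limit_circle_right_def by blast
qed

end

lemma absolutely_integrable_subinterval:
  fixes f :: "real \<Rightarrow> 'a::euclidean_space"
  assumes "f absolutely_integrable_on {x..y}" "x \<le> u" "v \<le> y"
  shows "f absolutely_integrable_on {u..v}"
  by (rule set_integrable_subset[OF assms(1)]) (use assms in auto)

lemma absolutely_integrable_imp_integrable:
  fixes f :: "real \<Rightarrow> 'a::euclidean_space"
  shows "f absolutely_integrable_on S \<Longrightarrow> f integrable_on S"
  by (rule set_lebesgue_integral_eq_integral(1))

context hs_side begin

text \<open>M and N1 are the two scales near b: antiderivatives of JHf with f in L^2 have first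
  components of size sqrt (1 + M), and second components within sqrt (N1) of their limit, up to
  constants.\<close>

definition M :: "real \<Rightarrow> real" where "M t = integral {a..t} h2"
definition N1 :: "real \<Rightarrow> real" where "N1 t = integral {t..b} h1"

lemmas hval_on = absolutely_integrable_imp_integrable[OF hval_integrable]
lemmas h1_sub = absolutely_integrable_subinterval[OF h1_integrable]
lemmas h1_on = absolutely_integrable_imp_integrable[OF h1_sub]

lemma M_diff: "a \<le> s \<Longrightarrow> s \<le> t \<Longrightarrow> t < b \<Longrightarrow> integral {s..t} h2 = M t - M s"
  using Henstock_Kurzweil_Integration.integral_combine[of a s t h2] hval_on[of a t 2 2] unfolding M_def by simp

lemma N1_diff: "a \<le> s \<Longrightarrow> s \<le> t \<Longrightarrow> t \<le> b \<Longrightarrow> integral {s..t} h1 = N1 s - N1 t"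
  using Henstock_Kurzweil_Integration.integral_combine[of s t b h1] h1_on[of s b] unfolding N1_def by simp

lemma M_mono: "a \<le> s \<Longrightarrow> s \<le> t \<Longrightarrow> t < b \<Longrightarrow> M s \<le> M t"
  using M_diff[of s t] integral_nonneg[OF hval_on[of s t 2 2]] h_psd(2) by simp

lemma M_nonneg: "a \<le> t \<Longrightarrow> t < b \<Longrightarrow> 0 \<le> M t"
  unfolding M_def by (rule integral_nonneg[OF hval_on]) (use h_psd in auto)

lemma N1_nonneg: "a \<le> t \<Longrightarrow> t \<le> b \<Longrightarrow> 0 \<le> N1 t"
  unfolding N1_def by (rule integral_nonneg[OF h1_on]) (use h_psd in auto)

lemma N1_continuous: "continuous_on {a..b} N1"
  unfolding N1_def[abs_def] by (rule indefinite_integral_continuous_1'[OF h1_on]) auto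

lemma M_h1_integrable: "(\<lambda>t. M t * h1 t) absolutely_integrable_on {a..b}"
proof -
  have L: "(LINT s:{a<..<t}|lebesgue. H s $ 2 $ 2) = M t" if t: "t \<in> {a<..<b}" for t
  proof -
    have h: "h2 absolutely_integrable_on {a<..<t}"
      by (rule set_integrable_subset[OF hval_integrable[of a t 2 2]]) (use t in auto)
    have H: "(\<lambda>s. H s $ 2 $ 2) absolutely_integrable_on {a<..<t}"
      by (rule absolutely_integrable_spike[OF h negligible_bad]) (use t in \<open>auto simp: hval_eq\<close>)
    have "(LINT s:{a<..<t}|lebesgue. H s $ 2 $ 2) = integral {a<..<t} (\<lambda>s. H s $ 2 $ 2)"
      by (rule set_lebesgue_integral_eq_integral(2)[OF H])
    also have "\<dots> = integral {a<..<t} h2"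
      by (rule integral_spike[OF negligible_bad]) (use t in \<open>auto simp: hval_eq\<close>)
    also have "\<dots> = integral {a..t} h2" by (simp add: integral_open_interval_real)
    finally show ?thesis unfolding M_def .
  qed
  have "(\<lambda>t. M t * h1 t) absolutely_integrable_on {a<..<b}"
    by (rule absolutely_integrable_spike[OF condHS negligible_bad]) (auto simp: L hval_eq)
  then have 1: "(\<lambda>t. if t \<in> {a<..<b} then M t * h1 t else 0) absolutely_integrable_on UNIV"
    by (rule iffD2[OF absolutely_integrable_restrict_UNIV])
  have "(\<lambda>t. if t \<in> {a<..<b} then M t * h1 t else 0) = (\<lambda>t. if t \<in> {a..b} then M t * h1 t else 0)"
    by (auto simp: fun_eq_iff hval_def)
  then have "(\<lambda>t. if t \<in> {a..b} then M t * h1 t else 0) absolutely_integrable_on UNIV" using 1 by simp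
  then show ?thesis by (rule iffD1[OF absolutely_integrable_restrict_UNIV])
qed

text \<open>Combines (I) and (HS) in a single integrable weight: h_1 times the square of the
  admissible size of first components.\<close>

definition Mh :: "real \<Rightarrow> real" where "Mh t = (1 + M t) * h1 t"

lemma Mh_integrable: "Mh absolutely_integrable_on {a..b}"
  using set_integral_add(1)[OF h1_integrable M_h1_integrable] unfolding Mh_def[abs_def] by (simp add: distrib_right)

lemmas Mh_sub = absolutely_integrable_subinterval[OF Mh_integrable]
lemmas Mh_on = absolutely_integrable_imp_integrable[OF Mh_sub]

lemma Mh_nonneg: "0 \<le> Mh t"
proof (cases "t \<in> {a<..<b}")
  case True then show ?thesis using M_nonneg[of t] h_psd(1) unfolding Mh_def by simp
next
  case False then show ?thesis unfolding Mh_def by (simp add: hval_outside)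
qed

text \<open>M is increasing, so the factor \<open>1 + M t\<close> may be moved under the integral of
  h_1 over [t, b]. This controls the boundary term in \<open>h2_N1_integrable\<close>.\<close>

lemma M_N1_le:
  assumes "a \<le> t" "t < b" shows "(1 + M t) * N1 t \<le> integral {t..b} Mh"
proof -
  have "(1 + M t) * N1 t = integral {t..b} (\<lambda>s. (1 + M t) * h1 s)"
    unfolding N1_def by (rule integral_mult_right[symmetric])
  also have "\<dots> \<le> integral {t..b} Mh"
  proof (rule integral_le)
    show "(\<lambda>s. (1 + M t) * h1 s) integrable_on {t..b}" by (rule integrable_on_mult_right[OF h1_on]) (use assms in auto)
    show "Mh integrable_on {t..b}" by (rule Mh_on) (use assms in auto)
    fix s assume s: "s \<in> {t..b}"
    show "(1 + M t) * h1 s \<le> Mh s"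
    proof (cases "s = b")
      case False
      then have "M t \<le> M s" using M_mono[of t s] assms s by auto
      then show ?thesis unfolding Mh_def using h_psd(1) by (intro mult_right_mono) auto
    qed (simp add: Mh_def)
  qed
  finally show ?thesis .
qed

text \<open>The counterpart of (HS) for second components. Exchanging the order of integration on
  [a, T] turns the integral of \<open>h2 * N1\<close> into that of \<open>M * h1\<close> plus the
  boundary term \<open>N1 T * M T\<close>; together they stay below the full integral of
  \<open>Mh\<close>, whatever T is.\<close>

lemma h2_N1_integrable: "(\<lambda>t. h2 t * N1 t) absolutely_integrable_on {a..b}"
proof -
  define f where "f t = (if t \<in> {a<..<b} then h2 t * N1 t else 0)" for t
  have f: "f t = h2 t * N1 t" for t unfolding f_def by (auto simp: hval_outside)
  have "f absolutely_integrable_on {a..b}"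
  proof (rule nonneg_absolutely_integrable_if_bounded[OF ab])
    show "0 \<le> f t" for t unfolding f_def using h_psd(2) N1_nonneg by auto
    show "f b = 0" by (simp add: f_def)
    fix T assume T: "a < T" "T < b"
    note tri = integral_triangle[OF less_imp_le[OF T(1)] hval_integrable[OF order_refl T(2), of 2 2] hval_integrable[OF order_refl T(2), of 1 1]]
    have e: "f t = h2 t * integral {t..T} h1 + N1 T * h2 t" if "t \<in> {a..T}" for t
    proof -
      have "N1 t = integral {t..T} h1 + N1 T" using N1_diff[of t T] that T by simp
      then show ?thesis unfolding f by (simp add: algebra_simps)
    qed
    have i1: "(\<lambda>t. h2 t * integral {t..T} h1) integrable_on {a..T}" by (rule absolutely_integrable_imp_integrable[OF tri(2)])
    have i2: "h2 integrable_on {a..T}" by (rule hval_on) (use T in auto)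
    have hi: "((\<lambda>t. h2 t * integral {t..T} h1 + N1 T * h2 t) has_integral (integral {a..T} (\<lambda>t. M t * h1 t) + N1 T * M T)) {a..T}"
      using has_integral_add[OF integrable_integral[OF i1] has_integral_mult_right[OF integrable_integral[OF i2], of "N1 T"]]
      unfolding tri(4) M_def .
    have fi: "(f has_integral (integral {a..T} (\<lambda>t. M t * h1 t) + N1 T * M T)) {a..T}"
      by (rule has_integral_eq[OF _ hi]) (simp add: e)
    then show "f integrable_on {a..T}" by blast
    have "integral {a..T} (\<lambda>t. M t * h1 t) \<le> integral {a..T} Mh"
    proof (rule integral_le)
      show "(\<lambda>t. M t * h1 t) integrable_on {a..T}"
        by (rule absolutely_integrable_imp_integrable[OF absolutely_integrable_subinterval[OF M_h1_integrable]]) (use T in auto)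
      show "Mh integrable_on {a..T}" by (rule Mh_on) (use T in auto)
      show "M t * h1 t \<le> Mh t" for t unfolding Mh_def using h_psd(1)[of t] by (simp add: algebra_simps)
    qed
    moreover have "N1 T * M T \<le> integral {T..b} Mh"
      using M_N1_le[of T] N1_nonneg[of T] T by (simp add: algebra_simps)
    moreover have "integral {a..T} Mh + integral {T..b} Mh = integral {a..b} Mh"
      by (rule Henstock_Kurzweil_Integration.integral_combine) (use T in \<open>auto intro: Mh_on\<close>)
    ultimately show "integral {a..T} f \<le> integral {a..b} Mh" using integral_unique[OF fi] by linarith
  qed
  then show ?thesis unfolding f[abs_def] .
qed

section \<open>Square integrable functions and the growth of their antiderivatives\<close>

definition d1 :: "fn \<Rightarrow> real \<Rightarrow> complex" where "d1 f t = of_real (h1 t) * f t $ 1 + of_real (h3 t) * f t $ 2"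
definition d2 :: "fn \<Rightarrow> real \<Rightarrow> complex" where "d2 f t = of_real (h3 t) * f t $ 1 + of_real (h2 t) * f t $ 2"
definition q :: "fn \<Rightarrow> real \<Rightarrow> real" where "q f t = qform (h1 t) (h3 t) (h2 t) (f t)"
definition mf :: "fn \<Rightarrow> bool" where "mf f \<longleftrightarrow> f \<in> borel_measurable (lebesgue_on {a<..<b})"
text \<open>Square integrability alone. The constancy on indivisible intervals that
  \<open>L2H\<close> also demands is treated separately and put back in
  \<open>L2_imp_L2H\<close>.\<close>

definition L2 :: "fn \<Rightarrow> bool" where "L2 f \<longleftrightarrow> mf f \<and> q f absolutely_integrable_on {a..b}"

lemma q_nonneg: "0 \<le> q f t" unfolding q_def by (rule qform_nonneg) (rule h_psd)+
lemma d1_le: "(norm (d1 f t))\<^sup>2 \<le> h1 t * q f t" unfolding q_def d1_def by (rule qform_row1) (rule h_psd)+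
lemma d2_le: "(norm (d2 f t))\<^sup>2 \<le> h2 t * q f t" unfolding q_def d2_def by (rule qform_row2) (rule h_psd)+
lemma q_add_le: "q (\<lambda>t. f t + g t) t \<le> 2 * q f t + 2 * q g t" unfolding q_def by (rule qform_add_le) (rule h_psd)+
lemma q_le_diag: "q f t \<le> 2 * (h1 t * (norm (f t $ 1))\<^sup>2) + 2 * (h2 t * (norm (f t $ 2))\<^sup>2)"
  unfolding q_def by (rule qform_le_diag) (rule h_psd)+
lemma q_scale: "q (\<lambda>t. c *s f t) t = (norm c)\<^sup>2 * q f t" unfolding q_def by (rule qform_scale)

lemma d1_cong: "f t = g t \<Longrightarrow> d1 f t = d1 g t" and d2_cong: "f t = g t \<Longrightarrow> d2 f t = d2 g t"
  and q_cong: "f t = g t \<Longrightarrow> q f t = q g t"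
  by (simp_all add: d1_def d2_def q_def)

lemma restrict_measurable:
  fixes u :: "real \<Rightarrow> 'b::euclidean_space"
  assumes "u \<in> borel_measurable (lebesgue_on {a<..<b})" "\<And>t. t \<notin> {a<..<b} \<Longrightarrow> u t = 0"
  shows "u \<in> borel_measurable lebesgue"
proof -
  have "(\<lambda>t. if t \<in> {a<..<b} then u t else 0) \<in> borel_measurable lebesgue"
    using assms(1) by (subst borel_measurable_if) auto
  moreover have "(\<lambda>t. if t \<in> {a<..<b} then u t else 0) = u" using assms(2) by (auto simp: fun_eq_iff)
  ultimately show ?thesis by simp
qed

lemma hval_measurable_on [measurable]: "hval i j \<in> borel_measurable (lebesgue_on S)"
  by (rule measurable_restrict_space1[OF hval_measurable])

lemma d_measurable:
  assumes "mf f"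
  shows "d1 f \<in> borel_measurable lebesgue" "d2 f \<in> borel_measurable lebesgue" "q f \<in> borel_measurable lebesgue"
proof -
  have f: "(\<lambda>t. f t $ i) \<in> borel_measurable (lebesgue_on {a<..<b})" for i
    using assms borel_measurable_vec_nth unfolding mf_def by blast
  note [measurable] = f[of 1] f[of 2]
  show "d1 f \<in> borel_measurable lebesgue" unfolding d1_def[abs_def]
    by (rule restrict_measurable) (measurable, simp add: hval_outside)
  show "d2 f \<in> borel_measurable lebesgue" unfolding d2_def[abs_def]
    by (rule restrict_measurable) (measurable, simp add: hval_outside)
  show "q f \<in> borel_measurable lebesgue" unfolding q_def[abs_def] qform_eq
    by (rule restrict_measurable) (measurable, simp add: hval_outside)
qed

lemmas d_measurable_on = d_measurable[THEN measurable_restrict_space1]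

lemma q_integrable_bound:
  assumes "mf f" "g absolutely_integrable_on {a..b}" "\<And>t. t \<in> {a<..<b} \<Longrightarrow> q f t \<le> g t"
  shows "q f absolutely_integrable_on {a..b}"
proof (rule measurable_bounded_by_integrable_imp_absolutely_integrable[where g="\<lambda>t. \<bar>g t\<bar>"])
  show "q f \<in> borel_measurable (lebesgue_on {a..b})" by (rule d_measurable_on(3)[OF assms(1)])
  show "(\<lambda>t. \<bar>g t\<bar>) integrable_on {a..b}" using assms(2) unfolding absolutely_integrable_on_def by simp
  fix t
  show "norm (q f t) \<le> \<bar>g t\<bar>"
  proof (cases "t \<in> {a<..<b}")
    case True then show ?thesis using assms(3)[OF True] q_nonneg[of f t] by simp
  next
    case False then show ?thesis by (simp add: q_def qform_eq hval_outside)
  qed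
qed simp

lemma mf_add: "mf f \<Longrightarrow> mf g \<Longrightarrow> mf (\<lambda>t. f t + g t)" unfolding mf_def by simp
lemma mf_scale: "mf f \<Longrightarrow> mf (\<lambda>t. c *s f t)"
proof -
  assume "mf f"
  moreover have "c *s x = vector [c * x $ 1, c * x $ 2]" for x :: "complex^2" by (simp add: vec2_eq_iff)
  ultimately show ?thesis unfolding mf_def by (auto intro!: borel_measurable_vector2 borel_measurable_vec_nth borel_measurable_times)
qed

lemma L2_add: assumes "L2 f" "L2 g" shows "L2 (\<lambda>t. f t + g t)"
  unfolding L2_def
proof
  show m: "mf (\<lambda>t. f t + g t)" using assms mf_add unfolding L2_def by blast
  have "(\<lambda>t. 2 * q f t + 2 * q g t) absolutely_integrable_on {a..b}"
    by (intro set_integral_add(1) set_integrable_mult_right impI assms[unfolded L2_def, THEN conjunct2])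
  then show "q (\<lambda>t. f t + g t) absolutely_integrable_on {a..b}"
    by (rule q_integrable_bound[OF m]) (rule q_add_le)
qed

lemma L2_scale: assumes "L2 f" shows "L2 (\<lambda>t. c *s f t)"
proof -
  have "q (\<lambda>t. c *s f t) = (\<lambda>t. (norm c)\<^sup>2 * q f t)" by (rule ext) (rule q_scale)
  moreover have "(\<lambda>t. (norm c)\<^sup>2 * q f t) absolutely_integrable_on {a..b}"
    by (intro set_integrable_mult_right impI assms[unfolded L2_def, THEN conjunct2])
  ultimately show ?thesis unfolding L2_def using assms[unfolded L2_def] mf_scale[of f c] by simp
qed

lemma L2_diff: assumes "L2 f" "L2 g" shows "L2 (\<lambda>t. f t - g t)"
proof -
  have "L2 (\<lambda>t. f t + (-1) *s g t)" by (intro L2_add L2_scale assms)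
  moreover have "(\<lambda>t. f t - g t) = (\<lambda>t. f t + (-1) *s g t)" by (simp add: vec2_eq_iff fun_eq_iff)
  ultimately show ?thesis by (simp only:)
qed

lemma L2_zero: "L2 (\<lambda>t. 0)"
proof -
  have "q (\<lambda>t. 0) = (\<lambda>t. 0)" by (simp add: q_def qform_eq fun_eq_iff)
  then show ?thesis unfolding L2_def mf_def by (simp add: set_integrable_def)
qed

lemma L2_sum: "finite A \<Longrightarrow> (\<And>i. i \<in> A \<Longrightarrow> L2 (f i)) \<Longrightarrow> L2 (\<lambda>t. \<Sum>i\<in>A. f i t)"
  by (induction A rule: finite_induct) (auto intro: L2_zero L2_add)

lemma mf_cong: "(\<And>t. t \<in> {a<..<b} \<Longrightarrow> f t = g t) \<Longrightarrow> mf f = mf g"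
  unfolding mf_def by (rule measurable_cong) simp

lemma L2_cong:
  assumes "\<And>t. t \<in> {a<..<b} \<Longrightarrow> f t = g t" shows "L2 f = L2 g"
proof -
  have "q f = q g"
  proof
    fix t show "q f t = q g t"
      using assms[of t] by (cases "t \<in> {a<..<b}") (auto simp: q_def qform_eq hval_outside)
  qed
  then show ?thesis unfolding L2_def using mf_cong[OF assms] by simp
qed

text \<open>The two growth bounds pair with the two integrable weights: the density of f is at most
  a multiple of \<open>Mh\<close> plus \<open>h2 * N1\<close>.\<close>

lemma L2_crit:
  assumes m: "mf f" and C: "\<And>t. t \<in> {a<..<b} \<Longrightarrow> (norm (f t $ 1))\<^sup>2 \<le> C * (1 + M t)"
     "\<And>t. t \<in> {a<..<b} \<Longrightarrow> (norm (f t $ 2))\<^sup>2 \<le> C * N1 t"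
  shows "L2 f"
  unfolding L2_def
proof (intro conjI m)
  have "(\<lambda>t. (2 * C) * Mh t + (2 * C) * (h2 t * N1 t)) absolutely_integrable_on {a..b}"
    by (intro set_integral_add(1) set_integrable_mult_right impI Mh_integrable h2_N1_integrable)
  then show "q f absolutely_integrable_on {a..b}"
  proof (rule q_integrable_bound[OF m])
    fix t assume t: "t \<in> {a<..<b}"
    have "h1 t * (norm (f t $ 1))\<^sup>2 \<le> h1 t * (C * (1 + M t))" "h2 t * (norm (f t $ 2))\<^sup>2 \<le> h2 t * (C * N1 t)"
      using C t h_psd by (intro mult_left_mono; simp)+
    then show "q f t \<le> (2 * C) * Mh t + (2 * C) * (h2 t * N1 t)"
      using q_le_diag[of f t] unfolding Mh_def by (simp add: algebra_simps)
  qed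
qed

definition Q :: "fn \<Rightarrow> real" where "Q f = integral {a..b} (q f)"

lemma Q_nonneg: "L2 f \<Longrightarrow> 0 \<le> Q f"
  unfolding Q_def L2_def by (intro integral_nonneg absolutely_integrable_imp_integrable) (auto simp: q_nonneg)

lemma q_sub: "L2 f \<Longrightarrow> a \<le> x \<Longrightarrow> y \<le> b \<Longrightarrow> q f absolutely_integrable_on {x..y}"
  unfolding L2_def by (rule absolutely_integrable_subinterval) auto

lemma integral_q_le: "L2 f \<Longrightarrow> a \<le> x \<Longrightarrow> y \<le> b \<Longrightarrow> integral {x..y} (q f) \<le> Q f"
  unfolding Q_def
  by (rule integral_subset_le) (auto simp: q_nonneg intro!: absolutely_integrable_imp_integrable q_sub)

lemma d1_integrable:
  assumes "L2 f" "a \<le> x" "y \<le> b" shows "d1 f absolutely_integrable_on {x..y}"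
  by (rule integral_norm_Cauchy_Schwarz(1)[OF _ h1_sub[OF assms(2,3)] q_sub[OF assms] d_measurable_on(1)])
     (use assms h_psd q_nonneg d1_le in \<open>auto simp: L2_def\<close>)

lemma d2_integrable:
  assumes "L2 f" "a \<le> x" "y < b" shows "d2 f absolutely_integrable_on {x..y}"
  by (rule integral_norm_Cauchy_Schwarz(1)[OF _ hval_integrable[OF assms(2,3), of 2 2] q_sub[OF assms(1,2) less_imp_le[OF assms(3)]] d_measurable_on(2)])
     (use assms h_psd q_nonneg d2_le in \<open>auto simp: L2_def\<close>)

text \<open>Cauchy-Schwarz between h_1 and the density of f. This rate tends to 0 at b, whereas the
  analogous bound for \<open>d2\<close> is governed by the increasing function M.\<close>

lemma d1_bound:
  assumes f: "L2 f" and t: "a \<le> t" "t \<le> b"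
  shows "integral {t..b} (\<lambda>s. norm (d1 f s)) \<le> sqrt (N1 t * Q f)"
proof -
  have "integral {t..b} (\<lambda>s. norm (d1 f s)) \<le> sqrt (integral {t..b} h1 * integral {t..b} (q f))"
    by (rule integral_norm_Cauchy_Schwarz(2)[OF _ h1_sub[OF t(1) order_refl] q_sub[OF f t(1) order_refl] d_measurable_on(1)])
     (use f h_psd q_nonneg d1_le in \<open>auto simp: L2_def\<close>)
  also have "\<dots> \<le> sqrt (N1 t * Q f)"
    unfolding N1_def[symmetric] using N1_nonneg[OF t] integral_q_le[OF f t(1) order_refl]
    by (simp add: mult_left_mono)
  finally show ?thesis .
qed

lemma d2_bound:
  assumes f: "L2 f" and t: "a \<le> s" "s \<le> t" "t < b"
  shows "integral {s..t} (\<lambda>s. norm (d2 f s)) \<le> sqrt (M t * Q f)"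
proof -
  have "integral {s..t} (\<lambda>s. norm (d2 f s)) \<le> sqrt (integral {s..t} h2 * integral {s..t} (q f))"
    by (rule integral_norm_Cauchy_Schwarz(2)[OF _ hval_integrable[OF t(1,3), of 2 2] q_sub[OF f t(1) less_imp_le[OF t(3)]] d_measurable_on(2)])
     (use f h_psd q_nonneg d2_le in \<open>auto simp: L2_def\<close>)
  also have "\<dots> \<le> sqrt (M t * Q f)"
  proof -
    have "integral {s..t} h2 \<le> M t" using M_diff[OF t] M_nonneg[of s] t by simp
    moreover have "0 \<le> integral {s..t} (q f)" using q_sub[OF f, of s t] t
      by (intro integral_nonneg absolutely_integrable_imp_integrable) (auto simp: q_nonneg)
    ultimately show ?thesis using integral_q_le[OF f t(1) less_imp_le[OF t(3)]] M_nonneg[of t] t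
      by (simp add: mult_mono)
  qed
  finally show ?thesis .
qed

end

lemma continuous_on_vec2_iff:
  fixes f :: "real \<Rightarrow> complex^2"
  shows "continuous_on S f \<longleftrightarrow> continuous_on S (\<lambda>t. f t $ 1) \<and> continuous_on S (\<lambda>t. f t $ 2)"
proof
  assume c: "continuous_on S (\<lambda>t. f t $ 1) \<and> continuous_on S (\<lambda>t. f t $ 2)"
  have "continuous_on S (\<lambda>t. \<chi> i. f t $ i)"
  proof (rule continuous_on_vec_lambda)
    fix i :: 2 show "continuous_on S (\<lambda>t. f t $ i)" using c exhaust_2[of i] by (elim disjE) simp_all
  qed
  then show "continuous_on S f" by simp
qed (auto intro!: continuous_intros)

lemma continuous_on_halfopen:
  fixes f :: "real \<Rightarrow> 'a::metric_space"
  assumes "\<And>T. a \<le> T \<Longrightarrow> T < b \<Longrightarrow> continuous_on {a..T} f"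
  shows "continuous_on {a..<b} f"
  unfolding continuous_on_eq_continuous_within
proof
  fix x assume x: "x \<in> {a..<b}"
  define T where "T = (x + b) / 2"
  have T: "x < T" "T < b" using x unfolding T_def by auto
  have "continuous (at x within {a..T}) f"
    using assms[of T] x T unfolding continuous_on_eq_continuous_within by auto
  moreover have "at x within {a..<b} = at x within {a..T}"
    by (rule at_within_nhd[of _ "{..<T}"]) (use x T in auto)
  ultimately show "continuous (at x within {a..<b}) f" by simp
qed

lemma indef_int_continuous_open:
  assumes "indef_int {a<..<b} f g" shows "continuous_on {a<..<b} f"
  unfolding continuous_on_eq_continuous_within
proof
  fix x assume x: "x \<in> {a<..<b}"
  define c where "c = (a + x) / 2" define d where "d = (x + b) / 2"
  have cd: "a < c" "c < x" "x < d" "d < b" using x unfolding c_def d_def by auto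
  have "continuous_on {c..d} f" by (rule indef_int_continuous[OF assms]) (use cd in auto)
  then have "continuous (at x within {c..d}) f" using cd unfolding continuous_on_eq_continuous_within by auto
  moreover have "at x within {a<..<b} = at x within {c..d}"
    by (rule at_within_nhd[of _ "{c<..<d}"]) (use cd in auto)
  ultimately show "continuous (at x within {a<..<b}) f" by simp
qed

text \<open>Linear combinations of a family F are indexed by polynomials, F i standing for the power
  X^i. Raising all indices by one becomes multiplication by X, and roots of the polynomial can be
  split off.\<close>

definition lin :: "(nat \<Rightarrow> fn) \<Rightarrow> complex poly \<Rightarrow> fn" where
  "lin F P t = (\<Sum>i\<le>degree P. coeff P i *s F i t)"

lemma lin_eq: "degree P \<le> n \<Longrightarrow> lin F P t = (\<Sum>i\<le>n. coeff P i *s F i t)"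
  unfolding lin_def by (rule sum.mono_neutral_left) (auto simp: coeff_eq_0 vec2_eq_iff)

lemma lin_add: "lin F (P + R) t = lin F P t + lin F R t"
proof -
  define n where "n = max (degree P) (degree R)"
  have "degree (P + R) \<le> n" "degree P \<le> n" "degree R \<le> n" unfolding n_def by (auto intro: degree_add_le)
  then show ?thesis by (simp add: lin_eq[of _ n] sum.distrib[symmetric] vector_sadd_rdistrib)
qed

lemma lin_smult: "lin F (Polynomial.smult c P) t = c *s lin F P t"
  by (simp add: lin_eq[of _ "degree P"] lin_def[of F P] vec2_eq_iff sum_distrib_left mult.assoc)

lemma lin_pCons0: "lin F (pCons 0 P) t = lin (\<lambda>i. F (Suc i)) P t"
proof -
  have "degree (pCons 0 P) \<le> Suc (degree P)" by (simp add: degree_pCons_le)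
  then show ?thesis
    by (simp add: lin_eq[of _ "Suc (degree P)"] lin_def[of _ P] sum.atMost_Suc_shift vec2_eq_iff del: sum.atMost_Suc)
qed

lemma lin_monom: "lin F (monom c n) t = c *s F n t"
proof -
  have "lin F (monom c n) t = (\<Sum>i\<le>n. coeff (monom c n) i *s F i t)" by (rule lin_eq[OF degree_monom_le])
  also have "\<dots> = (\<Sum>i\<le>n. if i = n then c *s F n t else 0)" by (rule sum.cong) (auto simp: coeff_monom vec2_eq_iff)
  finally show ?thesis by simp
qed

lemma sum_poly_coeff:
  fixes c :: "nat \<Rightarrow> complex" and n :: nat
  defines "P \<equiv> \<Sum>i\<le>n. monom (c i) i"
  shows "coeff P i = (if i \<le> n then c i else 0)" "degree P \<le> n" "lin F P t = (\<Sum>i\<le>n. c i *s F i t)"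
proof -
  show c: "coeff P i = (if i \<le> n then c i else 0)" for i
    unfolding P_def by (simp add: coeff_sum coeff_monom)
  show d: "degree P \<le> n" by (rule degree_le) (simp add: c)
  show "lin F P t = (\<Sum>i\<le>n. c i *s F i t)" using lin_eq[OF d, of F t] c by simp
qed

section \<open>The integral operator I and its iterates\<close>

context hs_side begin

abbreviation "I \<equiv> I_left H a"
abbreviation "nice f \<equiv> continuous_on {a..<b} f"

lemma mf_continuous: "continuous_on {a<..<b} f \<Longrightarrow> mf f"
  unfolding mf_def by (rule continuous_imp_measurable_on_sets_lebesgue) auto

lemma nice_mf: "nice f \<Longrightarrow> mf f"
  by (rule mf_continuous, rule continuous_on_subset) auto

lemma nice_d:
  assumes f: "nice f" and T: "a \<le> x" "T < b"
  shows "d1 f absolutely_integrable_on {x..T}" "d2 f absolutely_integrable_on {x..T}"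
proof -
  have c: "continuous_on {x..T} (\<lambda>t. f t $ i)" for i
  proof -
    have "{x..T} \<subseteq> {a..<b}" using T by auto
    from continuous_on_subset[OF f this] show ?thesis by (intro continuous_intros)
  qed
  have p: "(\<lambda>t. of_real (hval i j t) * f t $ k) absolutely_integrable_on {x..T}" for i j k
    using absolutely_integrable_continuous_mult[OF c absolutely_integrable_of_real[OF hval_integrable[OF T]]]
    by (simp only: mult.commute)
  show "d1 f absolutely_integrable_on {x..T}" unfolding d1_def[abs_def] by (rule set_integral_add(1)[OF p p])
  show "d2 f absolutely_integrable_on {x..T}" unfolding d2_def[abs_def] by (rule set_integral_add(1)[OF p p])
qed

lemma JH_eq: "t \<in> {a<..<b} \<Longrightarrow> t \<notin> bad \<Longrightarrow> Jmat *v (cmat (H t) *v f t) = vector [- d2 f t, d1 f t]"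
  using h_psd(4)[of t] by (simp add: Jmat_mult vec2_eq_iff matrix_vector_mult_2 d1_def d2_def hval_eq)

lemma I_eq:
  assumes "nice f" "t \<in> {a..<b}"
  shows "I f t = vector [- integral {a..t} (d2 f), integral {a..t} (d1 f)]"
proof -
  define F where "F s = (vector [- d2 f s, d1 f s] :: complex^2)" for s
  have d: "d1 f absolutely_integrable_on {a..t}" "d2 f absolutely_integrable_on {a..t}"
    using nice_d[OF assms(1), of a t] assms(2) by auto
  have md: "(\<lambda>s. - d2 f s) absolutely_integrable_on {a..t}"
    using set_integrable_mult_right[of "-1" lebesgue "{a..t}" "d2 f"] d(2) by simp
  have F: "F absolutely_integrable_on {a..t}"
    unfolding absolutely_integrable_vec2_iff F_def using d md by simp
  have N: "negligible (bad \<union> {a})" using negligible_bad by simp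
  have e: "Jmat *v (cmat (H s) *v f s) = F s" if "s \<in> {a..t} - (bad \<union> {a})" for s
    unfolding F_def by (rule JH_eq) (use that assms(2) in auto)
  have A: "(\<lambda>s. Jmat *v (cmat (H s) *v f s)) absolutely_integrable_on {a..t}"
    by (rule absolutely_integrable_spike[OF F N e])
  have "I f t = integral {a..t} (\<lambda>s. Jmat *v (cmat (H s) *v f s))"
    unfolding I_left_def by (rule set_lebesgue_integral_eq_integral(2)[OF A])
  also have "\<dots> = integral {a..t} F" by (rule integral_spike[OF N e[symmetric]])
  finally have IF: "I f t = integral {a..t} F" .
  have comp: "integral {a..t} F $ i = integral {a..t} (\<lambda>s. F s $ i)" for i
    using integral_linear[OF absolutely_integrable_imp_integrable[OF F] bounded_linear_vec_nth[of i]] by (simp add: o_def)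
  show ?thesis unfolding IF vec2_eq_iff comp by (simp add: F_def integral_neg)
qed

lemma indef_int_integral:
  assumes "\<And>T. T < b \<Longrightarrow> g absolutely_integrable_on {a..T}"
  shows "indef_int {a..<b} (\<lambda>t. integral {a..t} g) g"
proof (rule indef_intI)
  fix x y assume xy: "x \<in> {a..<b}" "y \<in> {a..<b}" "x \<le> y"
  have g: "g absolutely_integrable_on {a..y}" using assms xy by auto
  show g1: "g absolutely_integrable_on {x..y}" by (rule absolutely_integrable_subinterval[OF g]) (use xy in auto)
  have "integral {a..y} g - integral {a..x} g = integral {x..y} g"
  proof -
    have "integral {a..x} g + integral {x..y} g = integral {a..y} g"
      by (rule Henstock_Kurzweil_Integration.integral_combine[OF _ xy(3) absolutely_integrable_imp_integrable[OF g]]) (use xy in auto)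
    then show ?thesis by (metis add_diff_cancel_left')
  qed
  then show "(g has_integral integral {a..y} g - integral {a..x} g) {x..y}"
    using integrable_integral[OF absolutely_integrable_imp_integrable[OF g1]] by simp
qed

lemma I_props:
  assumes "nice f"
  shows "indef_int {a..<b} (\<lambda>t. I f t $ 1) (\<lambda>t. - d2 f t)" "indef_int {a..<b} (\<lambda>t. I f t $ 2) (d1 f)"
    and "I f a = 0" "nice (I f)"
proof -
  show 1: "indef_int {a..<b} (\<lambda>t. I f t $ 1) (\<lambda>t. - d2 f t)"
    by (rule indef_int_cong[OF indef_int_minus[OF indef_int_integral[OF nice_d(2)[OF assms order_refl]]], where N="{}"])
       (simp_all add: I_eq[OF assms])
  show 2: "indef_int {a..<b} (\<lambda>t. I f t $ 2) (d1 f)"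
    by (rule indef_int_cong[OF indef_int_integral[OF nice_d(1)[OF assms order_refl]], where N="{}"])
       (simp_all add: I_eq[OF assms])
  show "I f a = 0" using ab by (simp add: I_eq[OF assms] vec2_eq_iff)
  have "continuous_on {a..T} (\<lambda>t. I f t $ 1)" "continuous_on {a..T} (\<lambda>t. I f t $ 2)" if "a \<le> T" "T < b" for T
    by (rule indef_int_continuous[OF 1] indef_int_continuous[OF 2]; use that in auto)+
  then show "nice (I f)" unfolding continuous_on_vec2_iff by (intro conjI continuous_on_halfopen) auto
qed

lemma d_lin: "d1 (\<lambda>t. c *s f t + d *s g t) t = c * d1 f t + d * d1 g t"
  "d2 (\<lambda>t. c *s f t + d *s g t) t = c * d2 f t + d * d2 g t"
  by (simp_all add: d1_def d2_def algebra_simps)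

lemma I_lin:
  assumes "nice f" "nice g" "t \<in> {a..<b}"
  shows "I (\<lambda>t. c *s f t + d *s g t) t = c *s I f t + d *s I g t"
proof -
  have n: "nice (\<lambda>t. c *s f t + d *s g t)"
    using assms(1,2) unfolding continuous_on_vec2_iff by (auto intro!: continuous_intros)
  have i: "d1 f integrable_on {a..t}" "d2 f integrable_on {a..t}" "d1 g integrable_on {a..t}" "d2 g integrable_on {a..t}"
    using nice_d[OF assms(1), of a t] nice_d[OF assms(2), of a t] assms(3) by (auto intro: absolutely_integrable_imp_integrable)
  show ?thesis unfolding I_eq[OF n assms(3)] I_eq[OF assms(1,3)] I_eq[OF assms(2,3)] d_lin
    by (simp add: vec2_eq_iff integral_add i integrable_on_mult_right algebra_simps)
qed

lemma I_cong:
  assumes "\<And>t. t \<in> {a..<b} \<Longrightarrow> f t = g t" "nice f" "t \<in> {a..<b}"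
  shows "I f t = I g t"
proof -
  have "nice g" using assms(1,2) continuous_on_cong by metis
  moreover have "integral {a..t} (d1 f) = integral {a..t} (d1 g)" "integral {a..t} (d2 f) = integral {a..t} (d2 g)"
    using assms(1,3) by (auto intro!: integral_cong d1_cong d2_cong)
  ultimately show ?thesis using I_eq assms(2,3) by simp
qed

definition X :: "nat \<Rightarrow> fn" where "X k = (I ^^ k) (\<lambda>_. vector [1, 0])"
definition Y :: "nat \<Rightarrow> fn" where "Y k = (I ^^ k) (\<lambda>_. vector [0, 1])"

lemma nice_iter: "nice ((I ^^ k) (\<lambda>_. v))"
  by (induction k) (auto intro: I_props(4))

lemma iter_lin: "t \<in> {a..<b} \<Longrightarrow> (I ^^ k) (\<lambda>_. v) t = (v $ 1) *s X k t + (v $ 2) *s Y k t"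
proof (induction k arbitrary: t)
  case 0 then show ?case by (simp add: X_def Y_def vec2_eq_iff)
next
  case (Suc k)
  have "I ((I ^^ k) (\<lambda>_. v)) t = I (\<lambda>t. (v $ 1) *s X k t + (v $ 2) *s Y k t) t"
    by (rule I_cong[OF Suc.IH nice_iter Suc.prems])
  also have "\<dots> = (v $ 1) *s I (X k) t + (v $ 2) *s I (Y k) t"
    unfolding X_def Y_def by (rule I_lin[OF nice_iter nice_iter Suc.prems])
  finally show ?case by (simp add: X_def Y_def)
qed

lemma Y_nice: "nice (Y k)" unfolding Y_def by (rule nice_iter)
lemma X_nice: "nice (X k)" unfolding X_def by (rule nice_iter)
lemma Y_0: "Y 0 t = vector [0, 1]" by (simp add: Y_def)
lemma Y_Suc: "Y (Suc k) = I (Y k)" by (simp add: Y_def)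
lemma X_Suc: "X (Suc k) = I (X k)" by (simp add: X_def)

text \<open>The first row of Hf is integrable up to b, so the second component has a limit there,
  approached at the rate given by \<open>d1_bound\<close>. The first component is an integral of the
  second row, and \<open>d2_bound\<close> limits its growth.\<close>

lemma L2_antiderivative:
  fixes G :: fn
  assumes f: "L2 f" and G: "indef_int {a<..<b} (\<lambda>t. G t $ 1) (\<lambda>t. - d2 f t)" "indef_int {a<..<b} (\<lambda>t. G t $ 2) (d1 f)"
  obtains l C where "((\<lambda>t. G t $ 2) \<longlongrightarrow> l) (at_left b)"
    "\<And>t. t \<in> {a<..<b} \<Longrightarrow> (norm (G t $ 1))\<^sup>2 \<le> C * (1 + M t)"
    "\<And>t. t \<in> {a<..<b} \<Longrightarrow> (norm (G t $ 2 - l))\<^sup>2 \<le> C * N1 t"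
proof -
  define c where "c = (a + b) / 2"
  have c: "a < c" "c < b" using ab unfolding c_def by auto
  define l where "l = G c $ 2 + integral {c..b} (d1 f)"
  \<comment> \<open>G lives on the open interval, so increments are measured from the midpoint c.
    The term with \<open>M c\<close> pays for points left of c, where the increment is bounded by
    means of \<open>M c\<close> and not of \<open>M t\<close>.\<close>
  define C where "C = 2 * (norm (G c $ 1))\<^sup>2 + 2 * (1 + M c) * Q f + Q f"
  have Qf: "0 \<le> Q f" by (rule Q_nonneg[OF f])
  have Mc: "0 \<le> M c" using M_nonneg[of c] c by auto
  have CQ: "Q f \<le> C" unfolding C_def using Qf Mc by simp
  have G2: "G t $ 2 - l = - integral {t..b} (d1 f)" if t: "t \<in> {a<..<b}" for t
  proof -
    have i: "d1 f integrable_on {x..b}" if "a \<le> x" for x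
      using d1_integrable[OF f that order_refl] by (rule absolutely_integrable_imp_integrable)
    show ?thesis
    proof (cases "t \<le> c")
      case True
      have "integral {t..c} (d1 f) = G c $ 2 - G t $ 2" by (rule integral_unique, rule indef_intD(2)[OF G(2)]) (use t c True in auto)
      moreover have "integral {t..c} (d1 f) + integral {c..b} (d1 f) = integral {t..b} (d1 f)"
        by (rule Henstock_Kurzweil_Integration.integral_combine) (use True c t i in auto)
      ultimately show ?thesis unfolding l_def by algebra
    next
      case False
      then have "integral {c..t} (d1 f) = G t $ 2 - G c $ 2" by (intro integral_unique indef_intD(2)[OF G(2)]) (use t c in auto)
      moreover have "integral {c..t} (d1 f) + integral {t..b} (d1 f) = integral {c..b} (d1 f)"
        by (rule Henstock_Kurzweil_Integration.integral_combine) (use False c t i in auto)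
      ultimately show ?thesis unfolding l_def by algebra
    qed
  qed
  have nb: "norm (integral S g) \<le> integral S (\<lambda>s. norm (g s))" if "g absolutely_integrable_on S" for S and g :: "real \<Rightarrow> complex"
    using that unfolding absolutely_integrable_on_def by (intro integral_norm_bound_integral) auto
  have n2: "norm (G t $ 2 - l) \<le> sqrt (N1 t * Q f)" if t: "t \<in> {a<..<b}" for t
    unfolding G2[OF t] norm_minus_cancel
    using nb[OF d1_integrable[OF f, of t b]] d1_bound[OF f, of t] t by auto
  have N10: "(N1 \<longlongrightarrow> 0) (at_left b)"
  proof -
    have "continuous (at b within {a..b}) N1" using N1_continuous ab unfolding continuous_on_eq_continuous_within by auto
    then have "(N1 \<longlongrightarrow> N1 b) (at b within {a..b})" unfolding continuous_within .
    then show ?thesis using ab by (simp add: at_within_Icc_at_left N1_def)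
  qed
  have "((\<lambda>t. G t $ 2 - l) \<longlongrightarrow> 0) (at_left b)"
  proof (rule Lim_null_comparison)
    show "\<forall>\<^sub>F t in at_left b. norm (G t $ 2 - l) \<le> sqrt (N1 t * Q f)"
      using eventually_at_left_real[OF ab] by eventually_elim (rule n2)
    show "((\<lambda>t. sqrt (N1 t * Q f)) \<longlongrightarrow> 0) (at_left b)"
      using tendsto_real_sqrt[OF tendsto_mult_left_zero[OF N10, of "Q f"]] by simp
  qed
  then have 1: "((\<lambda>t. G t $ 2) \<longlongrightarrow> l) (at_left b)" using Lim_null by blast
  have 2: "(norm (G t $ 1))\<^sup>2 \<le> C * (1 + M t)" if t: "t \<in> {a<..<b}" for t
  proof -
    have Mt: "0 \<le> M t" using M_nonneg[of t] t by auto
    define m where "m = max t c"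
    have mm: "a < m" "m < b" "0 \<le> M m" "M m \<le> M t + M c"
      using t c Mt Mc unfolding m_def max_def by auto
    have d: "norm (G t $ 1 - G c $ 1) \<le> sqrt (M m * Q f)"
    proof (cases "t \<le> c")
      case True
      have hi: "((\<lambda>t. - d2 f t) has_integral G c $ 1 - G t $ 1) {t..c}" by (rule indef_intD(2)[OF G(1)]) (use t c True in auto)
      have e: "G t $ 1 - G c $ 1 = integral {t..c} (d2 f)" using integral_unique[OF has_integral_neg[OF hi]] by simp
      show ?thesis unfolding e using nb[OF d2_integrable[OF f, of t c]] d2_bound[OF f, of t c] t c True by (auto simp: m_def)
    next
      case False
      have hi: "((\<lambda>t. - d2 f t) has_integral G t $ 1 - G c $ 1) {c..t}" by (rule indef_intD(2)[OF G(1)]) (use t c False in auto)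
      have e: "G t $ 1 - G c $ 1 = - integral {c..t} (d2 f)" using integral_unique[OF has_integral_neg[OF hi]] by simp
      show ?thesis unfolding e norm_minus_cancel using nb[OF d2_integrable[OF f, of c t]] d2_bound[OF f, of c t] t c False by (auto simp: m_def)
    qed
    have "norm (G t $ 1) \<le> norm (G c $ 1) + sqrt (M m * Q f)"
      using d norm_triangle_ineq2[of "G t $ 1" "G c $ 1"] by linarith
    then have "(norm (G t $ 1))\<^sup>2 \<le> (norm (G c $ 1) + sqrt (M m * Q f))\<^sup>2" by (intro power_mono) auto
    also have "\<dots> \<le> 2 * (norm (G c $ 1))\<^sup>2 + 2 * (sqrt (M m * Q f))\<^sup>2"
      using sum_squares_bound[of "norm (G c $ 1)" "sqrt (M m * Q f)"] by (simp add: power2_sum)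
    also have "(sqrt (M m * Q f))\<^sup>2 = M m * Q f" using mm Qf by simp
    also have "\<dots> \<le> (M t + M c) * Q f" using mm Qf by (intro mult_right_mono) auto
    finally have A: "(norm (G t $ 1))\<^sup>2 \<le> 2 * (norm (G c $ 1))\<^sup>2 + 2 * ((M t + M c) * Q f)" by simp
    have "C * (1 + M t) - (2 * (norm (G c $ 1))\<^sup>2 + 2 * ((M t + M c) * Q f))
        = 2 * (norm (G c $ 1))\<^sup>2 * M t + 3 * Q f + 2 * (M c * Q f) * M t + Q f * M t"
      unfolding C_def by (simp add: algebra_simps)
    also have "\<dots> \<ge> 0" using Mt Mc Qf by (intro add_nonneg_nonneg mult_nonneg_nonneg) auto
    finally show ?thesis using A by linarith
  qed
  have 3: "(norm (G t $ 2 - l))\<^sup>2 \<le> C * N1 t" if t: "t \<in> {a<..<b}" for t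
  proof -
    have N: "0 \<le> N1 t" using N1_nonneg[of t] t by auto
    have "(norm (G t $ 2 - l))\<^sup>2 \<le> (sqrt (N1 t * Q f))\<^sup>2" using n2[OF t] by (intro power_mono) auto
    also have "\<dots> = Q f * N1 t" using N Qf by simp
    also have "\<dots> \<le> C * N1 t" using CQ N by (rule mult_right_mono)
    finally show ?thesis .
  qed
  show ?thesis by (rule that[OF 1 2 3])
qed

text \<open>Once the limit is removed from the second component, the bounds are those of
  \<open>L2_crit\<close>. Hence I maps L^2 into L^2 plus multiples of the constant (0, 1).\<close>

lemma L2_antiderivative_L2:
  fixes G :: fn
  assumes f: "L2 f" and G: "indef_int {a<..<b} (\<lambda>t. G t $ 1) (\<lambda>t. - d2 f t)" "indef_int {a<..<b} (\<lambda>t. G t $ 2) (d1 f)"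
  obtains l where "((\<lambda>t. G t $ 2) \<longlongrightarrow> l) (at_left b)" "L2 (\<lambda>t. G t - vector [0, l])"
proof -
  obtain l C where lC: "((\<lambda>t. G t $ 2) \<longlongrightarrow> l) (at_left b)"
    "\<And>t. t \<in> {a<..<b} \<Longrightarrow> (norm (G t $ 1))\<^sup>2 \<le> C * (1 + M t)"
    "\<And>t. t \<in> {a<..<b} \<Longrightarrow> (norm (G t $ 2 - l))\<^sup>2 \<le> C * N1 t"
    by (rule L2_antiderivative[OF assms]) blast
  have "continuous_on {a<..<b} G" unfolding continuous_on_vec2_iff
    using indef_int_continuous_open[OF G(1)] indef_int_continuous_open[OF G(2)] by blast
  then have "mf (\<lambda>t. G t - vector [0, l])" by (intro mf_continuous continuous_intros)
  then have "L2 (\<lambda>t. G t - vector [0, l])" by (rule L2_crit[where C=C]) (use lC in auto)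
  then show ?thesis by (rule that[OF lC(1)])
qed

lemma I_L2:
  assumes "nice f" "L2 f"
  obtains l where "((\<lambda>t. I f t $ 2) \<longlongrightarrow> l) (at_left b)" "L2 (\<lambda>t. I f t - vector [0, l])"
  using L2_antiderivative_L2[OF assms(2) indef_int_subset[OF I_props(1)[OF assms(1)]] indef_int_subset[OF I_props(2)[OF assms(1)]]]
  by (metis greaterThanLessThan_subseteq_atLeastLessThan_iff order_refl)

end

section \<open>Growth of the iterated integrals\<close>

context hs_side begin

lemma nice_scale: fixes f :: fn shows "nice f \<Longrightarrow> nice (\<lambda>t. c *s f t)"
  unfolding continuous_on_vec2_iff by (auto intro!: continuous_on_mult_left)

lemma nice_sum: fixes f :: "'i \<Rightarrow> fn" shows "(\<And>i. i \<in> A \<Longrightarrow> nice (f i)) \<Longrightarrow> nice (\<lambda>t. \<Sum>i\<in>A. c i *s f i t)"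
  by (intro continuous_on_sum nice_scale)

lemma I_sum:
  assumes "finite A" "\<And>i. i \<in> A \<Longrightarrow> nice (f i)" and t: "t \<in> {a..<b}"
  shows "I (\<lambda>t. \<Sum>i\<in>A. c i *s f i t) t = (\<Sum>i\<in>A. c i *s I (f i) t)"
  using assms(1,2)
proof (induction A rule: finite_induct)
  case empty
  have "d1 (\<lambda>t. 0) = (\<lambda>t. 0)" "d2 (\<lambda>t. 0) = (\<lambda>t. 0)" by (auto simp: d1_def d2_def)
  then show ?case using I_eq[of "\<lambda>t. 0", OF _ t] by (simp add: vec2_eq_iff)
next
  case (insert i A)
  have "I (\<lambda>t. \<Sum>i\<in>insert i A. c i *s f i t) t = I (\<lambda>t. c i *s f i t + 1 *s (\<Sum>i\<in>A. c i *s f i t)) t"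
    using insert(1,2) by simp
  also have "\<dots> = c i *s I (f i) t + 1 *s I (\<lambda>t. \<Sum>i\<in>A. c i *s f i t) t"
    by (rule I_lin[OF _ nice_sum t]) (use insert in auto)
  finally show ?case using insert by simp
qed

text \<open>The constant (1, 0) is in L^2 because h_1 is integrable. Each application of I leaves
  L^2 only by a multiple of (0, 1) = \<open>Y 0\<close>. Thus first entries of the vectors in the
  definition of \<Delta> can be traded for second entries.\<close>

lemma L2_X_reduction: "\<exists>\<rho> :: nat \<Rightarrow> complex. L2 (\<lambda>t. X n t + (\<Sum>k<n. \<rho> k *s Y k t))"
proof (induction n)
  case 0
  have "L2 (\<lambda>t. vector [1, 0])"
    by (rule L2_crit[where C=1]) (auto simp: mf_def M_nonneg N1_nonneg)
  then show ?case by (simp add: X_def)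
next
  case (Suc n)
  then obtain \<rho> :: "nat \<Rightarrow> complex" where \<rho>: "L2 (\<lambda>t. X n t + (\<Sum>k<n. \<rho> k *s Y k t))" by blast
  define u where "u t = X n t + (\<Sum>k<n. \<rho> k *s Y k t)" for t
  have ns: "nice (\<lambda>t. \<Sum>k<n. \<rho> k *s Y k t)" by (intro nice_sum Y_nice)
  have Is: "I (\<lambda>t. \<Sum>k<n. \<rho> k *s Y k t) t = (\<Sum>k<n. \<rho> k *s Y (Suc k) t)" if t: "t \<in> {a..<b}" for t
    unfolding Y_Suc by (rule I_sum[OF _ _ t]) (auto simp: Y_nice)
  have nu: "nice u" unfolding u_def by (intro continuous_intros X_nice ns)
  have L2u: "L2 u" using \<rho> unfolding u_def .
  obtain l where l: "L2 (\<lambda>t. I u t - vector [0, l])" by (rule I_L2[OF nu L2u])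
  \<comment> \<open>I raises every index by one, and the subtracted limit l becomes the coefficient
    of \<open>Y 0\<close>.\<close>
  define \<rho>' where "\<rho>' k = (case k of 0 \<Rightarrow> - l | Suc k \<Rightarrow> \<rho> k)" for k
  have "I u t - vector [0, l] = X (Suc n) t + (\<Sum>k<Suc n. \<rho>' k *s Y k t)" if "t \<in> {a<..<b}" for t
  proof -
    have t: "t \<in> {a..<b}" using that by auto
    have "I u t = I (\<lambda>t. 1 *s X n t + 1 *s (\<Sum>k<n. \<rho> k *s Y k t)) t" unfolding u_def by simp
    also have "\<dots> = 1 *s I (X n) t + 1 *s I (\<lambda>t. \<Sum>k<n. \<rho> k *s Y k t) t" by (rule I_lin[OF X_nice ns t])
    finally have "I u t = X (Suc n) t + (\<Sum>k<n. \<rho> k *s Y (Suc k) t)" using Is[OF t] by (simp add: X_Suc)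
    then show ?thesis unfolding sum.lessThan_Suc_shift \<rho>'_def by (simp add: Y_0 vec2_eq_iff)
  qed
  then have "L2 (\<lambda>t. X (Suc n) t + (\<Sum>k<Suc n. \<rho>' k *s Y k t))" using l L2_cong by (metis (no_types, lifting))
  then show ?case by blast
qed

text \<open>h_3 is integrable up to every T < b; neither boundedness nor convergence of
  \<open>av\<close> at b is available at this point.\<close>

definition av :: "real \<Rightarrow> real" where "av t = integral {a..t} h3"

lemma av_indef: "indef_int {a..<b} (\<lambda>t. complex_of_real (av t)) (\<lambda>t. complex_of_real (h3 t))"
proof (rule indef_int_cong[where N="{}"])
  show "indef_int {a..<b} (\<lambda>t. integral {a..t} (\<lambda>t. complex_of_real (h3 t))) (\<lambda>t. complex_of_real (h3 t))"
    by (rule indef_int_integral, rule absolutely_integrable_of_real, rule hval_integrable) auto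
  show "integral {a..t} (\<lambda>t. complex_of_real (h3 t)) = complex_of_real (av t)" if "t \<in> {a..<b}" for t
    unfolding av_def by (rule integral_unique, rule has_integral_of_real, rule integrable_integral, rule hval_on) (use that in auto)
qed auto

lemma av_0: "av a = 0" by (simp add: av_def)

lemma av_continuous: "T < b \<Longrightarrow> continuous_on {a..T} av"
  unfolding av_def[abs_def] by (rule indefinite_integral_continuous_1[OF hval_on]) auto

abbreviation "iv \<equiv> {a..<b}"

lemma iv_interval: "is_interval iv" by (simp add: is_interval_co)

text \<open>The coefficient of z^j in the exponential series of \<open>z * s * av t\<close>.\<close>

definition pw :: "complex \<Rightarrow> nat \<Rightarrow> real \<Rightarrow> complex" where "pw s j t = (s * of_real (av t)) ^ j / fact j"

lemma pw_0 [simp]: "pw s 0 t = 1" by (simp add: pw_def)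

lemma pw_indef: "indef_int iv (pw s (Suc j)) (\<lambda>t. s * of_real (h3 t) * pw s j t)"
proof -
  have "indef_int iv (\<lambda>t. (1 / fact (Suc j)) * (s * of_real (av t)) ^ Suc j)
     (\<lambda>t. (1 / fact (Suc j)) * (of_nat (Suc j) * (s * of_real (av t)) ^ (Suc j - 1) * (s * of_real (h3 t))))"
    by (intro indef_int_cmult indef_int_power av_indef iv_interval)
  then show ?thesis
  proof (rule indef_int_cong[where N="{}"])
    fix t
    have "1 / fact (Suc j) * complex_of_nat (Suc j) = 1 / fact j"
      by (simp add: fact_Suc del: of_nat_Suc)
    note f = this
    have "(1 / fact (Suc j)) * (of_nat (Suc j) * (s * of_real (av t)) ^ (Suc j - 1) * (s * of_real (h3 t)))
       = (1 / fact (Suc j) * complex_of_nat (Suc j)) * ((s * of_real (av t)) ^ j * (s * of_real (h3 t)))"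
      by (simp only: mult.assoc diff_Suc_1)
    also have "\<dots> = s * of_real (h3 t) * pw s j t" unfolding f pw_def by simp
    finally show "(1 / fact (Suc j)) * (of_nat (Suc j) * (s * of_real (av t)) ^ (Suc j - 1) * (s * of_real (h3 t))) = s * of_real (h3 t) * pw s j t" .
  qed (auto simp: pw_def)
qed

text \<open>Multiplication by the power series of $e^{-s a}$, $a = \int h_3$, removes the off-diagonal
  entry of the Hamiltonian.\<close>
lemma conv_indef:
  assumes u0: "indef_int iv (u 0) (\<lambda>t. 0)"
    and u: "\<And>k. indef_int iv (u (Suc k)) (\<lambda>t. \<alpha> k t - s * of_real (h3 t) * u k t)"
  shows "indef_int iv (\<lambda>t. \<Sum>j\<le>Suc n. pw s j t * u (Suc n - j) t) (\<lambda>t. \<Sum>j\<le>n. pw s j t * \<alpha> (n - j) t)"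
proof -
  define p' where "p' j t = (case j of 0 \<Rightarrow> 0 | Suc i \<Rightarrow> s * of_real (h3 t) * pw s i t)" for j t
  define u' where "u' k t = (case k of 0 \<Rightarrow> 0 | Suc i \<Rightarrow> \<alpha> i t - s * of_real (h3 t) * u i t)" for k t
  have p: "indef_int iv (pw s j) (p' j)" for j
  proof (cases j)
    case 0
    have "pw s 0 = (\<lambda>t. 1)" "p' 0 = (\<lambda>t. 0)" by (auto simp: p'_def)
    then show ?thesis using 0 indef_int_const by simp
  next
    case (Suc i) then show ?thesis using pw_indef[of s i] unfolding p'_def by simp
  qed
  have u2: "indef_int iv (u k) (u' k)" for k
    using u0 u[of "k - 1"] unfolding u'_def by (cases k) simp_all
  have "indef_int iv (\<lambda>t. \<Sum>j\<le>Suc n. pw s j t * u (Suc n - j) t)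
     (\<lambda>t. \<Sum>j\<le>Suc n. p' j t * u (Suc n - j) t + pw s j t * u' (Suc n - j) t)"
    by (intro indef_int_sum indef_int_mult p u2 iv_interval)
  then show ?thesis
  proof (rule indef_int_cong[where N="{}"])
    fix t
    have "(\<Sum>j\<le>Suc n. p' j t * u (Suc n - j) t) = (\<Sum>i\<le>n. s * of_real (h3 t) * pw s i t * u (n - i) t)"
      by (simp add: sum.atMost_Suc_shift p'_def del: sum.atMost_Suc)
    moreover have "(\<Sum>j\<le>Suc n. pw s j t * u' (Suc n - j) t) = (\<Sum>j\<le>n. pw s j t * (\<alpha> (n - j) t - s * of_real (h3 t) * u (n - j) t))"
    proof -
      have "(\<Sum>j\<le>n. pw s j t * u' (Suc n - j) t) = (\<Sum>j\<le>n. pw s j t * (\<alpha> (n - j) t - s * of_real (h3 t) * u (n - j) t))"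
        by (rule sum.cong) (auto simp: u'_def Suc_diff_le)
      then show ?thesis by (simp add: u'_def)
    qed
    ultimately show "(\<Sum>j\<le>Suc n. p' j t * u (Suc n - j) t + pw s j t * u' (Suc n - j) t) = (\<Sum>j\<le>n. pw s j t * \<alpha> (n - j) t)"
      by (simp add: sum.distrib right_diff_distrib sum_subtractf algebra_simps del: sum.atMost_Suc)
  qed auto
qed

text \<open>With Y(z) the generating series of the \<open>Y n\<close>, \<open>cB n\<close> and
  \<open>cD n\<close> are the coefficients of z^n in exp (-z av) Y_2(z) and exp (z av) Y_1(z). Their
  derivatives contain only h_1 and only h_2, respectively.\<close>

definition cB :: "nat \<Rightarrow> real \<Rightarrow> complex" where "cB n t = (\<Sum>j\<le>n. pw (-1) j t * Y (n - j) t $ 2)"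
definition cD :: "nat \<Rightarrow> real \<Rightarrow> complex" where "cD n t = (\<Sum>j\<le>n. pw 1 j t * Y (n - j) t $ 1)"

lemma cB_indef: "indef_int iv (cB (Suc n)) (\<lambda>t. of_real (h1 t) * (\<Sum>j\<le>n. pw (-1) j t * Y (n - j) t $ 1))"
proof -
  have "indef_int iv (\<lambda>t. \<Sum>j\<le>Suc n. pw (-1) j t * Y (Suc n - j) t $ 2) (\<lambda>t. \<Sum>j\<le>n. pw (-1) j t * (of_real (h1 t) * Y (n - j) t $ 1))"
  proof (rule conv_indef[where u="\<lambda>k t. Y k t $ 2" and \<alpha>="\<lambda>k t. of_real (h1 t) * Y k t $ 1"])
    show "indef_int iv (\<lambda>t. Y 0 t $ 2) (\<lambda>t. 0)" using indef_int_const by (simp add: Y_0)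
    show "indef_int iv (\<lambda>t. Y (Suc k) t $ 2) (\<lambda>t. of_real (h1 t) * Y k t $ 1 - - 1 * of_real (h3 t) * Y k t $ 2)" for k
      using I_props(2)[OF Y_nice[of k]] unfolding Y_Suc d1_def[abs_def] by simp
  qed
  then show ?thesis unfolding cB_def by (simp add: sum_distrib_left algebra_simps)
qed

lemma cD_indef: "indef_int iv (cD (Suc n)) (\<lambda>t. - of_real (h2 t) * (\<Sum>j\<le>n. pw 1 j t * Y (n - j) t $ 2))"
proof -
  have "indef_int iv (\<lambda>t. \<Sum>j\<le>Suc n. pw 1 j t * Y (Suc n - j) t $ 1) (\<lambda>t. \<Sum>j\<le>n. pw 1 j t * (- of_real (h2 t) * Y (n - j) t $ 2))"
  proof (rule conv_indef[where u="\<lambda>k t. Y k t $ 1" and \<alpha>="\<lambda>k t. - of_real (h2 t) * Y k t $ 2"])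
    show "indef_int iv (\<lambda>t. Y 0 t $ 1) (\<lambda>t. 0)" using indef_int_const by (simp add: Y_0)
    show "indef_int iv (\<lambda>t. Y (Suc k) t $ 1) (\<lambda>t. - of_real (h2 t) * Y k t $ 2 - 1 * of_real (h3 t) * Y k t $ 1)" for k
    proof -
      have "(\<lambda>t. - d2 (Y k) t) = (\<lambda>t. - of_real (h2 t) * Y k t $ 2 - 1 * of_real (h3 t) * Y k t $ 1)"
        by (simp add: d2_def fun_eq_iff)
      then show ?thesis using I_props(1)[OF Y_nice[of k]] unfolding Y_Suc by (simp only:)
    qed
  qed
  then show ?thesis unfolding cD_def by (simp add: sum_distrib_left algebra_simps sum_negf)
qed

lemma Y_at_a: "Y (Suc k) a = 0" unfolding Y_Suc by (rule I_props(3)[OF Y_nice])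

lemma conv_at_a: "cB (Suc n) a = 0" "cD (Suc n) a = 0"
proof -
  have "pw s j a * Y (Suc n - j) a $ i = 0" if "j \<le> Suc n" for s j and i :: 2
  proof (cases j)
    case 0 then show ?thesis by (simp add: Y_at_a)
  next
    case (Suc k) then show ?thesis by (simp add: pw_def av_0)
  qed
  then show "cB (Suc n) a = 0" "cD (Suc n) a = 0" unfolding cB_def cD_def by (intro sum.neutral; simp)+
qed

lemma cB_solve: "Y (Suc n) t $ 2 = cB (Suc n) t - (\<Sum>j\<le>n. pw (-1) (Suc j) t * Y (n - j) t $ 2)"
  unfolding cB_def by (simp add: sum.atMost_Suc_shift del: sum.atMost_Suc)

lemma cD_solve: "Y (Suc n) t $ 1 = cD (Suc n) t - (\<Sum>j\<le>n. pw 1 (Suc j) t * Y (n - j) t $ 1)"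
  unfolding cD_def by (simp add: sum.atMost_Suc_shift del: sum.atMost_Suc)

lemma norm_pw_le:
  assumes "\<bar>av t\<bar> \<le> r" "1 \<le> r" "norm s = 1" shows "norm (pw s j t) \<le> r ^ j"
proof -
  have "norm (pw s j t) = \<bar>av t\<bar> ^ j / fact j"
    using assms by (simp add: pw_def norm_divide norm_power norm_mult)
  also have "\<dots> \<le> \<bar>av t\<bar> ^ j / 1" by (intro divide_left_mono) (auto simp: fact_ge_1)
  also have "\<dots> \<le> r ^ j" using assms by (simp add: power_mono)
  finally show ?thesis .
qed

lemma indef_int_norm_le:
  assumes f: "indef_int iv f g" and t: "t \<in> iv" and "f a = 0"
    and w: "w integrable_on {a..t}" "\<And>s. s \<in> {a..t} \<Longrightarrow> norm (g s) \<le> w s"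
  shows "norm (f t) \<le> integral {a..t} w"
proof -
  have a: "a \<in> iv" "a \<le> t" using t ab by auto
  have i: "(g has_integral (f t - f a)) {a..t}" by (rule indef_intD(2)[OF f a(1) t a(2)])
  have "norm (integral {a..t} g) \<le> integral {a..t} w"
    by (rule integral_norm_bound_integral[OF _ w]) (use i in blast)
  then show ?thesis using integral_unique[OF i] assms(3) by simp
qed

text \<open>As \<open>av\<close> is not yet bounded, estimates are made on [a, T] in powers of a
  bound r of its modulus there. With 1 \<le> r, lower powers are dominated by higher ones.\<close>

definition tame :: "real \<Rightarrow> real \<Rightarrow> bool" where
  "tame T r \<longleftrightarrow> a \<le> T \<and> T < b \<and> 1 \<le> r \<and> (\<forall>t\<in>{a..T}. \<bar>av t\<bar> \<le> r)"

text \<open>The factor 1 + M is absorbed by h_1, since \<open>Mh\<close> is integrable up to b, so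
  no growth in M remains. The power is r^n for the index n + 1, and this gain of one power is what
  \<open>Y_asymp\<close> rests on.\<close>

lemma cB_bound:
  assumes C: "0 \<le> C" "\<And>k t. k \<le> n \<Longrightarrow> t \<in> {a..T} \<Longrightarrow> norm (Y k t $ 1) \<le> C * (1 + M t) * r ^ k"
    and tm: "tame T r" and t: "t \<in> {a..T}"
  shows "norm (cB (Suc n) t) \<le> real (Suc n) * C * integral {a..b} Mh * r ^ n"
proof -
  have T: "T < b" "1 \<le> r" "\<And>t. t \<in> {a..T} \<Longrightarrow> \<bar>av t\<bar> \<le> r" using tm unfolding tame_def by auto
  have t': "t \<in> iv" using t T by auto
  have "norm (cB (Suc n) t) \<le> integral {a..t} (\<lambda>s. real (Suc n) * C * r ^ n * Mh s)"
  proof (rule indef_int_norm_le[OF cB_indef t' conv_at_a(1)])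
    show "(\<lambda>s. real (Suc n) * C * r ^ n * Mh s) integrable_on {a..t}"
      by (rule integrable_on_mult_right, rule Mh_on) (use t' in auto)
    fix s assume s: "s \<in> {a..t}"
    then have sT: "s \<in> {a..T}" using t by auto
    have Ms: "0 \<le> M s" using M_nonneg[of s] sT T by auto
    have "norm (\<Sum>j\<le>n. pw (-1) j s * Y (n - j) s $ 1) \<le> (\<Sum>j\<le>n. C * (1 + M s) * r ^ n)"
    proof (rule sum_norm_le)
      fix j assume j: "j \<in> {..n}"
      have "norm (pw (-1) j s * Y (n - j) s $ 1) \<le> r ^ j * (C * (1 + M s) * r ^ (n - j))"
        unfolding norm_mult using norm_pw_le[OF T(3)[OF sT] T(2), of "-1" j] C(2)[OF _ sT, of "n - j"] T(2)
        by (intro mult_mono) auto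
      also have "\<dots> = C * (1 + M s) * r ^ n"
        using j by (simp add: mult.left_commute[of "r ^ j"] power_add[symmetric])
      finally show "norm (pw (-1) j s * Y (n - j) s $ 1) \<le> C * (1 + M s) * r ^ n" .
    qed
    then have "norm (of_real (h1 s) * (\<Sum>j\<le>n. pw (-1) j s * Y (n - j) s $ 1)) \<le> h1 s * (\<Sum>j\<le>n. C * (1 + M s) * r ^ n)"
      unfolding norm_mult using h_psd(1)[of s] by (simp add: mult_left_mono)
    also have "\<dots> = real (Suc n) * C * r ^ n * Mh s" by (simp add: Mh_def)
    finally show "norm (of_real (h1 s) * (\<Sum>j\<le>n. pw (-1) j s * Y (n - j) s $ 1)) \<le> real (Suc n) * C * r ^ n * Mh s" .
  qed
  also have "\<dots> = real (Suc n) * C * r ^ n * integral {a..t} Mh" by (rule integral_mult_right)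
  also have "\<dots> \<le> real (Suc n) * C * r ^ n * integral {a..b} Mh"
    using t' C(1) T(2) by (intro mult_left_mono integral_subset_le Mh_on) (auto simp: Mh_nonneg)
  finally show ?thesis by (simp add: algebra_simps)
qed

lemma cD_bound:
  assumes C: "0 \<le> C" "\<And>k t. k \<le> n \<Longrightarrow> t \<in> {a..T} \<Longrightarrow> norm (Y k t $ 2) \<le> C * r ^ k"
    and tm: "tame T r" and t: "t \<in> {a..T}"
  shows "norm (cD (Suc n) t) \<le> real (Suc n) * C * r ^ n * M t"
proof -
  have T: "T < b" "1 \<le> r" "\<And>t. t \<in> {a..T} \<Longrightarrow> \<bar>av t\<bar> \<le> r" using tm unfolding tame_def by auto
  have t': "t \<in> iv" using t T by auto
  have "norm (cD (Suc n) t) \<le> integral {a..t} (\<lambda>s. real (Suc n) * C * r ^ n * h2 s)"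
  proof (rule indef_int_norm_le[OF cD_indef t' conv_at_a(2)])
    show "(\<lambda>s. real (Suc n) * C * r ^ n * h2 s) integrable_on {a..t}"
      by (rule integrable_on_mult_right, rule hval_on) (use t' in auto)
    fix s assume s: "s \<in> {a..t}"
    then have sT: "s \<in> {a..T}" using t by auto
    have "norm (\<Sum>j\<le>n. pw 1 j s * Y (n - j) s $ 2) \<le> (\<Sum>j\<le>n. C * r ^ n)"
    proof (rule sum_norm_le)
      fix j assume j: "j \<in> {..n}"
      have "norm (pw 1 j s * Y (n - j) s $ 2) \<le> r ^ j * (C * r ^ (n - j))"
        unfolding norm_mult using norm_pw_le[OF T(3)[OF sT] T(2), of 1 j] C(2)[OF _ sT, of "n - j"] T(2)
        by (intro mult_mono) auto
      also have "\<dots> = C * r ^ n"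
        using j by (simp add: mult.left_commute[of "r ^ j"] power_add[symmetric])
      finally show "norm (pw 1 j s * Y (n - j) s $ 2) \<le> C * r ^ n" .
    qed
    then have "norm (- of_real (h2 s) * (\<Sum>j\<le>n. pw 1 j s * Y (n - j) s $ 2)) \<le> h2 s * (\<Sum>j\<le>n. C * r ^ n)"
      unfolding norm_mult using h_psd(2)[of s] by (simp add: mult_left_mono)
    also have "\<dots> = real (Suc n) * C * r ^ n * h2 s" by simp
    finally show "norm (- of_real (h2 s) * (\<Sum>j\<le>n. pw 1 j s * Y (n - j) s $ 2)) \<le> real (Suc n) * C * r ^ n * h2 s" .
  qed
  also have "\<dots> = real (Suc n) * C * r ^ n * M t" unfolding M_def by (rule integral_mult_right)
  finally show ?thesis .
qed

text \<open>Induction through \<open>cB_solve\<close> and \<open>cD_solve\<close>, for both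
  components at once because each bound feeds the other. The constant is fixed before T and r: in
  \<open>av_bounded\<close>, r will be the maximum of the modulus of \<open>av\<close> on
  [a, T].\<close>

lemma Y_bound:
  "\<exists>C\<ge>0. \<forall>T r k t. tame T r \<longrightarrow> k \<le> n \<longrightarrow> t \<in> {a..T} \<longrightarrow>
     norm (Y k t $ 1) \<le> C * (1 + M t) * r ^ k \<and> norm (Y k t $ 2) \<le> C * r ^ k"
proof (induction n)
  case 0
  have "norm (Y 0 t $ 1) \<le> 1 * (1 + M t) * r ^ 0 \<and> norm (Y 0 t $ 2) \<le> 1 * r ^ 0" if "tame T r" "t \<in> {a..T}" for T r t
    using M_nonneg[of t] that unfolding tame_def by (auto simp: Y_0)
  then show ?case by (intro exI[of _ 1]) auto
next
  case (Suc n)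
  then obtain C where C: "0 \<le> C" and CY: "\<And>T r k t. tame T r \<Longrightarrow> k \<le> n \<Longrightarrow> t \<in> {a..T} \<Longrightarrow>
     norm (Y k t $ 1) \<le> C * (1 + M t) * r ^ k \<and> norm (Y k t $ 2) \<le> C * r ^ k" by blast
  define K where "K = integral {a..b} Mh"
  have K: "0 \<le> K" unfolding K_def by (intro integral_nonneg Mh_on) (auto simp: Mh_nonneg)
  define C' where "C' = real (Suc n) * C * (K + 1) + real (Suc n) * C + C"
  have CC': "C \<le> C'" "real (Suc n) * C * K + real (Suc n) * C \<le> C'" "real (Suc n) * C + real (Suc n) * C \<le> C'" "0 \<le> C'"
    unfolding C'_def using C K by (auto simp: algebra_simps)
  show ?case
  proof (intro exI[of _ C'] conjI allI impI CC'(4))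
    fix T r k t assume tm: "tame T r" and k: "k \<le> Suc n" and t: "t \<in> {a..T}"
    have T: "T < b" "1 \<le> r" "\<bar>av t\<bar> \<le> r" using tm t unfolding tame_def by auto
    have Mt: "0 \<le> M t" using M_nonneg[of t] t T by auto
    have rr: "r ^ n \<le> r ^ Suc n" "0 \<le> r ^ n" "0 \<le> r ^ Suc n" using T(2) by (auto intro: power_increasing simp del: power_Suc)
    show "norm (Y k t $ 1) \<le> C' * (1 + M t) * r ^ k"
    proof (cases "k \<le> n")
      case True
      have "norm (Y k t $ 1) \<le> C * (1 + M t) * r ^ k" using CY[OF tm True t] by blast
      also have "\<dots> \<le> C' * (1 + M t) * r ^ k" using CC' Mt T by (intro mult_right_mono) auto
      finally show ?thesis .
    next
      case False
      then have k: "k = Suc n" using k by simp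
      have D: "norm (cD (Suc n) t) \<le> real (Suc n) * C * r ^ n * M t"
        by (rule cD_bound[OF C _ tm t]) (use CY[OF tm] in blast)
      also have "\<dots> \<le> real (Suc n) * C * r ^ Suc n * (1 + M t)"
        using C Mt rr by (intro mult_mono mult_left_mono mult_nonneg_nonneg) auto
      finally have D: "norm (cD (Suc n) t) \<le> real (Suc n) * C * r ^ Suc n * (1 + M t)" .
      have S: "norm (\<Sum>j\<le>n. pw 1 (Suc j) t * Y (n - j) t $ 1) \<le> (\<Sum>j\<le>n. C * (1 + M t) * r ^ Suc n)"
      proof (rule sum_norm_le)
        fix j assume j: "j \<in> {..n}"
        have "norm (pw 1 (Suc j) t * Y (n - j) t $ 1) \<le> r ^ Suc j * (C * (1 + M t) * r ^ (n - j))"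
          unfolding norm_mult using norm_pw_le[OF T(3) T(2), of 1 "Suc j"] CY[OF tm _ t, of "n - j"] T(2)
          by (intro mult_mono) auto
        also have "\<dots> = C * (1 + M t) * r ^ Suc n"
          using j by (simp add: mult.left_commute[of "r ^ Suc j"] power_add[symmetric] del: power_Suc)
        finally show "norm (pw 1 (Suc j) t * Y (n - j) t $ 1) \<le> C * (1 + M t) * r ^ Suc n" .
      qed
      have "norm (Y k t $ 1) \<le> real (Suc n) * C * r ^ Suc n * (1 + M t) + real (Suc n) * (C * (1 + M t) * r ^ Suc n)"
        unfolding k cD_solve by (rule order_trans[OF norm_triangle_ineq4 add_mono[OF D S[unfolded sum_constant card_atMost]]])
      also have "\<dots> = (real (Suc n) * C + real (Suc n) * C) * ((1 + M t) * r ^ Suc n)" by (simp add: algebra_simps)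
      also have "\<dots> \<le> C' * ((1 + M t) * r ^ Suc n)" using CC'(3) Mt rr by (intro mult_right_mono) auto
      finally show ?thesis unfolding k by (simp add: mult.assoc)
    qed
    show "norm (Y k t $ 2) \<le> C' * r ^ k"
    proof (cases "k \<le> n")
      case True
      have "norm (Y k t $ 2) \<le> C * r ^ k" using CY[OF tm True t] by blast
      also have "\<dots> \<le> C' * r ^ k" using CC' T by (intro mult_right_mono) auto
      finally show ?thesis .
    next
      case False
      then have k: "k = Suc n" using k by simp
      have B: "norm (cB (Suc n) t) \<le> real (Suc n) * C * K * r ^ n"
        unfolding K_def by (rule cB_bound[OF C _ tm t]) (use CY[OF tm] in blast)
      also have "\<dots> \<le> real (Suc n) * C * K * r ^ Suc n" using C K rr by (intro mult_left_mono) auto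
      finally have B: "norm (cB (Suc n) t) \<le> real (Suc n) * C * K * r ^ Suc n" .
      have S: "norm (\<Sum>j\<le>n. pw (-1) (Suc j) t * Y (n - j) t $ 2) \<le> (\<Sum>j\<le>n. C * r ^ Suc n)"
      proof (rule sum_norm_le)
        fix j assume j: "j \<in> {..n}"
        have "norm (pw (-1) (Suc j) t * Y (n - j) t $ 2) \<le> r ^ Suc j * (C * r ^ (n - j))"
          unfolding norm_mult using norm_pw_le[OF T(3) T(2), of "-1" "Suc j"] CY[OF tm _ t, of "n - j"] T(2)
          by (intro mult_mono) auto
        also have "\<dots> = C * r ^ Suc n"
          using j by (simp add: mult.left_commute[of "r ^ Suc j"] power_add[symmetric] del: power_Suc)
        finally show "norm (pw (-1) (Suc j) t * Y (n - j) t $ 2) \<le> C * r ^ Suc n" .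
      qed
      have "norm (Y k t $ 2) \<le> real (Suc n) * C * K * r ^ Suc n + real (Suc n) * (C * r ^ Suc n)"
        unfolding k cB_solve by (rule order_trans[OF norm_triangle_ineq4 add_mono[OF B S[unfolded sum_constant card_atMost]]])
      also have "\<dots> = (real (Suc n) * C * K + real (Suc n) * C) * r ^ Suc n" by (simp add: algebra_simps)
      also have "\<dots> \<le> C' * r ^ Suc n" using CC'(2) rr by (intro mult_right_mono) auto
      finally show ?thesis unfolding k .
    qed
  qed
qed

end

section \<open>Boundedness of the integral of h_3, and limits of the iterates\<close>

context hs_side begin

text \<open>The coefficient of z^(n+1) in exp (-z av) exp (z av) = 1.\<close>

lemma pw_binomial_zero: "(\<Sum>j\<le>Suc n. pw (-1) j t * pw 1 (Suc n - j) t) = 0"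
proof -
  define x where "x = complex_of_real (av t)"
  have "(\<Sum>j\<le>Suc n. pw (-1) j t * pw 1 (Suc n - j) t) = (\<Sum>j\<le>Suc n. of_nat (Suc n choose j) * (- x) ^ j * x ^ (Suc n - j) / fact (Suc n))"
  proof (rule sum.cong[OF refl])
    fix j assume "j \<in> {..Suc n}"
    then have "complex_of_nat (Suc n choose j) = fact (Suc n) / (fact j * fact (Suc n - j))" by (simp add: binomial_fact del: fact_Suc)
    then show "pw (-1) j t * pw 1 (Suc n - j) t = of_nat (Suc n choose j) * (- x) ^ j * x ^ (Suc n - j) / fact (Suc n)"
      by (simp add: pw_def x_def del: fact_Suc)
  qed
  also have "\<dots> = (- x + x) ^ Suc n / fact (Suc n)"
    unfolding binomial_ring sum_divide_distrib ..
  finally show ?thesis by simp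
qed

text \<open>To leading order in r the second component of \<open>Y k\<close> is \<open>av\<close>^k
  / k!, its exact value if h_1 and h_3 were replaced by 0 and h_3. The error is smaller by one power
  of r, by \<open>cB_bound\<close>; it is stated with a factor r on the left so that k = 0 is
  covered. The exponential terms cancel by \<open>pw_binomial_zero\<close>.\<close>

lemma Y_asymp:
  "\<exists>C\<ge>0. \<forall>T r k t. tame T r \<longrightarrow> k \<le> n \<longrightarrow> t \<in> {a..T} \<longrightarrow> r * norm (Y k t $ 2 - pw 1 k t) \<le> C * r ^ k"
proof (induction n)
  case 0
  show ?case by (intro exI[of _ 0]) (auto simp: Y_0)
next
  case (Suc n)
  then obtain C where C: "0 \<le> C" and CY: "\<And>T r k t. tame T r \<Longrightarrow> k \<le> n \<Longrightarrow> t \<in> {a..T} \<Longrightarrow>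
     r * norm (Y k t $ 2 - pw 1 k t) \<le> C * r ^ k" by blast
  obtain C1 where C1: "0 \<le> C1" and CY1: "\<And>T r k t. tame T r \<Longrightarrow> k \<le> n \<Longrightarrow> t \<in> {a..T} \<Longrightarrow>
     norm (Y k t $ 1) \<le> C1 * (1 + M t) * r ^ k \<and> norm (Y k t $ 2) \<le> C1 * r ^ k" using Y_bound[of n] by blast
  define K where "K = integral {a..b} Mh"
  have K: "0 \<le> K" unfolding K_def by (intro integral_nonneg Mh_on) (auto simp: Mh_nonneg)
  define C' where "C' = real (Suc n) * C1 * K + real (Suc n) * C + C"
  have CC': "C \<le> C'" "real (Suc n) * C1 * K + real (Suc n) * C \<le> C'" "0 \<le> C'"
    unfolding C'_def using C C1 K by (auto simp: algebra_simps)
  show ?case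
  proof (intro exI[of _ C'] conjI allI impI CC'(3))
    fix T r k t assume tm: "tame T r" and k: "k \<le> Suc n" and t: "t \<in> {a..T}"
    have T: "T < b" "1 \<le> r" "\<bar>av t\<bar> \<le> r" using tm t unfolding tame_def by auto
    show "r * norm (Y k t $ 2 - pw 1 k t) \<le> C' * r ^ k"
    proof (cases "k \<le> n")
      case True
      have "r * norm (Y k t $ 2 - pw 1 k t) \<le> C * r ^ k" using CY[OF tm True t] .
      also have "\<dots> \<le> C' * r ^ k" using CC' T by (intro mult_right_mono) auto
      finally show ?thesis .
    next
      case False
      then have k: "k = Suc n" using k by simp
      have e: "Y (Suc n) t $ 2 - pw 1 (Suc n) t = cB (Suc n) t - (\<Sum>j\<le>n. pw (-1) (Suc j) t * (Y (n - j) t $ 2 - pw 1 (n - j) t))"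
      proof -
        have "pw 1 (Suc n) t + (\<Sum>j\<le>n. pw (-1) (Suc j) t * pw 1 (n - j) t) = 0"
          using pw_binomial_zero[where n=n and t=t] unfolding sum.atMost_Suc_shift by simp
        then have "pw 1 (Suc n) t = - (\<Sum>j\<le>n. pw (-1) (Suc j) t * pw 1 (n - j) t)" by (rule eq_neg_iff_add_eq_0[THEN iffD2])
        then show ?thesis unfolding cB_solve by (simp add: right_diff_distrib sum_subtractf)
      qed
      have "norm (cB (Suc n) t) \<le> real (Suc n) * C1 * K * r ^ n"
        unfolding K_def by (rule cB_bound[OF C1 _ tm t]) (use CY1[OF tm] in blast)
      then have "r * norm (cB (Suc n) t) \<le> r * (real (Suc n) * C1 * K * r ^ n)" using T(2) by (intro mult_left_mono) auto
      then have B: "norm (of_real r * cB (Suc n) t) \<le> real (Suc n) * C1 * K * r ^ Suc n"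
        using T(2) by (simp add: norm_mult mult.left_commute)
      have S: "norm (\<Sum>j\<le>n. of_real r * (pw (-1) (Suc j) t * (Y (n - j) t $ 2 - pw 1 (n - j) t))) \<le> (\<Sum>j\<le>n. C * r ^ Suc n)"
      proof (rule sum_norm_le)
        fix j assume j: "j \<in> {..n}"
        have "norm (of_real r * (pw (-1) (Suc j) t * (Y (n - j) t $ 2 - pw 1 (n - j) t))) = norm (pw (-1) (Suc j) t) * (r * norm (Y (n - j) t $ 2 - pw 1 (n - j) t))"
          using T(2) by (simp add: norm_mult)
        also have "\<dots> \<le> r ^ Suc j * (C * r ^ (n - j))"
        proof (rule mult_mono)
          show "norm (pw (-1) (Suc j) t) \<le> r ^ Suc j" by (rule norm_pw_le[OF T(3) T(2)]) simp
          show "r * norm (Y (n - j) t $ 2 - pw 1 (n - j) t) \<le> C * r ^ (n - j)" by (rule CY[OF tm _ t]) simp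
        qed (use T(2) in auto)
        also have "\<dots> = C * r ^ Suc n"
          using j by (simp add: mult.left_commute[of "r ^ Suc j"] power_add[symmetric] del: power_Suc)
        finally show "norm (of_real r * (pw (-1) (Suc j) t * (Y (n - j) t $ 2 - pw 1 (n - j) t))) \<le> C * r ^ Suc n" .
      qed
      have "r * norm (Y k t $ 2 - pw 1 k t) = norm (of_real r * cB (Suc n) t - (\<Sum>j\<le>n. of_real r * (pw (-1) (Suc j) t * (Y (n - j) t $ 2 - pw 1 (n - j) t))))"
        unfolding k e sum_distrib_left[symmetric] right_diff_distrib[symmetric] norm_mult using T(2) by simp
      also have "\<dots> \<le> real (Suc n) * C1 * K * r ^ Suc n + real (Suc n) * (C * r ^ Suc n)"
        by (rule order_trans[OF norm_triangle_ineq4 add_mono[OF B S[unfolded sum_constant card_atMost]]])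
      also have "\<dots> = (real (Suc n) * C1 * K + real (Suc n) * C) * r ^ Suc n" by (simp add: algebra_simps)
      also have "\<dots> \<le> C' * r ^ Suc n" using CC'(2) T(2) by (intro mult_right_mono) auto
      finally show ?thesis unfolding k .
    qed
  qed
qed

lemma nice_bounded_if_tendsto:
  fixes g :: "real \<Rightarrow> complex"
  assumes g: "nice g" and l: "(g \<longlongrightarrow> l) (at_left b)"
  obtains K where "\<And>t. t \<in> iv \<Longrightarrow> norm (g t) \<le> K"
proof -
  have "\<forall>\<^sub>F t in at_left b. dist (g t) l < 1" using tendstoD[OF l] by simp
  then obtain c where c: "c < b" "\<And>t. c < t \<Longrightarrow> t < b \<Longrightarrow> dist (g t) l < 1"
    using eventually_at_left[of a b, OF ab] by metis
  define T where "T = (max a c + b) / 2"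
  have T: "a \<le> T" "c < T" "T < b" using c(1) ab unfolding T_def max_def by auto
  have "bounded (g ` {a..T})"
    by (rule compact_imp_bounded, rule compact_continuous_image[OF continuous_on_subset[OF g]]) (use T in auto)
  then obtain K where K: "\<forall>w\<in>g ` {a..T}. norm w \<le> K" unfolding bounded_iff by blast
  show thesis
  proof (rule that[of "max K (norm l + 1)"])
    fix t assume t: "t \<in> iv"
    show "norm (g t) \<le> max K (norm l + 1)"
    proof (cases "t \<le> T")
      case True then show ?thesis using K t by (auto simp: le_max_iff_disj)
    next
      case False
      then have "norm (g t - l) < 1" using c(2)[of t] T t by (auto simp: dist_norm)
      then show ?thesis using norm_triangle_ineq2[of "g t" l] by (auto simp: le_max_iff_disj)
    qed
  qed
qed

lemma nice_lin: "(\<And>i. nice (F i)) \<Longrightarrow> nice (lin F P)"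
  unfolding lin_def[abs_def] by (intro nice_sum) auto

lemma I_lin_poly:
  assumes "\<And>i. nice (F i)" "t \<in> iv" shows "I (lin F P) t = lin (\<lambda>i. I (F i)) P t"
  unfolding lin_def[abs_def] by (rule I_sum) (use assms in auto)

text \<open>The second component of I applied to an L^2 function converges at b and so is bounded.
  At a point where the modulus of \<open>av\<close> attains its maximum r > 1 on [a, T], the highest
  term of that component has the exact order r^(D+1) up to O(r^D), by \<open>Y_asymp\<close>, and
  the lower terms are O(r^D). This limits r independently of T.\<close>

lemma av_bounded:
  assumes L: "L2 (lin Y P)" and P: "P \<noteq> 0"
  obtains r where "1 \<le> r" "\<And>t. t \<in> iv \<Longrightarrow> \<bar>av t\<bar> \<le> r"
proof -
  define D where "D = degree P"
  define p where "p = coeff P D"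
  have p0: "p \<noteq> 0" using P unfolding p_def D_def by simp
  have nl: "nice (lin Y P)" by (intro nice_lin Y_nice)
  obtain l where "((\<lambda>t. I (lin Y P) t $ 2) \<longlongrightarrow> l) (at_left b)" by (rule I_L2[OF nl L])
  moreover have "nice (\<lambda>t. I (lin Y P) t $ 2)" using I_props(4)[OF nl] unfolding continuous_on_vec2_iff by blast
  ultimately obtain K where K: "\<And>t. t \<in> iv \<Longrightarrow> norm (I (lin Y P) t $ 2) \<le> K" using nice_bounded_if_tendsto by metis
  have Ie: "I (lin Y P) t $ 2 = (\<Sum>i<D. coeff P i * Y (Suc i) t $ 2) + p * Y (Suc D) t $ 2" if "t \<in> iv" for t
    using I_lin_poly[of Y t P, OF Y_nice that] unfolding Y_Suc[symmetric] lin_def D_def[symmetric] p_def lessThan_Suc_atMost[symmetric]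
    by simp
  obtain C where C: "0 \<le> C" and CY: "\<And>T r k t. tame T r \<Longrightarrow> k \<le> Suc D \<Longrightarrow> t \<in> {a..T} \<Longrightarrow>
     r * norm (Y k t $ 2 - pw 1 k t) \<le> C * r ^ k" using Y_asymp[of "Suc D"] by blast
  obtain C1 where C1: "0 \<le> C1" and CY1: "\<And>T r k t. tame T r \<Longrightarrow> k \<le> Suc D \<Longrightarrow> t \<in> {a..T} \<Longrightarrow>
     norm (Y k t $ 1) \<le> C1 * (1 + M t) * r ^ k \<and> norm (Y k t $ 2) \<le> C1 * r ^ k" using Y_bound[of "Suc D"] by blast
  define K2 where "K2 = (\<Sum>i<D. norm (coeff P i) * C1)"
  have K0: "0 \<le> K" using order_trans[OF norm_ge_zero K[of a]] ab by simp
  have K20: "0 \<le> K2" unfolding K2_def using C1 by (intro sum_nonneg) auto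
  \<comment> \<open>The second entry is what remains of the comparison below after r^(D+1) is
    cancelled; the entry 1 covers r \<le> 1.\<close>
  define R where "R = max 1 (fact (Suc D) * (K + K2 + norm p * C) / norm p)"
  show thesis
  proof (rule that[of R])
    show "1 \<le> R" unfolding R_def by simp
    fix T assume T: "T \<in> iv"
    obtain x where x: "x \<in> {a..T}" "\<And>t. t \<in> {a..T} \<Longrightarrow> \<bar>av t\<bar> \<le> \<bar>av x\<bar>"
    proof -
      have "continuous_on {a..T} (\<lambda>t. \<bar>av t\<bar>)" using av_continuous[of T] T by (intro continuous_intros) auto
      then have "\<exists>x\<in>{a..T}. \<forall>y\<in>{a..T}. \<bar>av y\<bar> \<le> \<bar>av x\<bar>" using T by (intro continuous_attains_sup) auto
      then show ?thesis using that by blast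
    qed
    define r where "r = \<bar>av x\<bar>"
    have "r \<le> R"
    proof (cases "r \<le> 1")
      case True then show ?thesis unfolding R_def by simp
    next
      case False
      have tm: "tame T r" unfolding tame_def using T False x(2) unfolding r_def by auto
      have r1: "1 \<le> r" using False by simp
      have xi: "x \<in> iv" using x(1) T by auto
      have npw: "norm (pw 1 (Suc D) x) = r ^ Suc D / fact (Suc D)"
        by (simp add: pw_def r_def norm_divide norm_power norm_mult del: fact_Suc)
      have s: "norm (\<Sum>i<D. coeff P i * Y (Suc i) x $ 2) \<le> (\<Sum>i<D. norm (coeff P i) * C1 * r ^ D)"
      proof (rule sum_norm_le)
        fix i assume i: "i \<in> {..<D}"
        have "norm (Y (Suc i) x $ 2) \<le> C1 * r ^ Suc i" using CY1[OF tm _ x(1), of "Suc i"] i by simp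
        also have "\<dots> \<le> C1 * r ^ D" using C1 r1 i by (intro mult_left_mono power_increasing) auto
        finally show "norm (coeff P i * Y (Suc i) x $ 2) \<le> norm (coeff P i) * C1 * r ^ D"
          unfolding norm_mult mult.assoc by (intro mult_left_mono) auto
      qed
      then have s: "norm (\<Sum>i<D. coeff P i * Y (Suc i) x $ 2) \<le> K2 * r ^ D" unfolding K2_def sum_distrib_right .
      have "p * Y (Suc D) x $ 2 = I (lin Y P) x $ 2 - (\<Sum>i<D. coeff P i * Y (Suc i) x $ 2)" using Ie[OF xi] by simp
      then have "norm (p * Y (Suc D) x $ 2) \<le> K + K2 * r ^ D"
        using order_trans[OF norm_triangle_ineq4 add_mono[OF K[OF xi] s]] by simp
      moreover have "K * 1 \<le> K * r ^ D" using K0 r1 by (intro mult_left_mono one_le_power)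
      ultimately have 1: "norm (p * Y (Suc D) x $ 2) \<le> (K + K2) * r ^ D" by (simp add: distrib_right)
      have 2: "r * norm (Y (Suc D) x $ 2 - pw 1 (Suc D) x) \<le> C * r ^ Suc D" by (rule CY[OF tm _ x(1)]) simp
      have "r * norm (p * pw 1 (Suc D) x) \<le> r * (norm (p * Y (Suc D) x $ 2) + norm (p * (Y (Suc D) x $ 2 - pw 1 (Suc D) x)))"
        using norm_triangle_ineq4[of "p * Y (Suc D) x $ 2" "p * (Y (Suc D) x $ 2 - pw 1 (Suc D) x)"] r1
        by (intro mult_left_mono) (auto simp: algebra_simps)
      also have "\<dots> = r * norm (p * Y (Suc D) x $ 2) + norm p * (r * norm (Y (Suc D) x $ 2 - pw 1 (Suc D) x))"
        unfolding norm_mult[of p "Y (Suc D) x $ 2 - pw 1 (Suc D) x"] by (simp only: distrib_left mult.left_commute)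
      also have "\<dots> \<le> r * ((K + K2) * r ^ D) + norm p * (C * r ^ Suc D)"
        using 1 2 r1 by (intro add_mono mult_left_mono) auto
      also have "\<dots> = (K + K2 + norm p * C) * r ^ Suc D" by (simp add: algebra_simps)
      finally have "r * (norm p * (r ^ Suc D / fact (Suc D))) \<le> (K + K2 + norm p * C) * r ^ Suc D"
        unfolding norm_mult npw .
      then have "(r * norm p / fact (Suc D)) * r ^ Suc D \<le> (K + K2 + norm p * C) * r ^ Suc D" by (simp add: mult.assoc)
      then have "r * norm p / fact (Suc D) \<le> K + K2 + norm p * C"
        using r1 by (subst (asm) mult_le_cancel_right_pos) auto
      then have "r \<le> fact (Suc D) * (K + K2 + norm p * C) / norm p"
        using p0 by (simp add: field_simps del: fact_Suc)
      then show ?thesis unfolding R_def by simp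
    qed
    then show "\<bar>av T\<bar> \<le> R" using x(2)[of T] T unfolding r_def by auto
  qed
qed

lemma Y_bound_global:
  assumes "1 \<le> r" "\<And>t. t \<in> iv \<Longrightarrow> \<bar>av t\<bar> \<le> r"
  obtains C where "0 \<le> C" "\<And>k t. k \<le> n \<Longrightarrow> t \<in> iv \<Longrightarrow> norm (Y k t $ 1) \<le> C * (1 + M t) \<and> norm (Y k t $ 2) \<le> C"
proof -
  obtain C where C: "0 \<le> C" and CY: "\<And>T r k t. tame T r \<Longrightarrow> k \<le> n \<Longrightarrow> t \<in> {a..T} \<Longrightarrow>
     norm (Y k t $ 1) \<le> C * (1 + M t) * r ^ k \<and> norm (Y k t $ 2) \<le> C * r ^ k" using Y_bound[of n] by blast
  show thesis
  proof (rule that[of "C * r ^ n"])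
    show "0 \<le> C * r ^ n" using C assms(1) by simp
    fix k t assume k: "k \<le> n" and t: "t \<in> iv"
    have tm: "tame t r" using t assms unfolding tame_def by auto
    have Mt: "0 \<le> M t" using M_nonneg[of t] t by auto
    have rk: "r ^ k \<le> r ^ n" using assms(1) k by (simp add: power_increasing)
    have *: "norm (Y k t $ 1) \<le> C * (1 + M t) * r ^ k" "norm (Y k t $ 2) \<le> C * r ^ k" using CY[OF tm k, of t] t by auto
    have "C * (1 + M t) * r ^ k \<le> C * (1 + M t) * r ^ n" "C * r ^ k \<le> C * r ^ n"
      using C Mt rk by (intro mult_left_mono; simp)+
    then show "norm (Y k t $ 1) \<le> C * r ^ n * (1 + M t) \<and> norm (Y k t $ 2) \<le> C * r ^ n"
      using * by (simp add: mult_ac)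
  qed
qed

lemma indef_dominated_tendsto:
  assumes f: "indef_int iv f (\<lambda>t. of_real (h1 t) * F t)" and F: "nice F" "\<And>t. t \<in> iv \<Longrightarrow> norm (F t) \<le> C * (1 + M t)"
  shows "(\<lambda>t. of_real (h1 t) * F t) absolutely_integrable_on {a..b}" "\<exists>l. (f \<longlongrightarrow> l) (at_left b)"
proof -
  have bd: "norm (of_real (h1 t) * F t) \<le> C * Mh t" if "t \<in> {a..b}" for t
  proof (cases "t = b")
    case False
    then have "h1 t * norm (F t) \<le> h1 t * (C * (1 + M t))" using F(2)[of t] h_psd(1) that by (intro mult_left_mono) auto
    then show ?thesis unfolding Mh_def norm_mult using h_psd(1)[of t] by (simp add: mult_ac)
  qed (simp add: Mh_def)
  show ai: "(\<lambda>t. of_real (h1 t) * F t) absolutely_integrable_on {a..b}"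
  proof (rule measurable_bounded_by_integrable_imp_absolutely_integrable[OF _ _ _ bd])
    have "F \<in> borel_measurable (lebesgue_on {a<..<b})"
      by (rule continuous_imp_measurable_on_sets_lebesgue, rule continuous_on_subset[OF F(1)]) auto
    note [measurable] = this
    have "(\<lambda>t. of_real (h1 t) * F t) \<in> borel_measurable lebesgue"
      by (rule restrict_measurable) (measurable, simp add: hval_outside)
    then show "(\<lambda>t. of_real (h1 t) * F t) \<in> borel_measurable (lebesgue_on {a..b})" by (rule measurable_restrict_space1)
    show "(\<lambda>t. C * Mh t) integrable_on {a..b}" by (rule integrable_on_mult_right[OF Mh_on]) auto
  qed simp
  define J where "J t = f a + integral {a..t} (\<lambda>t. of_real (h1 t) * F t)" for t
  have "continuous_on {a..b} J" unfolding J_def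
    by (intro continuous_intros indefinite_integral_continuous_1 absolutely_integrable_imp_integrable[OF ai])
  then have "(J \<longlongrightarrow> J b) (at b within {a..b})" using ab unfolding continuous_on_def by auto
  then have J: "(J \<longlongrightarrow> J b) (at_left b)" using ab by (simp add: at_within_Icc_at_left)
  have "\<forall>\<^sub>F t in at_left b. J t = f t"
    using eventually_at_left_real[OF ab]
  proof eventually_elim
    case (elim t)
    have "integral {a..t} (\<lambda>t. of_real (h1 t) * F t) = f t - f a"
      by (rule integral_unique, rule indef_intD(2)[OF f]) (use elim in auto)
    then show ?case unfolding J_def by simp
  qed
  then have "(f \<longlongrightarrow> J b) (at_left b)" using J by (rule Lim_transform_eventually[rotated])
  then show "\<exists>l. (f \<longlongrightarrow> l) (at_left b)" by blast
qed

text \<open>The derivative of \<open>cB n\<close> carries the factor h_1 and otherwise grows at most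
  like 1 + M, so a multiple of \<open>Mh\<close> dominates it. This limit exists even if
  \<open>av\<close> oscillates.\<close>

lemma cB_converges:
  assumes r: "1 \<le> r" "\<And>t. t \<in> iv \<Longrightarrow> \<bar>av t\<bar> \<le> r"
  shows "\<exists>l. (cB n \<longlongrightarrow> l) (at_left b)"
proof (cases n)
  case 0
  have "cB 0 = (\<lambda>t. 1)" by (simp add: cB_def Y_0 fun_eq_iff)
  then show ?thesis using 0 by auto
next
  case (Suc m)
  obtain C where C: "0 \<le> C" "\<And>k t. k \<le> m \<Longrightarrow> t \<in> iv \<Longrightarrow> norm (Y k t $ 1) \<le> C * (1 + M t) \<and> norm (Y k t $ 2) \<le> C"
    using Y_bound_global[OF r] by blast
  show ?thesis unfolding Suc
  proof (rule indef_dominated_tendsto(2)[OF cB_indef])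
    have cp: "nice (pw (-1) j)" for j unfolding pw_def[abs_def]
      by (intro continuous_intros continuous_on_halfopen av_continuous) auto
    have cy: "nice (\<lambda>t. Y j t $ 1)" for j using Y_nice[of j] unfolding continuous_on_vec2_iff by blast
    show "nice (\<lambda>t. \<Sum>j\<le>m. pw (-1) j t * Y (m - j) t $ 1)" by (intro continuous_on_sum continuous_on_mult cp cy)
    fix t assume t: "t \<in> iv"
    have Mt: "0 \<le> M t" using M_nonneg[of t] t by auto
    have "norm (\<Sum>j\<le>m. pw (-1) j t * Y (m - j) t $ 1) \<le> (\<Sum>j\<le>m. r ^ j * (C * (1 + M t)))"
    proof (rule sum_norm_le)
      fix j assume "j \<in> {..m}"
      show "norm (pw (-1) j t * Y (m - j) t $ 1) \<le> r ^ j * (C * (1 + M t))"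
        unfolding norm_mult using norm_pw_le[OF r(2)[OF t] r(1), of "-1" j] C(2)[of "m - j", OF _ t] r(1)
        by (intro mult_mono) auto
    qed
    also have "\<dots> = ((\<Sum>j\<le>m. r ^ j) * C) * (1 + M t)" by (simp add: sum_distrib_right sum_distrib_left algebra_simps)
    finally show "norm (\<Sum>j\<le>m. pw (-1) j t * Y (m - j) t $ 1) \<le> ((\<Sum>j\<le>m. r ^ j) * C) * (1 + M t)" .
  qed
qed

text \<open>In \<open>cB_solve\<close> the only factors without a limit at b are the powers of
  \<open>av\<close>. Along a filter on which \<open>av\<close> converges, limits therefore propagate
  by induction on n.\<close>

lemma Y_converges_along:
  assumes r: "1 \<le> r" "\<And>t. t \<in> iv \<Longrightarrow> \<bar>av t\<bar> \<le> r" and G: "G \<le> at_left b" "(av \<longlongrightarrow> \<alpha>) G"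
  shows "\<exists>l. ((\<lambda>t. Y n t $ 2) \<longlongrightarrow> l) G"
proof (induction n rule: less_induct)
  case (less n)
  show ?case
  proof (cases n)
    case 0 then show ?thesis by (auto simp: Y_0)
  next
    case (Suc m)
    obtain l where "(cB (Suc m) \<longlongrightarrow> l) (at_left b)" using cB_converges[OF r] by blast
    then have l: "(cB (Suc m) \<longlongrightarrow> l) G" using G(1) tendsto_mono by blast
    have p: "(pw (-1) j \<longlongrightarrow> (-1 * of_real \<alpha>) ^ j / fact j) G" for j
      unfolding pw_def[abs_def] by (intro tendsto_intros G(2)) auto
    obtain y where y: "\<And>k. k \<le> m \<Longrightarrow> ((\<lambda>t. Y k t $ 2) \<longlongrightarrow> y k) G" using less.IH unfolding Suc less_Suc_eq_le by metis
    have "((\<lambda>t. Y (Suc m) t $ 2) \<longlongrightarrow> l - (\<Sum>j\<le>m. (-1 * of_real \<alpha>) ^ Suc j / fact (Suc j) * y (m - j))) G"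
      unfolding cB_solve by (intro tendsto_diff l tendsto_sum tendsto_mult p y) auto
    then show ?thesis unfolding Suc by blast
  qed
qed

end

section \<open>The equation $g' = zJH(g - F)$ near the limit point endpoint\<close>

context hs_side begin

text \<open>One round of the iteration used next: the bound has the shape of the hypothesis, a
  combination of sqrt (1 + M) and 1 + M, multiplied by an integral of \<open>Mh\<close> that is
  small for t0 close to b. Fubini splits the double integral at t. On [t0, t] monotonicity of M is
  enough; on [t, b] the surplus factor M t is used to move the root from s to t.\<close>

lemma weighted_triangle:
  assumes \<psi>: "\<psi> absolutely_integrable_on {a..b}" "\<And>s. 0 \<le> \<psi> s" "\<psi> b = 0"
    and t: "a \<le> t0" "t0 \<le> t" "t < b" and nn: "0 \<le> \<alpha>" "0 \<le> \<beta>"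
    and le: "\<And>s. s \<in> {t0..<b} \<Longrightarrow> \<psi> s \<le> h1 s * (\<alpha> * sqrt (1 + M s) + \<beta> * (1 + M s))"
  shows "(\<lambda>s. h2 s * integral {s..b} \<psi>) integrable_on {t0..t}"
    and "integral {t0..t} (\<lambda>s. h2 s * integral {s..b} \<psi>) \<le> integral {t0..b} Mh * (\<alpha> * sqrt (1 + M t) + \<beta> * (1 + M t))"
proof -
  define W where "W = \<alpha> * sqrt (1 + M t) + \<beta> * (1 + M t)"
  have Mt: "0 \<le> M t" using M_nonneg[of t] t by simp
  have W: "0 \<le> W" unfolding W_def using nn Mt by (intro add_nonneg_nonneg mult_nonneg_nonneg) auto
  note \<psi>s = absolutely_integrable_subinterval[OF \<psi>(1)]
  note \<psi>i = absolutely_integrable_imp_integrable[OF \<psi>s]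
  have a1: "\<psi> absolutely_integrable_on {t0..t}" by (rule \<psi>s) (use t in auto)
  note tri = integral_triangle[OF t(2) hval_integrable[OF t(1,3), of 2 2] a1]
  have e: "h2 s * integral {s..b} \<psi> = h2 s * integral {s..t} \<psi> + integral {t..b} \<psi> * h2 s" if "s \<in> {t0..t}" for s
  proof -
    have "integral {s..t} \<psi> + integral {t..b} \<psi> = integral {s..b} \<psi>"
      by (rule Henstock_Kurzweil_Integration.integral_combine[OF _ _ \<psi>i]) (use that t in auto)
    then show ?thesis by (simp add: algebra_simps flip: \<open>integral {s..t} \<psi> + integral {t..b} \<psi> = integral {s..b} \<psi>\<close>)
  qed
  have i1: "((\<lambda>s. h2 s * integral {s..t} \<psi>) has_integral integral {t0..t} (\<lambda>s. integral {t0..s} h2 * \<psi> s)) {t0..t}"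
    using integrable_integral[OF absolutely_integrable_imp_integrable[OF tri(2)]] unfolding tri(4) .
  have i2: "((\<lambda>s. integral {t..b} \<psi> * h2 s) has_integral integral {t..b} \<psi> * integral {t0..t} h2) {t0..t}"
    by (rule has_integral_mult_right, rule integrable_integral, rule hval_on) (use t in auto)
  have hi: "((\<lambda>s. h2 s * integral {s..b} \<psi>) has_integral (integral {t0..t} (\<lambda>s. integral {t0..s} h2 * \<psi> s) + integral {t..b} \<psi> * integral {t0..t} h2)) {t0..t}"
    by (rule has_integral_eq[OF _ has_integral_add[OF i1 i2]]) (simp add: e)
  then show "(\<lambda>s. h2 s * integral {s..b} \<psi>) integrable_on {t0..t}" by blast
  have b1: "integral {t0..t} (\<lambda>s. integral {t0..s} h2 * \<psi> s) \<le> integral {t0..t} (\<lambda>s. W * Mh s)"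
  proof (rule integral_le)
    show "(\<lambda>s. integral {t0..s} h2 * \<psi> s) integrable_on {t0..t}" by (rule absolutely_integrable_imp_integrable[OF tri(3)])
    show "(\<lambda>s. W * Mh s) integrable_on {t0..t}" by (rule integrable_on_mult_right, rule Mh_on) (use t in auto)
    fix s assume s: "s \<in> {t0..t}"
    have Ms: "0 \<le> M s" "M s \<le> M t" using M_nonneg[of s] M_mono[of s t] s t by auto
    have "integral {t0..s} h2 \<le> M s" using M_diff[of t0 s] M_nonneg[of t0] s t by auto
    moreover have "0 \<le> integral {t0..s} h2" using M_diff[of t0 s] M_mono[of t0 s] s t by auto
    ultimately have "integral {t0..s} h2 * \<psi> s \<le> (1 + M s) * (h1 s * (\<alpha> * sqrt (1 + M s) + \<beta> * (1 + M s)))"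
      using le[of s] \<psi>(2)[of s] s t Ms by (intro mult_mono) auto
    also have "\<dots> = Mh s * (\<alpha> * sqrt (1 + M s) + \<beta> * (1 + M s))" by (simp add: Mh_def)
    also have "\<dots> \<le> Mh s * W" unfolding W_def
      using Ms nn by (intro mult_left_mono[OF _ Mh_nonneg] add_mono mult_left_mono) auto
    finally show "integral {t0..s} h2 * \<psi> s \<le> W * Mh s" by (simp add: mult.commute)
  qed
  have b2: "integral {t..b} \<psi> * integral {t0..t} h2 \<le> integral {t..b} (\<lambda>s. W * Mh s)"
  proof -
    have "integral {t0..t} h2 \<le> M t" using M_diff[of t0 t] M_nonneg[of t0] t by auto
    then have "integral {t..b} \<psi> * integral {t0..t} h2 \<le> integral {t..b} \<psi> * M t"
      by (intro mult_left_mono integral_nonneg \<psi>i) (use t \<psi>(2) in auto)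
    also have "\<dots> = integral {t..b} (\<lambda>s. M t * \<psi> s)" by (simp add: mult.commute)
    also have "\<dots> \<le> integral {t..b} (\<lambda>s. W * Mh s)"
    proof (rule integral_le)
      show "(\<lambda>s. M t * \<psi> s) integrable_on {t..b}" by (rule integrable_on_mult_right, rule \<psi>i) (use t in auto)
      show "(\<lambda>s. W * Mh s) integrable_on {t..b}" by (rule integrable_on_mult_right, rule Mh_on) (use t in auto)
      fix s assume s: "s \<in> {t..b}"
      show "M t * \<psi> s \<le> W * Mh s"
      proof (cases "s = b")
        case True then show ?thesis using \<psi>(3) by (simp add: Mh_def)
      next
        case False
        then have Ms: "M t \<le> M s" using M_mono[of t s] s t by auto
        have k: "M t * sqrt (1 + M s) \<le> (1 + M s) * sqrt (1 + M t)"
        proof -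
          have "M t * sqrt (1 + M s) \<le> (1 + M t) * sqrt (1 + M s)" using Ms Mt by (intro mult_right_mono) auto
          also have "\<dots> = sqrt (1 + M t) * (sqrt (1 + M t) * sqrt (1 + M s))" using Mt by (simp add: mult.assoc[symmetric])
          also have "\<dots> \<le> sqrt (1 + M t) * (sqrt (1 + M s) * sqrt (1 + M s))" using Ms Mt by (intro mult_left_mono mult_right_mono) auto
          also have "\<dots> = (1 + M s) * sqrt (1 + M t)" using Ms Mt by (simp add: mult.commute)
          finally show ?thesis .
        qed
        have "M t * (\<alpha> * sqrt (1 + M s) + \<beta> * (1 + M s)) = \<alpha> * (M t * sqrt (1 + M s)) + \<beta> * (M t * (1 + M s))" by (simp add: algebra_simps)
        also have "\<dots> \<le> \<alpha> * ((1 + M s) * sqrt (1 + M t)) + \<beta> * ((1 + M t) * (1 + M s))"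
          using nn k Ms Mt by (intro add_mono mult_left_mono mult_right_mono) auto
        also have "\<dots> = (1 + M s) * W" unfolding W_def by (simp add: algebra_simps)
        finally have m: "M t * (\<alpha> * sqrt (1 + M s) + \<beta> * (1 + M s)) \<le> (1 + M s) * W" .
        have "M t * \<psi> s \<le> M t * (h1 s * (\<alpha> * sqrt (1 + M s) + \<beta> * (1 + M s)))"
          using le[of s] s t False Mt by (intro mult_left_mono) auto
        also have "\<dots> = h1 s * (M t * (\<alpha> * sqrt (1 + M s) + \<beta> * (1 + M s)))" by (simp add: mult.left_commute)
        also have "\<dots> \<le> h1 s * ((1 + M s) * W)" using m by (rule mult_left_mono[OF _ h_psd(1)])
        finally show ?thesis unfolding Mh_def by (simp add: mult_ac)
      qed
    qed
    finally show ?thesis .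
  qed
  have "integral {t0..t} (\<lambda>s. W * Mh s) + integral {t..b} (\<lambda>s. W * Mh s) = integral {t0..b} (\<lambda>s. W * Mh s)"
    by (rule Henstock_Kurzweil_Integration.integral_combine) (use t in \<open>auto intro: integrable_on_mult_right Mh_on\<close>)
  also have "\<dots> = integral {t0..b} Mh * W" by simp
  finally show "integral {t0..t} (\<lambda>s. h2 s * integral {s..b} \<psi>) \<le> integral {t0..b} Mh * (\<alpha> * sqrt (1 + M t) + \<beta> * (1 + M t))"
    using integral_unique[OF hi] b1 b2 unfolding W_def by linarith
qed

lemma Mh_tail_small:
  assumes "0 < e" obtains t0 where "a < t0" "t0 < b" "integral {t0..b} Mh \<le> e"
proof -
  have "continuous_on {a..b} (\<lambda>t. integral {t..b} Mh)" by (rule indefinite_integral_continuous_1'[OF Mh_on]) auto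
  then have "((\<lambda>t. integral {t..b} Mh) \<longlongrightarrow> integral {b..b} Mh) (at b within {a..b})"
    unfolding continuous_on_def by (rule bspec) (use ab in simp)
  then have "((\<lambda>t. integral {t..b} Mh) \<longlongrightarrow> 0) (at_left b)" using ab by (simp add: at_within_Icc_at_left)
  then have "\<forall>\<^sub>F t in at_left b. integral {t..b} Mh < e" using assms by (rule order_tendstoD)
  with eventually_at_left_real[OF ab] have "\<forall>\<^sub>F t in at_left b. t \<in> {a<..<b} \<and> integral {t..b} Mh < e" by (rule eventually_conj)
  then obtain t where "t \<in> {a<..<b}" "integral {t..b} Mh < e"
    using eventually_happens' trivial_limit_at_left_real by blast
  then show ?thesis using that[of t] by auto
qed

lemma h1_norm_integrable:
  fixes F :: "real \<Rightarrow> complex"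
  assumes F: "nice F" "\<And>t. t \<in> iv \<Longrightarrow> norm (F t) \<le> C * (1 + M t)"
  shows "(\<lambda>t. h1 t * norm (F t)) absolutely_integrable_on {a..b}"
proof (rule measurable_bounded_by_integrable_imp_absolutely_integrable[where g="\<lambda>t. C * Mh t"])
  have "F \<in> borel_measurable (lebesgue_on {a<..<b})"
    by (rule continuous_imp_measurable_on_sets_lebesgue, rule continuous_on_subset[OF F(1)]) auto
  note [measurable] = this
  have "(\<lambda>t. h1 t * norm (F t)) \<in> borel_measurable lebesgue"
    by (rule restrict_measurable) (measurable, simp add: hval_outside)
  then show "(\<lambda>t. h1 t * norm (F t)) \<in> borel_measurable (lebesgue_on {a..b})" by (rule measurable_restrict_space1)
  show "(\<lambda>t. C * Mh t) integrable_on {a..b}" by (rule integrable_on_mult_right[OF Mh_on]) auto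
  fix t assume t: "t \<in> {a..b}"
  show "norm (h1 t * norm (F t)) \<le> C * Mh t"
  proof (cases "t = b")
    case False
    then have "h1 t * norm (F t) \<le> h1 t * (C * (1 + M t))" using F(2)[of t] h_psd(1) t by (intro mult_left_mono) auto
    then show ?thesis unfolding Mh_def using h_psd(1)[of t] by (simp add: mult_ac)
  qed (simp add: Mh_def)
qed simp

text \<open>The core of the argument: after conjugation with $e^{\pm z a}$ the equation
  $g' = zJH(g - F)$ becomes diagonal, and near $b$ the resulting Volterra operator
  halves the coefficient of $1 + M$ in a bound for $g_1$, so that only $\sqrt{1 + M}$ survives.\<close>
lemma L2_if_resolvent_L2:
  fixes f g :: fn and \<kappa> :: complex
  assumes r: "1 \<le> r" "\<And>t. t \<in> iv \<Longrightarrow> \<bar>av t\<bar> \<le> r"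
    and G: "G \<le> at_left b" "G \<noteq> bot"
    and g1: "indef_int iv (\<lambda>t. g t $ 1) (\<lambda>t. - d2 f t)" and g2: "indef_int iv (\<lambda>t. g t $ 2) (d1 f)"
    and ng: "nice g"
    and D: "0 \<le> D" "\<And>t. t \<in> iv \<Longrightarrow> norm (g t $ 1) \<le> D * (1 + M t)"
    and lim: "((\<lambda>t. g t $ 2) \<longlongrightarrow> 0) G"
    and \<kappa>: "\<kappa> \<noteq> 0" and L: "L2 (\<lambda>t. g t - \<kappa> *s f t)"
  shows "L2 f"
proof -
  \<comment> \<open>With z = 1/\<kappa> and F the given L^2 function, f = z (g - F), and g' = JHf
    takes the form of the equation to be solved.\<close>
  define z where "z = 1 / \<kappa>"
  define F where "F t = g t - \<kappa> *s f t" for t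
  have LF: "L2 F" using L unfolding F_def .
  have fz: "f t = z *s (g t - F t)" for t using \<kappa> unfolding F_def z_def by (simp add: vec2_eq_iff)
  have df: "d1 f t = z * (of_real (h1 t) * g t $ 1 + of_real (h3 t) * g t $ 2 - d1 F t)"
    "d2 f t = z * (of_real (h3 t) * g t $ 1 + of_real (h2 t) * g t $ 2 - d2 F t)" for t
    unfolding d1_def d2_def fz[of t] by (simp_all add: algebra_simps)
  define E where "E s t = exp (s * of_real (av t))" for s :: complex and t
  have Ei: "indef_int iv (E s) (\<lambda>t. E s t * (s * of_real (h3 t)))" for s
    unfolding E_def by (intro indef_int_exp indef_int_cmult av_indef iv_interval)
  define B where "B = exp (norm z * r)"
  have B: "1 \<le> B" unfolding B_def using r(1) by simp
  have EB: "norm (E s t) \<le> B" if "norm s = norm z" "t \<in> iv" for s t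
  proof -
    have "norm (E s t) \<le> exp (norm (s * of_real (av t)))" unfolding E_def by (rule norm_exp)
    also have "\<dots> \<le> B" unfolding B_def using that r(2)[OF that(2)] by (auto simp: norm_mult intro!: mult_left_mono)
    finally show ?thesis .
  qed
  have Einv: "E (- s) t * E s t = 1" for s t unfolding E_def by (simp add: exp_minus)
  \<comment> \<open>The exponential factors cancel the h_3 terms of the equation. They and their
    inverses are bounded by B because \<open>av\<close> is bounded.\<close>
  define u where "u t = E (- z) t * g t $ 2" for t
  define v where "v t = E z t * g t $ 1" for t
  have ui: "indef_int iv u (\<lambda>t. E (- z) t * z * (of_real (h1 t) * g t $ 1 - d1 F t))"
    unfolding u_def by (rule indef_int_cong[OF indef_int_mult[OF Ei g2 iv_interval], where N="{}"]) (auto simp: df algebra_simps)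
  have vi: "indef_int iv v (\<lambda>t. - E z t * z * (of_real (h2 t) * g t $ 2 - d2 F t))"
    unfolding v_def by (rule indef_int_cong[OF indef_int_mult[OF Ei g1 iv_interval], where N="{}"]) (auto simp: df algebra_simps)
  have gu: "norm (g t $ 2) \<le> B * norm (u t)" if "t \<in> iv" for t
  proof -
    have "g t $ 2 = E z t * u t" unfolding u_def using Einv[of z t] by (simp add: mult.assoc[symmetric] mult.commute)
    then show ?thesis using EB[of z t, OF refl that] by (simp add: norm_mult mult_right_mono)
  qed
  have gv: "norm (g t $ 1) \<le> B * norm (v t)" if "t \<in> iv" for t
  proof -
    have "g t $ 1 = E (- z) t * v t" unfolding v_def using Einv[of z t] by (simp add: mult.assoc[symmetric])
    then show ?thesis using EB[of "- z" t, OF _ that] by (simp add: norm_mult mult_right_mono)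
  qed
  define B2 where "B2 = B * norm z"
  have B2: "0 \<le> B2" unfolding B2_def using B by simp
  define \<psi> where "\<psi> t = h1 t * norm (g t $ 1)" for t
  have ng1: "nice (\<lambda>t. g t $ 1)" "nice (\<lambda>t. g t $ 2)" using ng unfolding continuous_on_vec2_iff by auto
  have \<psi>: "\<psi> absolutely_integrable_on {a..b}" unfolding \<psi>_def[abs_def] by (rule h1_norm_integrable[OF ng1(1) D(2)])
  have \<psi>0: "0 \<le> \<psi> s" "\<psi> b = 0" for s unfolding \<psi>_def using h_psd(1) by auto
  note \<psi>i = absolutely_integrable_imp_integrable[OF absolutely_integrable_subinterval[OF \<psi>]]
  have nd1: "(\<lambda>s. norm (d1 F s)) integrable_on {x..y}" if "a \<le> x" "y \<le> b" for x y
    using d1_integrable[OF LF that] unfolding absolutely_integrable_on_def by blast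
  have nd2: "(\<lambda>s. norm (d2 F s)) integrable_on {x..y}" if "a \<le> x" "y < b" for x y
    using d2_integrable[OF LF that] unfolding absolutely_integrable_on_def by blast
  have QF: "0 \<le> Q F" by (rule Q_nonneg[OF LF])
  have u_bd: "norm (u t) \<le> B2 * (integral {t..b} \<psi> + sqrt (N1 t * Q F))" if t: "t \<in> iv" for t
  proof -
    have st: "norm (u t - u t') \<le> B2 * (integral {t..b} \<psi> + sqrt (N1 t * Q F))" if t': "t < t'" "t' < b" for t'
    proof -
      have tt: "t' \<in> iv" "t \<le> t'" using t t' by auto
      have ui': "((\<lambda>t. E (- z) t * z * (of_real (h1 t) * g t $ 1 - d1 F t)) has_integral (u t' - u t)) {t..t'}"
        by (rule indef_intD(2)[OF ui t tt])
      have "norm (integral {t..t'} (\<lambda>t. E (- z) t * z * (of_real (h1 t) * g t $ 1 - d1 F t))) \<le> integral {t..t'} (\<lambda>s. B2 * (\<psi> s + norm (d1 F s)))"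
      proof (rule integral_norm_bound_integral)
        show "(\<lambda>t. E (- z) t * z * (of_real (h1 t) * g t $ 1 - d1 F t)) integrable_on {t..t'}" using ui' by blast
        show "(\<lambda>s. B2 * (\<psi> s + norm (d1 F s))) integrable_on {t..t'}"
          by (intro integrable_on_mult_right integrable_add \<psi>i nd1) (use t t' in auto)
        fix s assume s: "s \<in> {t..t'}"
        have "norm (of_real (h1 s) * g s $ 1 - d1 F s) \<le> \<psi> s + norm (d1 F s)"
          using norm_triangle_ineq4[of "of_real (h1 s) * g s $ 1" "d1 F s"] h_psd(1)[of s] unfolding \<psi>_def by (simp add: norm_mult)
        moreover have "norm (E (- z) s * z) \<le> B2" unfolding B2_def norm_mult using EB[of "- z" s] s t t' by (intro mult_right_mono) auto
        ultimately show "norm (E (- z) s * z * (of_real (h1 s) * g s $ 1 - d1 F s)) \<le> B2 * (\<psi> s + norm (d1 F s))"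
          unfolding norm_mult[of "E (- z) s * z"] using B2 by (intro mult_mono) auto
      qed
      also have "\<dots> = B2 * (integral {t..t'} \<psi> + integral {t..t'} (\<lambda>s. norm (d1 F s)))"
        using \<psi>i[of t t'] nd1[of t t'] t t' by (simp add: integral_add)
      also have "\<dots> \<le> B2 * (integral {t..b} \<psi> + integral {t..b} (\<lambda>s. norm (d1 F s)))"
        using t t' \<psi>0(1) by (intro mult_left_mono add_mono integral_subset_le \<psi>i nd1 B2) auto
      also have "\<dots> \<le> B2 * (integral {t..b} \<psi> + sqrt (N1 t * Q F))"
        using d1_bound[OF LF, of t] t B2 by (intro mult_left_mono add_left_mono) auto
      finally show ?thesis using integral_unique[OF ui'] by (simp add: norm_minus_commute)
    qed
    \<comment> \<open>Only along G is the second component of g known to tend to 0. Letting t' run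
      along G turns the estimate of the increment \<open>u t - u t'\<close> into one of
      \<open>u t\<close>.\<close>
    have ev: "\<forall>\<^sub>F t' in G. t < t' \<and> t' < b"
      using eventually_at_left_real[of t b] t G(1) by (auto simp: le_filter_def)
    have "(u \<longlongrightarrow> 0) G"
    proof (rule Lim_null_comparison)
      show "\<forall>\<^sub>F t' in G. norm (u t') \<le> B * norm (g t' $ 2)"
        using ev
      proof eventually_elim
        case (elim t')
        then have "t' \<in> iv" using t by auto
        then show ?case unfolding u_def norm_mult using EB[of "- z" t'] by (intro mult_right_mono) auto
      qed
      show "((\<lambda>t'. B * norm (g t' $ 2)) \<longlongrightarrow> 0) G"
        using tendsto_mult_right_zero[OF tendsto_norm_zero[OF lim]] .
    qed
    then have "((\<lambda>t'. norm (u t - u t')) \<longlongrightarrow> norm (u t - 0)) G" by (intro tendsto_intros)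
    then have "((\<lambda>t'. norm (u t - u t')) \<longlongrightarrow> norm (u t)) G" by simp
    moreover have "\<forall>\<^sub>F t' in G. norm (u t - u t') \<le> B2 * (integral {t..b} \<psi> + sqrt (N1 t * Q F))"
      using ev by eventually_elim (rule st; simp)
    ultimately show ?thesis by (rule tendsto_upperbound[OF _ _ G(2)])
  qed
  define B3 where "B3 = B * B2"
  have B3: "0 \<le> B3" unfolding B3_def using B B2 by simp
  have g2_bd: "norm (g t $ 2) \<le> B3 * (integral {t..b} \<psi> + sqrt (N1 t * Q F))" if t: "t \<in> iv" for t
  proof -
    have "B * norm (u t) \<le> B * (B2 * (integral {t..b} \<psi> + sqrt (N1 t * Q F)))" using u_bd[OF t] B by (intro mult_left_mono) auto
    then show ?thesis using gu[OF t] unfolding B3_def by (simp add: mult.assoc)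
  qed
  define c3 where "c3 = B3 * B3"
  have c3: "0 \<le> c3" unfolding c3_def by simp
  \<comment> \<open>Going from the first component to the second and back costs the factor c3 times
    this tail of the integral of \<open>Mh\<close>; t0 is taken so close to b that the product is at
    most 1/2.\<close>
  obtain t0 where t0: "a < t0" "t0 < b" "integral {t0..b} Mh \<le> 1 / (2 * (c3 + 1))"
    using Mh_tail_small[of "1 / (2 * (c3 + 1))"] c3 by auto
  have small: "c3 * integral {t0..b} Mh \<le> 1 / 2"
  proof -
    have "c3 * integral {t0..b} Mh \<le> c3 * (1 / (2 * (c3 + 1)))" using t0(3) c3 by (rule mult_left_mono)
    also have "\<dots> \<le> 1 / 2" using c3 by (simp add: divide_simps)
    finally show ?thesis .
  qed
  define K where "K = integral {a..b} (\<lambda>s. h2 s * N1 s)"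
  have hN: "(\<lambda>s. h2 s * N1 s) absolutely_integrable_on {x..y}" if "a \<le> x" "y \<le> b" for x y
    by (rule absolutely_integrable_subinterval[OF h2_N1_integrable that])
  have hNn: "0 \<le> h2 s * N1 s" for s
    using h_psd(2)[of s] N1_nonneg[of s] hval_outside[of s 2 2] by (cases "s \<in> {a<..<b}") auto
  \<comment> \<open>The coefficients of sqrt (1 + M) that do not involve g near b: the initial value
    at t0, the direct contribution of F, and its contribution by way of the second
    component.\<close>
  define c0 where "c0 = B * norm (v t0) + B3 * sqrt (Q F) + c3 * sqrt (K * Q F)"
  have c0: "0 \<le> c0"
  proof -
    have "0 \<le> K" unfolding K_def by (intro integral_nonneg absolutely_integrable_imp_integrable[OF hN]) (auto simp: hNn)
    then show ?thesis unfolding c0_def using B B3 c3 QF by (intro add_nonneg_nonneg mult_nonneg_nonneg) auto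
  qed
  have step: "norm (g t $ 1) \<le> (c0 + \<alpha> / 2) * sqrt (1 + M t) + \<beta> / 2 * (1 + M t)"
    if nn: "0 \<le> \<alpha>" "0 \<le> \<beta>" and hyp: "\<And>s. s \<in> {t0..<b} \<Longrightarrow> norm (g s $ 1) \<le> \<alpha> * sqrt (1 + M s) + \<beta> * (1 + M s)"
      and t: "t \<in> {t0..<b}" for \<alpha> \<beta> t
  proof -
    have tt: "t \<in> iv" "t0 \<in> iv" "t0 \<le> t" "a \<le> t0" "t < b" using t t0 by auto
    have Mt: "0 \<le> M t" using M_nonneg[of t] tt by simp
    define R where "R = sqrt (1 + M t)"
    have R: "1 \<le> R" "sqrt (M t) \<le> R" "R * R = 1 + M t" using Mt unfolding R_def by auto
    have psle: "\<psi> s \<le> h1 s * (\<alpha> * sqrt (1 + M s) + \<beta> * (1 + M s))" if "s \<in> {t0..<b}" for s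
      unfolding \<psi>_def by (rule mult_left_mono[OF hyp[OF that] h_psd(1)])
    note wt = weighted_triangle[OF \<psi> \<psi>0 tt(4,3,5) nn psle]
    define w where "w s = complex_of_real (h2 s * sqrt (N1 s * Q F))" for s
    have wm: "w \<in> borel_measurable (lebesgue_on {t0..t})"
    proof -
      have "continuous_on {t0..t} (\<lambda>s. sqrt (N1 s * Q F))"
        by (intro continuous_intros continuous_on_subset[OF N1_continuous]) (use tt in auto)
      then have "(\<lambda>s. sqrt (N1 s * Q F)) \<in> borel_measurable (lebesgue_on {t0..t})" by (rule continuous_imp_measurable_on_sets_lebesgue) simp
      then show ?thesis unfolding w_def by measurable
    qed
    have wn: "norm (w s) = h2 s * sqrt (N1 s * Q F)" if "s \<in> {t0..t}" for s
      unfolding w_def norm_of_real using h_psd(2)[of s] N1_nonneg[of s] QF that tt by simp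
    have CS: "w absolutely_integrable_on {t0..t}" "integral {t0..t} (\<lambda>s. norm (w s)) \<le> sqrt (integral {t0..t} h2 * integral {t0..t} (\<lambda>s. (h2 s * N1 s) * Q F))"
    proof -
      have A: "{t0..t} \<in> sets lebesgue" by simp
      have C: "(\<lambda>s. (h2 s * N1 s) * Q F) absolutely_integrable_on {t0..t}"
        by (rule set_integrable_mult_left, rule hN) (use tt in auto)
      have le: "(norm (w s))\<^sup>2 \<le> h2 s * ((h2 s * N1 s) * Q F)" if "s \<in> {t0..t}" for s
      proof -
        have "0 \<le> N1 s * Q F" using N1_nonneg[of s] QF that tt by auto
        then have "(h2 s * sqrt (N1 s * Q F))\<^sup>2 = h2 s * ((h2 s * N1 s) * Q F)"
          by (simp only: power_mult_distrib real_sqrt_pow2) (simp add: power2_eq_square)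
        then show ?thesis unfolding wn[OF that] by simp
      qed
      note cs = integral_norm_Cauchy_Schwarz[OF A hval_integrable[OF tt(4,5), of 2 2] C wm h_psd(2) mult_nonneg_nonneg[OF hNn QF] le]
      show "w absolutely_integrable_on {t0..t}" by (rule cs(1))
      show "integral {t0..t} (\<lambda>s. norm (w s)) \<le> sqrt (integral {t0..t} h2 * integral {t0..t} (\<lambda>s. (h2 s * N1 s) * Q F))" by (rule cs(2))
    qed
    have "sqrt (integral {t0..t} h2 * integral {t0..t} (\<lambda>s. (h2 s * N1 s) * Q F)) \<le> sqrt (M t * (K * Q F))"
    proof -
      have x1: "integral {t0..t} h2 \<le> M t" using M_diff[of t0 t] M_nonneg[of t0] tt by auto
      have x2: "integral {t0..t} (\<lambda>s. (h2 s * N1 s) * Q F) = integral {t0..t} (\<lambda>s. h2 s * N1 s) * Q F" by simp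
      have x3: "integral {t0..t} (\<lambda>s. h2 s * N1 s) \<le> K" unfolding K_def
        by (rule integral_subset_le) (use tt hNn in \<open>auto intro!: absolutely_integrable_imp_integrable[OF hN]\<close>)
      have x4: "0 \<le> integral {t0..t} (\<lambda>s. h2 s * N1 s)"
        by (intro integral_nonneg absolutely_integrable_imp_integrable[OF hN]) (use tt hNn in auto)
      have "integral {t0..t} h2 * (integral {t0..t} (\<lambda>s. h2 s * N1 s) * Q F) \<le> M t * (K * Q F)"
        using x1 x3 x4 QF Mt by (intro mult_mono mult_right_mono mult_nonneg_nonneg) auto
      then show ?thesis unfolding x2 by simp
    qed
    also have "\<dots> = sqrt (M t) * sqrt (K * Q F)" by (simp add: real_sqrt_mult)
    also have "\<dots> \<le> R * sqrt (K * Q F)"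
    proof -
      have "0 \<le> K" unfolding K_def by (intro integral_nonneg absolutely_integrable_imp_integrable[OF hN]) (auto simp: hNn)
      then show ?thesis using R QF by (intro mult_right_mono) auto
    qed
    finally have W: "integral {t0..t} (\<lambda>s. norm (w s)) \<le> R * sqrt (K * Q F)" using CS(2) by linarith
    have wi: "(\<lambda>s. norm (w s)) integrable_on {t0..t}" using CS(1) unfolding absolutely_integrable_on_def by blast
    have vi': "((\<lambda>t. - E z t * z * (of_real (h2 t) * g t $ 2 - d2 F t)) has_integral (v t - v t0)) {t0..t}"
      by (rule indef_intD(2)[OF vi tt(2,1,3)])
    define \<Phi> where "\<Phi> s = B2 * (B3 * (h2 s * integral {s..b} \<psi> + norm (w s)) + norm (d2 F s))" for s
    have "norm (integral {t0..t} (\<lambda>t. - E z t * z * (of_real (h2 t) * g t $ 2 - d2 F t))) \<le> integral {t0..t} \<Phi>"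
    proof (rule integral_norm_bound_integral)
      show "(\<lambda>t. - E z t * z * (of_real (h2 t) * g t $ 2 - d2 F t)) integrable_on {t0..t}" using vi' by blast
      show "\<Phi> integrable_on {t0..t}" unfolding \<Phi>_def
        by (intro integrable_on_mult_right integrable_add wt(1) wi nd2) (use tt in auto)
      fix s assume s: "s \<in> {t0..t}"
      have si: "s \<in> iv" using s tt by auto
      have "norm (of_real (h2 s) * g s $ 2 - d2 F s) \<le> h2 s * norm (g s $ 2) + norm (d2 F s)"
        using norm_triangle_ineq4[of "of_real (h2 s) * g s $ 2" "d2 F s"] h_psd(2)[of s] by (simp add: norm_mult)
      also have "h2 s * norm (g s $ 2) \<le> h2 s * (B3 * (integral {s..b} \<psi> + sqrt (N1 s * Q F)))"
        by (rule mult_left_mono[OF g2_bd[OF si] h_psd(2)])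
      also have "\<dots> = B3 * (h2 s * integral {s..b} \<psi> + norm (w s))" unfolding wn[OF s] by (simp add: algebra_simps)
      finally have x: "norm (of_real (h2 s) * g s $ 2 - d2 F s) \<le> B3 * (h2 s * integral {s..b} \<psi> + norm (w s)) + norm (d2 F s)" by simp
      have y: "norm (- E z s * z) \<le> B2" unfolding B2_def norm_mult using EB[of z s, OF refl si] by (simp add: mult_right_mono)
      show "norm (- E z s * z * (of_real (h2 s) * g s $ 2 - d2 F s)) \<le> \<Phi> s"
        unfolding norm_mult[of "- E z s * z"] \<Phi>_def by (rule mult_mono[OF y x B2]) simp
    qed
    also have "integral {t0..t} \<Phi> = B2 * (B3 * (integral {t0..t} (\<lambda>s. h2 s * integral {s..b} \<psi>) + integral {t0..t} (\<lambda>s. norm (w s))) + integral {t0..t} (\<lambda>s. norm (d2 F s)))"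
      unfolding \<Phi>_def using wt(1) wi nd2[OF tt(4,5)]
      by (simp add: integral_add integrable_add integrable_on_mult_right)
    also have "\<dots> \<le> B2 * (B3 * (integral {t0..b} Mh * (\<alpha> * R + \<beta> * (1 + M t)) + R * sqrt (K * Q F)) + R * sqrt (Q F))"
    proof -
      have "integral {t0..t} (\<lambda>s. norm (d2 F s)) \<le> sqrt (M t) * sqrt (Q F)"
        using d2_bound[OF LF tt(4,3,5)] by (simp add: real_sqrt_mult)
      also have "\<dots> \<le> R * sqrt (Q F)" using R QF by (intro mult_right_mono) auto
      finally have "integral {t0..t} (\<lambda>s. norm (d2 F s)) \<le> R * sqrt (Q F)" .
      then show ?thesis using wt(2) W B2 B3 unfolding R_def[symmetric] by (intro mult_left_mono add_mono) auto
    qed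
    finally have "norm (v t - v t0) \<le> B2 * (B3 * (integral {t0..b} Mh * (\<alpha> * R + \<beta> * (1 + M t)) + R * sqrt (K * Q F)) + R * sqrt (Q F))"
      unfolding integral_unique[OF vi'] .
    then have "norm (v t) \<le> norm (v t0) + B2 * (B3 * (integral {t0..b} Mh * (\<alpha> * R + \<beta> * (1 + M t)) + R * sqrt (K * Q F)) + R * sqrt (Q F))"
      using norm_triangle_ineq2[of "v t" "v t0"] by linarith
    then have "B * norm (v t) \<le> B * (norm (v t0) + B2 * (B3 * (integral {t0..b} Mh * (\<alpha> * R + \<beta> * (1 + M t)) + R * sqrt (K * Q F)) + R * sqrt (Q F)))"
      using B by (intro mult_left_mono) auto
    also have "\<dots> = B * norm (v t0) + (c3 * integral {t0..b} Mh) * (\<alpha> * R + \<beta> * (1 + M t)) + (c3 * sqrt (K * Q F) + B3 * sqrt (Q F)) * R"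
      unfolding c3_def B3_def by (simp add: algebra_simps)
    also have "\<dots> \<le> B * norm (v t0) * R + 1 / 2 * (\<alpha> * R + \<beta> * (1 + M t)) + (c3 * sqrt (K * Q F) + B3 * sqrt (Q F)) * R"
    proof -
      have x: "B * norm (v t0) \<le> B * norm (v t0) * R"
        using mult_left_mono[OF R(1), of "B * norm (v t0)"] B by simp
      have y: "(c3 * integral {t0..b} Mh) * (\<alpha> * R + \<beta> * (1 + M t)) \<le> 1 / 2 * (\<alpha> * R + \<beta> * (1 + M t))"
        using small nn R(1) Mt by (intro mult_right_mono) auto
      show ?thesis by (rule add_right_mono[OF add_mono[OF x y]])
    qed
    also have "\<dots> = (c0 + \<alpha> / 2) * R + \<beta> / 2 * (1 + M t)" unfolding c0_def by (simp add: algebra_simps)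
    finally show ?thesis using gv[OF tt(1)] unfolding R_def by linarith
  qed
  \<comment> \<open>\<alpha> = 2 c0 is the fixed point of \<alpha> -> c0 + \<alpha>/2, while the
    coefficient of 1 + M starts from the a priori bound D and is halved in every round.\<close>
  have iter: "\<forall>t\<in>{t0..<b}. norm (g t $ 1) \<le> (2 * c0) * sqrt (1 + M t) + D / 2 ^ n * (1 + M t)" for n
  proof (induction n)
    case 0
    show ?case
    proof
      fix t assume t: "t \<in> {t0..<b}"
      then have "norm (g t $ 1) \<le> D * (1 + M t)" using D(2)[of t] t0 by auto
      moreover have "0 \<le> (2 * c0) * sqrt (1 + M t)" using c0 M_nonneg[of t] t t0 by auto
      ultimately show "norm (g t $ 1) \<le> (2 * c0) * sqrt (1 + M t) + D / 2 ^ 0 * (1 + M t)" by simp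
    qed
  next
    case (Suc n)
    show ?case
    proof
      fix t assume t: "t \<in> {t0..<b}"
      have "norm (g t $ 1) \<le> (c0 + (2 * c0) / 2) * sqrt (1 + M t) + D / 2 ^ n / 2 * (1 + M t)"
        by (rule step) (use Suc c0 D(1) t in auto)
      then show "norm (g t $ 1) \<le> (2 * c0) * sqrt (1 + M t) + D / 2 ^ Suc n * (1 + M t)" by (simp add: mult.commute)
    qed
  qed
  have tail: "norm (g t $ 1) \<le> (2 * c0) * sqrt (1 + M t)" if t: "t \<in> {t0..<b}" for t
  proof -
    have "(\<lambda>n. (2 * c0) * sqrt (1 + M t) + D * (1 + M t) * (1 / 2) ^ n) \<longlonglongrightarrow> (2 * c0) * sqrt (1 + M t) + D * (1 + M t) * 0"
      by (intro tendsto_intros LIMSEQ_power_zero) auto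
    then have l: "(\<lambda>n. (2 * c0) * sqrt (1 + M t) + D / 2 ^ n * (1 + M t)) \<longlonglongrightarrow> (2 * c0) * sqrt (1 + M t)"
      by (simp add: power_divide)
    have "\<forall>n. norm (g t $ 1) \<le> (2 * c0) * sqrt (1 + M t) + D / 2 ^ n * (1 + M t)" using iter t by blast
    then show ?thesis using LIMSEQ_le_const[OF l] by blast
  qed
  obtain C where C: "0 \<le> C" "\<And>t. t \<in> iv \<Longrightarrow> norm (g t $ 1) \<le> C * sqrt (1 + M t)"
  proof -
    have "bounded ((\<lambda>t. g t $ 1) ` {a..t0})"
      by (rule compact_imp_bounded, rule compact_continuous_image[OF continuous_on_subset[OF ng1(1)]]) (use t0 in auto)
    then obtain K1 where K1: "\<forall>w\<in>(\<lambda>t. g t $ 1) ` {a..t0}. norm w \<le> K1" unfolding bounded_iff by blast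
    show thesis
    proof (rule that[of "max (2 * c0) K1"])
      show "0 \<le> max (2 * c0) K1" using c0 by simp
      fix t assume t: "t \<in> iv"
      have R: "1 \<le> sqrt (1 + M t)" using M_nonneg[of t] t by auto
      show "norm (g t $ 1) \<le> max (2 * c0) K1 * sqrt (1 + M t)"
      proof (cases "t < t0")
        case True
        then have "norm (g t $ 1) \<le> K1" using K1 t by auto
        also have "\<dots> \<le> max (2 * c0) K1 * 1" by simp
        also have "\<dots> \<le> max (2 * c0) K1 * sqrt (1 + M t)" using R c0 by (intro mult_left_mono) auto
        finally show ?thesis .
      next
        case False
        then have "norm (g t $ 1) \<le> (2 * c0) * sqrt (1 + M t)" using tail t by auto
        also have "\<dots> \<le> max (2 * c0) K1 * sqrt (1 + M t)" using R by (intro mult_right_mono) auto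
        finally show ?thesis .
      qed
    qed
  qed
  have "L2 g"
  proof (rule L2_crit[OF nice_mf[OF ng]])
    define KM where "KM = integral {a..b} Mh"
    have KM: "0 \<le> KM" unfolding KM_def by (intro integral_nonneg Mh_on) (auto simp: Mh_nonneg)
    define C' where "C' = max (C\<^sup>2) (B3\<^sup>2 * (2 * (C\<^sup>2 * KM) + 2 * Q F))"
    fix t assume t: "t \<in> {a<..<b}"
    then have ti: "t \<in> iv" by auto
    have Mt: "0 \<le> M t" using M_nonneg[of t] t by auto
    have N: "0 \<le> N1 t" using N1_nonneg[of t] t by auto
    have "(norm (g t $ 1))\<^sup>2 \<le> (C * sqrt (1 + M t))\<^sup>2" using C(2)[OF ti] by (intro power_mono) auto
    also have "\<dots> = C\<^sup>2 * (1 + M t)" using Mt by (simp add: power_mult_distrib)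
    also have "\<dots> \<le> C' * (1 + M t)" unfolding C'_def using Mt by (intro mult_right_mono) auto
    finally show "(norm (g t $ 1))\<^sup>2 \<le> C' * (1 + M t)" .
    \<comment> \<open>Now that the first component is of order sqrt (1 + M), Cauchy-Schwarz gains
      the factor sqrt (N1) that \<open>L2_crit\<close> demands of the second.\<close>
    have P: "integral {t..b} \<psi> \<le> sqrt (N1 t * (C\<^sup>2 * KM))"
    proof -
      define w where "w s = complex_of_real (\<psi> s)" for s
      have tb: "a \<le> t" "t \<le> b" using t by auto
      have wm: "w \<in> borel_measurable (lebesgue_on {t..b})"
      proof -
        have "\<psi> \<in> borel_measurable (lebesgue_on {t..b})"
          by (rule integrable_imp_measurable[OF \<psi>i]) (use t in auto)
        then show ?thesis unfolding w_def by measurable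
      qed
      have C2: "(\<lambda>s. C\<^sup>2 * Mh s) absolutely_integrable_on {t..b}"
        by (rule set_integrable_mult_right, rule Mh_sub) (use t in auto)
      have le: "(norm (w s))\<^sup>2 \<le> h1 s * (C\<^sup>2 * Mh s)" if s: "s \<in> {t..b}" for s
      proof (cases "s = b")
        case True then show ?thesis unfolding w_def using \<psi>0(2) by (simp add: Mh_def)
      next
        case False
        then have si: "s \<in> iv" using s t by auto
        have Ms: "0 \<le> M s" using M_nonneg[of s] si by auto
        have "(norm (g s $ 1))\<^sup>2 \<le> (C * sqrt (1 + M s))\<^sup>2" using C(2)[OF si] by (intro power_mono) auto
        also have "\<dots> = C\<^sup>2 * (1 + M s)" using Ms by (simp add: power_mult_distrib)
        finally have "(h1 s)\<^sup>2 * (norm (g s $ 1))\<^sup>2 \<le> (h1 s)\<^sup>2 * (C\<^sup>2 * (1 + M s))" by (intro mult_left_mono) auto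
        then show ?thesis unfolding w_def norm_of_real power2_abs \<psi>_def Mh_def by (simp add: power_mult_distrib power2_eq_square mult_ac)
      qed
      have A: "{t..b} \<in> sets lebesgue" by simp
      have nnM: "0 \<le> C\<^sup>2 * Mh s" for s using Mh_nonneg by simp
      have "integral {t..b} (\<lambda>s. norm (w s)) \<le> sqrt (integral {t..b} h1 * integral {t..b} (\<lambda>s. C\<^sup>2 * Mh s))"
        by (rule integral_norm_Cauchy_Schwarz(2)[OF A h1_sub[OF tb(1) order_refl] C2 wm h_psd(1) nnM le])
      also have "\<dots> \<le> sqrt (N1 t * (C\<^sup>2 * KM))"
      proof -
        have "integral {t..b} Mh \<le> KM" unfolding KM_def by (rule integral_subset_le) (use tb Mh_nonneg in \<open>auto intro!: Mh_on\<close>)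
        then show ?thesis unfolding N1_def[symmetric] using N by (simp add: mult_left_mono)
      qed
      also have "integral {t..b} (\<lambda>s. norm (w s)) = integral {t..b} \<psi>" unfolding w_def using \<psi>0(1) by simp
      finally show ?thesis .
    qed
    have P0: "0 \<le> integral {t..b} \<psi>" by (intro integral_nonneg \<psi>i) (use t \<psi>0 in auto)
    have "(norm (g t $ 2))\<^sup>2 \<le> (B3 * (integral {t..b} \<psi> + sqrt (N1 t * Q F)))\<^sup>2" using g2_bd[OF ti] by (intro power_mono) auto
    also have "\<dots> \<le> (B3 * (sqrt (N1 t * (C\<^sup>2 * KM)) + sqrt (N1 t * Q F)))\<^sup>2"
      using P P0 B3 N QF by (intro power_mono mult_left_mono add_mono mult_nonneg_nonneg add_nonneg_nonneg) auto
    also have "\<dots> \<le> B3\<^sup>2 * (2 * (sqrt (N1 t * (C\<^sup>2 * KM)))\<^sup>2 + 2 * (sqrt (N1 t * Q F))\<^sup>2)"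
      unfolding power_mult_distrib using sum_squares_bound[of "sqrt (N1 t * (C\<^sup>2 * KM))" "sqrt (N1 t * Q F)"]
      by (intro mult_left_mono) (auto simp: power2_sum)
    also have "\<dots> = B3\<^sup>2 * (2 * (C\<^sup>2 * KM) + 2 * Q F) * N1 t" using N KM QF by (simp add: algebra_simps)
    also have "\<dots> \<le> C' * N1 t" unfolding C'_def using N by (intro mult_right_mono) auto
    finally show "(norm (g t $ 2))\<^sup>2 \<le> C' * N1 t" .
  qed
  then have "L2 (\<lambda>t. z *s (g t - F t))" by (intro L2_scale L2_diff LF)
  then show ?thesis unfolding fz[symmetric] .
qed

end

section \<open>The numbers $\omega_n$\<close>

lemma absolutely_integrable_open_closed:
  fixes f :: "real \<Rightarrow> 'a::euclidean_space"
  shows "f absolutely_integrable_on {a<..<b} \<longleftrightarrow> f absolutely_integrable_on {a..b}"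
  by (rule absolutely_integrable_spike_set_eq; rule negligible_subset[of "{a, b}"]; auto)

lemma lin_sum: "finite A \<Longrightarrow> lin F (\<Sum>i\<in>A. P i) t = (\<Sum>i\<in>A. lin F (P i) t)"
  by (induction A rule: finite_induct) (simp_all add: lin_add, simp add: lin_def vec2_eq_iff)

lemma lin_minus: "lin F (- P) t = - lin F P t"
  using lin_smult[of F "-1" P t] by (simp add: vec2_eq_iff)

lemma lin_diff: "lin F (P - R) t = lin F P t - lin F R t"
  using lin_add[of F P "- R" t] by (simp add: lin_minus)

text \<open>Change of basis from the family of convolutions of c with F to F itself. It is
  triangular with diagonal c 0, so it respects degree bounds and, for c 0 = 1, non-vanishing. With c
  = \<omega> it passes from the w_n to the \<open>Y n\<close>, with the reciprocal series it passes
  back.\<close>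

definition conv_poly :: "(nat \<Rightarrow> complex) \<Rightarrow> complex poly \<Rightarrow> complex poly" where
  "conv_poly c P = (\<Sum>n\<le>degree P. Polynomial.smult (coeff P n) (\<Sum>k\<le>n. monom (c (n - k)) k))"

lemma conv_poly_lin:
  "lin F (conv_poly c P) t = lin (\<lambda>n t. \<Sum>k\<le>n. c (n - k) *s F k t) P t"
  unfolding conv_poly_def by (simp add: lin_sum lin_smult lin_monom) (simp add: lin_def)

lemma conv_poly_coeff:
  "coeff (conv_poly c P) i = (\<Sum>n\<le>degree P. coeff P n * (if i \<le> n then c (n - i) else 0))"
  unfolding conv_poly_def by (simp add: coeff_sum coeff_monom)

lemma conv_poly_degree: "degree (conv_poly c P) \<le> degree P"
  by (rule degree_le) (auto simp: conv_poly_coeff intro!: sum.neutral)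

lemma conv_poly_nonzero:
  assumes "c 0 = 1" "P \<noteq> 0" shows "conv_poly c P \<noteq> 0"
proof -
  have "coeff (conv_poly c P) (degree P) = (\<Sum>n\<le>degree P. if n = degree P then coeff P n else 0)"
    unfolding conv_poly_coeff by (rule sum.cong) (use assms in auto)
  then show ?thesis using assms(2) by (auto simp: leading_coeff_0_iff)
qed

text \<open>When the power of X is split off, a remaining root \<kappa> would be non-zero, and
  \<open>div\<close> would give a non-zero polynomial of smaller degree. By the fundamental theorem
  of algebra only a constant is left. \<open>[:-0, 1:]\<close> is X in the shape that
  \<open>order_decomp\<close> produces.\<close>

lemma poly_min_degree_monomial:
  assumes P: "(P :: complex poly) \<noteq> 0" "Z P"
    and min: "\<And>R. R \<noteq> 0 \<Longrightarrow> Z R \<Longrightarrow> degree P \<le> degree R"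
    and div: "\<And>R \<kappa>. \<kappa> \<noteq> 0 \<Longrightarrow> Z ([:-\<kappa>, 1:] * R) \<Longrightarrow> Z R"
  shows "\<exists>c. c \<noteq> 0 \<and> P = monom c (degree P)"
proof -
  obtain C where C: "P = [:-0, 1:] ^ order 0 P * C" "\<not> [:-0, 1:] dvd C"
    by (rule exE[OF order_decomp[OF P(1), of 0]]) (elim conjE)
  have C0: "poly C 0 \<noteq> 0" using C(2) by (simp add: poly_eq_0_iff_dvd)
  have "degree C = 0"
  proof (rule ccontr)
    assume "degree C \<noteq> 0"
    then have "\<not> constant (poly C)" by (simp add: constant_degree)
    from fundamental_theorem_of_algebra[OF this] obtain \<kappa> where \<kappa>: "poly C \<kappa> = 0" ..
    have k0: "\<kappa> \<noteq> 0" using \<kappa> C0 by auto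
    obtain S where S: "C = [:-\<kappa>, 1:] * S" using \<kappa> unfolding poly_eq_0_iff_dvd by (rule dvdE)
    define R where "R = [:-0, 1:] ^ order 0 P * S"
    have R: "P = [:-\<kappa>, 1:] * R" unfolding R_def by (subst C(1), subst S) (simp only: mult.left_commute)
    have R0: "R \<noteq> 0" using R P(1) by auto
    have "degree P = Suc (degree R)" unfolding R by (subst degree_mult_eq) (use R0 in auto)
    moreover have "degree P \<le> degree R" by (rule min[OF R0]) (rule div[OF k0], use P(2) R in \<open>simp only:\<close>)
    ultimately show False by simp
  qed
  then obtain c where c: "C = [:c:]" by (rule degree_eq_zeroE)
  have P': "P = monom c (order 0 P)" using C(1) c by (simp add: monom_altdef)
  have c0: "c \<noteq> 0" using C0 c by simp
  have "degree P = order 0 P" by (subst P') (rule degree_monom_eq[OF c0])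
  then have "P = monom c (degree P)" using P' by (simp only:)
  then show ?thesis using c0 by blast
qed

section \<open>Indivisible intervals and membership in L^2(H)\<close>

context hs_side begin

lemma cdot_eq: "t \<in> {a<..<b} \<Longrightarrow> t \<notin> bad \<Longrightarrow> cdot u (cmat (H t) *v v) = sesq (h1 t) (h3 t) (h2 t) u v"
  using h_psd(4)[of t] by (simp add: cdot_2 matrix_vector_mult_2 sesq_def hval_eq)

lemma L2H_imp_L2:
  assumes "f \<in> L2H H a b" shows "L2 f"
proof -
  have m: "mf f" and i: "(\<lambda>t. cdot (f t) (cmat (H t) *v f t)) absolutely_integrable_on {a<..<b}"
    using assms unfolding L2H_def mf_def mem_Collect_eq by (rule conjunct1, rule conjunct1[OF conjunct2])
  have "(\<lambda>t. Re (cdot (f t) (cmat (H t) *v f t))) absolutely_integrable_on {a<..<b}"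
    using absolutely_integrable_linear[OF i bounded_linear_Re] by (simp add: o_def)
  then have "q f absolutely_integrable_on {a<..<b}"
    by (rule absolutely_integrable_spike[OF _ negligible_bad]) (auto simp: cdot_eq q_def qform_def)
  then show ?thesis unfolding L2_def absolutely_integrable_open_closed using m by simp
qed

text \<open>Constancy at every point, not just almost every point: it holds for antiderivatives of
  JHf and passes to finite sums without exceptional sets to collect.\<close>

definition xi_const :: "fn \<Rightarrow> bool" where
  "xi_const f \<longleftrightarrow> (\<forall>\<phi> c d. a \<le> c \<and> d \<le> b \<and> indivisible_type H \<phi> c d \<longrightarrow>
        (\<exists>k. \<forall>t\<in>{c<..<d}. complex_of_real (cos \<phi>) * f t $ 1 + complex_of_real (sin \<phi>) * f t $ 2 = k))"

lemma L2_imp_L2H: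
  assumes "L2 f" "xi_const f" shows "f \<in> L2H H a b"
proof -
  have m: "mf f" and i: "q f absolutely_integrable_on {a..b}" using assms(1) unfolding L2_def by auto
  have "(\<lambda>t. complex_of_real (q f t)) absolutely_integrable_on {a<..<b}"
    unfolding absolutely_integrable_open_closed by (rule absolutely_integrable_of_real[OF i])
  then have "(\<lambda>t. cdot (f t) (cmat (H t) *v f t)) absolutely_integrable_on {a<..<b}"
    by (rule absolutely_integrable_spike[OF _ negligible_bad]) (auto simp: cdot_eq q_def sesq_self)
  moreover have "\<exists>k. AE t\<in>{c<..<d} in lebesgue. complex_of_real (cos \<phi>) * f t $ 1 + complex_of_real (sin \<phi>) * f t $ 2 = k"
    if cd: "a \<le> c \<and> d \<le> b \<and> indivisible_type H \<phi> c d" for \<phi> c d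
  proof -
    obtain k where "\<forall>t\<in>{c<..<d}. complex_of_real (cos \<phi>) * f t $ 1 + complex_of_real (sin \<phi>) * f t $ 2 = k"
      using assms(2)[unfolded xi_const_def, rule_format, OF cd] by blast
    then show ?thesis by (intro exI[of _ k] AE_I2) simp
  qed
  ultimately show ?thesis using m[unfolded mf_def] unfolding L2H_def mem_Collect_eq by (intro conjI allI impI) blast+
qed

text \<open>The columns of H are multiples of (cos \<phi>, sin \<phi>). By symmetry the row vector
  (cos \<phi>, sin \<phi>) J H vanishes, and this is what the two identities say; consequently an
  antiderivative of JHf has constant component in the direction \<phi>.\<close>

lemma indivisible_rows:
  assumes "indivisible_type H \<phi> c d" "a \<le> c" "d \<le> b"
  obtains N where "negligible N" "\<And>t. t \<in> {c<..<d} - N \<Longrightarrow> h1 t * sin \<phi> = h3 t * cos \<phi> \<and> h3 t * sin \<phi> = h2 t * cos \<phi>"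
proof -
  have ae: "AE t\<in>{c<..<d} in lebesgue. range ((*v) (H t)) = span {xi_vec \<phi>}" using assms(1) unfolding indivisible_type_def by blast
  then obtain N where N: "N \<in> null_sets lebesgue" "{t. \<not> (t \<in> {c<..<d} \<longrightarrow> range ((*v) (H t)) = span {xi_vec \<phi>})} \<subseteq> N"
    by (auto simp: eventually_ae_filter)
  show thesis
  proof (rule that[of "N \<union> bad"])
    show "negligible (N \<union> bad)" using N(1) negligible_bad by (simp add: negligible_iff_null_sets[symmetric])
    fix t assume t: "t \<in> {c<..<d} - (N \<union> bad)"
    then have r: "range ((*v) (H t)) = span {xi_vec \<phi>}" and ti: "t \<in> {a<..<b}" "t \<notin> bad" using N(2) assms by auto
    have "H t *v vector [1, 0] \<in> span {xi_vec \<phi>}" "H t *v vector [0, 1] \<in> span {xi_vec \<phi>}" unfolding r[symmetric] by auto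
    then obtain x y where "H t *v vector [1, 0] = x *\<^sub>R xi_vec \<phi>" "H t *v vector [0, 1] = y *\<^sub>R xi_vec \<phi>"
      unfolding span_singleton by auto
    then have "H t $ 1 $ 1 = x * cos \<phi>" "H t $ 2 $ 1 = x * sin \<phi>" "H t $ 1 $ 2 = y * cos \<phi>" "H t $ 2 $ 2 = y * sin \<phi>"
      by (auto simp: vec2_eq_iff matrix_vector_mult_2 xi_vec_def)
    then have e: "h1 t = x * cos \<phi>" "h3 t = x * sin \<phi>" "h3 t = y * cos \<phi>" "h2 t = y * sin \<phi>"
      using hval_eq[OF ti, of 1 1] hval_eq[OF ti, of 1 2] hval_eq[OF ti, of 2 2] hval_eq[OF ti, of 2 1] h_psd(4)[of t]
      by simp_all
    have "h1 t * sin \<phi> = h3 t * cos \<phi>" unfolding e(1,2) by simp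
    moreover have "h3 t * sin \<phi> = h2 t * cos \<phi>" unfolding e(3,4) by simp
    ultimately show "h1 t * sin \<phi> = h3 t * cos \<phi> \<and> h3 t * sin \<phi> = h2 t * cos \<phi>" ..
  qed
qed

lemma xi_const_antiderivative:
  assumes "indef_int {a<..<b} (\<lambda>t. G t $ 1) (\<lambda>t. - d2 f t)" "indef_int {a<..<b} (\<lambda>t. G t $ 2) (d1 f)"
  shows "xi_const G"
  unfolding xi_const_def
proof (intro allI impI)
  fix \<phi> c d assume a: "a \<le> c \<and> d \<le> b \<and> indivisible_type H \<phi> c d"
  then have cd: "a \<le> c" "d \<le> b" "indivisible_type H \<phi> c d" "c < d" unfolding indivisible_type_def by auto
  obtain N where N: "negligible N" "\<And>t. t \<in> {c<..<d} - N \<Longrightarrow> h1 t * sin \<phi> = h3 t * cos \<phi> \<and> h3 t * sin \<phi> = h2 t * cos \<phi>"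
    using indivisible_rows[OF cd(3,1,2)] by metis
  define C where "C = complex_of_real (cos \<phi>)" define S where "S = complex_of_real (sin \<phi>)"
  have "indef_int {a<..<b} (\<lambda>t. C * G t $ 1 + S * G t $ 2) (\<lambda>t. C * - d2 f t + S * d1 f t)"
    by (intro indef_int_add indef_int_cmult assms)
  then have "indef_int {c<..<d} (\<lambda>t. C * G t $ 1 + S * G t $ 2) (\<lambda>t. C * - d2 f t + S * d1 f t)"
    by (rule indef_int_subset) (use cd in auto)
  then have i: "indef_int {c<..<d} (\<lambda>t. C * G t $ 1 + S * G t $ 2) (\<lambda>t. 0)"
  proof (rule indef_int_cong[OF _ _ N(1)])
    fix t assume "t \<notin> N" "\<exists>x\<in>{c<..<d}. \<exists>y\<in>{c<..<d}. x \<le> t \<and> t \<le> y"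
    then have "h1 t * sin \<phi> = h3 t * cos \<phi>" "h3 t * sin \<phi> = h2 t * cos \<phi>" using N(2)[of t] by auto
    then have "of_real (h1 t) * S = of_real (h3 t) * C" "of_real (h3 t) * S = of_real (h2 t) * C"
      unfolding S_def C_def by (metis of_real_mult)+
    then show "C * - d2 f t + S * d1 f t = 0" unfolding d1_def d2_def by algebra
  qed auto
  define m where "m = (c + d) / 2"
  have m: "m \<in> {c<..<d}" using cd unfolding m_def by auto
  show "\<exists>k. \<forall>t\<in>{c<..<d}. complex_of_real (cos \<phi>) * G t $ 1 + complex_of_real (sin \<phi>) * G t $ 2 = k"
  proof (intro exI ballI)
    fix t assume t: "t \<in> {c<..<d}"
    have "C * G t $ 1 + S * G t $ 2 = C * G m $ 1 + S * G m $ 2"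
    proof (cases "t \<le> m")
      case True
      have hi: "((\<lambda>t. 0) has_integral (C * G m $ 1 + S * G m $ 2 - (C * G t $ 1 + S * G t $ 2))) {t..m}"
        by (rule indef_intD(2)[OF i t m True])
      show ?thesis using has_integral_unique[OF hi has_integral_0] by simp
    next
      case False
      have hi: "((\<lambda>t. 0) has_integral (C * G t $ 1 + S * G t $ 2 - (C * G m $ 1 + S * G m $ 2))) {m..t}"
        by (rule indef_intD(2)[OF i m t]) (use False in simp)
      show ?thesis using has_integral_unique[OF hi has_integral_0] by simp
    qed
    then show "complex_of_real (cos \<phi>) * G t $ 1 + complex_of_real (sin \<phi>) * G t $ 2 = C * G m $ 1 + S * G m $ 2"
      unfolding C_def S_def .
  qed
qed

lemma Y_xi_const: "xi_const (Y k)"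
proof (cases k)
  case 0 then show ?thesis unfolding xi_const_def by (simp add: Y_0)
next
  case (Suc n)
  show ?thesis unfolding Suc Y_Suc
    by (rule xi_const_antiderivative[OF indef_int_subset[OF I_props(1)[OF Y_nice]] indef_int_subset[OF I_props(2)[OF Y_nice]]]) auto
qed

lemma xi_const_sum:
  assumes "\<And>i. i \<in> A \<Longrightarrow> xi_const (f i)" shows "xi_const (\<lambda>t. \<Sum>i\<in>A. c i *s f i t)"
  unfolding xi_const_def
proof (intro allI impI)
  fix \<phi> u v assume a: "a \<le> u \<and> v \<le> b \<and> indivisible_type H \<phi> u v"
  have "\<exists>k. \<forall>i\<in>A. \<forall>t\<in>{u<..<v}. complex_of_real (cos \<phi>) * f i t $ 1 + complex_of_real (sin \<phi>) * f i t $ 2 = k i"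
    using assms a unfolding xi_const_def by (intro bchoice ballI) blast
  then obtain k where k: "\<And>i t. i \<in> A \<Longrightarrow> t \<in> {u<..<v} \<Longrightarrow> complex_of_real (cos \<phi>) * f i t $ 1 + complex_of_real (sin \<phi>) * f i t $ 2 = k i" by blast
  show "\<exists>k. \<forall>t\<in>{u<..<v}. complex_of_real (cos \<phi>) * (\<Sum>i\<in>A. c i *s f i t) $ 1 + complex_of_real (sin \<phi>) * (\<Sum>i\<in>A. c i *s f i t) $ 2 = k"
  proof (intro exI ballI)
    fix t assume t: "t \<in> {u<..<v}"
    have "complex_of_real (cos \<phi>) * (\<Sum>i\<in>A. c i *s f i t) $ 1 + complex_of_real (sin \<phi>) * (\<Sum>i\<in>A. c i *s f i t) $ 2
      = (\<Sum>i\<in>A. c i * (complex_of_real (cos \<phi>) * f i t $ 1 + complex_of_real (sin \<phi>) * f i t $ 2))"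
      by (simp add: sum_distrib_left sum.distrib[symmetric] algebra_simps)
    also have "\<dots> = (\<Sum>i\<in>A. c i * k i)" using k t by simp
    finally show "complex_of_real (cos \<phi>) * (\<Sum>i\<in>A. c i *s f i t) $ 1 + complex_of_real (sin \<phi>) * (\<Sum>i\<in>A. c i *s f i t) $ 2 = (\<Sum>i\<in>A. c i * k i)" .
  qed
qed

lemma xi_const_cong:
  assumes "\<And>t. t \<in> {a<..<b} \<Longrightarrow> f t = g t" "xi_const f" shows "xi_const g"
  unfolding xi_const_def
proof (intro allI impI)
  fix \<phi> u v assume a: "a \<le> u \<and> v \<le> b \<and> indivisible_type H \<phi> u v"
  then obtain k where k: "\<forall>t\<in>{u<..<v}. complex_of_real (cos \<phi>) * f t $ 1 + complex_of_real (sin \<phi>) * f t $ 2 = k"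
    using assms(2) unfolding xi_const_def by meson
  have "f t = g t" if "t \<in> {u<..<v}" for t using assms(1) that a by auto
  then show "\<exists>k. \<forall>t\<in>{u<..<v}. complex_of_real (cos \<phi>) * g t $ 1 + complex_of_real (sin \<phi>) * g t $ 2 = k" using k by auto
qed

lemma lin_Y_L2H:
  assumes "L2 (lin Y P)" "\<And>t. t \<in> {a<..<b} \<Longrightarrow> g t = c *s lin Y P t"
  shows "g \<in> L2H H a b"
proof (rule L2_imp_L2H)
  show "L2 g" using L2_scale[OF assms(1), of c] L2_cong[of g "\<lambda>t. c *s lin Y P t"] assms(2) by blast
  have "xi_const (\<lambda>t. \<Sum>i\<le>degree P. (c * coeff P i) *s Y i t)" by (rule xi_const_sum) (rule Y_xi_const)
  then show "xi_const g"
    by (rule xi_const_cong[rotated]) (simp add: assms(2) lin_def vec2_eq_iff sum_distrib_left mult.assoc)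
qed

text \<open>The density of the constant (0, 1) is h_2. This makes \<Delta> positive, and it forces
  the limits of the second components of elements of dom T_max to vanish.\<close>

lemma Y_0_not_L2: "\<not> L2 (Y 0)"
proof
  assume "L2 (Y 0)"
  moreover have "q (Y 0) = h2" by (auto simp: q_def qform_eq Y_0)
  ultimately have "h2 absolutely_integrable_on {a..b}" unfolding L2_def by simp
  then have "h2 absolutely_integrable_on {(a + b) / 2..b}" by (rule absolutely_integrable_subinterval) (use ab in auto)
  then show False using h2_not_integrable[of "(a + b) / 2"] ab by simp
qed

definition wseq :: "(nat \<Rightarrow> complex) \<Rightarrow> nat \<Rightarrow> fn" where
  "wseq \<omega> n t = (\<Sum>k\<le>n. \<omega> (n - k) *s Y k t)"

lemma w_comb_eq: "t \<in> iv \<Longrightarrow> w_comb I \<omega> n t = wseq \<omega> n t"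
  unfolding w_comb_def wseq_def by (rule sum.cong) (simp_all add: iter_lin)

lemma wseq_lin: "wseq \<omega> n t = lin Y (\<Sum>k\<le>n. monom (\<omega> (n - k)) k) t"
  unfolding wseq_def by (rule sum_poly_coeff(3)[symmetric])

lemma lin_wseq: "lin (wseq \<omega>) P t = lin Y (conv_poly \<omega> P) t"
  unfolding conv_poly_lin wseq_def ..

lemma w_comb_L2H:
  assumes "L2 (wseq \<omega> n)" shows "w_comb I \<omega> n \<in> L2H H a b"
proof -
  have e: "lin Y (\<Sum>k\<le>n. monom (\<omega> (n - k)) k) = wseq \<omega> n" by (auto simp: wseq_lin)
  show ?thesis
    by (rule lin_Y_L2H[where c=1 and P="\<Sum>k\<le>n. monom (\<omega> (n - k)) k"]) (use assms in \<open>simp_all add: e w_comb_eq\<close>)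
qed

lemma L2H_w_comb: "w_comb I \<omega> n \<in> L2H H a b \<Longrightarrow> L2 (wseq \<omega> n)"
  using L2H_imp_L2 L2_cong[of "w_comb I \<omega> n" "wseq \<omega> n"] w_comb_eq by auto

lemma wseq_nice: "nice (wseq \<omega> n)"
  unfolding wseq_def[abs_def] by (rule nice_sum) (rule Y_nice)

lemma wseq_0: "wseq \<omega> 0 t = vector [0, \<omega> 0]"
  by (simp add: wseq_def Y_0 vec2_eq_iff)

lemma wseq_Suc: "t \<in> iv \<Longrightarrow> wseq \<omega> (Suc n) t = I (wseq \<omega> n) t + vector [0, \<omega> (Suc n)]"
  unfolding wseq_def[abs_def] I_sum[OF finite_atMost Y_nice] Y_Suc[symmetric]
  by (simp add: sum.atMost_Suc_shift Y_0 vec2_eq_iff del: sum.atMost_Suc)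

lemma wseq_indef:
  "indef_int iv (\<lambda>t. wseq \<omega> (Suc n) t $ 1) (\<lambda>t. - d2 (wseq \<omega> n) t)"
  "indef_int iv (\<lambda>t. wseq \<omega> (Suc n) t $ 2) (d1 (wseq \<omega> n))"
proof -
  show "indef_int iv (\<lambda>t. wseq \<omega> (Suc n) t $ 1) (\<lambda>t. - d2 (wseq \<omega> n) t)"
    by (rule indef_int_cong[OF I_props(1)[OF wseq_nice], where N="{}"]) (auto simp: wseq_Suc)
  show "indef_int iv (\<lambda>t. wseq \<omega> (Suc n) t $ 2) (d1 (wseq \<omega> n))"
    by (rule indef_int_cong[OF indef_int_add[OF I_props(2)[OF wseq_nice] indef_int_const], where N="{}"]) (auto simp: wseq_Suc)
qed

end

section \<open>Existence and uniqueness of the sequence \<omega> when \<Delta> is finite\<close>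

locale hs_side_finite = hs_side +
  fixes D :: nat
  assumes Delta: "Delta_num H a b (I_left H a) = enat D"
begin

text \<open>Divided by its leading coefficient, the combination is of the kind considered in
  \<open>Delta_num\<close>, with vectors v whose first entries are 0.\<close>

lemma Delta_minimal:
  assumes L: "L2 (lin Y P)" and P: "P \<noteq> 0" shows "D \<le> degree P"
proof -
  define n where "n = degree P"
  define c where "c = coeff P n"
  have c: "c \<noteq> 0" using P unfolding c_def n_def by simp
  define v :: "nat \<Rightarrow> complex^2" where "v j = vector [0, coeff P (n - j) / c]" for j
  have "(\<lambda>t. (I ^^ n) (\<lambda>_. vector [0, 1]) t + (\<Sum>k<n. (I ^^ k) (\<lambda>_. v (n - k)) t)) \<in> L2H H a b"
  proof (rule lin_Y_L2H[OF L, where c="1 / c"])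
    fix t assume "t \<in> {a<..<b}"
    then have t: "t \<in> iv" by auto
    have "(1 / c) *s lin Y P t = (\<Sum>k<n. (coeff P k / c) *s Y k t) + Y n t"
      unfolding lin_def n_def[symmetric] lessThan_Suc_atMost[symmetric] using c
      by (simp add: vec2_eq_iff c_def[symmetric] distrib_left sum_distrib_left)
    moreover have "(\<Sum>k<n. (I ^^ k) (\<lambda>_. v (n - k)) t) = (\<Sum>k<n. (coeff P k / c) *s Y k t)"
      by (rule sum.cong) (simp_all add: iter_lin[OF t] v_def)
    ultimately show "(I ^^ n) (\<lambda>_. vector [0, 1]) t + (\<Sum>k<n. (I ^^ k) (\<lambda>_. v (n - k)) t) = (1 / c) *s lin Y P t"
      by (simp add: Y_def add.commute)
  qed
  then have "Delta_num H a b I \<le> enat n" unfolding Delta_num_def by (intro Inf_lower) blast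
  then show ?thesis unfolding Delta n_def by simp
qed

text \<open>The infimum defining \<Delta> is finite, so the set is non-empty and,
  \<open>enat\<close> being well-ordered, contains its infimum.\<close>

lemma Delta_vectors: obtains v :: "nat \<Rightarrow> complex^2"
  where "L2 (\<lambda>t. Y D t + (\<Sum>k<D. (I ^^ k) (\<lambda>_. v (D - k)) t))"
proof -
  define A where "A = {enat n | n. \<exists>v :: nat \<Rightarrow> complex^2.
     (\<lambda>t. (I ^^ n) (\<lambda>_. vector [0, 1]) t + (\<Sum>k<n. (I ^^ k) (\<lambda>_. v (n - k)) t)) \<in> L2H H a b}"
  have I: "Inf A = enat D" using Delta unfolding Delta_num_def A_def by simp
  then have "A \<noteq> {}" by (auto simp: Inf_enat_def)
  then have "Inf A \<in> A" by (meson ex_in_conv wellorder_InfI)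
  then have "enat D \<in> A" unfolding I .
  then obtain n and v :: "nat \<Rightarrow> complex^2" where "enat D = enat n"
    "(\<lambda>t. (I ^^ n) (\<lambda>_. vector [0, 1]) t + (\<Sum>k<n. (I ^^ k) (\<lambda>_. v (n - k)) t)) \<in> L2H H a b"
    unfolding A_def mem_Collect_eq by blast
  then have "L2 (\<lambda>t. Y D t + (\<Sum>k<D. (I ^^ k) (\<lambda>_. v (D - k)) t))" using L2H_imp_L2 unfolding Y_def by simp
  then show ?thesis by (rule that)
qed

lemma D_pos: "0 < D"
proof (rule ccontr)
  assume "\<not> 0 < D"
  then have D: "D = 0" by simp
  obtain v :: "nat \<Rightarrow> complex^2" where "L2 (\<lambda>t. Y D t + (\<Sum>k<D. (I ^^ k) (\<lambda>_. v (D - k)) t))" by (rule Delta_vectors)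
  then show False using Y_0_not_L2 unfolding D by simp
qed

text \<open>The vectors v may have non-zero first entries, which contribute iterates
  \<open>X k\<close>; \<open>L2_X_reduction\<close> replaces these by combinations of
  \<open>Y j\<close> with j < k, modulo L^2.\<close>

lemma Delta_attained: obtains P where "L2 (lin Y P)" "P \<noteq> 0" "degree P \<le> D"
proof -
  obtain v :: "nat \<Rightarrow> complex^2" where L: "L2 (\<lambda>t. Y D t + (\<Sum>k<D. (I ^^ k) (\<lambda>_. v (D - k)) t))" by (rule Delta_vectors)
  obtain \<rho> :: "nat \<Rightarrow> nat \<Rightarrow> complex" where \<rho>: "\<And>n. L2 (\<lambda>t. X n t + (\<Sum>k<n. \<rho> n k *s Y k t))"
  proof -
    have "\<forall>n. \<exists>\<rho> :: nat \<Rightarrow> complex. L2 (\<lambda>t. X n t + (\<Sum>k<n. \<rho> k *s Y k t))" by (rule allI, rule L2_X_reduction)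
    from choice[OF this] show thesis using that by blast
  qed
  define x where "x k = v (D - k) $ 1" for k
  define y where "y k = v (D - k) $ 2" for k
  have "L2 (\<lambda>t. \<Sum>k<D. x k *s (X k t + (\<Sum>j<k. \<rho> k j *s Y j t)))"
    by (rule L2_sum, simp, rule L2_scale, rule \<rho>)
  from L2_diff[OF L this]
  have L': "L2 (\<lambda>t. Y D t + (\<Sum>k<D. (I ^^ k) (\<lambda>_. v (D - k)) t) - (\<Sum>k<D. x k *s (X k t + (\<Sum>j<k. \<rho> k j *s Y j t))))" .
  \<comment> \<open>R has only coefficients of index below D, so the coefficient 1 of
    \<open>Y D\<close> survives in the sum with \<open>monom 1 D\<close>.\<close>
  define R where "R = (\<Sum>k<D. monom (y k) k - Polynomial.smult (x k) (\<Sum>j<k. monom (\<rho> k j) j))"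
  have cR: "coeff R i = 0" if "D \<le> i" for i
    unfolding R_def coeff_sum coeff_diff coeff_smult coeff_monom using that by (auto intro!: sum.neutral)
  show thesis
  proof (rule that[of "monom 1 D + R"])
    have "Y D t + (\<Sum>k<D. (I ^^ k) (\<lambda>_. v (D - k)) t) - (\<Sum>k<D. x k *s (X k t + (\<Sum>j<k. \<rho> k j *s Y j t))) = lin Y (monom 1 D + R) t"
      if "t \<in> {a<..<b}" for t
    proof -
      have t: "t \<in> iv" using that by auto
      have "lin Y (monom 1 D + R) t = Y D t + (\<Sum>k<D. y k *s Y k t - x k *s (\<Sum>j<k. \<rho> k j *s Y j t))"
        unfolding R_def by (simp add: lin_add lin_sum lin_diff lin_smult lin_monom)
      moreover have "(\<Sum>k<D. (I ^^ k) (\<lambda>_. v (D - k)) t) - (\<Sum>k<D. x k *s (X k t + (\<Sum>j<k. \<rho> k j *s Y j t)))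
         = (\<Sum>k<D. y k *s Y k t - x k *s (\<Sum>j<k. \<rho> k j *s Y j t))"
        unfolding sum_subtractf[symmetric] iter_lin[OF t] x_def y_def
        by (rule sum.cong) (simp_all add: vec2_eq_iff algebra_simps)
      ultimately show ?thesis by (simp only: add_diff_eq[symmetric])
    qed
    from iffD1[OF L2_cong[OF this] L'] show "L2 (lin Y (monom 1 D + R))" .
    have "coeff (monom 1 D + R) D = 1" using cR[of D] by simp
    then have c1: "coeff (monom 1 D + R) D \<noteq> 0" by (simp only: one_neq_zero not_False_eq_True)
    show "monom 1 D + R \<noteq> 0"
    proof
      assume z: "monom 1 D + R = 0"
      show False using c1 unfolding z by simp
    qed
    show "degree (monom 1 D + R) \<le> D" by (rule degree_le) (simp add: cR coeff_monom)
  qed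
qed

lemma av_bdd: obtains r where "1 \<le> r" "\<And>t. t \<in> iv \<Longrightarrow> \<bar>av t\<bar> \<le> r"
  using Delta_attained av_bounded by metis

text \<open>\<omega> is the reciprocal power series of the limits of the second components of
  \<open>Y n\<close> along G, which makes the second component of each w_(n+1) tend to 0 along G.
  The minimal polynomial then yields w_D in L^2, and I carries this to larger indices.\<close>

lemma omega_along:
  assumes G: "G \<le> at_left b" "G \<noteq> bot" "(av \<longlongrightarrow> \<alpha>) G"
  shows "\<exists>\<omega>. \<omega> 0 = 1 \<and> (\<forall>n. ((\<lambda>t. wseq \<omega> (Suc n) t $ 2) \<longlongrightarrow> 0) G) \<and> (\<forall>n\<ge>D. L2 (wseq \<omega> n))"
proof -
  obtain r where r: "1 \<le> r" "\<And>t. t \<in> iv \<Longrightarrow> \<bar>av t\<bar> \<le> r" using av_bdd by blast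
  obtain y where y: "\<And>n. ((\<lambda>t. Y n t $ 2) \<longlongrightarrow> y n) G" using Y_converges_along[OF r G(1,3)] by metis
  have "((\<lambda>t. Y 0 t $ 2) \<longlongrightarrow> 1) G" by (simp add: Y_0)
  then have y0: "y 0 = 1" using tendsto_unique[OF G(2) y] by blast
  define yf where "yf = Abs_fps y"
  define \<omega> where "\<omega> = fps_nth (inverse yf)"
  have om0: "\<omega> 0 = 1" unfolding \<omega>_def yf_def using y0 by simp
  have inv: "inverse yf * yf = 1" by (rule inverse_mult_eq_1) (simp add: yf_def y0)
  have conv: "(\<Sum>k\<le>n. \<omega> (n - k) * y k) = (if n = 0 then 1 else 0)" for n
  proof -
    have "(\<Sum>k\<le>n. \<omega> (n - k) * y k) = fps_nth (yf * inverse yf) n"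
      unfolding fps_mult_nth \<omega>_def yf_def atLeast0AtMost by (simp add: mult.commute)
    then show ?thesis using inv by (simp add: mult.commute)
  qed
  have lim: "((\<lambda>t. wseq \<omega> n t $ 2) \<longlongrightarrow> (if n = 0 then 1 else 0)) G" for n
    unfolding conv[symmetric] wseq_def by (simp, intro tendsto_intros y)
  have limS: "((\<lambda>t. wseq \<omega> (Suc n) t $ 2) \<longlongrightarrow> 0) G" for n using lim[of "Suc n"] by simp
  define W where "W = wseq \<omega>"
  have conv_nth: "fps_nth (u * Abs_fps c) n = (\<Sum>k\<le>n. fps_nth u (n - k) * c k)" for u :: "complex fps" and c n
    unfolding mult.commute[of u] fps_mult_nth atLeast0AtMost by (simp add: mult.commute)
  \<comment> \<open>Convolution with y undoes convolution with \<omega>, since the two power series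
    are reciprocal.\<close>
  have Yw: "(\<Sum>k\<le>n. y (n - k) *s W k t) = Y n t" for n t
  proof -
    have "(\<Sum>k\<le>n. y (n - k) * W k t $ i) = Y n t $ i" for i
    proof -
      have "Abs_fps (\<lambda>k. W k t $ i) = inverse yf * Abs_fps (\<lambda>k. Y k t $ i)"
        by (rule fps_ext) (simp add: conv_nth W_def wseq_def \<omega>_def)
      then have "yf * Abs_fps (\<lambda>k. W k t $ i) = (inverse yf * yf) * Abs_fps (\<lambda>k. Y k t $ i)" by (simp only: mult_ac)
      then have "fps_nth (yf * Abs_fps (\<lambda>k. W k t $ i)) n = Y n t $ i" unfolding inv by simp
      then show ?thesis unfolding conv_nth by (simp add: yf_def)
    qed
    then show ?thesis by (simp add: vec2_eq_iff)
  qed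
  obtain PY where PY: "L2 (lin Y PY)" "PY \<noteq> 0" "degree PY \<le> D" by (rule Delta_attained)
  define P1 where "P1 = conv_poly y PY"
  have P1: "P1 \<noteq> 0" "degree P1 \<le> D" "L2 (lin W P1)"
  proof -
    show "P1 \<noteq> 0" unfolding P1_def by (rule conv_poly_nonzero[of y PY, OF y0 PY(2)])
    show "degree P1 \<le> D" unfolding P1_def using conv_poly_degree PY(3) order_trans by blast
    have "lin W P1 = lin Y PY" unfolding P1_def by (auto simp: conv_poly_lin Yw)
    then show "L2 (lin W P1)" using PY(1) by simp
  qed
  \<comment> \<open>\<open>P1\<close>, the combination of \<open>Delta_attained\<close> rewritten in
    terms of the w_n, shows that the minimum is taken over a non-empty set.\<close>
  define P where "P = arg_min degree (\<lambda>R. R \<noteq> 0 \<and> L2 (lin W R))"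
  have P: "P \<noteq> 0" "L2 (lin W P)" "\<And>R. R \<noteq> 0 \<Longrightarrow> L2 (lin W R) \<Longrightarrow> degree P \<le> degree R"
    using arg_min_nat_lemma[of "\<lambda>R. R \<noteq> 0 \<and> L2 (lin W R)" P1 degree] P1 unfolding P_def by auto
  have W_nice: "nice (W n)" for n unfolding W_def by (rule wseq_nice)
  \<comment> \<open>Multiplication by X - \<kappa> corresponds to g - \<kappa> f, where g is f with
    all indices raised by one. Thus g is an antiderivative of JHf, and its second component tends to
    0 along G because w_0 does not occur in it.\<close>
  have div: "L2 (lin W R)" if "\<kappa> \<noteq> 0" "L2 (lin W ([:-\<kappa>, 1:] * R))" for R \<kappa>
  proof -
    define f where "f = lin W R"
    define g where "g = lin (\<lambda>i. W (Suc i)) R"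
    have gf: "lin W ([:-\<kappa>, 1:] * R) t = g t - \<kappa> *s f t" for t
    proof -
      have "[:-\<kappa>, 1:] * R = pCons 0 R - Polynomial.smult \<kappa> R" by simp
      then show ?thesis unfolding f_def g_def by (simp only: lin_diff lin_smult lin_pCons0)
    qed
    have gI: "g t $ 1 = I f t $ 1" "g t $ 2 = I f t $ 2 + (\<Sum>i\<le>degree R. coeff R i * \<omega> (Suc i))" if t: "t \<in> iv" for t
      unfolding g_def f_def I_lin_poly[OF W_nice t] unfolding lin_def W_def wseq_Suc[OF t]
      by (simp_all add: algebra_simps sum.distrib)
    have nf: "nice f" unfolding f_def by (intro nice_lin W_nice)
    obtain C where C: "0 \<le> C" "\<And>k t. k \<le> Suc (degree R) \<Longrightarrow> t \<in> iv \<Longrightarrow> norm (Y k t $ 1) \<le> C * (1 + M t) \<and> norm (Y k t $ 2) \<le> C"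
      using Y_bound_global[OF r] by blast
    define D' where "D' = (\<Sum>i\<le>degree R. norm (coeff R i) * (\<Sum>k\<le>Suc i. norm (\<omega> (Suc i - k)) * C))"
    have "L2 f"
    proof (rule L2_if_resolvent_L2[OF r G(1,2), where g=g and \<kappa>=\<kappa> and D=D'])
      show "indef_int iv (\<lambda>t. g t $ 1) (\<lambda>t. - d2 f t)"
        by (rule indef_int_cong[OF I_props(1)[OF nf], where N="{}"]) (auto simp: gI)
      show "indef_int iv (\<lambda>t. g t $ 2) (d1 f)"
        by (rule indef_int_cong[OF indef_int_add[OF I_props(2)[OF nf] indef_int_const], where N="{}"]) (auto simp: gI)
      show "nice g" unfolding g_def by (intro nice_lin W_nice)
      show "0 \<le> D'" unfolding D'_def using C(1) by (intro sum_nonneg mult_nonneg_nonneg) auto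
      show "norm (g t $ 1) \<le> D' * (1 + M t)" if t: "t \<in> iv" for t
      proof -
        have Mt: "0 \<le> M t" using M_nonneg[of t] t by auto
        have "g t $ 1 = (\<Sum>i\<le>degree R. coeff R i * (\<Sum>k\<le>Suc i. \<omega> (Suc i - k) * Y k t $ 1))"
          unfolding g_def lin_def W_def wseq_def by (simp del: sum.atMost_Suc)
        also have "norm \<dots> \<le> (\<Sum>i\<le>degree R. norm (coeff R i) * (\<Sum>k\<le>Suc i. norm (\<omega> (Suc i - k)) * (C * (1 + M t))))"
        proof (rule sum_norm_le)
          fix i assume i: "i \<in> {..degree R}"
          have "norm (\<Sum>k\<le>Suc i. \<omega> (Suc i - k) * Y k t $ 1) \<le> (\<Sum>k\<le>Suc i. norm (\<omega> (Suc i - k)) * (C * (1 + M t)))"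
          proof (rule sum_norm_le)
            fix k assume "k \<in> {..Suc i}"
            then have "norm (Y k t $ 1) \<le> C * (1 + M t)" using C(2)[of k t] i t by auto
            then show "norm (\<omega> (Suc i - k) * Y k t $ 1) \<le> norm (\<omega> (Suc i - k)) * (C * (1 + M t))"
              unfolding norm_mult by (rule mult_left_mono) simp
          qed
          then show "norm (coeff R i * (\<Sum>k\<le>Suc i. \<omega> (Suc i - k) * Y k t $ 1)) \<le> norm (coeff R i) * (\<Sum>k\<le>Suc i. norm (\<omega> (Suc i - k)) * (C * (1 + M t)))"
            unfolding norm_mult by (rule mult_left_mono) simp
        qed
        also have "\<dots> = D' * (1 + M t)" unfolding D'_def sum_distrib_right mult.assoc ..
        finally show ?thesis .
      qed
      show "((\<lambda>t. g t $ 2) \<longlongrightarrow> 0) G"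
      proof -
        have "((\<lambda>t. \<Sum>i\<le>degree R. coeff R i * W (Suc i) t $ 2) \<longlongrightarrow> (\<Sum>i\<le>degree R. coeff R i * 0)) G"
          unfolding W_def by (intro tendsto_intros limS)
        then show ?thesis unfolding g_def lin_def by simp
      qed
      show "\<kappa> \<noteq> 0" by fact
      show "L2 (\<lambda>t. g t - \<kappa> *s f t)" by (rule iffD1[OF L2_cong[OF gf] that(2)])
    qed
    then show ?thesis unfolding f_def .
  qed
  have "\<exists>c. c \<noteq> 0 \<and> P = monom c (degree P)"
    using poly_min_degree_monomial[where Z="\<lambda>R. L2 (lin W R)" and P=P] P div by blast
  then obtain c where c: "c \<noteq> 0" "P = monom c (degree P)" by blast
  \<comment> \<open>\<open>P1\<close> bounds the degree from above; minimality of D among the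
    combinations of the \<open>Y n\<close> bounds it from below.\<close>
  have "degree P = D"
  proof -
    have "degree P \<le> D" using P(3)[OF P1(1,3)] P1(2) by simp
    moreover have "D \<le> degree (conv_poly \<omega> P)"
    proof (rule Delta_minimal[OF _ conv_poly_nonzero[of \<omega> P, OF om0 P(1)]])
      have "lin W P = lin Y (conv_poly \<omega> P)" unfolding W_def by (auto simp: lin_wseq)
      then show "L2 (lin Y (conv_poly \<omega> P))" using P(2) by simp
    qed
    ultimately show ?thesis using conv_poly_degree[of \<omega> P] by simp
  qed
  then have "lin W P t = c *s W D t" for t using c(2) lin_monom by metis
  then have "L2 (\<lambda>t. (1 / c) *s (c *s W D t))" using L2_scale[OF P(2), of "1 / c"] by simp
  moreover have "(\<lambda>t. (1 / c) *s (c *s W D t)) = W D" using c(1) by (simp add: fun_eq_iff vec2_eq_iff)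
  ultimately have WD: "L2 (W D)" by simp
  have "L2 (W n)" if "D \<le> n" for n
    using that
  proof (induction n rule: dec_induct)
    case base show ?case by (rule WD)
  next
    case (step n)
    \<comment> \<open>As w_(n+1) has second component tending to 0 along G, the limit l must be the
      negative of the added constant \<omega>_(n+1). Subtracting (0, l) from I w_n therefore gives
      w_(n+1).\<close>
    obtain l where l: "((\<lambda>t. I (W n) t $ 2) \<longlongrightarrow> l) (at_left b)" "L2 (\<lambda>t. I (W n) t - vector [0, l])"
      by (rule I_L2[OF W_nice step.IH])
    have ev: "\<forall>\<^sub>F t in G. t \<in> iv" using eventually_at_left_real[OF ab] G(1) by (auto simp: le_filter_def elim!: eventually_mono)
    have "((\<lambda>t. I (W n) t $ 2 + \<omega> (Suc n)) \<longlongrightarrow> l + \<omega> (Suc n)) G" using l(1) G(1) tendsto_mono by (intro tendsto_intros) blast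
    moreover have "\<forall>\<^sub>F t in G. I (W n) t $ 2 + \<omega> (Suc n) = wseq \<omega> (Suc n) t $ 2"
      using ev by eventually_elim (simp add: wseq_Suc W_def)
    ultimately have "((\<lambda>t. wseq \<omega> (Suc n) t $ 2) \<longlongrightarrow> l + \<omega> (Suc n)) G" by (rule Lim_transform_eventually)
    then have "l + \<omega> (Suc n) = 0" using tendsto_unique[OF G(2) _ limS] by blast
    then have ll: "l = - \<omega> (Suc n)" by (simp add: eq_neg_iff_add_eq_0)
    have "I (W n) t - vector [0, l] = W (Suc n) t" if "t \<in> {a<..<b}" for t
      using that unfolding W_def ll by (simp add: wseq_Suc vec2_eq_iff)
    from iffD1[OF L2_cong[OF this] l(2)] show ?case .
  qed
  then show ?thesis using om0 limS unfolding W_def by blast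
qed

lemma omega_unique:
  assumes "\<omega> 0 = 1" "\<omega>' 0 = 1" "\<And>n. D \<le> n \<Longrightarrow> L2 (wseq \<omega> n)" "\<And>n. D \<le> n \<Longrightarrow> L2 (wseq \<omega>' n)"
  shows "\<omega> = \<omega>'"
proof (rule ccontr)
  assume ne: "\<omega> \<noteq> \<omega>'"
  define \<delta> where "\<delta> n = \<omega> n - \<omega>' n" for n
  have ex: "\<exists>n. \<delta> n \<noteq> 0" using ne unfolding \<delta>_def by auto
  define m where "m = (LEAST n. \<delta> n \<noteq> 0)"
  have m: "\<delta> m \<noteq> 0" unfolding m_def using ex by (rule LeastI_ex)
  have lt: "\<delta> n = 0" if "n < m" for n using not_less_Least that unfolding m_def by blast
  have "\<delta> 0 = 0" using assms(1,2) by (simp add: \<delta>_def)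
  then have "m \<noteq> 0" using m by (cases m) auto
  \<comment> \<open>For this n the difference of the two w_n has \<delta> m, the first non-zero
    difference, as coefficient of \<open>Y (D - 1)\<close>, and all higher coefficients vanish. It
    is a non-trivial L^2 combination of degree below D.\<close>
  define n where "n = D - 1 + m"
  have n: "D \<le> n" using \<open>m \<noteq> 0\<close> unfolding n_def by simp
  define P where "P = (\<Sum>k\<le>n. monom (\<delta> (n - k)) k)"
  have cP: "coeff P k = (if k \<le> n then \<delta> (n - k) else 0)" for k unfolding P_def by (rule sum_poly_coeff(1))
  have "n - (D - 1) = m" unfolding n_def by simp
  then have "coeff P (D - 1) \<noteq> 0" using m cP[of "D - 1"] unfolding n_def by simp
  then have P0: "P \<noteq> 0" by auto
  have "degree P \<le> D - 1"
  proof (rule degree_le, intro allI impI)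
    fix i assume "D - 1 < i"
    then have "i \<le> n \<Longrightarrow> n - i < m" unfolding n_def by simp
    then show "coeff P i = 0" using lt cP by simp
  qed
  moreover have "L2 (lin Y P)"
  proof -
    have L: "L2 (\<lambda>t. wseq \<omega> n t - wseq \<omega>' n t)" by (rule L2_diff[OF assms(3)[OF n] assms(4)[OF n]])
    have e: "wseq \<omega> n t - wseq \<omega>' n t = lin Y P t" for t
      unfolding P_def sum_poly_coeff(3) wseq_def sum_subtractf[symmetric] \<delta>_def by (simp add: vec2_eq_iff algebra_simps)
    show ?thesis by (rule iffD1[OF L2_cong[OF e] L])
  qed
  ultimately show False using Delta_minimal[OF _ P0] D_pos by simp
qed

end

section \<open>The properties of one side, independent of its orientation\<close>

definition JHint :: "real \<Rightarrow> real \<Rightarrow> (real \<Rightarrow> real^2^2) \<Rightarrow> fn \<Rightarrow> fn \<Rightarrow> bool" where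
  "JHint lo hi H f g \<longleftrightarrow> (\<forall>i. indef_int {lo<..<hi} (\<lambda>t. f t $ i) (\<lambda>t. (Jmat *v (cmat (H t) *v g t)) $ i))"

text \<open>The filter e stands for the regular endpoint and s for the singular one, so the same
  interface serves both sides. \<open>w_indep\<close> is phrased for relations modulo H because that
  is how the decomposition of f is given.\<close>

locale side_facts =
  fixes lo hi :: real and H :: "real \<Rightarrow> real^2^2" and e s :: "real filter"
    and \<omega> :: "nat \<Rightarrow> complex" and w :: "nat \<Rightarrow> fn" and D :: nat
  assumes lohi: "lo < hi"
    and psd_ae: "AE t\<in>{lo<..<hi} in lebesgue. pos_semidef (H t)"
    and omega_0: "\<omega> 0 = 1" and omega_real: "cnj (\<omega> n) = \<omega> n"
    and w_0: "t \<in> {lo<..<hi} \<Longrightarrow> w 0 t = vector [0, 1]"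
    and w_real: "t \<in> {lo<..<hi} \<Longrightarrow> cnj (w n t $ i) = w n t $ i"
    and w_JHint: "JHint lo hi H (w (Suc n)) (w n)"
    and w_end: "(w n \<longlongrightarrow> vector [0, \<omega> n]) e"
    and w_sing: "((\<lambda>t. w (Suc n) t $ 2) \<longlongrightarrow> 0) s"
    and w_L2H: "D \<le> n \<Longrightarrow> w n \<in> L2H H lo hi"
    and D_pos: "0 < D"
    and w_indep: "m \<le> D \<Longrightarrow> f \<in> L2H H lo hi \<Longrightarrow> g \<in> L2H H lo hi \<Longrightarrow> D \<le> k \<Longrightarrow>
       (AE t\<in>{lo<..<hi} in lebesgue. cmat (H t) *v (\<Sum>k<m. \<mu> k *s w k t) = cmat (H t) *v (g t - c *s f t - d *s w k t)) \<Longrightarrow>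
       j < m \<Longrightarrow> \<mu> j = 0"
    and L2H_sol: "f \<in> L2H H lo hi \<Longrightarrow> g \<in> L2H H lo hi \<Longrightarrow> JHint lo hi H fh g \<Longrightarrow> eq_H H lo hi fh f \<Longrightarrow>
       ((\<lambda>t. fh t $ 2) \<longlongrightarrow> 0) s \<and> (\<exists>v. (fh \<longlongrightarrow> v) e)"
    and L2H_cdot: "f \<in> L2H H lo hi \<Longrightarrow> g \<in> L2H H lo hi \<Longrightarrow>
       (\<lambda>t. cdot (f t) (cmat (H t) *v g t)) absolutely_integrable_on {lo<..<hi}"
    and L2H_JH: "g \<in> L2H H lo hi \<Longrightarrow> lo < x \<Longrightarrow> y < hi \<Longrightarrow>
       (\<lambda>t. (Jmat *v (cmat (H t) *v g t)) $ i) absolutely_integrable_on {x..y}"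
    and indiv_omega: "indivisible H lo hi \<Longrightarrow> \<omega> (Suc n) = 0"
    and indiv_row: "indivisible H lo hi \<Longrightarrow> AE t\<in>{lo<..<hi} in lebesgue. H t $ 1 $ 1 = 0 \<and> H t $ 1 $ 2 = 0 \<and> H t $ 2 $ 1 = 0"
    and kernel: "(AE t\<in>{lo<..<hi} in lebesgue. cmat (H t) *v v = 0) \<Longrightarrow> v $ 2 = 0 \<and> (\<not> indivisible H lo hi \<longrightarrow> v = 0)"

lemma sesq_hermitian: "sesq \<alpha> \<beta> \<gamma> u v = cnj (sesq \<alpha> \<beta> \<gamma> v u)"
  by (simp add: sesq_def algebra_simps)

text \<open>The form at u depends only on the image of u under the matrix, so square integrability
  is invariant under \<open>eq_H\<close>.\<close>

lemma qform_cong_image: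
  assumes "\<alpha> * u $ 1 + \<beta> * u $ 2 = \<alpha> * v $ 1 + \<beta> * v $ 2" "\<beta> * u $ 1 + \<gamma> * u $ 2 = \<beta> * v $ 1 + \<gamma> * v $ 2"
  shows "qform \<alpha> \<beta> \<gamma> u = qform \<alpha> \<beta> \<gamma> v"
proof -
  have "sesq \<alpha> \<beta> \<gamma> x u = sesq \<alpha> \<beta> \<gamma> x v" for x unfolding sesq_def assms ..
  then have "sesq \<alpha> \<beta> \<gamma> u u = cnj (sesq \<alpha> \<beta> \<gamma> v u)" using sesq_hermitian by metis
  also have "\<dots> = cnj (sesq \<alpha> \<beta> \<gamma> v v)" unfolding sesq_def[of _ _ _ v u] assms sesq_def[of _ _ _ v v] ..
  finally show ?thesis unfolding qform_def by simp
qed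

lemma AE_interval_iff:
  "(AE t\<in>S in lebesgue. P t) \<longleftrightarrow> (\<exists>N. negligible N \<and> (\<forall>t\<in>S - N. P t))"
proof
  assume "AE t\<in>S in lebesgue. P t"
  then obtain N where "N \<in> null_sets lebesgue" "{t. \<not> (t \<in> S \<longrightarrow> P t)} \<subseteq> N" by (auto simp: eventually_ae_filter)
  then show "\<exists>N. negligible N \<and> (\<forall>t\<in>S - N. P t)" unfolding negligible_iff_null_sets by (intro exI[of _ N]) auto
next
  assume "\<exists>N. negligible N \<and> (\<forall>t\<in>S - N. P t)"
  then obtain N where N: "N \<in> null_sets lebesgue" "\<forall>t\<in>S - N. P t" unfolding negligible_iff_null_sets by blast
  show "AE t\<in>S in lebesgue. P t" by (rule AE_I'[OF N(1)]) (use N(2) in auto)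
qed

lemma indef_int_zero_const:
  assumes i: "indef_int S f (\<lambda>t. 0)" and xy: "x \<in> S" "y \<in> S" shows "f x = f y"
proof (cases "x \<le> y")
  case True
  show ?thesis using has_integral_unique[OF indef_intD(2)[OF i xy True] has_integral_0] by simp
next
  case False
  then have yx: "y \<le> x" by simp
  show ?thesis using has_integral_unique[OF indef_intD(2)[OF i xy(2,1) yx] has_integral_0] by simp
qed

lemma indef_int_tendsto_left:
  fixes f g :: "real \<Rightarrow> complex"
  assumes f: "indef_int {a<..<b} f g" and c: "a < c" "c < b" and g: "g absolutely_integrable_on {a..c}"
  shows "\<exists>l. (f \<longlongrightarrow> l) (at_right a)"
proof -
  define J where "J t = f c - integral {t..c} g" for t
  have "continuous_on {a..c} J" unfolding J_def
    by (intro continuous_intros indefinite_integral_continuous_1' absolutely_integrable_imp_integrable[OF g])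
  then have "(J \<longlongrightarrow> J a) (at a within {a..c})" unfolding continuous_on_def by (rule bspec) (use c in simp)
  then have J: "(J \<longlongrightarrow> J a) (at_right a)" using c by (simp add: at_within_Icc_at_right)
  have "\<forall>\<^sub>F t in at_right a. J t = f t"
    using eventually_at_right_real[OF c(1)]
  proof eventually_elim
    case (elim t)
    have "integral {t..c} g = f c - f t" by (rule integral_unique, rule indef_intD(2)[OF f]) (use elim c in auto)
    then show ?case unfolding J_def by simp
  qed
  from Lim_transform_eventually[OF J this] show ?thesis by blast
qed

lemma tendsto_vec2:
  fixes f :: fn
  assumes "((\<lambda>t. f t $ 1) \<longlongrightarrow> x) G" "((\<lambda>t. f t $ 2) \<longlongrightarrow> y) G"
  shows "(f \<longlongrightarrow> vector [x, y]) G"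
proof (rule vec_tendstoI)
  fix i :: 2
  show "((\<lambda>t. f t $ i) \<longlongrightarrow> vector [x, y] $ i) G" using assms exhaust_2[of i] by (elim disjE) simp_all
qed

context hs_side begin

lemma JHint_indef:
  assumes "JHint a b H f g"
  shows "indef_int {a<..<b} (\<lambda>t. f t $ 1) (\<lambda>t. - d2 g t)" "indef_int {a<..<b} (\<lambda>t. f t $ 2) (d1 g)"
proof -
  have i: "indef_int {a<..<b} (\<lambda>t. f t $ i) (\<lambda>t. (Jmat *v (cmat (H t) *v g t)) $ i)" for i using assms unfolding JHint_def by blast
  show "indef_int {a<..<b} (\<lambda>t. f t $ 1) (\<lambda>t. - d2 g t)"
    by (rule indef_int_cong[OF i[of 1] _ negligible_bad]) (auto simp: JH_eq)
  show "indef_int {a<..<b} (\<lambda>t. f t $ 2) (d1 g)"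
    by (rule indef_int_cong[OF i[of 2] _ negligible_bad]) (auto simp: JH_eq)
qed

lemma indef_JHint:
  assumes "indef_int {a<..<b} (\<lambda>t. f t $ 1) (\<lambda>t. - d2 g t)" "indef_int {a<..<b} (\<lambda>t. f t $ 2) (d1 g)"
  shows "JHint a b H f g"
  unfolding JHint_def
proof
  fix i :: 2
  have 1: "indef_int {a<..<b} (\<lambda>t. f t $ 1) (\<lambda>t. (Jmat *v (cmat (H t) *v g t)) $ 1)"
    by (rule indef_int_cong[OF assms(1) _ negligible_bad]) (auto simp: JH_eq)
  have 2: "indef_int {a<..<b} (\<lambda>t. f t $ 2) (\<lambda>t. (Jmat *v (cmat (H t) *v g t)) $ 2)"
    by (rule indef_int_cong[OF assms(2) _ negligible_bad]) (auto simp: JH_eq)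
  show "indef_int {a<..<b} (\<lambda>t. f t $ i) (\<lambda>t. (Jmat *v (cmat (H t) *v g t)) $ i)"
    using 1 2 exhaust_2[of i] by (elim disjE) simp_all
qed

lemma Hmult_eq:
  assumes "t \<in> {a<..<b}" "t \<notin> bad"
  shows "(cmat (H t) *v u) $ 1 = h1 t * u $ 1 + h3 t * u $ 2" "(cmat (H t) *v u) $ 2 = h3 t * u $ 1 + h2 t * u $ 2"
  using h_psd(4)[of t] assms by (simp_all add: matrix_vector_mult_2 hval_eq)

lemma L2_eq_H:
  assumes "L2 g" "mf f" "AE t\<in>{a<..<b} in lebesgue. cmat (H t) *v f t = cmat (H t) *v g t"
  shows "L2 f"
proof -
  obtain N where N: "negligible N" "\<And>t. t \<in> {a<..<b} - N \<Longrightarrow> cmat (H t) *v f t = cmat (H t) *v g t"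
    using assms(3) unfolding AE_interval_iff by blast
  have "q f t = q g t" if t: "t \<in> {a..b} - (N \<union> bad)" for t
  proof (cases "t \<in> {a<..<b}")
    case True
    then have "cmat (H t) *v f t = cmat (H t) *v g t" using N(2) t by auto
    then show ?thesis unfolding q_def using Hmult_eq[of t] True t by (intro qform_cong_image) (metis UnCI DiffD2)+
  next
    case False then show ?thesis by (simp add: q_def qform_eq hval_outside)
  qed
  note e = this
  have "negligible (N \<union> bad)" using N(1) negligible_bad by simp
  then have "q f absolutely_integrable_on {a..b}"
    by (rule absolutely_integrable_spike[OF assms(1)[unfolded L2_def, THEN conjunct2]]) (rule e)
  then show ?thesis using assms(2) unfolding L2_def by simp
qed

lemma L2_sesq:
  assumes "L2 f" "L2 g"
  shows "(\<lambda>t. cdot (f t) (cmat (H t) *v g t)) absolutely_integrable_on {a<..<b}"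
proof -
  define S where "S t = sesq (h1 t) (h3 t) (h2 t) (f t) (g t)" for t
  have S: "S t = cnj (f t $ 1) * d1 g t + cnj (f t $ 2) * d2 g t" for t by (simp add: S_def sesq_def d1_def d2_def)
  have m: "mf f" "mf g" using assms unfolding L2_def by auto
  have "S absolutely_integrable_on {a<..<b}"
  proof (rule measurable_bounded_by_integrable_imp_absolutely_integrable[where g="\<lambda>t. (q f t + q g t) / 2"])
    have f: "(\<lambda>t. f t $ i) \<in> borel_measurable (lebesgue_on {a<..<b})" for i
      using m(1) borel_measurable_vec_nth unfolding mf_def by blast
    have c: "(\<lambda>t. cnj (f t $ i)) \<in> borel_measurable (lebesgue_on {a<..<b})" for i
      by (rule borel_measurable_continuous_on[OF _ f, of cnj]) (auto intro!: continuous_intros)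
    note [measurable] = c[of 1] c[of 2] d_measurable_on(1,2)[OF m(2)]
    show "S \<in> borel_measurable (lebesgue_on {a<..<b})" unfolding S by measurable
    have "q f absolutely_integrable_on {a<..<b}" "q g absolutely_integrable_on {a<..<b}"
      using assms unfolding L2_def absolutely_integrable_open_closed by auto
    then show "(\<lambda>t. (q f t + q g t) / 2) integrable_on {a<..<b}"
      by (intro integrable_on_divide integrable_add absolutely_integrable_imp_integrable)
    fix t show "norm (S t) \<le> (q f t + q g t) / 2"
      unfolding S_def q_def by (rule norm_sesq_le) (rule h_psd)+
  qed simp
  then show ?thesis
    by (rule absolutely_integrable_spike[OF _ negligible_bad]) (auto simp: cdot_eq S_def)
qed

lemma Y_real: "t \<in> iv \<Longrightarrow> cnj (Y k t $ i) = Y k t $ i"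
proof (induction k arbitrary: t i)
  case 0 then show ?case using exhaust_2[of i] by (elim disjE) (simp_all add: Y_0)
next
  case (Suc k)
  have c: "cnj (integral {a..t} g) = integral {a..t} g" if "\<And>s. s \<in> {a..t} \<Longrightarrow> cnj (g s) = g s" for g
    using integral_cnj[of "{a..t}" g] integral_cong[of "{a..t}" "\<lambda>s. cnj (g s)" g] that by simp
  have s: "cnj (d1 (Y k) s) = d1 (Y k) s" "cnj (d2 (Y k) s) = d2 (Y k) s" if "s \<in> {a..t}" for s
    using Suc.IH[of s] that Suc.prems by (auto simp: d1_def d2_def)
  show ?case unfolding Y_Suc I_eq[OF Y_nice Suc.prems]
    using exhaust_2[of i] c[of "d1 (Y k)"] c[of "d2 (Y k)"] s by (elim disjE) simp_all
qed

text \<open>If cos \<phi> were non-zero, h_2 would be a constant multiple of h_1 and thus integrable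
  up to b, against the limit point case.\<close>

lemma indivisible_type_vertical:
  assumes "indivisible_type H \<phi> a b" shows "cos \<phi> = 0"
proof (rule ccontr)
  assume c: "cos \<phi> \<noteq> 0"
  obtain N where N: "negligible N" "\<And>t. t \<in> {a<..<b} - N \<Longrightarrow> h1 t * sin \<phi> = h3 t * cos \<phi> \<and> h3 t * sin \<phi> = h2 t * cos \<phi>"
    using indivisible_rows[OF assms order_refl order_refl] by metis
  have e: "h2 t = (sin \<phi> / cos \<phi>)\<^sup>2 * h1 t" if "t \<in> {a..b} - N" for t
  proof (cases "t \<in> {a<..<b}")
    case True
    then have "h1 t * sin \<phi> = h3 t * cos \<phi>" "h3 t * sin \<phi> = h2 t * cos \<phi>" using N(2) that by auto
    then have "h3 t = h1 t * sin \<phi> / cos \<phi>" "h2 t = h3 t * sin \<phi> / cos \<phi>" using c by (simp_all add: eq_divide_eq)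
    then show ?thesis by (simp add: power2_eq_square)
  next
    case False then show ?thesis by (simp add: hval_outside)
  qed
  have "(\<lambda>t. (sin \<phi> / cos \<phi>)\<^sup>2 * h1 t) absolutely_integrable_on {a..b}" by (rule set_integrable_mult_right, rule h1_integrable)
  then have "h2 absolutely_integrable_on {a..b}" by (rule absolutely_integrable_spike[OF _ N(1)]) (rule e)
  then have "h2 absolutely_integrable_on {(a + b) / 2..b}" by (rule absolutely_integrable_subinterval) (use ab in auto)
  then show False using h2_not_integrable[of "(a + b) / 2"] ab by simp
qed

lemma indivisible_h:
  assumes "indivisible H a b"
  obtains N where "negligible N" "\<And>t. t \<in> {a<..<b} - N \<Longrightarrow> h1 t = 0 \<and> h3 t = 0"
proof -
  obtain \<phi> where \<phi>: "indivisible_type H \<phi> a b" using assms unfolding indivisible_def by blast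
  have c: "cos \<phi> = 0" by (rule indivisible_type_vertical[OF \<phi>])
  then have s: "sin \<phi> \<noteq> 0" using sin_cos_squared_add[of \<phi>] by auto
  obtain N where N: "negligible N" "\<And>t. t \<in> {a<..<b} - N \<Longrightarrow> h1 t * sin \<phi> = h3 t * cos \<phi> \<and> h3 t * sin \<phi> = h2 t * cos \<phi>"
    using indivisible_rows[OF \<phi> order_refl order_refl] by metis
  show thesis by (rule that[OF N(1)]) (use N(2) c s in auto)
qed

text \<open>A non-zero constant vector (x, y) in the kernel of H leaves the direction of (y, -x) as
  the range of H almost everywhere. The whole interval is then indivisible, and its type is vertical
  by \<open>indivisible_type_vertical\<close>, which means y = 0.\<close>

lemma real_kernel:
  fixes x y :: real
  assumes k: "\<And>t. t \<in> {a<..<b} - N \<Longrightarrow> h1 t * x + h3 t * y = 0 \<and> h3 t * x + h2 t * y = 0" and N: "negligible N"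
    and ne: "x \<noteq> 0 \<or> y \<noteq> 0"
  shows "y = 0 \<and> indivisible H a b"
proof -
  define \<rho> where "\<rho> = sqrt (x\<^sup>2 + y\<^sup>2)"
  have \<rho>: "\<rho> > 0" "\<rho>\<^sup>2 = x\<^sup>2 + y\<^sup>2" unfolding \<rho>_def using ne by (auto simp: sum_power2_gt_zero_iff)
  have "(y / \<rho>)\<^sup>2 + (- x / \<rho>)\<^sup>2 = (x\<^sup>2 + y\<^sup>2) / \<rho>\<^sup>2" by (simp add: power_divide add_divide_distrib)
  then have "(y / \<rho>)\<^sup>2 + (- x / \<rho>)\<^sup>2 = 1" unfolding \<rho>(2)[symmetric] using \<rho>(1) by simp
  then obtain \<phi> where "y / \<rho> = cos \<phi>" "- x / \<rho> = sin \<phi>" using sincos_total_2pi by metis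
  then have xy: "y = \<rho> * cos \<phi>" "x = - (\<rho> * sin \<phi>)" using \<rho>(1) by (auto simp: field_simps)
  have Z: "negligible {t \<in> {a<..<b}. H t = 0}" using ham unfolding hamiltonian_def negligible_iff_null_sets by blast
  define N' where "N' = N \<union> bad \<union> {t \<in> {a<..<b}. H t = 0}"
  have N': "negligible N'" unfolding N'_def using N negligible_bad Z by simp
  have r: "range ((*v) (H t)) = span {xi_vec \<phi>}" if t: "t \<in> {a<..<b} - N'" for t
  proof -
    have tt: "t \<in> {a<..<b}" "t \<notin> bad" "t \<in> {a<..<b} - N" "H t \<noteq> 0" using t unfolding N'_def by auto
    have "\<rho> * (h3 t * cos \<phi> - h1 t * sin \<phi>) = 0" "\<rho> * (h2 t * cos \<phi> - h3 t * sin \<phi>) = 0"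
      using k[OF tt(3)] unfolding xy by (simp_all add: algebra_simps)
    then have r1: "h3 t * cos \<phi> = h1 t * sin \<phi>" and r2: "h2 t * cos \<phi> = h3 t * sin \<phi>" using \<rho>(1) by auto
    \<comment> \<open>T is the trace of H, and H is T times the orthogonal projection onto the
      direction \<phi>. T is non-zero because H is.\<close>
    define T where "T = h1 t + h2 t"
    have sc: "sin \<phi> * sin \<phi> + cos \<phi> * cos \<phi> = 1" using sin_cos_squared_add[of \<phi>] by (simp add: power2_eq_square)
    have e1: "h1 t = T * (cos \<phi> * cos \<phi>)" unfolding T_def using r1 r2 sc by algebra
    have e2: "h2 t = T * (sin \<phi> * sin \<phi>)" unfolding T_def using r1 r2 sc by algebra
    have e3: "h3 t = T * (cos \<phi> * sin \<phi>)" unfolding T_def using r1 r2 sc by algebra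
    have Hx: "H t *v v = (T * (cos \<phi> * v $ 1 + sin \<phi> * v $ 2)) *\<^sub>R xi_vec \<phi>" for v
      using hval_eq[OF tt(1,2)] h_psd(4)[of t] by (simp add: vec2_eq_iff matrix_vector_mult_2 xi_vec_def e1 e2 e3 algebra_simps)
    have "T \<noteq> 0"
    proof
      assume "T = 0"
      then have "h1 t = 0" "h2 t = 0" "h3 t = 0" using e1 e2 e3 by auto
      then have "H t = 0" using hval_eq[OF tt(1,2)] h_psd(4)[of t] by (simp add: vec2_eq_iff)
      then show False using tt(4) by simp
    qed
    show ?thesis
    proof
      show "range ((*v) (H t)) \<subseteq> span {xi_vec \<phi>}" unfolding span_singleton using Hx by auto
      show "span {xi_vec \<phi>} \<subseteq> range ((*v) (H t))"
      proof
        fix v assume "v \<in> span {xi_vec \<phi>}"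
        then obtain c where c: "v = c *\<^sub>R xi_vec \<phi>" unfolding span_singleton by auto
        have "cos \<phi> * (xi_vec \<phi>) $ 1 + sin \<phi> * (xi_vec \<phi>) $ 2 = 1" using sc by (simp add: xi_vec_def add.commute)
        then have "cos \<phi> * ((c / T) *\<^sub>R xi_vec \<phi>) $ 1 + sin \<phi> * ((c / T) *\<^sub>R xi_vec \<phi>) $ 2 = c / T"
          by (simp add: distrib_left[symmetric] mult.left_commute[of "cos \<phi>"] mult.left_commute[of "sin \<phi>"] del: xi_vec_def flip: times_divide_eq_left)
        then have "H t *v ((c / T) *\<^sub>R xi_vec \<phi>) = v" unfolding Hx c using \<open>T \<noteq> 0\<close> by simp
        then show "v \<in> range ((*v) (H t))" by (metis rangeI)
      qed
    qed
  qed
  have "indivisible_type H \<phi> a b" unfolding indivisible_type_def AE_interval_iff using ab N' r by blast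
  then show ?thesis using indivisible_type_vertical xy(1) unfolding indivisible_def by auto
qed

end

context hs_side_finite begin

abbreviation "om \<equiv> omega_seq H a b I"

text \<open>Since \<open>av\<close> is bounded, every sequence tending to b has a subsequence along
  which \<open>av\<close> converges, and \<open>omega_along\<close> applies there. Uniqueness
  identifies all resulting \<omega> with \<open>omega_seq\<close>. So every sequence has a
  subsequence along which the second component tends to 0, which gives the limit at b.\<close>

lemma om_facts:
  shows om_0: "om 0 = 1" and om_L2: "\<And>n. D \<le> n \<Longrightarrow> L2 (wseq om n)"
    and om_sing: "((\<lambda>t. wseq om (Suc n) t $ 2) \<longlongrightarrow> 0) (at_left b)"
proof -
  define Good where "Good \<omega> \<longleftrightarrow> \<omega> 0 = 1 \<and> (\<forall>n\<ge>D. L2 (wseq \<omega> n))" for \<omega>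
  have uniq: "\<omega> = \<omega>'" if "Good \<omega>" "Good \<omega>'" for \<omega> \<omega>'
    using that unfolding Good_def by (intro omega_unique) auto
  have along: "\<exists>\<omega>. Good \<omega> \<and> (\<forall>n. ((\<lambda>t. wseq \<omega> (Suc n) t $ 2) \<longlongrightarrow> 0) G)" if "G \<le> at_left b" "G \<noteq> bot" "(av \<longlongrightarrow> \<alpha>) G" for G \<alpha>
    using omega_along[OF that] unfolding Good_def by blast
  obtain r where r: "1 \<le> r" "\<And>t. t \<in> iv \<Longrightarrow> \<bar>av t\<bar> \<le> r" using av_bdd by blast
  have sub: "\<exists>s. strict_mono s \<and> (\<exists>\<omega>. Good \<omega> \<and> (\<forall>n. (\<lambda>k. wseq \<omega> (Suc n) (x (s k)) $ 2) \<longlonglongrightarrow> 0))"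
    if x: "\<And>k. x k \<in> {a<..<b}" "x \<longlonglongrightarrow> b" for x
  proof -
    have "av (x k) \<in> {-r..r}" for k using r(2)[of "x k"] x(1)[of k] by (auto simp: abs_le_iff)
    then have "\<forall>k. av (x k) \<in> {-r..r}" ..
    then obtain l s where s: "strict_mono s" "((\<lambda>k. av (x k)) \<circ> s) \<longlonglongrightarrow> l"
      using compact_imp_seq_compact[OF compact_Icc[of "-r" r]] unfolding seq_compact_def by metis
    \<comment> \<open>The subsequence is turned into a filter below \<open>at_left b\<close>, the
      form in which \<open>omega_along\<close> expects it.\<close>
    define G where "G = filtermap (\<lambda>k. x (s k)) sequentially"
    have xs: "(\<lambda>k. x (s k)) \<longlonglongrightarrow> b" using LIMSEQ_subseq_LIMSEQ[OF x(2) s(1)] by (simp add: o_def)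
    have "filterlim (\<lambda>k. x (s k)) (at_left b) sequentially"
      unfolding filterlim_at using xs x(1) by (auto intro!: always_eventually)
    then have G1: "G \<le> at_left b" unfolding G_def filterlim_def .
    have G2: "G \<noteq> bot" unfolding G_def by (simp add: filtermap_bot_iff)
    have G3: "(av \<longlongrightarrow> l) G" unfolding G_def filterlim_filtermap using s(2) by (simp add: o_def)
    obtain \<omega> where "Good \<omega>" "\<forall>n. ((\<lambda>t. wseq \<omega> (Suc n) t $ 2) \<longlongrightarrow> 0) G" using along[OF G1 G2 G3] by blast
    then show ?thesis using s(1) unfolding G_def filterlim_filtermap by blast
  qed
  have ex: "\<exists>\<omega>. Good \<omega>"
  proof -
    define x where "x k = b - (b - a) / real (k + 2)" for k :: nat
    have 1: "x k \<in> {a<..<b}" for k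
    proof -
      have "(b - a) * 1 < (b - a) * real (k + 2)" using ab by (intro mult_strict_left_mono) auto
      then have "(b - a) / real (k + 2) < b - a" by (simp add: divide_less_eq)
      then show ?thesis using ab unfolding x_def by auto
    qed
    have "(\<lambda>k. b - (b - a) / real (k + 2)) \<longlonglongrightarrow> b - 0"
      by (intro tendsto_intros real_tendsto_divide_at_top filterlim_compose[OF filterlim_real_sequentially filterlim_add_const_nat_at_top]) auto
    then have 2: "x \<longlonglongrightarrow> b" unfolding x_def by simp
    show ?thesis using sub[OF 1 2] by blast
  qed
  then obtain \<omega> where \<omega>: "Good \<omega>" by blast
  have iff: "(\<forall>n. Delta_num H a b I \<le> enat n \<longrightarrow> w_comb I \<omega>' n \<in> L2H H a b) \<longleftrightarrow> (\<forall>n\<ge>D. L2 (wseq \<omega>' n))" for \<omega>'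
    unfolding Delta using w_comb_L2H L2H_w_comb by auto
  have "om = \<omega>" unfolding omega_seq_def
  proof (rule the_equality)
    show "\<omega> 0 = 1 \<and> (\<forall>n. Delta_num H a b I \<le> enat n \<longrightarrow> w_comb I \<omega> n \<in> L2H H a b)" unfolding iff using \<omega> unfolding Good_def .
    fix \<omega>' assume "\<omega>' 0 = 1 \<and> (\<forall>n. Delta_num H a b I \<le> enat n \<longrightarrow> w_comb I \<omega>' n \<in> L2H H a b)"
    then have "Good \<omega>'" unfolding iff Good_def .
    then show "\<omega>' = \<omega>" using uniq \<omega> by blast
  qed
  then have Gom: "Good om" using \<omega> by simp
  then show "om 0 = 1" "\<And>n. D \<le> n \<Longrightarrow> L2 (wseq om n)" unfolding Good_def by auto
  show "((\<lambda>t. wseq om (Suc n) t $ 2) \<longlongrightarrow> 0) (at_left b)"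
  proof (rule tendsto_at_left_sequentially[OF ab])
    fix S assume S: "\<And>k. S k < b" "\<And>k. a < S k" "incseq S" "S \<longlonglongrightarrow> b"
    define f where "f k = wseq om (Suc n) (S k) $ 2" for k
    show "(\<lambda>k. wseq om (Suc n) (S k) $ 2) \<longlonglongrightarrow> 0"
    proof (rule ccontr)
      assume "\<not> (\<lambda>k. wseq om (Suc n) (S k) $ 2) \<longlonglongrightarrow> 0"
      then obtain \<epsilon> where e: "\<epsilon> > 0" "\<not> (\<forall>\<^sub>F k in sequentially. dist (f k) 0 < \<epsilon>)" unfolding tendsto_iff f_def by blast
      obtain u :: "nat \<Rightarrow> nat" where u: "strict_mono u" "\<forall>k. \<not> dist (f (u k)) 0 < \<epsilon>"
        using not_eventually_sequentiallyD[OF e(2)] by (elim exE conjE)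
      have x: "\<And>k. S (u k) \<in> {a<..<b}" using S by auto
      have "(\<lambda>k. S (u k)) \<longlonglongrightarrow> b" using LIMSEQ_subseq_LIMSEQ[OF S(4) u(1)] by (simp add: o_def)
      from sub[OF x this] obtain s \<omega>' where s: "Good \<omega>'" "(\<lambda>k. wseq \<omega>' (Suc n) (S (u (s k))) $ 2) \<longlonglongrightarrow> 0" by blast
      have "\<omega>' = om" by (rule uniq[OF s(1) Gom])
      then have "(\<lambda>k. f (u (s k))) \<longlonglongrightarrow> 0" using s(2) unfolding f_def by simp
      then have "\<forall>\<^sub>F k in sequentially. dist (f (u (s k))) 0 < \<epsilon>" using e(1) tendstoD by blast
      then show False using u(2) by (auto dest: eventually_happens)
    qed
  qed
qed

text \<open>H and the \<open>Y k\<close> are real, so the conjugate sequence has the characterising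
  properties as well, and uniqueness applies.\<close>

lemma om_real: "cnj (om n) = om n"
proof -
  define \<omega>' where "\<omega>' n = cnj (om n)" for n
  have "\<omega>' = om"
  proof (rule omega_unique)
    show "\<omega>' 0 = 1" "om 0 = 1" unfolding \<omega>'_def using om_0 by auto
    show "\<And>n. D \<le> n \<Longrightarrow> L2 (wseq om n)" by (rule om_L2)
    fix n assume n: "D \<le> n"
    have e: "wseq \<omega>' n t $ i = cnj (wseq om n t $ i)" if "t \<in> {a<..<b}" for t i
      using that unfolding wseq_def \<omega>'_def by (simp add: Y_real cnj_sum)
    have "q (wseq \<omega>' n) t = q (wseq om n) t" for t
    proof (cases "t \<in> {a<..<b}")
      case True show ?thesis unfolding q_def qform_eq e[OF True] by simp
    next
      case False then show ?thesis by (simp add: q_def qform_eq hval_outside)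
    qed
    then have "q (wseq \<omega>' n) = q (wseq om n)" by (rule ext)
    then show "L2 (wseq \<omega>' n)" using om_L2[OF n] nice_mf[OF wseq_nice] unfolding L2_def by simp
  qed
  then have "\<omega>' n = om n" by simp
  then show ?thesis unfolding \<omega>'_def .
qed

theorem side_facts_left: "side_facts a b H (at_right a) (at_left b) om (w_comb I om) D"
proof
  show "a < b" by (rule ab)
  show "AE t\<in>{a<..<b} in lebesgue. pos_semidef (H t)" using ham unfolding hamiltonian_def by (elim conjE)
  show "om 0 = 1" by (rule om_0)
  show "cnj (om n) = om n" for n by (rule om_real)
  have we: "w_comb I om n t = wseq om n t" if "t \<in> {a<..<b}" for n t using that by (intro w_comb_eq) auto
  show "w_comb I om 0 t = vector [0, 1]" if "t \<in> {a<..<b}" for t using we[OF that] by (simp add: wseq_0 om_0)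
  show "cnj (w_comb I om n t $ i) = w_comb I om n t $ i" if "t \<in> {a<..<b}" for n t i
    unfolding we[OF that] using that unfolding wseq_def by (simp add: Y_real om_real cnj_sum)
  show "JHint a b H (w_comb I om (Suc n)) (w_comb I om n)" for n
  proof (rule indef_JHint)
    show "indef_int {a<..<b} (\<lambda>t. w_comb I om (Suc n) t $ 1) (\<lambda>t. - d2 (w_comb I om n) t)"
      by (rule indef_int_cong[OF indef_int_subset[OF wseq_indef(1)], where N="{}"]) (auto simp: we intro!: d2_cong)
    show "indef_int {a<..<b} (\<lambda>t. w_comb I om (Suc n) t $ 2) (d1 (w_comb I om n))"
      by (rule indef_int_cong[OF indef_int_subset[OF wseq_indef(2)], where N="{}"]) (auto simp: we intro!: d1_cong)
  qed
  have wa: "wseq om n a = vector [0, om n]" for n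
    using ab I_props(3)[OF wseq_nice] by (cases n) (simp_all add: wseq_0 wseq_Suc vec2_eq_iff)
  have ev_a: "\<forall>\<^sub>F t in at_right a. wseq om n t = w_comb I om n t" for n
    using eventually_at_right_real[OF ab] by eventually_elim (simp add: we)
  have ev_b: "\<forall>\<^sub>F t in at_left b. wseq om n t $ 2 = w_comb I om n t $ 2" for n
    using eventually_at_left_real[OF ab] by eventually_elim (simp add: we)
  show "(w_comb I om n \<longlongrightarrow> vector [0, om n]) (at_right a)" for n
  proof -
    have "(wseq om n \<longlongrightarrow> wseq om n a) (at a within {a..<b})"
      using wseq_nice[of om n] unfolding continuous_on_def by (rule bspec) (use ab in simp)
    moreover have "at a within {a..<b} = at_right a" by (rule at_within_nhd[of _ "{..<b}"]) (use ab in auto)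
    ultimately have "(wseq om n \<longlongrightarrow> vector [0, om n]) (at_right a)" unfolding wa by simp
    then show ?thesis by (rule Lim_transform_eventually[OF _ ev_a])
  qed
  show "((\<lambda>t. w_comb I om (Suc n) t $ 2) \<longlongrightarrow> 0) (at_left b)" for n
    by (rule Lim_transform_eventually[OF om_sing ev_b])
  show "w_comb I om n \<in> L2H H a b" if "D \<le> n" for n by (rule w_comb_L2H[OF om_L2[OF that]])
  show "0 < D" by (rule D_pos)
  show "\<mu> i = 0"
    if m: "m \<le> D" and f: "f \<in> L2H H a b" and g: "g \<in> L2H H a b" and k: "D \<le> k"
      and ae: "AE t\<in>{a<..<b} in lebesgue. cmat (H t) *v (\<Sum>i<m. \<mu> i *s w_comb I om i t) = cmat (H t) *v (g t - c *s f t - d *s w_comb I om k t)"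
      and i: "i < m" for m f g k \<mu> c d i
  proof (rule ccontr)
    assume ne: "\<mu> i \<noteq> 0"
    \<comment> \<open>Padding with zeros presents the sum as a polynomial of degree at most m - 1 <
      D.\<close>
    define \<mu>' where "\<mu>' j = (if j < m then \<mu> j else 0)" for j
    define P where "P = (\<Sum>j\<le>m - 1. monom (\<mu>' j) j)"
    have "coeff P i = \<mu> i" unfolding P_def sum_poly_coeff(1) \<mu>'_def using i by auto
    then have P0: "P \<noteq> 0" using ne by auto
    have dP: "degree P \<le> m - 1" unfolding P_def by (rule sum_poly_coeff(2))
    have lP: "lin (wseq om) P t = (\<Sum>j<m. \<mu> j *s wseq om j t)" for t
    proof -
      have "lin (wseq om) P t = (\<Sum>j\<le>m - 1. \<mu>' j *s wseq om j t)" unfolding P_def by (rule sum_poly_coeff(3))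
      also have "{..m - 1} = {..<m}" using i by auto
      finally show ?thesis unfolding \<mu>'_def by simp
    qed
    have "L2 (\<lambda>t. g t - c *s f t - d *s w_comb I om k t)"
      by (rule L2_diff[OF L2_diff[OF L2H_imp_L2[OF g] L2_scale[OF L2H_imp_L2[OF f]]] L2_scale[OF L2H_imp_L2[OF w_comb_L2H[OF om_L2[OF k]]]]])
    moreover have "mf (lin (wseq om) P)" by (intro nice_mf nice_lin wseq_nice)
    moreover have "AE t\<in>{a<..<b} in lebesgue. cmat (H t) *v lin (wseq om) P t = cmat (H t) *v (g t - c *s f t - d *s w_comb I om k t)"
      using ae by eventually_elim (simp add: lP we)
    ultimately have "L2 (lin (wseq om) P)" by (rule L2_eq_H)
    then have "L2 (lin Y (conv_poly om P))" unfolding lin_wseq[abs_def] .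
    then have "D \<le> degree (conv_poly om P)" by (rule Delta_minimal) (rule conv_poly_nonzero[of om P, OF om_0 P0])
    then show False using conv_poly_degree[of om P] dP m i by simp
  qed
  show "((\<lambda>t. fh t $ 2) \<longlongrightarrow> 0) (at_left b) \<and> (\<exists>v. (fh \<longlongrightarrow> v) (at_right a))"
    if f: "f \<in> L2H H a b" and g: "g \<in> L2H H a b" and J: "JHint a b H fh g" and eq: "eq_H H a b fh f" for f g fh
  proof -
    note ind = JHint_indef[OF J]
    have Lg: "L2 g" by (rule L2H_imp_L2[OF g])
    obtain l where l: "((\<lambda>t. fh t $ 2) \<longlongrightarrow> l) (at_left b)" "L2 (\<lambda>t. fh t - vector [0, l])"
      by (rule L2_antiderivative_L2[OF Lg ind])
    have "continuous_on {a<..<b} fh" unfolding continuous_on_vec2_iff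
      using indef_int_continuous_open[OF ind(1)] indef_int_continuous_open[OF ind(2)] by blast
    then have "L2 fh" using L2_eq_H[OF L2H_imp_L2[OF f] mf_continuous] eq unfolding eq_H_def by blast
    then have "L2 (\<lambda>t. fh t - (fh t - vector [0, l]))" using l(2) by (rule L2_diff)
    \<comment> \<open>The difference of two L^2 functions is the constant (0, l), a multiple of
      \<open>Y 0\<close>, so l must vanish.\<close>
    then have Lv: "L2 (\<lambda>t. vector [0, l])" by simp
    have "l = 0"
    proof (rule ccontr)
      assume "l \<noteq> 0"
      then have "(\<lambda>t. (1 / l) *s vector [0, l]) = Y 0" by (auto simp: Y_0 vec2_eq_iff)
      then show False using L2_scale[OF Lv, of "1 / l"] Y_0_not_L2 by simp
    qed
    define c where "c = (a + b) / 2"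
    have c: "a < c" "c < b" using ab unfolding c_def by auto
    have "(\<lambda>t. - 1 * d2 g t) absolutely_integrable_on {a..c}" by (rule set_integrable_mult_right, rule d2_integrable[OF Lg]) (use c in auto)
    then have i1: "(\<lambda>t. - d2 g t) absolutely_integrable_on {a..c}" by simp
    have i2: "d1 g absolutely_integrable_on {a..c}" by (rule d1_integrable[OF Lg]) (use c in auto)
    obtain x y where "((\<lambda>t. fh t $ 1) \<longlongrightarrow> x) (at_right a)" "((\<lambda>t. fh t $ 2) \<longlongrightarrow> y) (at_right a)"
      using indef_int_tendsto_left[OF ind(1) c i1] indef_int_tendsto_left[OF ind(2) c i2] by blast
    then have "(fh \<longlongrightarrow> vector [x, y]) (at_right a)" by (rule tendsto_vec2)
    then show ?thesis using l(1) \<open>l = 0\<close> by blast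
  qed
  show "(\<lambda>t. cdot (f t) (cmat (H t) *v g t)) absolutely_integrable_on {a<..<b}" if "f \<in> L2H H a b" "g \<in> L2H H a b" for f g
    by (rule L2_sesq[OF L2H_imp_L2[OF that(1)] L2H_imp_L2[OF that(2)]])
  show "(\<lambda>t. (Jmat *v (cmat (H t) *v g t)) $ i) absolutely_integrable_on {x..y}"
    if g: "g \<in> L2H H a b" and xy: "a < x" "y < b" for g x y i
  proof -
    have Lg: "L2 g" by (rule L2H_imp_L2[OF g])
    have "(\<lambda>t. - 1 * d2 g t) absolutely_integrable_on {x..y}" by (rule set_integrable_mult_right, rule d2_integrable[OF Lg]) (use xy in auto)
    then have i1: "(\<lambda>t. - d2 g t) absolutely_integrable_on {x..y}" by simp
    have i2: "d1 g absolutely_integrable_on {x..y}" by (rule d1_integrable[OF Lg]) (use xy in auto)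
    have "(\<lambda>t. (Jmat *v (cmat (H t) *v g t)) $ 1) absolutely_integrable_on {x..y}"
      by (rule absolutely_integrable_spike[OF i1 negligible_bad]) (use xy in \<open>auto simp: JH_eq\<close>)
    moreover have "(\<lambda>t. (Jmat *v (cmat (H t) *v g t)) $ 2) absolutely_integrable_on {x..y}"
      by (rule absolutely_integrable_spike[OF i2 negligible_bad]) (use xy in \<open>auto simp: JH_eq\<close>)
    ultimately show ?thesis using exhaust_2[of i] by (elim disjE) simp_all
  qed
  show "om (Suc n) = 0" if ind: "indivisible H a b" for n
  proof -
    obtain N where N: "negligible N" "\<And>t. t \<in> {a<..<b} - N \<Longrightarrow> h1 t = 0 \<and> h3 t = 0" using indivisible_h[OF ind] by blast
    \<comment> \<open>On an indivisible interval h_1 = h_3 = 0 almost everywhere. The second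
      component of w_(n+1) thus keeps its value \<omega>_(n+1) from the endpoint a, yet it tends to
      0 at b.\<close>
    have z: "indef_int iv (\<lambda>t. wseq om (Suc n) t $ 2) (\<lambda>t. 0)"
    proof (rule indef_int_cong[OF wseq_indef(2)[of om n] _ N(1)])
      fix t assume "t \<notin> N" "\<exists>x\<in>iv. \<exists>y\<in>iv. x \<le> t \<and> t \<le> y"
      then show "d1 (wseq om n) t = 0" using N(2)[of t] by (cases "t = a") (auto simp: d1_def)
    qed simp
    have "wseq om (Suc n) t $ 2 = om (Suc n)" if "t \<in> {a<..<b}" for t
      using indef_int_zero_const[OF z, of t a] wa[of "Suc n"] that by auto
    then have "\<forall>\<^sub>F t in at_left b. om (Suc n) = wseq om (Suc n) t $ 2"
      using eventually_at_left_real[OF ab] by (auto elim: eventually_mono)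
    then have "((\<lambda>t. wseq om (Suc n) t $ 2) \<longlongrightarrow> om (Suc n)) (at_left b)" by (rule Lim_transform_eventually[OF tendsto_const])
    then show ?thesis using tendsto_unique[OF trivial_limit_at_left_real _ om_sing] by blast
  qed
  show "AE t\<in>{a<..<b} in lebesgue. H t $ 1 $ 1 = 0 \<and> H t $ 1 $ 2 = 0 \<and> H t $ 2 $ 1 = 0" if ind: "indivisible H a b"
  proof -
    obtain N where N: "negligible N" "\<And>t. t \<in> {a<..<b} - N \<Longrightarrow> h1 t = 0 \<and> h3 t = 0" using indivisible_h[OF ind] by blast
    show ?thesis unfolding AE_interval_iff
    proof (intro exI[of _ "N \<union> bad"] conjI ballI)
      show "negligible (N \<union> bad)" using N(1) negligible_bad by simp
      fix t assume "t \<in> {a<..<b} - (N \<union> bad)"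
      then have t: "t \<in> {a<..<b}" "t \<notin> bad" "t \<in> {a<..<b} - N" by auto
      show "H t $ 1 $ 1 = 0" "H t $ 1 $ 2 = 0" "H t $ 2 $ 1 = 0"
        using hval_eq[OF t(1,2)] N(2)[OF t(3)] h_psd(4)[of t] by simp_all
    qed
  qed
  show "v $ 2 = 0 \<and> (\<not> indivisible H a b \<longrightarrow> v = 0)" if ae: "AE t\<in>{a<..<b} in lebesgue. cmat (H t) *v v = 0" for v
  proof -
    obtain N where N: "negligible N" "\<And>t. t \<in> {a<..<b} - N \<Longrightarrow> cmat (H t) *v v = 0" using ae unfolding AE_interval_iff by blast
    define N' where "N' = N \<union> bad"
    have N': "negligible N'" unfolding N'_def using N(1) negligible_bad by simp
    have eqs: "h1 t * v $ 1 + h3 t * v $ 2 = 0 \<and> h3 t * v $ 1 + h2 t * v $ 2 = 0" if "t \<in> {a<..<b} - N'" for t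
    proof -
      have t: "t \<in> {a<..<b}" "t \<notin> bad" "t \<in> {a<..<b} - N" using that unfolding N'_def by auto
      show ?thesis unfolding Hmult_eq[OF t(1,2), symmetric] N(2)[OF t(3)] by simp
    qed
    have R: "h1 t * Re (v $ 1) + h3 t * Re (v $ 2) = 0 \<and> h3 t * Re (v $ 1) + h2 t * Re (v $ 2) = 0" if "t \<in> {a<..<b} - N'" for t
      using eqs[OF that] by (auto simp: complex_eq_iff)
    have Im: "h1 t * Im (v $ 1) + h3 t * Im (v $ 2) = 0 \<and> h3 t * Im (v $ 1) + h2 t * Im (v $ 2) = 0" if "t \<in> {a<..<b} - N'" for t
      using eqs[OF that] by (auto simp: complex_eq_iff)
    note R' = real_kernel[OF R N'] and Im' = real_kernel[OF Im N']
    have "Re (v $ 2) = 0" "Im (v $ 2) = 0" using R' Im' by blast+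
    moreover have "v $ 1 = 0" if "\<not> indivisible H a b"
    proof -
      have "Re (v $ 1) = 0" "Im (v $ 1) = 0" using R' Im' that by blast+
      then show ?thesis by (simp add: complex_eq_iff)
    qed
    ultimately show ?thesis by (simp add: vec2_eq_iff complex_eq_iff)
  qed
qed

end

section \<open>Reflection\<close>

text \<open>Conjugation by diag(-1, 1). This matrix anticommutes with J, and the resulting sign
  cancels the one from t -> -t, so f' = JHg keeps its form. It fixes (0, 1), hence \<Delta> and the
  \<omega>_n are preserved.\<close>

definition rM :: "real^2^2 \<Rightarrow> real^2^2" where
  "rM A = vector [vector [A $ 1 $ 1, - A $ 1 $ 2], vector [- A $ 2 $ 1, A $ 2 $ 2]]"

definition rV :: "'a::group_add^2 \<Rightarrow> 'a^2" where "rV u = vector [- u $ 1, u $ 2]"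

definition rH :: "(real \<Rightarrow> real^2^2) \<Rightarrow> real \<Rightarrow> real^2^2" where "rH H t = rM (H (- t))"

definition rF :: "fn \<Rightarrow> fn" where "rF f t = rV (f (- t))"

lemma rV_nth [simp]: "rV u $ 1 = - u $ 1" "rV u $ 2 = u $ 2" by (simp_all add: rV_def)

lemma rM_nth: "rM A $ 1 $ 1 = A $ 1 $ 1" "rM A $ 1 $ 2 = - A $ 1 $ 2" "rM A $ 2 $ 1 = - A $ 2 $ 1" "rM A $ 2 $ 2 = A $ 2 $ 2"
  by (simp_all add: rM_def)

lemma rV_rV [simp]: "rV (rV u) = (u :: 'a::group_add^2)" by (simp add: vec2_eq_iff)
lemma rF_rF [simp]: "rF (rF f) = f" by (simp add: rF_def fun_eq_iff)
lemma rM_rM [simp]: "rM (rM A) = A" by (simp add: vec2_eq_iff rM_nth)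
lemma rH_rH [simp]: "rH (rH H) = H" by (simp add: rH_def fun_eq_iff)

lemma cmat_rM: "cmat (rM A) *v rV u = rV (cmat A *v u)"
  by (simp add: vec2_eq_iff matrix_vector_mult_2 rM_nth)

lemma mult_rM: "rM A *v rV u = rV (A *v u)"
  by (simp add: vec2_eq_iff matrix_vector_mult_2 rM_nth)

lemma Jmat_rV: "Jmat *v rV u = - rV (Jmat *v u)"
  by (simp add: Jmat_mult vec2_eq_iff)

lemma cdot_rV: "cdot (rV u) (rV v) = cdot u v" by (simp add: cdot_2)

lemma rV_eq_iff: "rV u = rV v \<longleftrightarrow> u = (v :: 'a::group_add^2)" by (auto simp: vec2_eq_iff)

lemma bounded_linear_rV: "bounded_linear (rV :: complex^2 \<Rightarrow> complex^2)"
  by (rule linear_conv_bounded_linear[THEN iffD1], rule linearI) (auto simp: vec2_eq_iff)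

lemma pos_semidef_rM: assumes "pos_semidef A" shows "pos_semidef (rM A)"
proof -
  have t: "transpose A = A" and p: "\<And>x. 0 \<le> x \<bullet> (A *v x)" using assms unfolding pos_semidef_def by auto
  have s: "A $ 2 $ 1 = A $ 1 $ 2" by (rule pos_semidef_2(3)[OF assms])
  have "x \<bullet> (rM A *v x) = rV x \<bullet> (A *v rV x)" for x
    by (simp add: inner_vec_def sum_2 matrix_vector_mult_2 rM_nth algebra_simps)
  then show ?thesis using p unfolding pos_semidef_def by (simp add: transpose_def vec2_eq_iff rM_nth s)
qed

lemma negligible_uminus: fixes N :: "real set" shows "negligible N \<Longrightarrow> negligible (uminus ` N)"
  by (rule negligible_differentiable_image_negligible) (auto intro!: derivative_intros)

lemma AE_reflect:
  assumes "AE t\<in>{lo<..<hi} in lebesgue. P (t::real)" shows "AE t\<in>{-hi<..<-lo} in lebesgue. P (- t)"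
proof -
  obtain N where N: "negligible N" "\<And>t. t \<in> {lo<..<hi} - N \<Longrightarrow> P t" using assms unfolding AE_interval_iff by blast
  show ?thesis unfolding AE_interval_iff
  proof (intro exI[of _ "uminus ` N"] conjI ballI)
    show "negligible (uminus ` N)" by (rule negligible_uminus[OF N(1)])
    fix t assume t: "t \<in> {-hi<..<-lo} - uminus ` N"
    then have "- t \<notin> N" by force
    then show "P (- t)" using N(2)[of "- t"] t by auto
  qed
qed

lemma absolutely_integrable_reflect_open:
  fixes f :: "real \<Rightarrow> 'a::euclidean_space"
  shows "(\<lambda>t. f (- t)) absolutely_integrable_on {-hi<..<-lo} \<longleftrightarrow> f absolutely_integrable_on {lo<..<hi}"
  unfolding absolutely_integrable_open_closed by (rule absolutely_integrable_reflect_real)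

lemma borel_measurable_reflect:
  fixes f :: "real \<Rightarrow> 'a::topological_space"
  assumes "f \<in> borel_measurable (lebesgue_on {lo<..<hi})"
  shows "(\<lambda>t. f (- t)) \<in> borel_measurable (lebesgue_on {-hi<..<-lo})"
proof -
  have "(\<lambda>t::real. (-1) *\<^sub>R t) \<in> lebesgue \<rightarrow>\<^sub>M lebesgue" by (rule lebesgue_measurable_scaling)
  then have "(\<lambda>t::real. - t) \<in> lebesgue \<rightarrow>\<^sub>M lebesgue" by simp
  then have "(\<lambda>t::real. - t) \<in> lebesgue_on {-hi<..<-lo} \<rightarrow>\<^sub>M lebesgue_on {lo<..<hi}"
    by (rule measurable_restrict_space3) auto
  from measurable_compose[OF this assms] show ?thesis .
qed

lemma LINT_reflect:
  fixes g :: "real \<Rightarrow> 'a::euclidean_space"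
  assumes "\<And>s. s \<in> S \<longleftrightarrow> - s \<in> T"
  shows "(LINT s:S|lebesgue. g (- s)) = (LINT s:T|lebesgue. g s)"
proof -
  have "(\<integral>s. indicator T s *\<^sub>R g s \<partial>lebesgue) = \<bar>-1\<bar> *\<^sub>R (\<integral>s. indicator T (0 + -1 * s) *\<^sub>R g (0 + -1 * s) \<partial>lebesgue)"
    by (rule lebesgue_integral_real_affine) simp
  moreover have "indicator T (- s) = (indicator S s :: real)" for s using assms[of s] by (simp add: indicator_def)
  ultimately show ?thesis unfolding set_lebesgue_integral_def by simp
qed

text \<open>diag(-1, 1) sends the direction of angle \<phi> to that of angle \<pi> - \<phi>.\<close>

lemma indivisible_type_reflect:
  assumes "indivisible_type H \<phi> c d" shows "indivisible_type (rH H) (pi - \<phi>) (- d) (- c)"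
proof -
  have xi: "xi_vec (pi - \<phi>) = rV (xi_vec \<phi>)" by (simp add: vec2_eq_iff xi_vec_def)
  have "range ((*v) (rM A)) = span {rV (xi_vec \<phi>)}" if r: "range ((*v) A) = span {xi_vec \<phi>}" for A
  proof -
    have "rM A *v x = rV (A *v rV x)" for x using mult_rM[of A "rV x"] by simp
    then have "range ((*v) (rM A)) = rV ` range (\<lambda>x. A *v rV x)" by auto
    also have "range (\<lambda>x. A *v rV x) = range ((*v) A)"
    proof -
      have "A *v y = A *v rV (rV y)" for y by simp
      then show ?thesis by blast
    qed
    also note r
    also have "rV ` span {xi_vec \<phi>} = span {rV (xi_vec \<phi>)}"
    proof -
      have "rV (k *\<^sub>R xi_vec \<phi>) = k *\<^sub>R rV (xi_vec \<phi>)" for k by (simp add: vec2_eq_iff)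
      then show ?thesis unfolding span_singleton by (auto simp: image_image)
    qed
    finally show ?thesis .
  qed
  note im = this
  have "AE t\<in>{c<..<d} in lebesgue. range ((*v) (H t)) = span {xi_vec \<phi>}" "c < d" using assms unfolding indivisible_type_def by auto
  then have "AE t\<in>{-d<..<-c} in lebesgue. range ((*v) (H (- t))) = span {xi_vec \<phi>}" by (intro AE_reflect)
  then have "AE t\<in>{-d<..<-c} in lebesgue. range ((*v) (rH H t)) = span {xi_vec (pi - \<phi>)}"
    unfolding rH_def xi by eventually_elim (use im in blast)
  then show ?thesis using \<open>c < d\<close> unfolding indivisible_type_def by simp
qed

lemma indivisible_reflect: "indivisible H c d \<Longrightarrow> indivisible (rH H) (- d) (- c)"
  unfolding indivisible_def using indivisible_type_reflect by blast

lemma L2H_reflect: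
  assumes "f \<in> L2H H lo hi" shows "rF f \<in> L2H (rH H) (- hi) (- lo)"
proof -
  have m: "f \<in> borel_measurable (lebesgue_on {lo<..<hi})"
    and i: "(\<lambda>t. cdot (f t) (cmat (H t) *v f t)) absolutely_integrable_on {lo<..<hi}"
    and x: "\<And>\<phi> c d. lo \<le> c \<and> d \<le> hi \<and> indivisible_type H \<phi> c d \<Longrightarrow>
        (\<exists>k. AE t\<in>{c<..<d} in lebesgue. complex_of_real (cos \<phi>) * f t $ 1 + complex_of_real (sin \<phi>) * f t $ 2 = k)"
    using assms unfolding L2H_def mem_Collect_eq by simp_all
  have 1: "rF f \<in> borel_measurable (lebesgue_on {-hi<..<-lo})"
    unfolding rF_def[abs_def]
    by (rule borel_measurable_continuous_on[OF _ borel_measurable_reflect[OF m], of rV])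
       (rule linear_continuous_on[OF bounded_linear_rV])
  have "cdot (rF f t) (cmat (rH H t) *v rF f t) = cdot (f (- t)) (cmat (H (- t)) *v f (- t))" for t
    unfolding rF_def rH_def cmat_rM cdot_rV ..
  then have 2: "(\<lambda>t. cdot (rF f t) (cmat (rH H t) *v rF f t)) absolutely_integrable_on {-hi<..<-lo}"
    using i absolutely_integrable_reflect_open[where f="\<lambda>t. cdot (f t) (cmat (H t) *v f t)" and hi=hi and lo=lo] by simp
  have 3: "\<exists>k. AE t\<in>{c<..<d} in lebesgue. complex_of_real (cos \<phi>) * rF f t $ 1 + complex_of_real (sin \<phi>) * rF f t $ 2 = k"
    if a: "- hi \<le> c \<and> d \<le> - lo \<and> indivisible_type (rH H) \<phi> c d" for \<phi> c d
  proof -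
    have "indivisible_type H (pi - \<phi>) (- d) (- c)" using indivisible_type_reflect[of "rH H" \<phi> c d] a by simp
    then obtain k where "AE t\<in>{-d<..<-c} in lebesgue. complex_of_real (cos (pi - \<phi>)) * f t $ 1 + complex_of_real (sin (pi - \<phi>)) * f t $ 2 = k"
      using x[of "- d" "- c" "pi - \<phi>"] a by auto
    from AE_reflect[OF this] show ?thesis by (intro exI[of _ k]) (simp add: rF_def)
  qed
  show ?thesis unfolding L2H_def mem_Collect_eq using 1 2 3 by simp
qed

lemma L2H_reflect_iff: "rF f \<in> L2H (rH H) (- hi) (- lo) \<longleftrightarrow> f \<in> L2H H lo hi"
  using L2H_reflect[of f H lo hi] L2H_reflect[of "rF f" "rH H" "- hi" "- lo"] by auto

lemma I_right_reflect: "I_right H hi f = rF (I_left (rH H) (- hi) (rF f))"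
proof
  fix t
  define G where "G s = Jmat *v (cmat (H s) *v f s)" for s
  have "I_left (rH H) (- hi) (rF f) (- t) = (LINT s:{-hi..-t}|lebesgue. - rV (G (- s)))"
    unfolding I_left_def rF_def rH_def cmat_rM Jmat_rV G_def ..
  also have "\<dots> = (LINT s:{t..hi}|lebesgue. - rV (G s))"
    by (rule LINT_reflect[where g="\<lambda>s. - rV (G s)"]) auto
  also have "\<dots> = - rV (LINT s:{t..hi}|lebesgue. G s)"
  proof -
    \<comment> \<open>The map is an involution, so it commutes with the integral whether or not the
      integrand is integrable; the identity of operators holds for every f.\<close>
    have bl: "bounded_linear (\<lambda>u. - rV u :: complex^2)" using bounded_linear_minus[OF bounded_linear_rV] .
    have "(\<integral>s. - rV (indicator {t..hi} s *\<^sub>R G s) \<partial>lebesgue) = - rV (\<integral>s. indicator {t..hi} s *\<^sub>R G s \<partial>lebesgue)"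
    proof (rule integral_bounded_linear'[OF bl bl])
      show "\<forall>x :: complex^2. - rV (- rV x) = x" by (simp add: vec2_eq_iff)
    qed
    moreover have "- rV (r *\<^sub>R u) = r *\<^sub>R - rV u" for r and u :: "complex^2" by (simp add: vec2_eq_iff)
    ultimately show ?thesis unfolding set_lebesgue_integral_def by simp
  qed
  finally have "rF (I_left (rH H) (- hi) (rF f)) t = rV (- rV (LINT s:{t..hi}|lebesgue. G s))" unfolding rF_def by simp
  also have "\<dots> = - (LINT s:{t..hi}|lebesgue. G s)" by (simp add: vec2_eq_iff)
  finally show "I_right H hi f t = rF (I_left (rH H) (- hi) (rF f)) t" unfolding I_right_def G_def by simp
qed

lemma rF_const: "rF (\<lambda>_. v) = (\<lambda>_. rV v)" by (simp add: rF_def fun_eq_iff)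

lemma I_right_iter: "(I_right H hi ^^ k) (\<lambda>_. v) = rF ((I_left (rH H) (- hi) ^^ k) (\<lambda>_. rV v))"
  by (induction k) (simp_all add: rF_const I_right_reflect)

lemma rF_sum: "rF (\<lambda>t. \<Sum>k\<in>A. f k t) = (\<lambda>t. \<Sum>k\<in>A. rF (f k) t)"
  unfolding rF_def by (simp add: fun_eq_iff vec2_eq_iff sum_negf)

lemma rF_add: "rF (\<lambda>t. f t + g t) = (\<lambda>t. rF f t + rF g t)"
  unfolding rF_def by (simp add: fun_eq_iff vec2_eq_iff)

lemma Delta_num_reflect:
  "Delta_num H lo hi (I_right H hi) = Delta_num (rH H) (- hi) (- lo) (I_left (rH H) (- hi))"
proof -
  let ?R = "I_right H hi" and ?L = "I_left (rH H) (- hi)"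
  have e01: "rV (vector [0, 1]) = (vector [0, 1] :: complex^2)" by (simp add: vec2_eq_iff)
  have eq: "(\<lambda>t. (?R ^^ n) (\<lambda>_. vector [0, 1]) t + (\<Sum>k<n. (?R ^^ k) (\<lambda>_. v (n - k)) t))
     = rF (\<lambda>t. (?L ^^ n) (\<lambda>_. vector [0, 1]) t + (\<Sum>k<n. (?L ^^ k) (\<lambda>_. rV (v (n - k))) t))" for n v
    unfolding rF_add rF_sum I_right_iter e01 ..
  have mem: "rF g \<in> L2H H lo hi \<longleftrightarrow> g \<in> L2H (rH H) (- hi) (- lo)" for g
    using L2H_reflect_iff[of "rF g" H hi lo] by simp
  have "(\<exists>v :: nat \<Rightarrow> complex^2. (\<lambda>t. (?R ^^ n) (\<lambda>_. vector [0, 1]) t + (\<Sum>k<n. (?R ^^ k) (\<lambda>_. v (n - k)) t)) \<in> L2H H lo hi)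
    \<longleftrightarrow> (\<exists>v :: nat \<Rightarrow> complex^2. (\<lambda>t. (?L ^^ n) (\<lambda>_. vector [0, 1]) t + (\<Sum>k<n. (?L ^^ k) (\<lambda>_. v (n - k)) t)) \<in> L2H (rH H) (- hi) (- lo))" for n
    unfolding eq mem
  proof
    assume "\<exists>v :: nat \<Rightarrow> complex^2. (\<lambda>t. (?L ^^ n) (\<lambda>_. vector [0, 1]) t + (\<Sum>k<n. (?L ^^ k) (\<lambda>_. rV (v (n - k))) t)) \<in> L2H (rH H) (- hi) (- lo)"
    then obtain v :: "nat \<Rightarrow> complex^2" where "(\<lambda>t. (?L ^^ n) (\<lambda>_. vector [0, 1]) t + (\<Sum>k<n. (?L ^^ k) (\<lambda>_. rV (v (n - k))) t)) \<in> L2H (rH H) (- hi) (- lo)" ..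
    then show "\<exists>v :: nat \<Rightarrow> complex^2. (\<lambda>t. (?L ^^ n) (\<lambda>_. vector [0, 1]) t + (\<Sum>k<n. (?L ^^ k) (\<lambda>_. v (n - k)) t)) \<in> L2H (rH H) (- hi) (- lo)"
      by (intro exI[of _ "\<lambda>j. rV (v j)"])
  next
    assume "\<exists>v :: nat \<Rightarrow> complex^2. (\<lambda>t. (?L ^^ n) (\<lambda>_. vector [0, 1]) t + (\<Sum>k<n. (?L ^^ k) (\<lambda>_. v (n - k)) t)) \<in> L2H (rH H) (- hi) (- lo)"
    then obtain v :: "nat \<Rightarrow> complex^2" where v: "(\<lambda>t. (?L ^^ n) (\<lambda>_. vector [0, 1]) t + (\<Sum>k<n. (?L ^^ k) (\<lambda>_. v (n - k)) t)) \<in> L2H (rH H) (- hi) (- lo)" ..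
    show "\<exists>v :: nat \<Rightarrow> complex^2. (\<lambda>t. (?L ^^ n) (\<lambda>_. vector [0, 1]) t + (\<Sum>k<n. (?L ^^ k) (\<lambda>_. rV (v (n - k))) t)) \<in> L2H (rH H) (- hi) (- lo)"
      by (rule exI[of _ "\<lambda>j. rV (v j)"]) (use v in simp)
  qed
  then show ?thesis unfolding Delta_num_def by simp
qed

lemma w_comb_reflect: "w_comb (I_right H hi) \<omega> n = rF (w_comb (I_left (rH H) (- hi)) \<omega> n)"
proof -
  have "rV (vector [0, x]) = (vector [0, x] :: complex^2)" for x by (simp add: vec2_eq_iff)
  then show ?thesis unfolding w_comb_def rF_sum I_right_iter by simp
qed

lemma omega_seq_reflect:
  "omega_seq H lo hi (I_right H hi) = omega_seq (rH H) (- hi) (- lo) (I_left (rH H) (- hi))"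
proof -
  have "w_comb (I_right H hi) \<omega> n \<in> L2H H lo hi \<longleftrightarrow> w_comb (I_left (rH H) (- hi)) \<omega> n \<in> L2H (rH H) (- hi) (- lo)" for \<omega> n
    unfolding w_comb_reflect using L2H_reflect_iff[of "rF (w_comb (I_left (rH H) (- hi)) \<omega> n)" H hi lo] by simp
  then show ?thesis unfolding omega_seq_def Delta_num_reflect by simp
qed

lemma JHint_reflect:
  assumes "JHint lo hi H f g" shows "JHint (- hi) (- lo) (rH H) (rF f) (rF g)"
  unfolding JHint_def
proof
  fix i :: 2
  have i: "indef_int {lo<..<hi} (\<lambda>t. f t $ i) (\<lambda>t. (Jmat *v (cmat (H t) *v g t)) $ i)" for i using assms unfolding JHint_def by blast
  have r: "indef_int {-hi<..<-lo} (\<lambda>t. f (- t) $ i) (\<lambda>t. - (Jmat *v (cmat (H (- t)) *v g (- t))) $ i)" for i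
  proof (rule indef_intI)
    define G where "G t = (Jmat *v (cmat (H t) *v g t)) $ i" for t
    fix x y assume xy: "x \<in> {-hi<..<-lo}" "y \<in> {-hi<..<-lo}" "x \<le> y"
    have m: "- y \<in> {lo<..<hi}" "- x \<in> {lo<..<hi}" "- y \<le> - x" using xy by auto
    have "G absolutely_integrable_on {-y..-x}" unfolding G_def by (rule indef_intD(1)[OF i m])
    then have "(\<lambda>t. G (- t)) absolutely_integrable_on {x..y}" using absolutely_integrable_reflect_real[where f=G and a="- y" and b="- x"] by simp
    then have "(\<lambda>t. -1 * G (- t)) absolutely_integrable_on {x..y}" by (intro set_integrable_mult_right)
    then show "(\<lambda>t. - (Jmat *v (cmat (H (- t)) *v g (- t))) $ i) absolutely_integrable_on {x..y}" unfolding G_def by simp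
    have "(G has_integral (f (- x) $ i - f (- y) $ i)) {-y..-x}" unfolding G_def by (rule indef_intD(2)[OF i m])
    then have "((\<lambda>t. G (- t)) has_integral (f (- x) $ i - f (- y) $ i)) {x..y}" using has_integral_reflect_real[where f=G and a="- y" and b="- x"] by simp
    from has_integral_neg[OF this]
    show "((\<lambda>t. - (Jmat *v (cmat (H (- t)) *v g (- t))) $ i) has_integral (f (- y) $ i - f (- x) $ i)) {x..y}" unfolding G_def by simp
  qed
  have d: "Jmat *v (cmat (rH H t) *v rF g t) = - rV (Jmat *v (cmat (H (- t)) *v g (- t)))" for t
    unfolding rF_def rH_def cmat_rM Jmat_rV ..
  show "indef_int {-hi<..<-lo} (\<lambda>t. rF f t $ i) (\<lambda>t. (Jmat *v (cmat (rH H t) *v rF g t)) $ i)"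
    unfolding d using r[of 2] indef_int_minus[OF r[of 1]] exhaust_2[of i] by (elim disjE) (simp_all add: rF_def)
qed

lemma hs_side_reflect:
  assumes ab: "lo < hi" and ham: "hamiltonian lo hi H" and lp: "limit_point_left lo hi H" and lc: "limit_circle_right lo hi H"
    and I: "set_integrable lebesgue {lo<..<hi} (\<lambda>t. H t $ 1 $ 1)"
    and HS: "set_integrable lebesgue {lo<..<hi} (\<lambda>t. (LINT s:{t<..<hi}|lebesgue. H s $ 2 $ 2) * H t $ 1 $ 1)"
  shows "hs_side (- hi) (- lo) (rH H)"
proof
  have bl: "bounded_linear rM" by (rule linear_conv_bounded_linear[THEN iffD1], rule linearI) (auto simp: vec2_eq_iff rM_nth)
  have ri: "rH H absolutely_integrable_on {-d<..<-c}" if "H absolutely_integrable_on {c<..<d}" for c d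
    using absolutely_integrable_linear[OF iffD2[OF absolutely_integrable_reflect_open that] bl] unfolding rH_def[abs_def] by (simp add: o_def)
  show "- hi < - lo" using ab by simp
  show "hamiltonian (- hi) (- lo) (rH H)"
    unfolding hamiltonian_def
  proof (intro conjI allI impI)
    note m = ham[unfolded hamiltonian_def, THEN conjunct1]
    note ci = ham[unfolded hamiltonian_def, THEN conjunct2, THEN conjunct1, rule_format]
    note ae = ham[unfolded hamiltonian_def, THEN conjunct2, THEN conjunct2, THEN conjunct1]
    note z = ham[unfolded hamiltonian_def, THEN conjunct2, THEN conjunct2, THEN conjunct2]
    show "rH H \<in> borel_measurable (lebesgue_on {-hi<..<-lo})"
      unfolding rH_def[abs_def]
      by (rule borel_measurable_continuous_on[OF linear_continuous_on[OF bl] borel_measurable_reflect[OF m]])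
    show "rH H absolutely_integrable_on {c..d}" if "- hi < c \<and> c < d \<and> d < - lo" for c d
    proof -
      have "H absolutely_integrable_on {- d..- c}" by (rule ci) (use that in simp)
      then have "rH H absolutely_integrable_on {- (- c)<..<- (- d)}" by (intro ri iffD2[OF absolutely_integrable_open_closed])
      then have "rH H absolutely_integrable_on {c<..<d}" by (simp only: minus_minus)
      then show ?thesis by (rule iffD1[OF absolutely_integrable_open_closed])
    qed
    show "AE t\<in>{-hi<..<-lo} in lebesgue. pos_semidef (rH H t)"
      using AE_reflect[OF ae] unfolding rH_def by eventually_elim (use pos_semidef_rM in blast)
    have "rM 0 = 0" by (simp add: vec2_eq_iff rM_nth)
    then have r0: "rM A = 0 \<longleftrightarrow> A = 0" for A by (metis rM_rM)
    have "{t \<in> {-hi<..<-lo}. rH H t = 0} = uminus ` {t \<in> {lo<..<hi}. H t = 0}"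
    proof (rule set_eqI)
      fix t
      have "t \<in> uminus ` S \<longleftrightarrow> - t \<in> S" for S :: "real set"
      proof
        assume "- t \<in> S"
        then have "- (- t) \<in> uminus ` S" by (rule imageI)
        then show "t \<in> uminus ` S" by simp
      qed auto
      then show "t \<in> {t \<in> {-hi<..<-lo}. rH H t = 0} \<longleftrightarrow> t \<in> uminus ` {t \<in> {lo<..<hi}. H t = 0}"
        unfolding rH_def r0 by auto
    qed
    moreover have "negligible (uminus ` {t \<in> {lo<..<hi}. H t = 0})"
      by (rule negligible_uminus) (use z in \<open>simp only: negligible_iff_null_sets\<close>)
    ultimately show "{t \<in> {-hi<..<-lo}. rH H t = 0} \<in> null_sets lebesgue" by (simp only: negligible_iff_null_sets)
  qed
  show "limit_circle_left (- hi) (- lo) (rH H)"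
  proof -
    obtain c where c: "lo < c" "c < hi" "H absolutely_integrable_on {c<..<hi}" using lc unfolding limit_circle_right_def by blast
    show ?thesis unfolding limit_circle_left_def by (rule exI[of _ "- c"], intro conjI ri c(3)) (use c in simp_all)
  qed
  show "limit_point_right (- hi) (- lo) (rH H)"
  proof
    assume "limit_circle_right (- hi) (- lo) (rH H)"
    then obtain c where c: "- hi < c" "c < - lo" "rH H absolutely_integrable_on {c<..<- lo}" unfolding limit_circle_right_def by blast
    have "(\<lambda>t. rM (rH H (- t))) absolutely_integrable_on {- (- lo)<..<- c}"
      using absolutely_integrable_linear[OF iffD2[OF absolutely_integrable_reflect_open c(3)] bl] by (simp add: o_def)
    then have "H absolutely_integrable_on {lo<..<- c}" unfolding rH_def by simp
    then have "limit_circle_left lo hi H" unfolding limit_circle_left_def by (intro exI[of _ "- c"] conjI) (use c in simp_all)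
    then show False using lp by simp
  qed
  show "set_integrable lebesgue {- hi<..<- lo} (\<lambda>t. rH H t $ 1 $ 1)"
    unfolding rH_def rM_nth by (rule iffD2[OF absolutely_integrable_reflect_open[where f="\<lambda>t. H t $ 1 $ 1"] I])
  have "(LINT s:{- hi<..<t}|lebesgue. rH H s $ 2 $ 2) = (LINT s:{- t<..<hi}|lebesgue. H s $ 2 $ 2)" for t
    unfolding rH_def rM_nth by (rule LINT_reflect[where g="\<lambda>s. H s $ 2 $ 2"]) auto
  then show "set_integrable lebesgue {- hi<..<- lo} (\<lambda>t. (LINT s:{- hi<..<t}|lebesgue. rH H s $ 2 $ 2) * rH H t $ 1 $ 1)"
    using iffD2[OF absolutely_integrable_reflect_open[where f="\<lambda>t. (LINT s:{t<..<hi}|lebesgue. H s $ 2 $ 2) * H t $ 1 $ 1"] HS]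
    unfolding rH_def rM_nth by simp
qed

lemma tendsto_reflect_left: "((\<lambda>t. F (- t)) \<longlongrightarrow> l) (at_left x) \<longleftrightarrow> (F \<longlongrightarrow> l) (at_right (- x))" for x :: real
  unfolding filterlim_at_left_to_right[of "\<lambda>t. F (- t)"] by simp

lemma tendsto_reflect_right: "((\<lambda>t. F (- t)) \<longlongrightarrow> l) (at_right x) \<longleftrightarrow> (F \<longlongrightarrow> l) (at_left (- x))" for x :: real
  using tendsto_reflect_left[of "\<lambda>t. F (- t)" l "- x"] by simp

text \<open>The reflected Hamiltonian on (-hi, -lo) satisfies \<open>side_facts_left\<close>. Its
  \<omega> is the given one and its w_n are the reflections of the given ones, so each property can
  be carried back.\<close>

theorem side_facts_right:
  assumes hs: "lo < hi" "hamiltonian lo hi H" "limit_point_left lo hi H" "limit_circle_right lo hi H"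
    "set_integrable lebesgue {lo<..<hi} (\<lambda>t. H t $ 1 $ 1)"
    "set_integrable lebesgue {lo<..<hi} (\<lambda>t. (LINT s:{t<..<hi}|lebesgue. H s $ 2 $ 2) * H t $ 1 $ 1)"
    and D: "Delta_num H lo hi (I_right H hi) = enat D"
  defines "\<omega> \<equiv> omega_seq H lo hi (I_right H hi)"
  shows "side_facts lo hi H (at_left hi) (at_right lo) \<omega> (w_comb (I_right H hi) \<omega>) D"
proof -
  define w' where "w' = w_comb (I_left (rH H) (- hi)) \<omega>"
  interpret R: hs_side_finite "- hi" "- lo" "rH H" D
    unfolding hs_side_finite_def hs_side_finite_axioms_def using hs_side_reflect[OF hs] D unfolding Delta_num_reflect by simp
  interpret S: side_facts "- hi" "- lo" "rH H" "at_right (- hi)" "at_left (- lo)" \<omega> w' D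
    using R.side_facts_left unfolding w'_def \<omega>_def omega_seq_reflect .
  have w: "w_comb (I_right H hi) \<omega> n = rF (w' n)" for n unfolding w'_def by (rule w_comb_reflect)
  have AEr: "AE t\<in>{- hi<..<- lo} in lebesgue. P (- t)" if "AE t\<in>{lo<..<hi} in lebesgue. P t" for P by (rule AE_reflect[OF that])
  have AEb: "AE t\<in>{lo<..<hi} in lebesgue. P t" if "AE t\<in>{- hi<..<- lo} in lebesgue. P (- t)" for P using AE_reflect[OF that] by simp
  have Hr: "cmat (rH H t) *v rV u = rV (cmat (H (- t)) *v u)" for t u unfolding rH_def cmat_rM ..
  show ?thesis
  proof
    show "lo < hi" by fact
    show "AE t\<in>{lo<..<hi} in lebesgue. pos_semidef (H t)" using hs(2) unfolding hamiltonian_def by (elim conjE)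
    show "\<omega> 0 = 1" by (rule S.omega_0)
    show "cnj (\<omega> n) = \<omega> n" for n by (rule S.omega_real)
    show "w_comb (I_right H hi) \<omega> 0 t = vector [0, 1]" if "t \<in> {lo<..<hi}" for t
      using S.w_0[of "- t"] that unfolding w rF_def by (simp add: vec2_eq_iff)
    show "cnj (w_comb (I_right H hi) \<omega> n t $ i) = w_comb (I_right H hi) \<omega> n t $ i" if "t \<in> {lo<..<hi}" for n t i
      using S.w_real[of "- t" n i] that exhaust_2[of i] unfolding w rF_def by auto
    show "JHint lo hi H (w_comb (I_right H hi) \<omega> (Suc n)) (w_comb (I_right H hi) \<omega> n)" for n
      using JHint_reflect[OF S.w_JHint[of n]] unfolding w by simp
    show "(w_comb (I_right H hi) \<omega> n \<longlongrightarrow> vector [0, \<omega> n]) (at_left hi)" for n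
    proof -
      have "((\<lambda>t. w' n (- t)) \<longlongrightarrow> vector [0, \<omega> n]) (at_left hi)" unfolding tendsto_reflect_left by (rule S.w_end)
      then have "((\<lambda>t. rV (w' n (- t))) \<longlongrightarrow> rV (vector [0, \<omega> n])) (at_left hi)" by (rule bounded_linear.tendsto[OF bounded_linear_rV])
      moreover have "rV (vector [0, \<omega> n]) = (vector [0, \<omega> n] :: complex^2)" by (simp add: vec2_eq_iff)
      ultimately show ?thesis unfolding w rF_def[abs_def] by simp
    qed
    show "((\<lambda>t. w_comb (I_right H hi) \<omega> (Suc n) t $ 2) \<longlongrightarrow> 0) (at_right lo)" for n
      using S.w_sing[of n] unfolding w rF_def rV_nth tendsto_reflect_right[of "\<lambda>t. w' (Suc n) t $ 2"] .
    show "w_comb (I_right H hi) \<omega> n \<in> L2H H lo hi" if "D \<le> n" for n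
      using L2H_reflect[OF S.w_L2H[OF that]] unfolding w by simp
    show "0 < D" by (rule S.D_pos)
    show "\<mu> j = 0"
      if m: "m \<le> D" and f: "f \<in> L2H H lo hi" and g: "g \<in> L2H H lo hi" and k: "D \<le> k"
        and ae: "AE t\<in>{lo<..<hi} in lebesgue. cmat (H t) *v (\<Sum>k<m. \<mu> k *s w_comb (I_right H hi) \<omega> k t) = cmat (H t) *v (g t - c *s f t - d *s w_comb (I_right H hi) \<omega> k t)"
        and j: "j < m" for m f g k \<mu> c d j
    proof (rule S.w_indep[OF m L2H_reflect[OF f] L2H_reflect[OF g] k _ j])
      have "rV (\<Sum>k<m. \<mu> k *s u k) = (\<Sum>k<m. \<mu> k *s rV (u k))" for u by (simp add: vec2_eq_iff sum_negf)
      moreover have "rV (x - c *s y - d *s v) = rV x - c *s rV y - d *s rV v" for x y v by (simp add: vec2_eq_iff)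
      ultimately have "cmat (rH H t) *v (\<Sum>k<m. \<mu> k *s w' k t) = cmat (rH H t) *v (rF g t - c *s rF f t - d *s w' k t)
         \<longleftrightarrow> cmat (H (- t)) *v (\<Sum>k<m. \<mu> k *s rF (w' k) (- t)) = cmat (H (- t)) *v (g (- t) - c *s f (- t) - d *s rF (w' k) (- t))" for t
        using Hr[of t "\<Sum>k<m. \<mu> k *s rF (w' k) (- t)"] Hr[of t "g (- t) - c *s f (- t) - d *s rF (w' k) (- t)"]
        by (simp add: rF_def rV_eq_iff)
      then show "AE t\<in>{- hi<..<- lo} in lebesgue. cmat (rH H t) *v (\<Sum>k<m. \<mu> k *s w' k t) = cmat (rH H t) *v (rF g t - c *s rF f t - d *s w' k t)"
        using AEr[OF ae] unfolding w by simp
    qed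
    show "((\<lambda>t. fh t $ 2) \<longlongrightarrow> 0) (at_right lo) \<and> (\<exists>v. (fh \<longlongrightarrow> v) (at_left hi))"
      if f: "f \<in> L2H H lo hi" and g: "g \<in> L2H H lo hi" and J: "JHint lo hi H fh g" and eq: "eq_H H lo hi fh f" for f g fh
    proof -
      have "eq_H (rH H) (- hi) (- lo) (rF fh) (rF f)"
        unfolding eq_H_def rF_def Hr rV_eq_iff by (rule AEr) (use eq in \<open>simp add: eq_H_def\<close>)
      from S.L2H_sol[OF L2H_reflect[OF f] L2H_reflect[OF g] JHint_reflect[OF J] this]
      obtain v where v: "((\<lambda>t. rF fh t $ 2) \<longlongrightarrow> 0) (at_left (- lo))" "(rF fh \<longlongrightarrow> v) (at_right (- hi))" by blast
      have "((\<lambda>t. fh t $ 2) \<longlongrightarrow> 0) (at_right lo)"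
        using v(1) tendsto_reflect_right[of "\<lambda>t. rF fh t $ 2" 0 lo] by (simp add: rF_def)
      moreover have "(fh \<longlongrightarrow> rV v) (at_left hi)"
        using bounded_linear.tendsto[OF bounded_linear_rV v(2)] tendsto_reflect_left[of "\<lambda>t. rV (rF fh t)" "rV v" hi] by (simp add: rF_def)
      ultimately show ?thesis by blast
    qed
    show "(\<lambda>t. cdot (f t) (cmat (H t) *v g t)) absolutely_integrable_on {lo<..<hi}" if "f \<in> L2H H lo hi" "g \<in> L2H H lo hi" for f g
    proof -
      have "(\<lambda>t. cdot (rF f t) (cmat (rH H t) *v rF g t)) absolutely_integrable_on {- hi<..<- lo}"
        by (rule S.L2H_cdot[OF L2H_reflect[OF that(1)] L2H_reflect[OF that(2)]])
      then show ?thesis unfolding rF_def Hr cdot_rV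
        using absolutely_integrable_reflect_open[where f="\<lambda>t. cdot (f t) (cmat (H t) *v g t)" and hi=hi and lo=lo] by simp
    qed
    show "(\<lambda>t. (Jmat *v (cmat (H t) *v g t)) $ i) absolutely_integrable_on {x..y}"
      if g: "g \<in> L2H H lo hi" and xy: "lo < x" "y < hi" for g x y i
    proof -
      define F where "F t = (Jmat *v (cmat (rH H t) *v rF g t)) $ i" for t
      have F: "F absolutely_integrable_on {- y..- x}"
        unfolding F_def by (rule S.L2H_JH[OF L2H_reflect[OF g]]) (use xy in auto)
      then have F1: "(\<lambda>t. F (- t)) absolutely_integrable_on {x..y}"
        using absolutely_integrable_reflect_real[where f=F and a="- y" and b="- x"] by simp
      have F2: "(\<lambda>t. - 1 * F (- t)) absolutely_integrable_on {x..y}" using F1 by (intro set_integrable_mult_right)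
      have "F (- t) = - rV (Jmat *v (cmat (H t) *v g t)) $ i" for t
        unfolding F_def rF_def Hr Jmat_rV by simp
      then show ?thesis using F1 F2 exhaust_2[of i] by (elim disjE) simp_all
    qed
    show "\<omega> (Suc n) = 0" if "indivisible H lo hi" for n by (rule S.indiv_omega[OF indivisible_reflect[OF that]])
    show "AE t\<in>{lo<..<hi} in lebesgue. H t $ 1 $ 1 = 0 \<and> H t $ 1 $ 2 = 0 \<and> H t $ 2 $ 1 = 0" if "indivisible H lo hi"
      using AE_reflect[OF S.indiv_row[OF indivisible_reflect[OF that]]] by (simp add: rH_def rM_nth)
    show "v $ 2 = 0 \<and> (\<not> indivisible H lo hi \<longrightarrow> v = 0)" if ae: "AE t\<in>{lo<..<hi} in lebesgue. cmat (H t) *v v = 0" for v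
    proof -
      have "rV u = 0 \<longleftrightarrow> u = (0 :: complex^2)" for u by (auto simp: vec2_eq_iff)
      then have "AE t\<in>{- hi<..<- lo} in lebesgue. cmat (rH H t) *v rV v = 0" using AEr[OF ae] unfolding Hr by simp
      from S.kernel[OF this] have "rV v $ 2 = 0" "\<not> indivisible (rH H) (- hi) (- lo) \<longrightarrow> rV v = 0" by auto
      moreover have "indivisible H lo hi" if "indivisible (rH H) (- hi) (- lo)" using indivisible_reflect[OF that] by simp
      ultimately show ?thesis by (auto simp: vec2_eq_iff)
    qed
  qed
qed

section \<open>Solutions on one side of the singularity\<close>

lemma JHint_add:
  assumes "JHint lo hi H f g" "JHint lo hi H f' g'"
  shows "JHint lo hi H (\<lambda>t. f t + f' t) (\<lambda>t. g t + g' t)"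
  unfolding JHint_def matrix_vector_right_distrib vector_add_component
  using assms[unfolded JHint_def] by (intro allI indef_int_add) blast+

lemma JHint_scale:
  assumes "JHint lo hi H f g"
  shows "JHint lo hi H (\<lambda>t. c *s f t) (\<lambda>t. c *s g t)"
  unfolding JHint_def vector_scalar_commute vector_smult_component
  using assms[unfolded JHint_def] by (intro allI indef_int_cmult) blast

lemma JHint_const: "JHint lo hi H (\<lambda>t. v) (\<lambda>t. 0)"
  unfolding JHint_def matrix_vector_mult_0_right zero_index by (intro allI indef_int_const)

lemma JHint_sum:
  assumes "finite A" "\<And>i. i \<in> A \<Longrightarrow> JHint lo hi H (f i) (g i)"
  shows "JHint lo hi H (\<lambda>t. \<Sum>i\<in>A. f i t) (\<lambda>t. \<Sum>i\<in>A. g i t)"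
  using assms
proof (induction A rule: finite_induct)
  case empty then show ?case using JHint_const[of lo hi H 0] by simp
next
  case (insert i A)
  then show ?case using JHint_add[of lo hi H "f i" "g i"] by simp
qed

lemma JHint_cong:
  assumes f: "JHint lo hi H f g" and e: "\<And>t. t \<in> {lo<..<hi} \<Longrightarrow> f t = f' t"
    and ae: "AE t\<in>{lo<..<hi} in lebesgue. cmat (H t) *v g t = cmat (H t) *v g' t"
  shows "JHint lo hi H f' g'"
  unfolding JHint_def
proof
  fix i
  obtain N where N: "negligible N" "\<And>t. t \<in> {lo<..<hi} - N \<Longrightarrow> cmat (H t) *v g t = cmat (H t) *v g' t"
    using ae unfolding AE_interval_iff by blast
  show "indef_int {lo<..<hi} (\<lambda>t. f' t $ i) (\<lambda>t. (Jmat *v (cmat (H t) *v g' t)) $ i)"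
    by (rule indef_int_cong[OF f[unfolded JHint_def, rule_format, of i] _ N(1)])
       (use e N(2) in \<open>auto simp: greaterThanLessThan_iff\<close>)
qed

lemma abs_continuous_on_component:
  fixes f :: fn
  assumes "abs_continuous_on c d f" shows "abs_continuous_on c d (\<lambda>t. f t $ i)"
  unfolding abs_continuous_on_def
proof (intro allI impI)
  fix \<epsilon> :: real assume "0 < \<epsilon>"
  then obtain \<delta> where d: "\<delta> > 0" "\<And>D T. D division_of T \<Longrightarrow> T \<subseteq> {c..d} \<Longrightarrow>
        (\<Sum>K\<in>D. Sup K - Inf K) < \<delta> \<Longrightarrow> (\<Sum>K\<in>D. norm (f (Sup K) - f (Inf K))) < \<epsilon>"
    using assms unfolding abs_continuous_on_def by meson
  have le: "(\<Sum>K\<in>D. norm (f (Sup K) $ i - f (Inf K) $ i)) \<le> (\<Sum>K\<in>D. norm (f (Sup K) - f (Inf K)))" for D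
    unfolding vector_minus_component[symmetric] by (intro sum_mono Finite_Cartesian_Product.norm_nth_le)
  show "\<exists>\<delta>>0. \<forall>D T. D division_of T \<longrightarrow> T \<subseteq> {c..d} \<longrightarrow>
        (\<Sum>K\<in>D. Sup K - Inf K) < \<delta> \<longrightarrow> (\<Sum>K\<in>D. norm (f (Sup K) $ i - f (Inf K) $ i)) < \<epsilon>"
    by (rule exI[of _ \<delta>], intro conjI d(1) allI impI, rule order_le_less_trans[OF le d(2)])
qed

text \<open>Passage from a derivative almost everywhere to the integrated equation, by the
  fundamental theorem applied to each component. Absolute integrability of the right-hand side is
  supplied separately.\<close>

lemma ac_rep_JHint:
  assumes ac: "ac_rep H lo hi f g fh"
    and ai: "\<And>x y i. lo < x \<Longrightarrow> y < hi \<Longrightarrow>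
       (\<lambda>t. (Jmat *v (cmat (H t) *v g t)) $ i) absolutely_integrable_on {x..y}"
  shows "JHint lo hi H fh g"
  unfolding JHint_def
proof (intro allI indef_intI)
  fix i x y assume xy: "x \<in> {lo<..<hi}" "y \<in> {lo<..<hi}" "x \<le> y"
  show "(\<lambda>t. (Jmat *v (cmat (H t) *v g t)) $ i) absolutely_integrable_on {x..y}" by (rule ai) (use xy in auto)
  show "((\<lambda>t. (Jmat *v (cmat (H t) *v g t)) $ i) has_integral fh y $ i - fh x $ i) {x..y}"
  proof (cases "x = y")
    case True then show ?thesis using has_integral_refl(2) by simp
  next
    case False
    have der: "AE t\<in>{lo<..<hi} in lebesgue. (fh has_vector_derivative (Jmat *v (cmat (H t) *v g t))) (at t)"
      and la: "loc_abs_continuous lo hi fh" using ac unfolding ac_rep_def by blast+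
    show ?thesis
    proof (rule abs_continuous_on_has_integral)
      show "x < y" using False xy by simp
      show "abs_continuous_on x y (\<lambda>t. fh t $ i)"
        using la False xy unfolding loc_abs_continuous_def by (intro abs_continuous_on_component) auto
      show "AE t\<in>{x<..<y} in lebesgue. ((\<lambda>t. fh t $ i) has_vector_derivative (Jmat *v (cmat (H t) *v g t)) $ i) (at t)"
        using der
      proof eventually_elim
        case (elim t)
        show ?case by (intro impI bounded_linear.has_vector_derivative[OF bounded_linear_vec_nth] elim[rule_format]) (use xy in simp)
      qed
    qed
  qed
qed

lemma indef_int_limits:
  assumes f: "indef_int {lo<..<hi} f g" and g: "g absolutely_integrable_on {lo<..<hi}" and lohi: "lo < hi"
  shows "\<exists>l m. (f \<longlongrightarrow> l) (at_right lo) \<and> (f \<longlongrightarrow> m) (at_left hi) \<and> m - l = integral {lo<..<hi} g"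
proof -
  define c where "c = (lo + hi) / 2"
  have c: "lo < c" "c < hi" using lohi by (auto simp: c_def)
  have gi: "g integrable_on {lo..hi}" using g unfolding absolutely_integrable_open_closed by (rule absolutely_integrable_imp_integrable)
  define F where "F t = f c + (integral {lo..t} g - integral {lo..c} g)" for t
  have F: "continuous_on {lo..hi} F" unfolding F_def by (intro continuous_intros indefinite_integral_continuous_1 gi)
  have sub: "g integrable_on {x..y}" if "lo \<le> x" "y \<le> hi" for x y
    using gi by (rule integrable_on_subinterval) (use that in auto)
  have comb: "integral {lo..y} g = integral {lo..x} g + integral {x..y} g" if "lo \<le> x" "x \<le> y" "y \<le> hi" for x y
    using Henstock_Kurzweil_Integration.integral_combine[OF that(1,2) sub] that by simp
  have eq: "F t = f t" if t: "t \<in> {lo<..<hi}" for t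
  proof (cases "c \<le> t")
    case True
    then have "integral {c..t} g = f t - f c" by (intro integral_unique indef_intD(2)[OF f]) (use t c in auto)
    then show ?thesis using comb[of c t] True t c unfolding F_def by simp
  next
    case False
    then have "integral {t..c} g = f c - f t" by (intro integral_unique indef_intD(2)[OF f]) (use t c in auto)
    then show ?thesis using comb[of t c] False t c unfolding F_def by simp
  qed
  have ev: "\<forall>\<^sub>F t in at_right lo. F t = f t" "\<forall>\<^sub>F t in at_left hi. F t = f t"
    using eventually_at_right_real[OF lohi] eventually_at_left_real[OF lohi] by (auto elim!: eventually_mono intro!: eq)
  have "(F \<longlongrightarrow> F lo) (at lo within {lo..hi})" "(F \<longlongrightarrow> F hi) (at hi within {lo..hi})"
    using F lohi unfolding continuous_on_def by auto
  then have "(F \<longlongrightarrow> F lo) (at_right lo)" "(F \<longlongrightarrow> F hi) (at_left hi)"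
    using lohi by (simp_all add: at_within_Icc_at_right at_within_Icc_at_left)
  moreover have "F hi - F lo = integral {lo<..<hi} g" unfolding F_def by (simp add: integral_open_interval_real)
  ultimately show ?thesis using Lim_transform_eventually ev by blast
qed

text \<open>Bilinear, not sesquilinear, so that it is symmetric for symmetric A. It agrees with the
  sesquilinear form when the first argument is real, as the w_n are.\<close>

definition bil :: "real^2^2 \<Rightarrow> complex^2 \<Rightarrow> complex^2 \<Rightarrow> complex" where
  "bil A u v = u $ 1 * (cmat A *v v) $ 1 + u $ 2 * (cmat A *v v) $ 2"

lemma bil_sym: "A $ 2 $ 1 = A $ 1 $ 2 \<Longrightarrow> bil A u v = bil A v u"
  by (simp add: bil_def matrix_vector_mult_2 algebra_simps)

lemma bil_linear:
  "bil A u (c *s v) = c * bil A u v" "bil A u (v + v') = bil A u v + bil A u v'"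
  "bil A u (v - v') = bil A u v - bil A u v'" "bil A u 0 = 0" "bil A 0 v = 0"
  by (simp_all add: bil_def matrix_vector_mult_2 algebra_simps)

lemma bil_sum: "bil A u (\<Sum>i\<in>I. f i) = (\<Sum>i\<in>I. bil A u (f i))"
  by (induction I rule: infinite_finite_induct) (simp_all add: bil_linear)

text \<open>The Lagrange identity: the function on the left is the bilinear pairing of u with Jv,
  and J^2 = -1 together with the symmetry of H leaves two terms.\<close>

lemma JHint_pair:
  assumes u: "JHint lo hi H u u'" and v: "JHint lo hi H v v'"
    and sym: "AE t\<in>{lo<..<hi} in lebesgue. pos_semidef (H t)"
  shows "indef_int {lo<..<hi} (\<lambda>t. u t $ 2 * v t $ 1 - u t $ 1 * v t $ 2)
     (\<lambda>t. bil (H t) (u' t) (v t) - bil (H t) (u t) (v' t))"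
proof -
  obtain N where N: "negligible N" "\<And>t. t \<in> {lo<..<hi} - N \<Longrightarrow> pos_semidef (H t)"
    using sym unfolding AE_interval_iff by blast
  note ui = u[unfolded JHint_def, rule_format] and vi = v[unfolded JHint_def, rule_format]
  have "indef_int {lo<..<hi} (\<lambda>t. u t $ 2 * v t $ 1 - u t $ 1 * v t $ 2)
     (\<lambda>t. ((Jmat *v (cmat (H t) *v u' t)) $ 2 * v t $ 1 + u t $ 2 * (Jmat *v (cmat (H t) *v v' t)) $ 1)
        - ((Jmat *v (cmat (H t) *v u' t)) $ 1 * v t $ 2 + u t $ 1 * (Jmat *v (cmat (H t) *v v' t)) $ 2))"
    by (intro indef_int_diff indef_int_mult ui vi is_interval_oo)
  then show ?thesis
  proof (rule indef_int_cong[OF _ refl N(1)])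
    fix t assume "t \<notin> N" "\<exists>x\<in>{lo<..<hi}. \<exists>y\<in>{lo<..<hi}. x \<le> t \<and> t \<le> y"
    then have "pos_semidef (H t)" by (intro N(2)) auto
    from bil_sym[OF pos_semidef_2(3)[OF this], of "u' t" "v t"]
    show "(Jmat *v (cmat (H t) *v u' t)) $ 2 * v t $ 1 + u t $ 2 * (Jmat *v (cmat (H t) *v v' t)) $ 1
        - ((Jmat *v (cmat (H t) *v u' t)) $ 1 * v t $ 2 + u t $ 1 * (Jmat *v (cmat (H t) *v v' t)) $ 2)
        = bil (H t) (u' t) (v t) - bil (H t) (u t) (v' t)"
      by (simp add: bil_def Jmat_mult algebra_simps)
  qed
qed

lemma telescope_single:
  fixes z :: complex
  shows "(\<Sum>n\<le>m. z ^ n * ((if n = 0 then 0 else s (n - 1)) - z * s n)) = - (z ^ Suc m * s m)"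
  by (induction m) (simp_all add: algebra_simps)

text \<open>Along n + j = const the two terms are neighbouring values of one array. The upper limit
  2d - n decreases by one with each n, so after a shift of n the ranges differ only in the entries
  with j = d.\<close>

lemma telescope_double:
  fixes z :: complex
  shows "(\<Sum>n\<le>d. \<Sum>j=d+1..2*d-n. z ^ (n + j) * ((if n = 0 then 0 else a (n - 1) j) - a n (j - 1)))
    = - (\<Sum>n<d. z ^ (n + d + 1) * a n d)"
proof -
  define b where "b n j = z ^ (n + j + 1) * a n j" for n j
  have "(\<Sum>n\<le>d. \<Sum>j=d+1..2*d-n. z ^ (n + j) * ((if n = 0 then 0 else a (n - 1) j) - a n (j - 1)))
    = (\<Sum>n\<le>d. \<Sum>j=d+1..2*d-n. (if n = 0 then 0 else b (n - 1) j) - b n (j - 1))"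
  proof (intro sum.cong refl)
    fix n j assume "j \<in> {d+1..2*d-n}"
    then have "j \<noteq> 0" by auto
    then show "z ^ (n + j) * ((if n = 0 then 0 else a (n - 1) j) - a n (j - 1)) = (if n = 0 then 0 else b (n - 1) j) - b n (j - 1)"
      by (cases n; cases j) (simp_all add: b_def algebra_simps)
  qed
  also have "\<dots> = (\<Sum>n\<le>d. \<Sum>j=d+1..2*d-n. if n = 0 then 0 else b (n - 1) j) - (\<Sum>n\<le>d. \<Sum>j=d+1..2*d-n. b n (j - 1))"
    by (simp add: sum_subtractf)
  also have "(\<Sum>n\<le>d. \<Sum>j=d+1..2*d-n. if n = 0 then 0 else b (n - 1) j) = (\<Sum>n<d. \<Sum>j=d+1..2*d-Suc n. b n j)"
    by (simp add: sum.atMost_shift)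
  also have "(\<Sum>n\<le>d. \<Sum>j=d+1..2*d-n. b n (j - 1)) = (\<Sum>n<d. \<Sum>j=d+1..2*d-n. b n (j - 1))"
    unfolding lessThan_Suc_atMost[symmetric] by (simp add: mult_2)
  also have "\<dots> = (\<Sum>n<d. b n d + (\<Sum>j=d+1..2*d-Suc n. b n j))"
  proof (intro sum.cong refl)
    fix n assume "n \<in> {..<d}"
    then have n: "2 * d - n = Suc (2 * d - Suc n)" "d \<le> 2 * d - Suc n" by auto
    have "(\<Sum>j=d+1..2*d-n. b n (j - 1)) = (\<Sum>j=d..2*d-Suc n. b n j)"
      unfolding n(1) using sum.shift_bounds_cl_Suc_ivl[of "\<lambda>j. b n (j - 1)" d "2 * d - Suc n"] by simp
    then show "(\<Sum>j=d+1..2*d-n. b n (j - 1)) = b n d + (\<Sum>j=d+1..2*d-Suc n. b n j)"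
      using sum.atLeast_Suc_atMost[OF n(2), of "b n"] by simp
  qed
  finally show ?thesis by (simp add: sum.distrib b_def)
qed

text \<open>One side of an element of the relation with g = zf: \<kappa> is the sequence of the
  \<lambda>_i, which both sides share, and g0 is zf minus the shifted combination of the
  w_i.\<close>

locale side_solution = side_facts +
  fixes f0 f g0 fh0 :: fn and \<kappa> :: "nat \<Rightarrow> complex" and z :: complex and \<Delta> :: nat
  assumes es: "e = at_right lo \<and> s = at_left hi \<or> e = at_left hi \<and> s = at_right lo"
    and f0: "f0 \<in> L2H H lo hi" and g0: "g0 \<in> L2H H lo hi" and fh0: "ac_rep H lo hi f0 g0 fh0"
    and f_eq: "eq_H H lo hi f (\<lambda>t. f0 t + (\<Sum>i\<le>\<Delta>. \<kappa> i *s w i t))"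
    and g0_eq: "\<And>t. t \<in> {lo<..<hi} \<Longrightarrow> g0 t = z *s f t - (\<Sum>i<\<Delta>. \<kappa> (Suc i) *s w i t)"
    and D_le: "D \<le> \<Delta>"
begin

abbreviation "sol fh \<equiv> ac_rep H lo hi f (\<lambda>t. z *s fh t) fh"

lemma ev_es: "eventually (\<lambda>t. t \<in> {lo<..<hi}) e" "eventually (\<lambda>t. t \<in> {lo<..<hi}) s"
  using es eventually_at_right_real[OF lohi] eventually_at_left_real[OF lohi] by auto

lemma es_nontrivial: "e \<noteq> bot" "s \<noteq> bot"
  using es trivial_limit_at_right_real trivial_limit_at_left_real by metis+

text \<open>A reference representative of f, built from the given antiderivative \<open>fh0\<close>;
  it is an antiderivative of JH(zf), because I lowers the indices of the w_i exactly as the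
  subtraction in g0 prescribes.\<close>

definition fS :: fn where "fS t = fh0 t + (\<Sum>i\<le>\<Delta>. \<kappa> i *s w i t)"

lemma fh0_JHint: "JHint lo hi H fh0 g0" by (rule ac_rep_JHint[OF fh0 L2H_JH[OF g0]])

lemma w0_JHint: "JHint lo hi H (w 0) (\<lambda>t. 0)"
  by (rule JHint_cong[OF JHint_const]) (simp_all add: w_0)

lemma fS_JHint: "JHint lo hi H fS (\<lambda>t. z *s f t)"
proof -
  have "JHint lo hi H (\<lambda>t. fh0 t + (\<kappa> 0 *s w 0 t + (\<Sum>i<\<Delta>. \<kappa> (Suc i) *s w (Suc i) t)))
     (\<lambda>t. g0 t + (\<kappa> 0 *s 0 + (\<Sum>i<\<Delta>. \<kappa> (Suc i) *s w i t)))"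
    by (intro JHint_add JHint_sum JHint_scale fh0_JHint w0_JHint w_JHint) simp
  then show ?thesis by (rule JHint_cong) (simp_all add: fS_def sum.atMost_shift g0_eq)
qed

lemma fS_eq_H: "AE t\<in>{lo<..<hi} in lebesgue. cmat (H t) *v fS t = cmat (H t) *v f t"
proof -
  have "AE t\<in>{lo<..<hi} in lebesgue. cmat (H t) *v fh0 t = cmat (H t) *v f0 t"
    using fh0 unfolding ac_rep_def eq_H_def by (elim conjE)
  with f_eq[unfolded eq_H_def] show ?thesis
    by eventually_elim (auto simp: fS_def matrix_vector_right_distrib)
qed

lemma sol_eq_H: "sol fh \<Longrightarrow> AE t\<in>{lo<..<hi} in lebesgue. cmat (H t) *v fh t = cmat (H t) *v f t"
  unfolding ac_rep_def eq_H_def by blast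

lemma sol_scaled_eq:
  assumes "sol fh" shows "AE t\<in>{lo<..<hi} in lebesgue. cmat (H t) *v (z *s f t) = cmat (H t) *v (z *s fh t)"
  using sol_eq_H[OF assms] unfolding vector_scalar_commute by eventually_elim simp

lemma sol_JHint:
  assumes "sol fh" shows "JHint lo hi H fh (\<lambda>t. z *s fh t)"
proof (rule ac_rep_JHint[OF assms])
  fix x y i assume xy: "lo < x" "y < hi"
  \<comment> \<open>Local integrability of the right-hand side for fh is borrowed from
    \<open>fS\<close>, as H does not distinguish f and fh almost everywhere.\<close>
  have j: "JHint lo hi H fS (\<lambda>t. z *s fh t)" by (rule JHint_cong[OF fS_JHint refl sol_scaled_eq[OF assms]])
  show "(\<lambda>t. (Jmat *v (cmat (H t) *v (z *s fh t))) $ i) absolutely_integrable_on {x..y}"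
  proof (cases "x \<le> y")
    case True
    show ?thesis by (rule indef_intD(1)[OF j[unfolded JHint_def, rule_format]]) (use xy True in auto)
  next
    case False then have "{x..y} = {}" by simp
    then show ?thesis by simp
  qed
qed

text \<open>fh and \<open>fS\<close> are antiderivatives of the same function, so they differ by a
  constant v; both represent f, so H annihilates v, and \<open>kernel\<close> applies.\<close>

lemma sol_repr:
  assumes fh: "sol fh"
  obtains v where "v $ 2 = 0" "\<not> indivisible H lo hi \<Longrightarrow> v = 0" "\<And>t. t \<in> {lo<..<hi} \<Longrightarrow> fh t = fS t + v"
proof -
  have j: "JHint lo hi H (\<lambda>t. fh t + (- 1) *s fS t) (\<lambda>t. z *s fh t + (- 1) *s (z *s f t))"
    by (intro JHint_add JHint_scale sol_JHint fh fS_JHint)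
  have "JHint lo hi H (\<lambda>t. fh t - fS t) (\<lambda>t. 0)"
  proof (rule JHint_cong[OF j])
    show "AE t\<in>{lo<..<hi} in lebesgue. cmat (H t) *v (z *s fh t + (- 1) *s (z *s f t)) = cmat (H t) *v 0"
      using sol_scaled_eq[OF fh] by eventually_elim (auto simp: matrix_vector_right_distrib vector_scalar_commute matrix_vector_mult_diff_distrib)
  qed simp
  then have i: "indef_int {lo<..<hi} (\<lambda>t. fh t $ i - fS t $ i) (\<lambda>t. 0)" for i unfolding JHint_def by simp
  define c where "c = (lo + hi) / 2" define v where "v = fh c - fS c"
  have c: "c \<in> {lo<..<hi}" using lohi by (auto simp: c_def)
  have v: "fh t = fS t + v" if t: "t \<in> {lo<..<hi}" for t
    using indef_int_zero_const[OF i t c, of 1] indef_int_zero_const[OF i t c, of 2] unfolding v_def vec2_eq_iff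
    by (simp add: algebra_simps)
  have "AE t\<in>{lo<..<hi} in lebesgue. cmat (H t) *v v = 0"
    using sol_eq_H[OF fh] fS_eq_H by eventually_elim (use v in \<open>auto simp: matrix_vector_right_distrib\<close>)
  from kernel[OF this] show ?thesis using that v by blast
qed

lemma fS_limits: "((\<lambda>t. fS t $ 2) \<longlongrightarrow> \<kappa> 0) s" "\<exists>v. (fS \<longlongrightarrow> v) e"
proof -
  have l0: "((\<lambda>t. fh0 t $ 2) \<longlongrightarrow> 0) s" and le: "\<exists>v. (fh0 \<longlongrightarrow> v) e"
    using L2H_sol[OF f0 g0 fh0_JHint] fh0 unfolding ac_rep_def by blast+
  have w0: "((\<lambda>t. w 0 t $ 2) \<longlongrightarrow> 1) s"
    by (rule tendsto_eventually) (rule eventually_mono[OF ev_es(2)], simp add: w_0)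
  have "((\<lambda>t. fh0 t $ 2 + (\<kappa> 0 * w 0 t $ 2 + (\<Sum>i<\<Delta>. \<kappa> (Suc i) * w (Suc i) t $ 2)))
    \<longlongrightarrow> 0 + (\<kappa> 0 * 1 + (\<Sum>i<\<Delta>. \<kappa> (Suc i) * 0))) s"
    by (intro tendsto_intros l0 w0 w_sing)
  then show "((\<lambda>t. fS t $ 2) \<longlongrightarrow> \<kappa> 0) s" by (simp add: fS_def sum.atMost_shift sum_component)
  from le obtain v where v: "(fh0 \<longlongrightarrow> v) e" by blast
  have "((\<lambda>t. fS t $ i) \<longlongrightarrow> v $ i + (\<Sum>n\<le>\<Delta>. \<kappa> n * vector [0, \<omega> n] $ i)) e" for i
    unfolding fS_def by (simp add: sum_component) (intro tendsto_intros v w_end)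
  then show "\<exists>v. (fS \<longlongrightarrow> v) e" using tendsto_vec2[of fS _ e] by blast
qed

lemma sol_sing:
  assumes "sol fh" shows "((\<lambda>t. fh t $ 2) \<longlongrightarrow> \<kappa> 0) s"
proof -
  obtain v where v: "v $ 2 = 0" "\<And>t. t \<in> {lo<..<hi} \<Longrightarrow> fh t = fS t + v" using sol_repr[OF assms] by blast
  show ?thesis by (rule Lim_transform_eventually[OF fS_limits(1)]) (rule eventually_mono[OF ev_es(2)], simp add: v)
qed

lemma sol_end:
  assumes "sol fh" shows "\<exists>V. (fh \<longlongrightarrow> V) e"
proof -
  obtain v where v: "\<And>t. t \<in> {lo<..<hi} \<Longrightarrow> fh t = fS t + v" using sol_repr[OF assms] by blast
  obtain V where V: "(fS \<longlongrightarrow> V) e" using fS_limits(2) by blast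
  have "(fh \<longlongrightarrow> V + v) e"
    by (rule Lim_transform_eventually[OF tendsto_add[OF V tendsto_const]]) (rule eventually_mono[OF ev_es(1)], simp add: v)
  then show ?thesis by blast
qed

lemma sol_unique:
  assumes "sol fh" "sol fh'"
  obtains c where "\<not> indivisible H lo hi \<Longrightarrow> c = 0" "\<And>t. t \<in> {lo<..<hi} \<Longrightarrow> fh' t = fh t + c *s vector [1, 0]"
proof -
  obtain v where v: "v $ 2 = 0" "\<not> indivisible H lo hi \<Longrightarrow> v = 0" "\<And>t. t \<in> {lo<..<hi} \<Longrightarrow> fh t = fS t + v" using sol_repr[OF assms(1)] by blast
  obtain v' where v': "v' $ 2 = 0" "\<not> indivisible H lo hi \<Longrightarrow> v' = 0" "\<And>t. t \<in> {lo<..<hi} \<Longrightarrow> fh' t = fS t + v'" using sol_repr[OF assms(2)] by blast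
  show ?thesis by (rule that[of "v' $ 1 - v $ 1"]) (use v v' in \<open>auto simp: vec2_eq_iff\<close>)
qed

lemma sol_shift:
  assumes fh: "sol fh" and i: "indivisible H lo hi"
  shows "sol (\<lambda>t. fh t + c *s vector [1, 0])"
  unfolding ac_rep_def
proof (intro conjI)
  have k: "AE t\<in>{lo<..<hi} in lebesgue. cmat (H t) *v (c *s vector [1, 0]) = 0"
    using indiv_row[OF i] by eventually_elim (auto simp: vec2_eq_iff matrix_vector_mult_2)
  show "loc_abs_continuous lo hi (\<lambda>t. fh t + c *s vector [1, 0])"
    using fh unfolding ac_rep_def loc_abs_continuous_def abs_continuous_on_def by simp
  show "eq_H H lo hi (\<lambda>t. fh t + c *s vector [1, 0]) f"
    unfolding eq_H_def using k sol_eq_H[OF fh] by eventually_elim (auto simp: matrix_vector_right_distrib)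
  have d: "AE t\<in>{lo<..<hi} in lebesgue. (fh has_vector_derivative (Jmat *v (cmat (H t) *v (z *s fh t)))) (at t)"
    using fh unfolding ac_rep_def by blast
  show "AE t\<in>{lo<..<hi} in lebesgue. ((\<lambda>t. fh t + c *s vector [1, 0]) has_vector_derivative
      (Jmat *v (cmat (H t) *v (z *s (fh t + c *s vector [1, 0]))))) (at t)"
    using k d
  proof eventually_elim
    case (elim t)
    then show ?case
      by (auto simp del: vector_smult_assoc simp: has_vector_derivative_add_const vector_add_ldistrib matrix_vector_right_distrib vector_scalar_commute)
  qed
qed

lemma sol_indiv_2:
  assumes fh: "sol fh" and i: "indivisible H lo hi" and t: "t \<in> {lo<..<hi}"
  shows "fh t $ 2 = \<kappa> 0"
proof -
  obtain N where N: "negligible N" "\<And>t. t \<in> {lo<..<hi} - N \<Longrightarrow> H t $ 1 $ 1 = 0 \<and> H t $ 1 $ 2 = 0"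
    using indiv_row[OF i] unfolding AE_interval_iff by blast
  have z: "indef_int {lo<..<hi} (\<lambda>t. fh t $ 2) (\<lambda>t. 0)"
  proof (rule indef_int_cong[OF sol_JHint[OF fh, unfolded JHint_def, rule_format, of 2] refl N(1)])
    fix t assume "t \<notin> N" "\<exists>x\<in>{lo<..<hi}. \<exists>y\<in>{lo<..<hi}. x \<le> t \<and> t \<le> y"
    then have "H t $ 1 $ 1 = 0 \<and> H t $ 1 $ 2 = 0" by (intro N(2)) auto
    then show "(Jmat *v (cmat (H t) *v (z *s fh t))) $ 2 = 0" by (simp add: Jmat_mult matrix_vector_mult_2)
  qed
  have "((\<lambda>u. fh u $ 2) \<longlongrightarrow> fh t $ 2) s"
    by (rule tendsto_eventually, rule eventually_mono[OF ev_es(2)]) (rule indef_int_zero_const[OF z _ t])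
  then show ?thesis using sol_sing[OF fh] es_nontrivial(2) tendsto_unique by blast
qed

text \<open>On an indivisible interval the second component of a solution is constantly \<kappa> 0,
  and multiples of (1, 0) lie in the kernel of H. Exactly the first entry of the end value can be
  prescribed.\<close>

lemma sol_indiv_end:
  assumes fh: "sol fh" and i: "indivisible H lo hi" and V: "V $ 2 = \<kappa> 0"
  obtains fh1 where "sol fh1" "(fh1 \<longlongrightarrow> V) e"
    "\<And>fh2. sol fh2 \<Longrightarrow> (fh2 \<longlongrightarrow> V) e \<Longrightarrow> \<forall>t\<in>{lo<..<hi}. fh2 t = fh1 t"
proof -
  obtain W where W: "(fh \<longlongrightarrow> W) e" using sol_end[OF fh] by blast
  have "((\<lambda>u. fh u $ 2) \<longlongrightarrow> \<kappa> 0) e"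
    by (rule tendsto_eventually, rule eventually_mono[OF ev_es(1)]) (rule sol_indiv_2[OF fh i])
  then have W2: "W $ 2 = \<kappa> 0" using tendsto_unique[OF es_nontrivial(1) tendsto_vec_nth[OF W]] by blast
  define fh1 where "fh1 = (\<lambda>t. fh t + (V $ 1 - W $ 1) *s vector [1, 0])"
  have s1: "sol fh1" unfolding fh1_def by (rule sol_shift[OF fh i])
  have "(fh1 \<longlongrightarrow> W + (V $ 1 - W $ 1) *s vector [1, 0]) e" unfolding fh1_def by (intro tendsto_add W tendsto_const)
  moreover have "W + (V $ 1 - W $ 1) *s vector [1, 0] = V" using W2 V by (simp add: vec2_eq_iff)
  ultimately have l1: "(fh1 \<longlongrightarrow> V) e" by simp
  show ?thesis
  proof (rule that[OF s1 l1])
    fix fh2 assume s2: "sol fh2" and l2: "(fh2 \<longlongrightarrow> V) e"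
    obtain c where c: "\<And>t. t \<in> {lo<..<hi} \<Longrightarrow> fh2 t = fh1 t + c *s vector [1, 0]" using sol_unique[OF s1 s2] by blast
    have "(fh2 \<longlongrightarrow> V + c *s vector [1, 0]) e"
      by (rule Lim_transform_eventually[OF tendsto_add[OF l1 tendsto_const]]) (rule eventually_mono[OF ev_es(1)], simp add: c)
    then have "V = V + c *s vector [1, 0]" using tendsto_unique[OF es_nontrivial(1) l2] by blast
    then have "c = 0" by (simp add: vec2_eq_iff)
    then show "\<forall>t\<in>{lo<..<hi}. fh2 t = fh1 t" using c by simp
  qed
qed

text \<open>Modulo H, the combination of w_0, ..., w_(\<Delta>-1) with coefficients z \<kappa>_k -
  \<kappa>_(k+1) equals g0 - z f0 - z \<kappa>_\<Delta> w_\<Delta>, which lies in L^2. Independence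
  of all \<Delta> functions is available on a side whose own number D is \<Delta>.\<close>

lemma lambda_power:
  assumes "D = \<Delta>" "i \<le> \<Delta>" shows "\<kappa> i = z ^ i * \<kappa> 0"
proof -
  have "z * \<kappa> j - \<kappa> (Suc j) = 0" if "j < \<Delta>" for j
  proof (rule w_indep[where m=\<Delta> and f=f0 and g=g0 and c=z and d="z * \<kappa> \<Delta>" and k=\<Delta>, OF _ f0 g0 _ _ that])
    show "AE t\<in>{lo<..<hi} in lebesgue. cmat (H t) *v (\<Sum>k<\<Delta>. (z * \<kappa> k - \<kappa> (Suc k)) *s w k t) =
      cmat (H t) *v (g0 t - z *s f0 t - (z * \<kappa> \<Delta>) *s w \<Delta> t)"
      using f_eq unfolding eq_H_def
    proof eventually_elim
      case (elim t)
      show ?case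
      proof
        assume t: "t \<in> {lo<..<hi}"
        have a: "(\<Sum>k<\<Delta>. (z * \<kappa> k - \<kappa> (Suc k)) *s w k t)
          = z *s (f0 t + (\<Sum>i\<le>\<Delta>. \<kappa> i *s w i t)) - z *s f0 t - (\<Sum>i<\<Delta>. \<kappa> (Suc i) *s w i t) - (z * \<kappa> \<Delta>) *s w \<Delta> t"
          by (simp add: lessThan_Suc_atMost[symmetric] vec2_eq_iff sum_component sum_subtractf sum_distrib_left algebra_simps)
        have b: "g0 t - z *s f0 t - (z * \<kappa> \<Delta>) *s w \<Delta> t
          = z *s f t - z *s f0 t - (\<Sum>i<\<Delta>. \<kappa> (Suc i) *s w i t) - (z * \<kappa> \<Delta>) *s w \<Delta> t"
          unfolding g0_eq[OF t] by simp
        have "cmat (H t) *v (z *s (f0 t + (\<Sum>i\<le>\<Delta>. \<kappa> i *s w i t))) = cmat (H t) *v (z *s f t)"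
          using elim t by (simp only: vector_scalar_commute)
        then show "cmat (H t) *v (\<Sum>k<\<Delta>. (z * \<kappa> k - \<kappa> (Suc k)) *s w k t) =
          cmat (H t) *v (g0 t - z *s f0 t - (z * \<kappa> \<Delta>) *s w \<Delta> t)"
          unfolding a b by (simp only: matrix_vector_mult_diff_distrib)
      qed
    qed
  qed (use assms in simp_all)
  then have s: "\<kappa> (Suc j) = z * \<kappa> j" if "j < \<Delta>" for j using that by simp
  show ?thesis using assms(2) by (induction i) (simp_all add: s)
qed

end

section \<open>Limits of the sum that defines the singular boundary value\<close>

context side_solution begin

text \<open>The predecessor of w_n with value 0 for n = 0, so that w_n' = JH wp_n holds without
  exception: w_0 is constant.\<close>

definition wp :: "nat \<Rightarrow> fn" where "wp n = (if n = 0 then (\<lambda>t. 0) else w (n - 1))"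

lemma w_wp: "JHint lo hi H (w n) (wp n)"
proof (cases n)
  case 0 then show ?thesis unfolding wp_def using w0_JHint by simp
next
  case (Suc m)
  then show ?thesis unfolding wp_def using w_JHint[of m] by simp
qed

lemma cdot_w:
  assumes "t \<in> {lo<..<hi}"
  shows "cdot (w n t) (Jmat *v v) = w n t $ 2 * v $ 1 - w n t $ 1 * v $ 2"
    and "cdot (w n t) (cmat (H t) *v v) = bil (H t) (w n t) v"
  unfolding cdot_2 w_real[OF assms] Jmat_mult bil_def by simp_all

definition Sg :: "fn \<Rightarrow> real \<Rightarrow> complex" where
  "Sg fh x = (\<Sum>n\<le>\<Delta>. z ^ n * cdot (w n x)
     (Jmat *v (fh x - \<kappa> 0 *s (\<Sum>j=\<Delta>+1..2*\<Delta>-n. z ^ j *s w j x))))"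

lemma Sg_expand:
  assumes "t \<in> {lo<..<hi}"
  shows "Sg fh t = (\<Sum>n\<le>\<Delta>. z ^ n * ((w n t $ 2 * fh t $ 1 - w n t $ 1 * fh t $ 2)
    - \<kappa> 0 * (\<Sum>j=\<Delta>+1..2*\<Delta>-n. z ^ j * (w n t $ 2 * w j t $ 1 - w n t $ 1 * w j t $ 2))))"
  unfolding Sg_def cdot_w(1)[OF assms]
  by (intro sum.cong refl) (simp add: sum_component sum_distrib_left sum_subtractf algebra_simps)

text \<open>The sum defining the singular boundary value telescopes when it is differentiated; what
  remains is a density which is integrable up to the singular endpoint.\<close>
lemma Sg_indef:
  assumes fh: "sol fh" and pow: "\<And>i. i \<le> \<Delta> \<Longrightarrow> \<kappa> i = z ^ i * \<kappa> 0"
  shows "indef_int {lo<..<hi} (Sg fh) (\<lambda>t. - (z ^ \<Delta>) * cdot (w \<Delta> t) (cmat (H t) *v g0 t))"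
proof -
  have i: "indef_int {lo<..<hi} (\<lambda>t. \<Sum>n\<le>\<Delta>. z ^ n * ((w n t $ 2 * fh t $ 1 - w n t $ 1 * fh t $ 2)
      - \<kappa> 0 * (\<Sum>j=\<Delta>+1..2*\<Delta>-n. z ^ j * (w n t $ 2 * w j t $ 1 - w n t $ 1 * w j t $ 2))))
    (\<lambda>t. \<Sum>n\<le>\<Delta>. z ^ n * ((bil (H t) (wp n t) (fh t) - bil (H t) (w n t) (z *s fh t))
      - \<kappa> 0 * (\<Sum>j=\<Delta>+1..2*\<Delta>-n. z ^ j * (bil (H t) (wp n t) (w j t) - bil (H t) (w n t) (wp j t)))))"
    by (intro indef_int_sum indef_int_cmult indef_int_diff JHint_pair w_wp sol_JHint fh psd_ae)
  obtain N1 where N1: "negligible N1" "\<And>t. t \<in> {lo<..<hi} - N1 \<Longrightarrow> pos_semidef (H t)"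
    using psd_ae unfolding AE_interval_iff by blast
  obtain N2 where N2: "negligible N2" "\<And>t. t \<in> {lo<..<hi} - N2 \<Longrightarrow> cmat (H t) *v fh t = cmat (H t) *v f t"
    using sol_eq_H[OF fh] unfolding AE_interval_iff by blast
  have N: "negligible (N1 \<union> N2)" using N1(1) N2(1) by simp
  show ?thesis
  proof (rule indef_int_cong[OF i _ N])
    fix t assume "t \<in> {lo<..<hi}"
    then show "(\<Sum>n\<le>\<Delta>. z ^ n * ((w n t $ 2 * fh t $ 1 - w n t $ 1 * fh t $ 2)
      - \<kappa> 0 * (\<Sum>j=\<Delta>+1..2*\<Delta>-n. z ^ j * (w n t $ 2 * w j t $ 1 - w n t $ 1 * w j t $ 2)))) = Sg fh t"
      by (rule Sg_expand[symmetric])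
  next
    fix t assume tN: "t \<notin> N1 \<union> N2" "\<exists>x\<in>{lo<..<hi}. \<exists>y\<in>{lo<..<hi}. x \<le> t \<and> t \<le> y"
    then have t: "t \<in> {lo<..<hi}" by auto
    have sy: "bil (H t) u v = bil (H t) v u" for u v
      by (rule bil_sym[OF pos_semidef_2(3)[OF N1(2)]]) (use t tN in auto)
    have Hf: "cmat (H t) *v fh t = cmat (H t) *v f t" by (rule N2(2)) (use t tN in auto)
    define S where "S n = bil (H t) (w n t) (fh t)" for n
    define A where "A n j = bil (H t) (w n t) (w j t)" for n j
    have S': "bil (H t) (wp n t) (fh t) = (if n = 0 then 0 else S (n - 1))" for n
      by (simp add: wp_def S_def bil_linear)
    have A': "bil (H t) (wp n t) (w j t) = (if n = 0 then 0 else A (n - 1) j)" for n j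
      by (simp add: wp_def A_def bil_linear)
    have A'': "bil (H t) (w n t) (wp j t) = A n (j - 1)" if "j \<in> {\<Delta>+1..2*\<Delta>-n}" for n j
      using that by (simp add: wp_def A_def)
    have "(\<Sum>n\<le>\<Delta>. z ^ n * ((bil (H t) (wp n t) (fh t) - bil (H t) (w n t) (z *s fh t))
        - \<kappa> 0 * (\<Sum>j=\<Delta>+1..2*\<Delta>-n. z ^ j * (bil (H t) (wp n t) (w j t) - bil (H t) (w n t) (wp j t)))))
      = (\<Sum>n\<le>\<Delta>. z ^ n * ((if n = 0 then 0 else S (n - 1)) - z * S n)
        - \<kappa> 0 * (\<Sum>j=\<Delta>+1..2*\<Delta>-n. z ^ (n + j) * ((if n = 0 then 0 else A (n - 1) j) - A n (j - 1))))"
    proof (rule sum.cong[OF refl])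
      fix n
      have ar: "x * (y - k * q) = x * y - k * (x * q)" for x y k q :: complex by (simp add: algebra_simps)
      have "(\<Sum>j=\<Delta>+1..2*\<Delta>-n. z ^ j * (bil (H t) (wp n t) (w j t) - bil (H t) (w n t) (wp j t)))
        = (\<Sum>j=\<Delta>+1..2*\<Delta>-n. z ^ j * ((if n = 0 then 0 else A (n - 1) j) - A n (j - 1)))"
        by (rule sum.cong[OF refl]) (simp only: A' A'')
      note inner = this
      have pull: "(\<Sum>j=\<Delta>+1..2*\<Delta>-n. z ^ (n + j) * ((if n = 0 then 0 else A (n - 1) j) - A n (j - 1)))
        = z ^ n * (\<Sum>j=\<Delta>+1..2*\<Delta>-n. z ^ j * ((if n = 0 then 0 else A (n - 1) j) - A n (j - 1)))"
        unfolding sum_distrib_left power_add mult.assoc ..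
      show "z ^ n * ((bil (H t) (wp n t) (fh t) - bil (H t) (w n t) (z *s fh t))
        - \<kappa> 0 * (\<Sum>j=\<Delta>+1..2*\<Delta>-n. z ^ j * (bil (H t) (wp n t) (w j t) - bil (H t) (w n t) (wp j t))))
        = z ^ n * ((if n = 0 then 0 else S (n - 1)) - z * S n)
        - \<kappa> 0 * (\<Sum>j=\<Delta>+1..2*\<Delta>-n. z ^ (n + j) * ((if n = 0 then 0 else A (n - 1) j) - A n (j - 1)))"
        unfolding inner pull S' bil_linear(1) S_def[symmetric] by (rule ar)
    qed
    also have "\<dots> = - (z ^ Suc \<Delta> * S \<Delta>) + \<kappa> 0 * (\<Sum>n<\<Delta>. z ^ (n + \<Delta> + 1) * A n \<Delta>)"
      by (simp only: sum_subtractf telescope_single sum_distrib_left[symmetric] telescope_double) simp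
    \<comment> \<open>Here \<kappa>_(n+1) = z^(n+1) \<kappa>_0 is used: what the double sum leaves
      over is exactly the subtraction that turns zf into g0.\<close>
    also have "\<dots> = - (z ^ \<Delta>) * (z * S \<Delta> - (\<Sum>n<\<Delta>. \<kappa> (Suc n) * A n \<Delta>))"
    proof -
      have "(\<Sum>n<\<Delta>. \<kappa> (Suc n) * A n \<Delta>) = (\<Sum>n<\<Delta>. (z ^ Suc n * \<kappa> 0) * A n \<Delta>)"
        by (rule sum.cong[OF refl]) (metis lessThan_iff Suc_leI pow)
      also have "\<dots> = z * (\<kappa> 0 * (\<Sum>n<\<Delta>. z ^ n * A n \<Delta>))"
        unfolding sum_distrib_left by (rule sum.cong[OF refl]) (simp only: power_Suc mult_ac)
      finally have 1: "(\<Sum>n<\<Delta>. \<kappa> (Suc n) * A n \<Delta>) = z * (\<kappa> 0 * (\<Sum>n<\<Delta>. z ^ n * A n \<Delta>))" .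
      have "(\<Sum>n<\<Delta>. z ^ (n + \<Delta> + 1) * A n \<Delta>) = z ^ \<Delta> * z * (\<Sum>n<\<Delta>. z ^ n * A n \<Delta>)"
        unfolding sum_distrib_left by (rule sum.cong[OF refl]) (simp only: power_add power_one_right mult_ac)
      then show ?thesis unfolding 1 by (simp add: right_diff_distrib)
    qed
    also have "z * S \<Delta> - (\<Sum>n<\<Delta>. \<kappa> (Suc n) * A n \<Delta>) = cdot (w \<Delta> t) (cmat (H t) *v g0 t)"
    proof -
      have "S \<Delta> = bil (H t) (w \<Delta> t) (f t)" unfolding S_def bil_def Hf ..
      moreover have "A n \<Delta> = bil (H t) (w \<Delta> t) (w n t)" for n unfolding A_def by (rule sy)
      ultimately show ?thesis unfolding cdot_w(2)[OF t] g0_eq[OF t] bil_linear bil_sum by simp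
    qed
    finally show "(\<Sum>n\<le>\<Delta>. z ^ n * ((bil (H t) (wp n t) (fh t) - bil (H t) (w n t) (z *s fh t))
        - \<kappa> 0 * (\<Sum>j=\<Delta>+1..2*\<Delta>-n. z ^ j * (bil (H t) (wp n t) (w j t) - bil (H t) (w n t) (wp j t)))))
      = - (z ^ \<Delta>) * cdot (w \<Delta> t) (cmat (H t) *v g0 t)" .
  qed
qed

text \<open>At the regular endpoint all w_n have first component 0, so the pairings among them
  disappear and only the terms \<omega>_n times the first entry of V remain.\<close>

lemma Sg_end:
  assumes V: "(fh \<longlongrightarrow> V) e"
  shows "(Sg fh \<longlongrightarrow> (\<Sum>n\<le>\<Delta>. z ^ n * \<omega> n * V $ 1)) e"
proof -
  define q :: "nat \<Rightarrow> complex^2" where "q n = vector [0, \<omega> n]" for n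
  have wq: "(w n \<longlongrightarrow> q n) e" for n unfolding q_def by (rule w_end)
  have "((\<lambda>t. \<Sum>n\<le>\<Delta>. z ^ n * ((w n t $ 2 * fh t $ 1 - w n t $ 1 * fh t $ 2)
    - \<kappa> 0 * (\<Sum>j=\<Delta>+1..2*\<Delta>-n. z ^ j * (w n t $ 2 * w j t $ 1 - w n t $ 1 * w j t $ 2)))) \<longlongrightarrow>
    (\<Sum>n\<le>\<Delta>. z ^ n * ((q n $ 2 * V $ 1 - q n $ 1 * V $ 2)
    - \<kappa> 0 * (\<Sum>j=\<Delta>+1..2*\<Delta>-n. z ^ j * (q n $ 2 * q j $ 1 - q n $ 1 * q j $ 2))))) e"
    by (intro tendsto_intros V wq)
  then have "((\<lambda>t. \<Sum>n\<le>\<Delta>. z ^ n * ((w n t $ 2 * fh t $ 1 - w n t $ 1 * fh t $ 2)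
    - \<kappa> 0 * (\<Sum>j=\<Delta>+1..2*\<Delta>-n. z ^ j * (w n t $ 2 * w j t $ 1 - w n t $ 1 * w j t $ 2)))) \<longlongrightarrow>
    (\<Sum>n\<le>\<Delta>. z ^ n * \<omega> n * V $ 1)) e"
    by (simp add: q_def mult.assoc)
  then show ?thesis
    by (rule Lim_transform_eventually) (rule eventually_mono[OF ev_es(1)], simp only: Sg_expand)
qed

text \<open>The density of \<open>Sg_indef\<close> is integrable over the whole interval. The sign
  of X depends on whether the singular endpoint is reached to the right or to the left.\<close>

lemma Sg_limit:
  assumes fh: "sol fh" and pow: "\<And>i. i \<le> \<Delta> \<Longrightarrow> \<kappa> i = z ^ i * \<kappa> 0" and V: "(fh \<longlongrightarrow> V) e"
  defines "X \<equiv> LINT t:{lo<..<hi}|lebesgue. cdot (w \<Delta> t) (cmat (H t) *v g0 t)"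
  defines "C \<equiv> \<Sum>n\<le>\<Delta>. z ^ n * \<omega> n * V $ 1"
  shows "e = at_right lo \<Longrightarrow> s = at_left hi \<Longrightarrow> (Sg fh \<longlongrightarrow> C - z ^ \<Delta> * X) s"
    and "e = at_left hi \<Longrightarrow> s = at_right lo \<Longrightarrow> (Sg fh \<longlongrightarrow> C + z ^ \<Delta> * X) s"
proof -
  have ai: "(\<lambda>t. cdot (w \<Delta> t) (cmat (H t) *v g0 t)) absolutely_integrable_on {lo<..<hi}"
    by (rule L2H_cdot[OF w_L2H[OF D_le] g0])
  then have X: "X = integral {lo<..<hi} (\<lambda>t. cdot (w \<Delta> t) (cmat (H t) *v g0 t))"
    unfolding X_def by (rule set_lebesgue_integral_eq_integral(2))
  have ai': "(\<lambda>t. - (z ^ \<Delta>) * cdot (w \<Delta> t) (cmat (H t) *v g0 t)) absolutely_integrable_on {lo<..<hi}"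
    by (rule set_integrable_mult_right, rule ai)
  obtain l m where lm: "(Sg fh \<longlongrightarrow> l) (at_right lo)" "(Sg fh \<longlongrightarrow> m) (at_left hi)"
    "m - l = integral {lo<..<hi} (\<lambda>t. - (z ^ \<Delta>) * cdot (w \<Delta> t) (cmat (H t) *v g0 t))"
    using indef_int_limits[OF Sg_indef[OF fh pow] ai' lohi] by blast
  have d: "m - l = - (z ^ \<Delta>) * X" unfolding lm(3) X integral_mult_right ..
  have C: "(Sg fh \<longlongrightarrow> C) e" unfolding C_def by (rule Sg_end[OF V])
  show "(Sg fh \<longlongrightarrow> C - z ^ \<Delta> * X) s" if "e = at_right lo" "s = at_left hi"
  proof -
    have "l = C" using tendsto_unique[OF es_nontrivial(1)] C lm(1) that(1) by blast
    then have "m = C - z ^ \<Delta> * X" using d by (simp add: algebra_simps)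
    then show ?thesis using lm(2) that(2) by blast
  qed
  show "(Sg fh \<longlongrightarrow> C + z ^ \<Delta> * X) s" if "e = at_left hi" "s = at_right lo"
  proof -
    have "m = C" using tendsto_unique[OF es_nontrivial(1)] C lm(2) that(1) by blast
    then have "l = C + z ^ \<Delta> * X" using d by (simp add: algebra_simps)
    then show ?thesis using lm(1) that(2) by blast
  qed
qed

end

section \<open>Matching the two sides\<close>

context side_solution begin

text \<open>Boundary values are defined through JH(zf), solutions through JH applied to z times
  themselves. Both mean the same for representatives of f.\<close>

lemma ac_rep_scaled: "ac_rep H lo hi f (\<lambda>t. z *s f t) fh \<longleftrightarrow> sol fh"
proof (cases "eq_H H lo hi fh f")
  case True
  have "(AE t\<in>{lo<..<hi} in lebesgue. (fh has_vector_derivative Jmat *v (cmat (H t) *v (z *s f t))) (at t)) \<longleftrightarrow>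
    (AE t\<in>{lo<..<hi} in lebesgue. (fh has_vector_derivative Jmat *v (cmat (H t) *v (z *s fh t))) (at t))"
  proof -
    have e: "AE t in lebesgue. (t \<in> {lo<..<hi} \<longrightarrow> (fh has_vector_derivative Jmat *v (cmat (H t) *v (z *s f t))) (at t)) =
      (t \<in> {lo<..<hi} \<longrightarrow> (fh has_vector_derivative Jmat *v (cmat (H t) *v (z *s fh t))) (at t))"
      using True unfolding eq_H_def vector_scalar_commute by eventually_elim simp
    show ?thesis by (rule eventually_subst[OF e])
  qed
  then show ?thesis unfolding ac_rep_def by (rule arg_cong)
next
  case False
  then show ?thesis unfolding ac_rep_def by simp
qed

lemma boundary_value_eq:
  assumes fh: "sol fh" and V: "(fh \<longlongrightarrow> V) e" and n: "\<not> indivisible H lo hi"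
  shows "(THE v. \<exists>fh. ac_rep H lo hi f (\<lambda>t. z *s f t) fh \<and> (fh \<longlongrightarrow> v) e) = V"
  unfolding ac_rep_scaled
proof (rule the_equality)
  show "\<exists>fh. sol fh \<and> (fh \<longlongrightarrow> V) e" using fh V by blast
  fix v assume "\<exists>fh. sol fh \<and> (fh \<longlongrightarrow> v) e"
  then obtain fh' where fh': "sol fh'" "(fh' \<longlongrightarrow> v) e" by blast
  obtain c where c: "\<not> indivisible H lo hi \<Longrightarrow> c = 0" "\<And>t. t \<in> {lo<..<hi} \<Longrightarrow> fh' t = fh t + c *s vector [1, 0]"
    using sol_unique[OF fh fh'(1)] by blast
  have "(fh' \<longlongrightarrow> V) e"
    by (rule Lim_transform_eventually[OF V]) (rule eventually_mono[OF ev_es(1)], simp add: c n)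
  then show "v = V" using tendsto_unique[OF es_nontrivial(1) fh'(2)] by blast
qed

end

text \<open>Unrolls the recursion for the \<alpha>_j, from j = 1 up to the top entry given by
  condition (2), with one factor z per step.\<close>

lemma alpha_sum:
  fixes \<alpha> b :: "nat \<Rightarrow> complex" and z m :: complex
  assumes top: "\<alpha> p = b 1 * m" and o: "1 \<le> p"
    and step: "\<And>j. 2 \<le> j \<Longrightarrow> j \<le> p \<Longrightarrow> z * \<alpha> j = \<alpha> (j - 1) - b (p + 2 - j) * m"
  shows "z * \<alpha> 1 = m * (\<Sum>j=1..p. z ^ j * b (p + 1 - j))"
proof -
  have "z * \<alpha> 1 = z ^ Suc k * \<alpha> (Suc k) + m * (\<Sum>j=1..k. z ^ j * b (p + 1 - j))" if "Suc k \<le> p" for k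
    using that
  proof (induction k)
    case 0 then show ?case by simp
  next
    case (Suc k)
    have "\<alpha> (Suc k) = z * \<alpha> (Suc (Suc k)) + b (p + 1 - Suc k) * m"
      using step[of "Suc (Suc k)"] Suc.prems by (simp add: algebra_simps)
    then show ?case using Suc by (simp add: algebra_simps)
  qed
  from this[of "p - 1"] obtain k where k: "p = Suc k" "z * \<alpha> 1 = z ^ Suc k * \<alpha> (Suc k) + m * (\<Sum>j=1..k. z ^ j * b (p + 1 - j))"
    using o by (cases p) auto
  then show ?thesis using top by (simp add: algebra_simps)
qed

text \<open>Condition (4) is a first-order recursion for \<xi>_k; the factor z^(k+1) makes it a
  telescoping sum that starts from condition (3).\<close>

lemma xi_sum:
  fixes \<xi> d B :: "nat \<Rightarrow> complex" and z r :: complex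
  assumes x0: "z * \<xi> 0 = B 0 - 1/2 * (\<Sum>i<\<Delta>. d i * (z ^ Suc i * r))"
    and step: "\<And>k. 1 \<le> k \<Longrightarrow> k \<le> \<Delta> - 1 \<Longrightarrow>
      z * \<xi> k = \<xi> (k - 1) - 1/2 * d (k - 1) * r - 1/2 * d (k + \<Delta> - 1) * (z ^ \<Delta> * r) + B k"
    and k: "k < \<Delta>"
  shows "z ^ Suc k * \<xi> k = (\<Sum>m\<le>k. z ^ m * B m) - 1/2 * (\<Sum>i<\<Delta>. z ^ Suc i * d i) * r
    - 1/2 * (\<Sum>m<k. z ^ Suc m * d m + z ^ Suc (m + \<Delta>) * d (m + \<Delta>)) * r"
  using k
proof (induction k)
  case 0
  have "(\<Sum>i<\<Delta>. d i * (z ^ Suc i * r)) = (\<Sum>i<\<Delta>. z ^ Suc i * d i) * r"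
    unfolding sum_distrib_right by (rule sum.cong) (simp_all only: mult_ac)
  then show ?case using x0 by simp
next
  case (Suc k)
  have st: "z * \<xi> (Suc k) = \<xi> k - 1/2 * d k * r - 1/2 * d (k + \<Delta>) * (z ^ \<Delta> * r) + B (Suc k)"
    using step[of "Suc k"] Suc.prems by simp
  have "z ^ Suc (Suc k) * \<xi> (Suc k) = z ^ Suc k * (z * \<xi> (Suc k))" by simp
  also have "\<dots> = z ^ Suc k * \<xi> k - 1/2 * (z ^ Suc k * d k) * r - 1/2 * (z ^ Suc (k + \<Delta>) * d (k + \<Delta>)) * r + z ^ Suc k * B (Suc k)"
    unfolding st by (simp add: algebra_simps power_add)
  also have "z ^ Suc k * \<xi> k = (\<Sum>m\<le>k. z ^ m * B m) - 1/2 * (\<Sum>i<\<Delta>. z ^ Suc i * d i) * r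
    - 1/2 * (\<Sum>m<k. z ^ Suc m * d m + z ^ Suc (m + \<Delta>) * d (m + \<Delta>)) * r"
    using Suc by simp
  finally show ?case unfolding sum.atMost_Suc sum.lessThan_Suc by (simp only: algebra_simps)
qed

text \<open>Inserts \<xi>_(\<Delta>-1) from \<open>xi_sum\<close> into the two expressions for E.
  Each d_n with n < 2 \<Delta> - 1 is met twice with weight 1/2, and d_(2\<Delta>-1) once with
  weight 1, so the polynomial appears with whole coefficients.\<close>

lemma boundary_sum:
  fixes \<xi> \<alpha> d b B :: "nat \<Rightarrow> complex" and z r X E :: complex
  assumes D: "1 \<le> \<Delta>"
    and x0: "z * \<xi> 0 = B 0 - 1/2 * (\<Sum>i<\<Delta>. d i * (z ^ Suc i * r))"
    and step: "\<And>k. 1 \<le> k \<Longrightarrow> k \<le> \<Delta> - 1 \<Longrightarrow>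
      z * \<xi> k = \<xi> (k - 1) - 1/2 * d (k - 1) * r - 1/2 * d (k + \<Delta> - 1) * (z ^ \<Delta> * r) + B k"
    and E: "E = X + 1/2 * (\<Sum>i<\<Delta>. d (\<Delta> - 1 + i) * (z ^ i * r)) + d (2 * \<Delta> - 1) * (z ^ \<Delta> * r) - B \<Delta>"
    and E2: "E = \<xi> (\<Delta> - 1) + (z ^ \<Delta> * r) * S"
  shows "(\<Sum>m\<le>\<Delta>. z ^ m * B m) = z ^ \<Delta> * X + ((\<Sum>n=1..2*\<Delta>. d (n - 1) * z ^ n) - z ^ (2 * \<Delta>) * S) * r"
proof -
  obtain q where q: "\<Delta> = Suc q" using D by (cases \<Delta>) auto
  define e where "e n = z ^ Suc n * d n" for n
  have x: "z ^ \<Delta> * \<xi> q = (\<Sum>m\<le>q. z ^ m * B m) - 1/2 * (\<Sum>i<\<Delta>. e i) * r - 1/2 * (\<Sum>m<q. e m + e (m + \<Delta>)) * r"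
    using xi_sum[OF x0 step, of q] unfolding q e_def by simp
  have e1: "z ^ \<Delta> * (\<Sum>i<\<Delta>. d (\<Delta> - 1 + i) * (z ^ i * r)) = (\<Sum>i<\<Delta>. e (q + i)) * r"
    unfolding sum_distrib_left sum_distrib_right e_def q by (rule sum.cong) (simp_all add: power_add mult_ac)
  have e2: "z ^ \<Delta> * (d (2 * \<Delta> - 1) * (z ^ \<Delta> * r)) = e (q + \<Delta>) * r"
  proof -
    have "2 * \<Delta> - 1 = q + \<Delta>" "Suc (q + \<Delta>) = \<Delta> + \<Delta>" unfolding q by simp_all
    then show ?thesis unfolding e_def by (simp only: power_add mult_ac)
  qed
  have "(\<Sum>n=1..2*\<Delta>. d (n - 1) * z ^ n) = (\<Sum>n<2*\<Delta>. e n)"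
  proof -
    have "(\<Sum>n=1..2*\<Delta>. d (n - 1) * z ^ n) = (\<Sum>n=Suc 0..<Suc (2*\<Delta>). d (n - 1) * z ^ n)"
      by (simp add: atLeastLessThanSuc_atLeastAtMost)
    also have "\<dots> = (\<Sum>n<2*\<Delta>. e n)"
      unfolding sum.shift_bounds_Suc_ivl e_def lessThan_atLeast0 by (simp add: mult.commute)
    finally show ?thesis .
  qed
  also have "\<dots> = (\<Sum>n<\<Delta>. e n) + (\<Sum>n<\<Delta>. e (n + \<Delta>))"
  proof -
    have "(\<Sum>n<k + \<Delta>. e n) = (\<Sum>n<\<Delta>. e n) + (\<Sum>n<k. e (n + \<Delta>))" for k by (induction k) (simp_all add: add_ac)
    from this[of \<Delta>] show ?thesis unfolding mult_2 .
  qed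
  finally have pp: "(\<Sum>n=1..2*\<Delta>. d (n - 1) * z ^ n) = (\<Sum>n<\<Delta>. e n) + (\<Sum>n<\<Delta>. e (n + \<Delta>))" .
  have s1: "(\<Sum>i<\<Delta>. e (q + i)) = e q + (\<Sum>m<q. e (m + \<Delta>))"
    unfolding q sum.lessThan_Suc_shift by (simp add: add.commute)
  have s2: "(\<Sum>i<\<Delta>. e i) = (\<Sum>i<q. e i) + e q" "(\<Sum>i<\<Delta>. e (i + \<Delta>)) = (\<Sum>i<q. e (i + \<Delta>)) + e (q + \<Delta>)"
    unfolding q by simp_all
  have "(\<Sum>m\<le>\<Delta>. z ^ m * B m) = (\<Sum>m\<le>q. z ^ m * B m) + z ^ \<Delta> * B \<Delta>" unfolding q by simp
  also have "\<dots> = z ^ \<Delta> * \<xi> q + 1/2 * (\<Sum>i<\<Delta>. e i) * r + 1/2 * (\<Sum>m<q. e m + e (m + \<Delta>)) * r + z ^ \<Delta> * B \<Delta>"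
    unfolding x by simp
  also have "z ^ \<Delta> * B \<Delta> = z ^ \<Delta> * X + 1/2 * (\<Sum>i<\<Delta>. e (q + i)) * r + e (q + \<Delta>) * r - z ^ \<Delta> * E"
  proof -
    have "B \<Delta> = X + 1/2 * (\<Sum>i<\<Delta>. d (\<Delta> - 1 + i) * (z ^ i * r)) + d (2 * \<Delta> - 1) * (z ^ \<Delta> * r) - E"
      using E by simp
    then have "z ^ \<Delta> * B \<Delta> = z ^ \<Delta> * X + 1/2 * (z ^ \<Delta> * (\<Sum>i<\<Delta>. d (\<Delta> - 1 + i) * (z ^ i * r)))
      + z ^ \<Delta> * (d (2 * \<Delta> - 1) * (z ^ \<Delta> * r)) - z ^ \<Delta> * E"
      by (simp only: right_diff_distrib distrib_left mult.left_commute)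
    then show ?thesis unfolding e1 e2 by simp
  qed
  also have "z ^ \<Delta> * E = z ^ \<Delta> * \<xi> q + z ^ (2 * \<Delta>) * S * r"
    unfolding E2 q by (simp add: algebra_simps power_add mult_2 mult_2_right)
  finally show ?thesis unfolding pp s1 s2 sum.distrib by (simp add: algebra_simps)
qed

lemma p_poly_eq:
  "p_poly h z = - (\<Sum>n=1..2 * Delta h. complex_of_real (d_par h (n - 1)) * z ^ n)
    + z ^ (2 * Delta h) * (\<Sum>j=1..o_par h. z ^ j * complex_of_real (b_par h (o_par h + 1 - j)))"
proof -
  have "(\<Sum>n=2 * Delta h + 1..2 * Delta h + o_par h. complex_of_real (b_par h (o_par h + 2 * Delta h + 1 - n)) * z ^ n)
    = (\<Sum>j=1..o_par h. complex_of_real (b_par h (o_par h + 2 * Delta h + 1 - (j + 2 * Delta h))) * z ^ (j + 2 * Delta h))"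
    using sum.shift_bounds_cl_nat_ivl[of "\<lambda>n. complex_of_real (b_par h (o_par h + 2 * Delta h + 1 - n)) * z ^ n" 1 "2 * Delta h" "o_par h"]
    by (simp only: add.commute)
  also have "\<dots> = z ^ (2 * Delta h) * (\<Sum>j=1..o_par h. z ^ j * complex_of_real (b_par h (o_par h + 1 - j)))"
    unfolding sum_distrib_left by (rule sum.cong) (simp_all add: power_add)
  finally show ?thesis unfolding p_poly_def by simp
qed

section \<open>Assembly of the two sides\<close>

lemma side_facts_minus:
  assumes "elem_indef_ham_A h"
  obtains D where "Delta_minus h = enat D" "side_facts (s_minus h) (sing h) (ham h) (at_right (s_minus h)) (at_left (sing h))
    (omega_minus h) (w_comb (I_minus h) (omega_minus h)) D"
proof -
  have a: "s_minus h < sing h" "ham_side_minus h" "Delta_minus h < \<infinity>" using assms unfolding elem_indef_ham_A_def by blast+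
  obtain D where D: "Delta_minus h = enat D" using a(3) by (cases "Delta_minus h") auto
  interpret hs_side_finite "s_minus h" "sing h" "ham h" D
    unfolding hs_side_finite_def hs_side_finite_axioms_def hs_side_def
    using a(1) a(2)[unfolded ham_side_minus_def] D[unfolded Delta_minus_def I_minus_def] by blast
  have "side_facts (s_minus h) (sing h) (ham h) (at_right (s_minus h)) (at_left (sing h))
    (omega_minus h) (w_comb (I_minus h) (omega_minus h)) D"
    using side_facts_left unfolding I_minus_def omega_minus_def .
  from that[OF D this] show ?thesis .
qed

lemma side_facts_plus:
  assumes "elem_indef_ham_A h"
  obtains D where "Delta_plus h = enat D" "side_facts (sing h) (s_plus h) (ham h) (at_left (s_plus h)) (at_right (sing h))
    (omega_plus h) (w_comb (I_plus h) (omega_plus h)) D"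
proof -
  have a: "sing h < s_plus h" "ham_side_plus h" "Delta_plus h < \<infinity>" using assms unfolding elem_indef_ham_A_def by blast+
  obtain D where D: "Delta_plus h = enat D" using a(3) by (cases "Delta_plus h") auto
  have b: "hamiltonian (sing h) (s_plus h) (ham h)" "limit_point_left (sing h) (s_plus h) (ham h)"
    "limit_circle_right (sing h) (s_plus h) (ham h)"
    "set_integrable lebesgue {sing h<..<s_plus h} (\<lambda>t. ham h t $ 1 $ 1)"
    "set_integrable lebesgue {sing h<..<s_plus h}
       (\<lambda>t. (LINT s:{t<..<s_plus h}|lebesgue. ham h s $ 2 $ 2) * ham h t $ 1 $ 1)"
    using a(2) unfolding ham_side_plus_def by blast+
  have "side_facts (sing h) (s_plus h) (ham h) (at_left (s_plus h)) (at_right (sing h))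
    (omega_plus h) (w_comb (I_plus h) (omega_plus h)) D"
    using side_facts_right[OF a(1) b D[unfolded Delta_plus_def I_plus_def]] unfolding I_plus_def omega_plus_def .
  from that[OF D this] show ?thesis .
qed

lemma not_both_indivisible:
  assumes "elem_indef_ham_A h" shows "\<not> (indiv_minus h \<and> indiv_plus h)"
proof
  assume i: "indiv_minus h \<and> indiv_plus h"
  have lt: "s_minus h < sing h" "sing h < s_plus h" using assms unfolding elem_indef_ham_A_def by blast+
  have "s_minus h \<in> {s_minus h..<sing h}" using lt by simp
  then have "\<not> (\<forall>s\<in>{s_minus h..<sing h}. \<not> indivisible (ham h) s (sing h))"
    using i unfolding indiv_minus_def by blast
  then have r: "\<forall>s\<in>{sing h<..<s_plus h}. \<not> indivisible (ham h) (sing h) s"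
    using assms unfolding elem_indef_ham_A_def by blast
  obtain s where s: "sing h < s" "s < s_plus h" using dense[OF lt(2)] by blast
  obtain \<phi> where "indivisible_type (ham h) \<phi> (sing h) (s_plus h)" using i unfolding indiv_plus_def indivisible_def by blast
  then have ae: "AE t\<in>{sing h<..<s_plus h} in lebesgue. range ((*v) (ham h t)) = span {xi_vec \<phi>}"
    unfolding indivisible_type_def by blast
  have "AE t\<in>{sing h<..<s} in lebesgue. range ((*v) (ham h t)) = span {xi_vec \<phi>}"
    using ae
  proof eventually_elim
    case (elim t)
    show ?case by (intro impI elim[rule_format]) (use s in auto)
  qed
  then have "indivisible (ham h) (sing h) s" unfolding indivisible_def indivisible_type_def using s by blast
  then show False using r s by auto
qed

theorem theorem4p2:
  fixes h :: indef_ham and z :: complex and f fh :: "real \<Rightarrow> complex^2"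
    and \<xi> \<alpha> :: "nat \<Rightarrow> complex" and F :: elt
  assumes "elem_indef_ham_A h"
    and "F = (f, \<xi>, \<alpha>)"
    and "F \<in> P_ring h"
    and "(F, scale_elt z F) \<in> T_ring h"
    and "sol_minus h z f fh" and "sol_plus h z f fh"
  shows
    "(\<exists>r_minus r_plus sg_minus sg_plus.
        ((\<lambda>x. fh x $ 2) \<longlongrightarrow> r_minus) (at_left (sing h)) \<and>
        ((\<lambda>x. fh x $ 2) \<longlongrightarrow> r_plus) (at_right (sing h)) \<and>
        (sing_expr h z fh r_minus \<longlongrightarrow> sg_minus) (at_left (sing h)) \<and>
        (sing_expr h z fh r_plus \<longlongrightarrow> sg_plus) (at_right (sing h)) \<and>
        r_plus = r_minus \<and>
        sg_plus = sg_minus + p_poly h z * r_minus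
          + Gamma_minus h F (scale_elt z F) $ 1 - Lim (at_right (s_minus h)) fh $ 1
          - Gamma_plus h F (scale_elt z F) $ 1 + Lim (at_left (s_plus h)) fh $ 1)
     \<and> (\<not> indiv_minus h \<longrightarrow>
          (\<forall>fh'. sol_minus h z f fh' \<longrightarrow> (\<forall>t\<in>{s_minus h<..<sing h}. fh' t = fh t)) \<and>
          (fh \<longlongrightarrow> Gamma_minus h F (scale_elt z F)) (at_right (s_minus h)))
     \<and> (indiv_minus h \<longrightarrow>
          (\<forall>fh'. sol_minus h z f fh' \<longrightarrow>
             (\<exists>c. \<forall>t\<in>{s_minus h<..<sing h}. fh' t = fh t + c *s vector [1, 0])) \<and>
          (\<exists>fh1. sol_minus h z f fh1 \<and>
             (fh1 \<longlongrightarrow> Gamma_minus h F (scale_elt z F)) (at_right (s_minus h)) \<and>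
             (\<forall>fh2. sol_minus h z f fh2 \<and>
                (fh2 \<longlongrightarrow> Gamma_minus h F (scale_elt z F)) (at_right (s_minus h)) \<longrightarrow>
                (\<forall>t\<in>{s_minus h<..<sing h}. fh2 t = fh1 t))))
     \<and> (\<not> indiv_plus h \<longrightarrow>
          (\<forall>fh'. sol_plus h z f fh' \<longrightarrow> (\<forall>t\<in>{sing h<..<s_plus h}. fh' t = fh t)) \<and>
          (fh \<longlongrightarrow> Gamma_plus h F (scale_elt z F)) (at_left (s_plus h)))
     \<and> (indiv_plus h \<longrightarrow>
          (\<forall>fh'. sol_plus h z f fh' \<longrightarrow>
             (\<exists>c. \<forall>t\<in>{sing h<..<s_plus h}. fh' t = fh t + c *s vector [1, 0])) \<and>
          (\<exists>fh1. sol_plus h z f fh1 \<and>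
             (fh1 \<longlongrightarrow> Gamma_plus h F (scale_elt z F)) (at_left (s_plus h)) \<and>
             (\<forall>fh2. sol_plus h z f fh2 \<and>
                (fh2 \<longlongrightarrow> Gamma_plus h F (scale_elt z F)) (at_left (s_plus h)) \<longrightarrow>
                (\<forall>t\<in>{sing h<..<s_plus h}. fh2 t = fh1 t))))"
proof -
  define L where "L = lam h f (\<lambda>t. z *s f t)"
  define d where "d n = complex_of_real (d_par h n)" for n
  define b where "b n = complex_of_real (b_par h n)" for n
  have lt: "s_minus h < sing h" "sing h < s_plus h" using assms(1) unfolding elem_indef_ham_A_def by blast+
  have T: "((f, \<xi>, \<alpha>), (\<lambda>t. z *s f t, \<lambda>i. z * \<xi> i, \<lambda>k. z * \<alpha> k)) \<in> T_ring h"
    using assms(2,4) by (simp add: scale_elt_def)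
  have T1: "decomposes h f (\<lambda>t. z *s f t) L"
    and T2: "if o_par h = 0 then \<xi> (Delta h - 1) = E_num h f (\<lambda>t. z *s f t) else \<alpha> (o_par h) = b 1 * L (Delta h)"
    and T3: "\<not> indiv_minus h \<and> \<not> indiv_plus h \<longrightarrow> z * \<xi> 0 = val_minus h f (\<lambda>t. z *s f t) $ 1
      - val_plus h f (\<lambda>t. z *s f t) $ 1 - 1/2 * (\<Sum>i<Delta h. d i * L (i + 1))"
    and T4: "\<And>k. 1 \<le> k \<Longrightarrow> k \<le> Delta h - 1 \<Longrightarrow> z * \<xi> k = \<xi> (k - 1) - 1/2 * d (k - 1) * L 0
      - 1/2 * d (k + Delta h - 1) * L (Delta h) + B_num h f (\<lambda>t. z *s f t) k"
    and T5: "o_par h > 0 \<longrightarrow> z * \<alpha> 1 = E_num h f (\<lambda>t. z *s f t) - \<xi> (Delta h - 1) \<and>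
        (\<forall>j. 2 \<le> j \<and> j \<le> o_par h \<longrightarrow> z * \<alpha> j = \<alpha> (j - 1) - b (o_par h + 2 - j) * L (Delta h))"
  proof -
    note Tc = T[unfolded T_ring_def mem_Collect_eq prod.case, THEN conjunct2, THEN conjunct2, folded L_def d_def b_def]
    show "decomposes h f (\<lambda>t. z *s f t) L" by (rule Tc[THEN conjunct1])
    note Tc' = Tc[THEN conjunct2]
    show "if o_par h = 0 then \<xi> (Delta h - 1) = E_num h f (\<lambda>t. z *s f t) else \<alpha> (o_par h) = b 1 * L (Delta h)"
      by (rule Tc'[THEN conjunct1])
    note Tc'' = Tc'[THEN conjunct2]
    show "\<not> indiv_minus h \<and> \<not> indiv_plus h \<longrightarrow> z * \<xi> 0 = val_minus h f (\<lambda>t. z *s f t) $ 1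
      - val_plus h f (\<lambda>t. z *s f t) $ 1 - 1/2 * (\<Sum>i<Delta h. d i * L (i + 1))" by (rule Tc''[THEN conjunct1])
    show "z * \<xi> k = \<xi> (k - 1) - 1/2 * d (k - 1) * L 0
      - 1/2 * d (k + Delta h - 1) * L (Delta h) + B_num h f (\<lambda>t. z *s f t) k" if "1 \<le> k" "k \<le> Delta h - 1" for k
      using Tc''[THEN conjunct2, THEN conjunct1] that by blast
    show "o_par h > 0 \<longrightarrow> z * \<alpha> 1 = E_num h f (\<lambda>t. z *s f t) - \<xi> (Delta h - 1) \<and>
        (\<forall>j. 2 \<le> j \<and> j \<le> o_par h \<longrightarrow> z * \<alpha> j = \<alpha> (j - 1) - b (o_par h + 2 - j) * L (Delta h))"
      by (rule Tc''[THEN conjunct2, THEN conjunct2])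
  qed
  obtain f0 where f0: "eq_ham h f (\<lambda>t. f0 t + (\<Sum>i\<le>Delta h. L i *s wfun h i t))"
    "(f0, shift_part h (\<lambda>t. z *s f t) L) \<in> Tmax_ham h"
    using T1 unfolding decomposes_def by blast
  define g0 where "g0 = shift_part h (\<lambda>t. z *s f t) L"
  have Tm: "(f0, g0) \<in> Tmax (ham h) (s_minus h) (sing h)" "(f0, g0) \<in> Tmax (ham h) (sing h) (s_plus h)"
    using f0(2) unfolding g0_def Tmax_ham_def by blast+
  define wm where "wm = w_comb (I_minus h) (omega_minus h)"
  define wq where "wq = w_comb (I_plus h) (omega_plus h)"
  have wm: "wfun h n t = wm n t" if "t \<in> {s_minus h<..<sing h}" for n t using that by (simp add: wfun_def wm_def)
  have wq: "wfun h n t = wq n t" if "t \<in> {sing h<..<s_plus h}" for n t using that by (simp add: wfun_def wq_def)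
  obtain Dm where Dm: "Delta_minus h = enat Dm" "side_facts (s_minus h) (sing h) (ham h) (at_right (s_minus h)) (at_left (sing h))
    (omega_minus h) wm Dm" unfolding wm_def using side_facts_minus[OF assms(1)] .
  obtain Dp where Dp: "Delta_plus h = enat Dp" "side_facts (sing h) (s_plus h) (ham h) (at_left (s_plus h)) (at_right (sing h))
    (omega_plus h) wq Dp" unfolding wq_def using side_facts_plus[OF assms(1)] .
  have Delta: "Delta h = max Dm Dp" unfolding Delta_def Dm(1) Dp(1) by (simp add: max_def)
  obtain fm where fm: "ac_rep (ham h) (s_minus h) (sing h) f0 g0 fm" using Tm(1) unfolding Tmax_def by blast
  obtain fq where fq: "ac_rep (ham h) (sing h) (s_plus h) f0 g0 fq" using Tm(2) unfolding Tmax_def by blast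
  interpret M: side_solution "s_minus h" "sing h" "ham h" "at_right (s_minus h)" "at_left (sing h)" "omega_minus h" wm Dm
    f0 f g0 fm L z "Delta h"
  proof (rule side_solution.intro[OF Dm(2)], unfold_locales)
    show "f0 \<in> L2H (ham h) (s_minus h) (sing h)" "g0 \<in> L2H (ham h) (s_minus h) (sing h)" using Tm(1) unfolding Tmax_def by blast+
    show "eq_H (ham h) (s_minus h) (sing h) f (\<lambda>t. f0 t + (\<Sum>i\<le>Delta h. L i *s wm i t))"
      using conjunct1[OF f0(1)[unfolded eq_ham_def]] unfolding eq_H_def by eventually_elim (auto simp: wm)
    show "g0 t = z *s f t - (\<Sum>i<Delta h. L (Suc i) *s wm i t)" if "t \<in> {s_minus h<..<sing h}" for t
      using that by (simp add: g0_def shift_part_def wm)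
  qed (use fm Delta in simp_all)
  interpret P: side_solution "sing h" "s_plus h" "ham h" "at_left (s_plus h)" "at_right (sing h)" "omega_plus h" wq Dp
    f0 f g0 fq L z "Delta h"
  proof (rule side_solution.intro[OF Dp(2)], unfold_locales)
    show "f0 \<in> L2H (ham h) (sing h) (s_plus h)" "g0 \<in> L2H (ham h) (sing h) (s_plus h)" using Tm(2) unfolding Tmax_def by blast+
    show "eq_H (ham h) (sing h) (s_plus h) f (\<lambda>t. f0 t + (\<Sum>i\<le>Delta h. L i *s wq i t))"
      using conjunct2[OF f0(1)[unfolded eq_ham_def]] unfolding eq_H_def by eventually_elim (auto simp: wq)
    show "g0 t = z *s f t - (\<Sum>i<Delta h. L (Suc i) *s wq i t)" if "t \<in> {sing h<..<s_plus h}" for t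
      using that by (simp add: g0_def shift_part_def wq)
  qed (use fq Delta in simp_all)
  \<comment> \<open>One of the two sides has \<Delta> as its own number, and the coefficients are
    shared, so \<open>lambda_power\<close> for that side suffices.\<close>
  have pow: "L i = z ^ i * L 0" if "i \<le> Delta h" for i
  proof (cases "Dm = Delta h")
    case True show ?thesis by (rule M.lambda_power[OF True that])
  next
    case False
    then have "Dp = Delta h" using Delta by (simp add: max_def split: if_splits)
    then show ?thesis by (rule P.lambda_power[OF _ that])
  qed
  have D1: "1 \<le> Delta h" using M.D_pos M.D_le by simp
  have sm: "M.sol fh" and sp: "P.sol fh" using assms(5,6) unfolding sol_minus_def sol_plus_def .
  obtain Vm where Vm: "(fh \<longlongrightarrow> Vm) (at_right (s_minus h))" using M.sol_end[OF sm] by blast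
  obtain Vp where Vp: "(fh \<longlongrightarrow> Vp) (at_left (s_plus h))" using P.sol_end[OF sp] by blast
  have vm: "val_minus h f (\<lambda>t. z *s f t) = Vm" if "\<not> indiv_minus h"
    unfolding val_minus_def by (rule M.boundary_value_eq[OF sm Vm that[unfolded indiv_minus_def]])
  have vp: "val_plus h f (\<lambda>t. z *s f t) = Vp" if "\<not> indiv_plus h"
    unfolding val_plus_def by (rule P.boundary_value_eq[OF sp Vp that[unfolded indiv_plus_def]])
  have om: "omega_minus h (Suc n) = 0" if "indiv_minus h" for n by (rule M.indiv_omega[OF that[unfolded indiv_minus_def]])
  have op: "omega_plus h (Suc n) = 0" if "indiv_plus h" for n by (rule P.indiv_omega[OF that[unfolded indiv_plus_def]])
  note nb = not_both_indivisible[OF assms(1)]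
  define Gm where "Gm = Gamma_minus h F (scale_elt z F)"
  define Gp where "Gp = Gamma_plus h F (scale_elt z F)"
  define half where "half = 1/2 * (\<Sum>i<Delta h. d i * L (i + 1))"
  have Gm: "Gm = (if \<not> indiv_minus h then Vm else vector [Vp $ 1 + z * \<xi> 0 + half, L 0])"
    using vm vp nb unfolding Gm_def assms(2) Gamma_minus_def scale_elt_def half_def L_def d_def by auto
  have Gp: "Gp = (if \<not> indiv_plus h then Vp else vector [Vm $ 1 - z * \<xi> 0 - half, L 0])"
    using vm vp nb unfolding Gp_def assms(2) Gamma_plus_def scale_elt_def half_def L_def d_def by auto
  \<comment> \<open>A uniform version of the B_k. For k \<ge> 1 the terms omitted on an indivisible
    side have \<omega>_k = 0. For k = 0 the value is chosen such that condition (3) and the boundary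
    mapping on an indivisible side become one and the same equation \<open>x0\<close>.\<close>
  define B where "B k = (if k = 0 then Gm $ 1 - Gp $ 1 else omega_minus h k * Vm $ 1 - omega_plus h k * Vp $ 1)" for k
  have B: "B_num h f (\<lambda>t. z *s f t) k = B k" if "1 \<le> k" for k
    using that vm vp nb om[of "k - 1"] op[of "k - 1"] unfolding B_num_def B_def by auto
  have x0: "z * \<xi> 0 = B 0 - 1/2 * (\<Sum>i<Delta h. d i * (z ^ Suc i * L 0))"
  proof -
    have "1/2 * (\<Sum>i<Delta h. d i * (z ^ Suc i * L 0)) = half"
      unfolding half_def using pow[of "Suc _"] by (intro arg_cong2[where f="(*)"] sum.cong refl) simp
    moreover have "z * \<xi> 0 = B 0 - half"
      using T3 nb vm vp unfolding B_def Gm Gp half_def by (cases "indiv_minus h"; cases "indiv_plus h") auto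
    ultimately show ?thesis by simp
  qed
  have x4: "z * \<xi> k = \<xi> (k - 1) - 1/2 * d (k - 1) * L 0 - 1/2 * d (k + Delta h - 1) * (z ^ Delta h * L 0) + B k"
    if "1 \<le> k" "k \<le> Delta h - 1" for k
    using T4[OF that] B[OF that(1)] pow[OF order_refl] by simp
  define ft where "ft t = cdot (wfun h (Delta h) t) (cmat (ham h t) *v g0 t)" for t
  define Xm where "Xm = (LINT t:{s_minus h<..<sing h}|lebesgue. cdot (wm (Delta h) t) (cmat (ham h t) *v g0 t))"
  define Xp where "Xp = (LINT t:{sing h<..<s_plus h}|lebesgue. cdot (wq (Delta h) t) (cmat (ham h t) *v g0 t))"
  have im: "set_integrable lebesgue {s_minus h<..<sing h} ft"
    by (rule iffD1[OF set_integrable_cong[OF refl refl] M.L2H_cdot[OF M.w_L2H[OF M.D_le] M.g0]]) (simp add: ft_def wm)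
  have ip: "set_integrable lebesgue {sing h<..<s_plus h} ft"
    by (rule iffD1[OF set_integrable_cong[OF refl refl] P.L2H_cdot[OF P.w_L2H[OF P.D_le] P.g0]]) (simp add: ft_def wq)
  have X: "(LINT t:{s_minus h<..<sing h} \<union> {sing h<..<s_plus h}|lebesgue. ft t) = Xm + Xp"
  proof -
    have "(LINT t:{s_minus h<..<sing h} \<union> {sing h<..<s_plus h}|lebesgue. ft t)
      = (LINT t:{s_minus h<..<sing h}|lebesgue. ft t) + (LINT t:{sing h<..<s_plus h}|lebesgue. ft t)"
      by (rule set_integral_Un[OF _ im ip]) auto
    also have "(LINT t:{s_minus h<..<sing h}|lebesgue. ft t) = Xm"
      unfolding Xm_def by (rule set_lebesgue_integral_cong) (simp_all add: ft_def wm)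
    also have "(LINT t:{sing h<..<s_plus h}|lebesgue. ft t) = Xp"
      unfolding Xp_def by (rule set_lebesgue_integral_cong) (simp_all add: ft_def wq)
    finally show ?thesis .
  qed
  define E where "E = E_num h f (\<lambda>t. z *s f t)"
  have E: "E = (Xm + Xp) + 1/2 * (\<Sum>i<Delta h. d (Delta h - 1 + i) * (z ^ i * L 0))
    + d (2 * Delta h - 1) * (z ^ Delta h * L 0) - B (Delta h)"
  proof -
    have "(\<Sum>i<Delta h. d (Delta h - 1 + i) * L i) = (\<Sum>i<Delta h. d (Delta h - 1 + i) * (z ^ i * L 0))"
      using pow by (intro sum.cong refl) (metis lessThan_iff less_imp_le)
    then show ?thesis
      unfolding E_def E_num_def L_def[symmetric] g0_def[symmetric] ft_def[symmetric] X d_def[symmetric] B[OF D1]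
      using pow[OF order_refl] by simp
  qed
  \<comment> \<open>z^(2\<Delta>) S is the part of the polynomial with the coefficients b_j; it is
    an empty sum if \<open>o_par h = 0\<close>, which fits the first case of condition (2).\<close>
  define S where "S = (\<Sum>j=1..o_par h. z ^ j * b (o_par h + 1 - j))"
  have E2: "E = \<xi> (Delta h - 1) + (z ^ Delta h * L 0) * S"
  proof (cases "o_par h = 0")
    case True then show ?thesis using T2 by (simp add: E_def S_def)
  next
    case False
    have "z * \<alpha> 1 = L (Delta h) * S" unfolding S_def
      by (rule alpha_sum) (use False T2 T5 in auto)
    then show ?thesis using T5 False pow[OF order_refl] by (simp add: E_def)
  qed
  have key: "(\<Sum>m\<le>Delta h. z ^ m * B m) = z ^ Delta h * (Xm + Xp)
    + ((\<Sum>n=1..2*Delta h. d (n - 1) * z ^ n) - z ^ (2 * Delta h) * S) * L 0"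
    by (rule boundary_sum[OF D1 x0 x4 E E2])
  have pz: "p_poly h z = - (\<Sum>n=1..2*Delta h. d (n - 1) * z ^ n) + z ^ (2 * Delta h) * S"
    unfolding p_poly_eq d_def S_def b_def ..
  define Cm where "Cm = (\<Sum>n\<le>Delta h. z ^ n * omega_minus h n * Vm $ 1)"
  define Cp where "Cp = (\<Sum>n\<le>Delta h. z ^ n * omega_plus h n * Vp $ 1)"
  \<comment> \<open>For m \<ge> 1 the terms are those of Cm and Cp. For m = 0, where \<omega>_0 = 1,
    B has the values of the boundary mapping in the place of those of fh, and this is the origin of
    the four correction terms in the jump.\<close>
  have C: "(\<Sum>m\<le>Delta h. z ^ m * B m) = Cm - Cp + (Gm $ 1 - Vm $ 1) - (Gp $ 1 - Vp $ 1)"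
  proof -
    have "(\<Sum>m\<le>Delta h. z ^ m * B m) = B 0 + (\<Sum>m<Delta h. z ^ Suc m * B (Suc m))" by (simp add: sum.atMost_shift)
    moreover have "Cm = Vm $ 1 + (\<Sum>m<Delta h. z ^ Suc m * omega_minus h (Suc m) * Vm $ 1)"
      unfolding Cm_def sum.atMost_shift using M.omega_0 by simp
    moreover have "Cp = Vp $ 1 + (\<Sum>m<Delta h. z ^ Suc m * omega_plus h (Suc m) * Vp $ 1)"
      unfolding Cp_def sum.atMost_shift using P.omega_0 by simp
    moreover have "(\<Sum>m<Delta h. z ^ Suc m * B (Suc m)) = (\<Sum>m<Delta h. z ^ Suc m * omega_minus h (Suc m) * Vm $ 1)
      - (\<Sum>m<Delta h. z ^ Suc m * omega_plus h (Suc m) * Vp $ 1)"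
      unfolding sum_subtractf[symmetric] by (rule sum.cong) (simp_all add: B_def algebra_simps)
    moreover have "B 0 = Gm $ 1 - Gp $ 1" by (simp add: B_def)
    ultimately show ?thesis by simp
  qed
  have rm: "((\<lambda>x. fh x $ 2) \<longlongrightarrow> L 0) (at_left (sing h))" by (rule M.sol_sing[OF sm])
  have rp: "((\<lambda>x. fh x $ 2) \<longlongrightarrow> L 0) (at_right (sing h))" by (rule P.sol_sing[OF sp])
  have sgm: "(sing_expr h z fh (L 0) \<longlongrightarrow> Cm - z ^ Delta h * Xm) (at_left (sing h))"
  proof (rule Lim_transform_eventually)
    show "(M.Sg fh \<longlongrightarrow> Cm - z ^ Delta h * Xm) (at_left (sing h))"
      unfolding Cm_def Xm_def by (rule M.Sg_limit(1)[OF sm pow Vm refl refl])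
    show "\<forall>\<^sub>F t in at_left (sing h). M.Sg fh t = sing_expr h z fh (L 0) t"
      by (rule eventually_mono[OF M.ev_es(2)]) (simp add: M.Sg_def sing_expr_def wm)
  qed
  have sgp: "(sing_expr h z fh (L 0) \<longlongrightarrow> Cp + z ^ Delta h * Xp) (at_right (sing h))"
  proof (rule Lim_transform_eventually)
    show "(P.Sg fh \<longlongrightarrow> Cp + z ^ Delta h * Xp) (at_right (sing h))"
      unfolding Cp_def Xp_def by (rule P.Sg_limit(2)[OF sp pow Vp refl refl])
    show "\<forall>\<^sub>F t in at_right (sing h). P.Sg fh t = sing_expr h z fh (L 0) t"
      by (rule eventually_mono[OF P.ev_es(2)]) (simp add: P.Sg_def sing_expr_def wq)
  qed
  have lims: "Lim (at_right (s_minus h)) fh = Vm" "Lim (at_left (s_plus h)) fh = Vp"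
    by (rule tendsto_Lim[OF M.es_nontrivial(1) Vm], rule tendsto_Lim[OF P.es_nontrivial(1) Vp])
  have jump: "Cp + z ^ Delta h * Xp = Cm - z ^ Delta h * Xm + p_poly h z * L 0
    + Gm $ 1 - Lim (at_right (s_minus h)) fh $ 1 - Gp $ 1 + Lim (at_left (s_plus h)) fh $ 1"
    using key unfolding C pz lims by (simp add: algebra_simps)
  have mu: "\<forall>t\<in>{s_minus h<..<sing h}. fh' t = fh t" if "\<not> indiv_minus h" "sol_minus h z f fh'" for fh'
    using M.sol_unique[OF sm that(2)[unfolded sol_minus_def]] that(1)[unfolded indiv_minus_def]
    by (metis vector_smult_lzero add.right_neutral)
  have pu: "\<forall>t\<in>{sing h<..<s_plus h}. fh' t = fh t" if "\<not> indiv_plus h" "sol_plus h z f fh'" for fh'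
    using P.sol_unique[OF sp that(2)[unfolded sol_plus_def]] that(1)[unfolded indiv_plus_def]
    by (metis vector_smult_lzero add.right_neutral)
  have mi: "\<exists>c. \<forall>t\<in>{s_minus h<..<sing h}. fh' t = fh t + c *s vector [1, 0]" if "sol_minus h z f fh'" for fh'
    using M.sol_unique[OF sm that[unfolded sol_minus_def]] by metis
  have pi: "\<exists>c. \<forall>t\<in>{sing h<..<s_plus h}. fh' t = fh t + c *s vector [1, 0]" if "sol_plus h z f fh'" for fh'
    using P.sol_unique[OF sp that[unfolded sol_plus_def]] by metis
  have me: "\<exists>fh1. sol_minus h z f fh1 \<and> (fh1 \<longlongrightarrow> Gm) (at_right (s_minus h)) \<and>
     (\<forall>fh2. sol_minus h z f fh2 \<and> (fh2 \<longlongrightarrow> Gm) (at_right (s_minus h)) \<longrightarrow> (\<forall>t\<in>{s_minus h<..<sing h}. fh2 t = fh1 t))"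
    if i: "indiv_minus h"
  proof -
    have "Gm $ 2 = L 0" unfolding Gm using i by simp
    from M.sol_indiv_end[OF sm i[unfolded indiv_minus_def] this] show ?thesis unfolding sol_minus_def by metis
  qed
  have pe: "\<exists>fh1. sol_plus h z f fh1 \<and> (fh1 \<longlongrightarrow> Gp) (at_left (s_plus h)) \<and>
     (\<forall>fh2. sol_plus h z f fh2 \<and> (fh2 \<longlongrightarrow> Gp) (at_left (s_plus h)) \<longrightarrow> (\<forall>t\<in>{sing h<..<s_plus h}. fh2 t = fh1 t))"
    if i: "indiv_plus h"
  proof -
    have "Gp $ 2 = L 0" unfolding Gp using i by simp
    from P.sol_indiv_end[OF sp i[unfolded indiv_plus_def] this] show ?thesis unfolding sol_plus_def by metis
  qed
  have mg: "(fh \<longlongrightarrow> Gm) (at_right (s_minus h))" if "\<not> indiv_minus h" using Vm that unfolding Gm by simp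
  have pg: "(fh \<longlongrightarrow> Gp) (at_left (s_plus h))" if "\<not> indiv_plus h" using Vp that unfolding Gp by simp
  show ?thesis
    unfolding Gm_def[symmetric] Gp_def[symmetric]
  proof (intro conjI)
    show "\<exists>r_minus r_plus sg_minus sg_plus.
        ((\<lambda>x. fh x $ 2) \<longlongrightarrow> r_minus) (at_left (sing h)) \<and>
        ((\<lambda>x. fh x $ 2) \<longlongrightarrow> r_plus) (at_right (sing h)) \<and>
        (sing_expr h z fh r_minus \<longlongrightarrow> sg_minus) (at_left (sing h)) \<and>
        (sing_expr h z fh r_plus \<longlongrightarrow> sg_plus) (at_right (sing h)) \<and>
        r_plus = r_minus \<and>
        sg_plus = sg_minus + p_poly h z * r_minus
          + Gm $ 1 - Lim (at_right (s_minus h)) fh $ 1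
          - Gp $ 1 + Lim (at_left (s_plus h)) fh $ 1"
      using rm rp sgm sgp jump by blast
  qed (use mu pu mi pi me pe mg pg in blast)+
qed

end
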